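(* For each $d\in\mathbb N$ consider a finite-horizon MDP with state space $\mathsf S=\mathbb R^d$, compact action space $\mathsf A_d\subset\mathbb R^d$, horizon $H$, transition densities $p_{h}^a(y|x)=p_{d,h}^a(y|x)$, and rewards $R_h$, $F$ bounded in absolute value by $G$ (uniformly in $d$), satisfying: for any compact $\mathcal D\subset\mathbb R^d$ there are $\delta_{\mathcal D}>0$, $\Lambda_d>0$, $L_{\mathcal D}>0$ and $\mathcal L_{\mathcal D}:\mathbb R^d\to\mathbb R_+$ such that $$0<\delta_{\mathcal D}\le p_h^a(z|x)\le\Lambda_d,\qquad |p_h^{a_1}(y|x_1)-p_h^{a_2}(y|x_2)|\le\mathcal L_{\mathcal D}(y)\bigl(|x_1-x_2|+\rho_{\mathsf A}(a_1,a_2)\bigr)$$ for all $x,z,x_1,x_2\in\mathcal D$, $y\in\mathbb R^d$, $a,a_1,a_2\in\mathsf A_d$, $h=1,\dots,H$, with $\|\mathcal L_{\mathcal D}\|_{L^\infty(\mathcal D)}+\frac1{\mathrm{Leb}(\mathcal D)}\|\mathcal L_{\mathcal D}\|_{L^1(\mathbb R^d\setminus\mathcal D)}\le L_{\mathcal D}$. Suppose that, for a generic $d$, there is a sequence of compact sets $\mathcal D_{d,N}$, $N\in\mathbb N$, such that $$\frac{L_{\mathcal D_{d,N}}\,\mathrm{DI}(\mathcal D_{d,N}\times\mathsf A_d)+L_{\mathcal D_{d,N}}\,\mathrm{diam}(\mathcal D_{d,N})\,\mathrm{diam}(\mathsf A_d)}{\delta_{\mathcal D_{d,N}}}+\frac{\Lambda_d^2}{\delta_{\mathcal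 D_{d,N}}^2}\le C_1(H,\log N,d)\,N^\alpha$$ and $$\sum_{h=1}^H\sup_{\boldsymbol\pi\in\Pi}\mathbb P_{\boldsymbol\pi}\bigl(S_h^{(x_0,0)}\notin\mathcal D_{d,N}\bigr)\le C_2(H,\log N,d)\,N^{-\beta}$$ for $N>N_0$, where $C_1$ and $C_2$ are functions on $\mathbb N\times\mathbb R\times\mathbb N$ such that $0\le C_{1,2}(x,y,d)\le c_d|xy|^{q_d}$ for all $x,y\ge1$, and the parameters $\alpha\in[0,1/2)$, $\beta>0$ do not depend on $N$ and $d$. Here both $c_d>0$ and $q_d\in\mathbb R_+$ are independent of $H$ and $\epsilon$. Then the complexity $\mathcal C(\epsilon,d)$ of the weighted mesh algorithm can be bounded as $$\mathcal C(\epsilon,d)\lesssim H\,\max\left(2Gc_dH^2\Bigl(\frac{2H}{1-2\alpha}\Bigr)^{q_d},\ 2Gc_dH\Bigl(\frac H\beta\Bigr)^{q_d},\ 1\right)^{2\max(1/\beta,\,2/(1-2\alpha))}\times\frac{\log^{2q_d\max(1/\beta,\,2/(1-2\alpha))}(1/\epsilon)}{\epsilon^{2\max(1/\beta,\,2/(1-2\alpha))}}.$$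
   Context: **MDP.** Fix $d$. $|\cdot|$ is the Euclidean norm, $\rho_{\mathsf A}$ the metric on $\mathsf A_d$, and $x_0\in\mathbb R^d$ a fixed starting point. For $h=1,\dots,H$, $P_h(\cdot|x,a)$ is the probability kernel with Lebesgue density $p_h^a(\cdot|x)$. A policy is $\boldsymbol\pi=(\pi_0,\dots,\pi_{H-1})$ with measurable $\pi_t:\mathbb R^d\to\mathcal P(\mathsf A_d)$ (probability measures on $\mathsf A_d$); $\Pi$ is the set of policies. Under $\boldsymbol\pi$, $A_t\sim\pi_t(S_t)$, $S_{t+1}\sim P_{t+1}(\cdot|S_t,A_t)$; $S_h^{(x_0,0)}$ is the state at time $h$ of this chain started at $S_0=x_0$, and $\mathbb P_{\boldsymbol\pi}$ its law. $V_0^\star(x_0)=\sup_{\boldsymbol\pi\in\Pi}\mathbb E_{\boldsymbol\pi}\bigl[\sum_{t=0}^{H-1}R_t(S_t,A_t)+F(S_H)\,|\,S_0=x_0\bigr]$, with $R_t:\mathbb R^d\times\mathsf A_d\to\mathbb R$, $F:\mathbb R^d\to\mathbb R$. **Reflected MDP.** For compact $\mathcal D\subset\mathbb R^d$ (Lebesgue measure $\mathrm{Leb}(\mathcal D)>0$, as is implicit in dividing by it), the MDP reflected in $\mathcal D$ has state space $\mathcal D$, the same actions, horizon and rewards, and transition densities $p_h^{a,\mathcal D}(y|x)=p_h^a(y|x)+\frac1{\mathrm{Leb}(\mathcal D)}\int_{\mathbb R^d\setminus\mathcal D}p_h^a(z|x)\,dz$, $x,y\in\mathcal D$. **Weighted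 mesh algorithm.** It is applied to the MDP reflected in $\mathcal D=\mathcal D_{d,N}$, started in $x_0\in\mathcal D$. Fix controls $b_0,\dots,b_{H-1}\in\mathsf A_d$. Simulate independently for $n=1,\dots,N$ chains with $S_0^{(n)}=x_0$ and $S_{h+1}^{(n)}$ drawn from $p_{h+1}^{b_h,\mathcal D}(\cdot|S_h^{(n)})$. With $0/0=0$ let $$w_{h,n,N}(x,a)=\frac{p_{h+1}^{a,\mathcal D}(S_{h+1}^{(n)}|x)}{\sum_{k\ne n}p_{h+1}^{b_h,\mathcal D}(S_{h+1}^{(n)}|S_h^{(k)})}\Big/\sum_{n'=1}^N\frac{p_{h+1}^{a,\mathcal D}(S_{h+1}^{(n')}|x)}{\sum_{k'\ne n'}p_{h+1}^{b_h,\mathcal D}(S_{h+1}^{(n')}|S_h^{(k')})}.$$ Put $\overline V_H^{\mathcal D}(S_H^{(n)})=F(S_H^{(n)})$ and, for $h=H-1,\dots,0$, $r=1,\dots,N$, $\overline V_h^{\mathcal D}(S_h^{(r)})=\sup_{a\in\mathsf A_d}\bigl(R_h(S_h^{(r)},a)+\sum_{n=1}^N\overline V_{h+1}^{\mathcal D}(S_{h+1}^{(n)})w_{h,n,N}(S_h^{(r)},a)\bigr)$. The output is $\overline V_0^{\mathcal D}(x_0)$. **Complexity.** $\mathcal C(\epsilon,d)$ is the computational budget needed for computing $V_0^\star(x_0)$ in dimension $d$ by this algorithm with accuracy $\epsilon>0$ in $L^1$, i.e. $\mathbb E[|\overline V_0^{\mathcal D_{d,N}}(x_0)-V_0^\star(x_0)|]\le\epsilon$.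 The overall cost with $N$ trajectories is identified with $HN^2$ (the cost of computing all weights); the cost of the optimization over $a$ is disregarded. **Dudley integral.** For a metric space $(\mathsf X,\rho)$, $\mathcal N(\mathsf X,\rho,u)$ is the smallest number of $\rho$-balls of radius $u$ covering $\mathsf X$, and $\mathrm{DI}(\mathsf X)=\int_0^{\mathrm{diam}(\mathsf X)}\sqrt{\log\mathcal N(\mathsf X,\rho,u)}\,du$. On $\mathcal D\times\mathsf A_d$ the metric is $|x-x'|+\rho_{\mathsf A}(a,a')$. **Notation.** $\lesssim$ denotes $\le$ up to an absolute proportionality constant.
   Formalization: The complexity bound is proved for all sufficiently small accuracies ε, with a threshold depending on the problem data; for all ε>0 it fails, e.g. at ε=1 with q_d>0 the right side is 0, and nothing is assumed for N≤N_0. *)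

theory Defs
  imports "HOL-Probability.Probability" "HOL-Probability.Essential_Supremum"
begin

section \<open>Euclidean space of variable dimension\<close>

text \<open>
  The dimension is a bound variable of the result (the proportionality constant must not depend
  on it), so \<open>\<real>\<^sup>d\<close> is the space \<open>{..<d} \<rightarrow>\<^sub>E UNIV\<close> of the product measure below,
  not a type.
\<close>

type_synonym rvec = "nat \<Rightarrow> real"

definition leb :: "nat \<Rightarrow> rvec measure" where
  "leb d = PiM {..<d} (\<lambda>_. lborel)"

definition edist :: "nat \<Rightarrow> rvec \<Rightarrow> rvec \<Rightarrow> real" where
  "edist d x y = L2_set (\<lambda>i. x i - y i) {..<d}"

definition euclid_top :: "nat \<Rightarrow> rvec topology" where
  "euclid_top d = Metric_space.mtopology (space (leb d)) (edist d)"

lemma space_leb: "space (leb d) = ({..<d} \<rightarrow>\<^sub>E UNIV)"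
  by (simp add: leb_def space_PiM)

lemma Metric_space_edist: "Metric_space (space (leb d)) (edist d)"
proof
  fix x y z
  show "0 \<le> edist d x y"
    by (simp add: edist_def)
  show "edist d x y = edist d y x"
    by (simp add: edist_def L2_set_def power2_commute)
  show "edist d x y = 0 \<longleftrightarrow> x = y" if "x \<in> space (leb d)" "y \<in> space (leb d)"
    using that by (auto simp: edist_def L2_set_eq_0_iff space_leb intro: PiE_ext)
  have "edist d x z = L2_set (\<lambda>i. (x i - y i) + (y i - z i)) {..<d}"
    by (simp add: edist_def)
  also have "\<dots> \<le> edist d x y + edist d y z"
    unfolding edist_def by (rule L2_set_triangle_ineq)
  finally show "edist d x z \<le> edist d x y + edist d y z" .
qed


section \<open>Covering numbers and the Dudley integral\<close>

definition mdiam :: "'x set \<Rightarrow> ('x \<Rightarrow> 'x \<Rightarrow> real) \<Rightarrow> real" where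
  "mdiam X \<rho> = (SUP (x, y) \<in> X \<times> X. \<rho> x y)"

text \<open>
  Only meant for totally bounded \<open>X\<close>, where the set of admissible \<open>n\<close> is nonempty.  Closed balls are used; the version with open balls differs
  at countably many radii only and has the same Dudley integral.
\<close>

definition covering_number :: "'x set \<Rightarrow> ('x \<Rightarrow> 'x \<Rightarrow> real) \<Rightarrow> real \<Rightarrow> nat" where
  "covering_number X \<rho> u =
     (LEAST n. \<exists>C. finite C \<and> C \<subseteq> X \<and> card C = n \<and> X \<subseteq> (\<Union>x\<in>C. {y \<in> X. \<rho> x y \<le> u}))"

text \<open>Valued in \<^typ>\<open>ennreal\<close>, so that a divergent integral is not silently read as \<open>0\<close>.\<close>

definition dudley :: "'x set \<Rightarrow> ('x \<Rightarrow> 'x \<Rightarrow> real) \<Rightarrow> ennreal" where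
  "dudley X \<rho> =
     (\<integral>\<^sup>+u\<in>{0<..<mdiam X \<rho>}. ennreal (sqrt (ln (real (covering_number X \<rho> u)))) \<partial>lborel)"

definition sum_metric ::
  "('x \<Rightarrow> 'x \<Rightarrow> real) \<Rightarrow> ('y \<Rightarrow> 'y \<Rightarrow> real) \<Rightarrow> 'x \<times> 'y \<Rightarrow> 'x \<times> 'y \<Rightarrow> real" where
  "sum_metric \<rho> \<sigma> = (\<lambda>(x, a) (y, b). \<rho> x y + \<sigma> a b)"


section \<open>Markov decision processes with transition densities\<close>

text \<open>
  \<open>base\<close> is the reference measure on the state space, \<open>act\<close> carries the action space and its
  sigma-algebra (its measure is irrelevant), and \<open>dens h a y x\<close> stands for \<open>p\<^sub>h\<^sup>a(y|x)\<close>.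
\<close>

record ('s, 'a) mdp =
  base :: "'s measure"
  act :: "'a measure"
  horizon :: nat
  dens :: "nat \<Rightarrow> 'a \<Rightarrow> 's \<Rightarrow> 's \<Rightarrow> real"
  reward :: "nat \<Rightarrow> 's \<Rightarrow> 'a \<Rightarrow> real"
  final :: "'s \<Rightarrow> real"

definition trans_kernel :: "('s, 'a) mdp \<Rightarrow> nat \<Rightarrow> 's \<Rightarrow> 'a \<Rightarrow> 's measure" where
  "trans_kernel M h x a = density (base M) (\<lambda>y. ennreal (dens M h a y x))"

definition policies :: "('s, 'a) mdp \<Rightarrow> (nat \<Rightarrow> 's \<Rightarrow> 'a measure) set" where
  "policies M = {\<pi>. \<forall>t<horizon M. \<pi> t \<in> base M \<rightarrow>\<^sub>M prob_algebra (act M)}"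

definition hist :: "('s, 'a) mdp \<Rightarrow> nat \<Rightarrow> ((nat \<Rightarrow> 's) \<times> (nat \<Rightarrow> 'a)) measure" where
  "hist M h = PiM {..h} (\<lambda>_. base M) \<Otimes>\<^sub>M PiM {..<h} (\<lambda>_. act M)"

text \<open>The joint law of \<open>((S\<^sub>0, \<dots>, S\<^sub>h), (A\<^sub>0, \<dots>, A\<^sub>h\<^sub>-\<^sub>1))\<close> under the policy \<open>\<pi>\<close>, started in \<open>x\<close>.\<close>

primrec traj ::
  "('s, 'a) mdp \<Rightarrow> 's \<Rightarrow> (nat \<Rightarrow> 's \<Rightarrow> 'a measure) \<Rightarrow> nat \<Rightarrow> ((nat \<Rightarrow> 's) \<times> (nat \<Rightarrow> 'a)) measure"
where
  "traj M x \<pi> 0 = return (hist M 0) (\<lambda>i\<in>{..0}. x, \<lambda>_. undefined)"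
| "traj M x \<pi> (Suc h) = traj M x \<pi> h \<bind> (\<lambda>(s, a). \<pi> h (s h) \<bind> (\<lambda>b.
     distr (trans_kernel M (Suc h) (s h) b) (hist M (Suc h)) (\<lambda>y. (s(Suc h := y), a(h := b)))))"

definition policy_value :: "('s, 'a) mdp \<Rightarrow> 's \<Rightarrow> (nat \<Rightarrow> 's \<Rightarrow> 'a measure) \<Rightarrow> real" where
  "policy_value M x \<pi> =
     (LINT (s, a)|traj M x \<pi> (horizon M).
        (\<Sum>t<horizon M. reward M t (s t) (a t)) + final M (s (horizon M)))"

definition opt_value :: "('s, 'a) mdp \<Rightarrow> 's \<Rightarrow> real" where
  "opt_value M x = (SUP \<pi>\<in>policies M. policy_value M x \<pi>)"

definition outside_prob ::
  "('s, 'a) mdp \<Rightarrow> 's \<Rightarrow> (nat \<Rightarrow> 's \<Rightarrow> 'a measure) \<Rightarrow> nat \<Rightarrow> 's set \<Rightarrow> real" where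
  "outside_prob M x \<pi> h D =
     measure (traj M x \<pi> (horizon M)) {\<omega> \<in> space (traj M x \<pi> (horizon M)). fst \<omega> h \<notin> D}"

definition reflect :: "'s set \<Rightarrow> ('s, 'a) mdp \<Rightarrow> ('s, 'a) mdp" where
  "reflect D M = M\<lparr>base := restrict_space (base M) D,
     dens := (\<lambda>h a y x. dens M h a y x
       + 1 / measure (base M) D * (LINT z:space (base M) - D|base M. dens M h a z x))\<rparr>"


section \<open>The weighted mesh algorithm\<close>

text \<open>
  In this section \<open>M\<close> is the MDP the algorithm runs on (later a reflected one), \<open>b h\<close> is the
  control used at time \<open>h\<close> to simulate the mesh, and \<open>S n h\<close> is the state of the \<open>n\<close>-th simulated
  chain at time \<open>h\<close>.
\<close>

definition mesh_law :: "('s, 'a) mdp \<Rightarrow> (nat \<Rightarrow> 'a) \<Rightarrow> 's \<Rightarrow> nat \<Rightarrow> (nat \<Rightarrow> nat \<Rightarrow> 's) measure" where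
  "mesh_law M b x N = PiM {1..N} (\<lambda>_.
     distr (traj M x (\<lambda>t _. return (act M) (b t)) (horizon M))
       (PiM {..horizon M} (\<lambda>_. base M)) fst)"

definition raw_weight ::
  "('s, 'a) mdp \<Rightarrow> (nat \<Rightarrow> 'a) \<Rightarrow> nat \<Rightarrow> (nat \<Rightarrow> nat \<Rightarrow> 's) \<Rightarrow> nat \<Rightarrow> nat \<Rightarrow> 's \<Rightarrow> 'a \<Rightarrow> real" where
  "raw_weight M b N S h n x a =
     dens M (Suc h) a (S n (Suc h)) x
     / (\<Sum>k\<in>{1..N} - {n}. dens M (Suc h) (b h) (S n (Suc h)) (S k h))"

definition weight ::
  "('s, 'a) mdp \<Rightarrow> (nat \<Rightarrow> 'a) \<Rightarrow> nat \<Rightarrow> (nat \<Rightarrow> nat \<Rightarrow> 's) \<Rightarrow> nat \<Rightarrow> nat \<Rightarrow> 's \<Rightarrow> 'a \<Rightarrow> real" where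
  "weight M b N S h n x a =
     raw_weight M b N S h n x a / (\<Sum>n'\<in>{1..N}. raw_weight M b N S h n' x a)"

text \<open>
  The recursion runs over the number \<open>k\<close> of remaining steps: \<open>mesh_value M b N S k\<close> is the
  approximate value function at time \<open>horizon M - k\<close>.
\<close>

primrec mesh_value ::
  "('s, 'a) mdp \<Rightarrow> (nat \<Rightarrow> 'a) \<Rightarrow> nat \<Rightarrow> (nat \<Rightarrow> nat \<Rightarrow> 's) \<Rightarrow> nat \<Rightarrow> 's \<Rightarrow> real"
where
  "mesh_value M b N S 0 x = final M x"
| "mesh_value M b N S (Suc k) x = (let h = horizon M - Suc k in
     (SUP a\<in>space (act M). reward M h x a
        + (\<Sum>n\<in>{1..N}. mesh_value M b N S k (S n (Suc h)) * weight M b N S h n x a)))"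

definition mesh_error :: "('s, 'a) mdp \<Rightarrow> (nat \<Rightarrow> 'a) \<Rightarrow> 's \<Rightarrow> 's set \<Rightarrow> nat \<Rightarrow> ennreal" where
  "mesh_error M b x D N =
     (\<integral>\<^sup>+S. ennreal \<bar>mesh_value (reflect D M) b N S (horizon M) x - opt_value M x\<bar>
        \<partial>mesh_law (reflect D M) b x N)"

text \<open>
  The least cost \<open>H N\<^sup>2\<close> for which the mesh with \<open>N\<close> chains, reflected in \<open>\<D> N\<close>, is
  \<open>\<epsilon>\<close>-accurate in \<open>L\<^sup>1\<close>; it is \<open>\<infinity>\<close> if there is no such \<open>N\<close>.  For \<open>N = 1\<close> the leave-one-out sums in
  the weights are empty, hence \<open>N \<ge> 2\<close>.
\<close>

definition complexity ::
  "('s, 'a) mdp \<Rightarrow> (nat \<Rightarrow> 'a) \<Rightarrow> 's \<Rightarrow> (nat \<Rightarrow> 's set) \<Rightarrow> real \<Rightarrow> ennreal" where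
  "complexity M b x \<D> \<epsilon> =
     (INF N\<in>{N. 2 \<le> N \<and> mesh_error M b x (\<D> N) N \<le> ennreal \<epsilon>}.
        ennreal (real (horizon M) * real N ^ 2))"


section \<open>Standing assumptions\<close>

text \<open>
  An MDP with state space \<open>\<real>\<^sup>d\<close>, horizon \<open>H\<close> and rewards bounded by \<open>G\<close>, whose actions form a compact
  subset of \<open>\<real>\<^sup>d\<close>; \<open>\<rho>\<close> is a metric for the topology of that subset.
\<close>

definition euclidean_mdp ::
  "nat \<Rightarrow> nat \<Rightarrow> real \<Rightarrow> (rvec, rvec) mdp \<Rightarrow> (rvec \<Rightarrow> rvec \<Rightarrow> real) \<Rightarrow> bool" where
  "euclidean_mdp d H G M \<rho> \<longleftrightarrow>
     base M = leb d \<and> horizon M = H \<and>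
     space (act M) \<noteq> {} \<and>
     compactin (euclid_top d) (space (act M)) \<and>
     sets (act M) = sets (restrict_space (leb d) (space (act M))) \<and>
     Metric_space (space (act M)) \<rho> \<and>
     Metric_space.mtopology (space (act M)) \<rho> = subtopology (euclid_top d) (space (act M)) \<and>
     (\<forall>h\<in>{1..H}.
        (\<lambda>(x, a, y). dens M h a y x) \<in> borel_measurable (leb d \<Otimes>\<^sub>M act M \<Otimes>\<^sub>M leb d) \<and>
        (\<forall>x\<in>space (leb d). \<forall>a\<in>space (act M).
           (\<forall>y\<in>space (leb d). 0 \<le> dens M h a y x) \<and> prob_space (trans_kernel M h x a))) \<and>
     (\<forall>t<H.
        (\<lambda>(x, a). reward M t x a) \<in> borel_measurable (leb d \<Otimes>\<^sub>M act M) \<and>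
        (\<forall>x\<in>space (leb d). \<forall>a\<in>space (act M). \<bar>reward M t x a\<bar> \<le> G)) \<and>
     final M \<in> borel_measurable (leb d) \<and>
     (\<forall>x\<in>space (leb d). \<bar>final M x\<bar> \<le> G)"

text \<open>
  The conditions on the densities.  Compact sets of Lebesgue measure zero are left out because of the
  division by \<open>Leb(D)\<close>.
\<close>

definition density_conditions ::
  "nat \<Rightarrow> (rvec, rvec) mdp \<Rightarrow> (rvec \<Rightarrow> rvec \<Rightarrow> real) \<Rightarrow>
   (rvec set \<Rightarrow> real) \<Rightarrow> real \<Rightarrow> (rvec set \<Rightarrow> real) \<Rightarrow> (rvec set \<Rightarrow> rvec \<Rightarrow> real) \<Rightarrow> bool" where
  "density_conditions d M \<rho> \<delta> \<Lambda> L Lip \<longleftrightarrow>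
     0 < \<Lambda> \<and>
     (\<forall>D. compactin (euclid_top d) D \<and> 0 < measure (leb d) D \<longrightarrow>
        0 < \<delta> D \<and> 0 < L D \<and>
        Lip D \<in> borel_measurable (leb d) \<and> (\<forall>y\<in>space (leb d). 0 \<le> Lip D y) \<and>
        (\<forall>h\<in>{1..horizon M}. \<forall>a\<in>space (act M). \<forall>x\<in>D. \<forall>z\<in>D.
           \<delta> D \<le> dens M h a z x \<and> dens M h a z x \<le> \<Lambda>) \<and>
        (\<forall>h\<in>{1..horizon M}. \<forall>a\<^sub>1\<in>space (act M). \<forall>a\<^sub>2\<in>space (act M).
           \<forall>x\<^sub>1\<in>D. \<forall>x\<^sub>2\<in>D. \<forall>y\<in>space (leb d).
             \<bar>dens M h a\<^sub>1 y x\<^sub>1 - dens M h a\<^sub>2 y x\<^sub>2\<bar> \<le> Lip D y * (edist d x\<^sub>1 x\<^sub>2 + \<rho> a\<^sub>1 a\<^sub>2)) \<and>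
        esssup (restrict_space (leb d) D) (\<lambda>y. ennreal (Lip D y))
          + (\<integral>\<^sup>+y\<in>space (leb d) - D. ennreal (Lip D y) \<partial>leb d) / emeasure (leb d) D
          \<le> ennreal (L D))"

end

theory Submission
  imports Defs "HOL-Real_Asymp.Real_Asymp"
begin

text \<open>
  The error of the mesh is split into a truncation error and a sampling error.  Measurable selection
  gives value functions for the MDP reflected in \<open>\<D>\<close>; telescoping them along the original
  chain bounds the truncation error by \<open>2 G H\<close> times the sum of the exit probabilities.  One step of
  the mesh is a self-normalised importance sampling estimate.  Its error, uniformly over the actions
  and over the starting points, is controlled by subgaussian maximal inequalities along a chain of
  nets of the action space only: the starting points are themselves mesh points, and leaving one out
  makes the estimate conditionally a sum of independent terms.

  The sampling error turns out to be \<open>o(ln\<^sup>q N \<cdot> N\<^bsup>\<alpha> - 1/2\<^esup>)\<close> with \<open>q = q\<^sub>d\<close>: the parts of the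
  chain carrying \<open>\<Lambda> / \<delta>\<close> only grow like \<open>N\<^bsup>\<alpha>/2\<^esup>\<close> up to logarithms, and the parts
  carrying \<open>L / \<delta>\<close> come from scales tending to zero, where the tail of the Dudley sum vanishes.  So
  only the truncation error has to be matched with the constants of the claim, and the choice
  \<open>N = \<lfloor>2 X\<rfloor>\<close>, where \<open>H X\<^sup>2\<close> is the bound without its absolute constant, leaves room for all
  lower order terms, at the price \<open>N\<^sup>2 \<le> 4 X\<^sup>2\<close>.
\<close>

section \<open>Measurable selection\<close>

text \<open>The rewards are only jointly measurable, so a supremum over the actions need not be
  Borel. Hence Suslin's operation, Bellman equations that hold only almost everywhere, and
  measurable majorants for the errors of the mesh. The starting point, the one atom in the law of
  the chain, is always treated separately. The claim allows no logarithm beyond the power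
  \<open>q\<close> of the hypotheses, while a maximal inequality costs roots of logarithms. Chaining
  therefore starts at a scale near \<open>1 / ln N\<close>. The net at that scale costs
  \<Lambda>/\<delta> times logarithms, and because the growth condition bounds the square of
  \<Lambda>/\<delta>, a factor N^(-\<alpha>/2) is left over to absorb them. The finer levels cost
  L/\<delta> at the full rate, and smallness comes from the tail of the Dudley sum. For \<alpha> = 0
  there is no such spare power. That case is excluded: small exit probabilities force the truncation
  sets to fill the whole space, and the lower density bounds then make \<Lambda>/\<delta> grow
  faster than any power of \<open>ln N\<close>. The same filling argument controls the term 1/Leb(D)
  that reflection adds to the upper density bound.\<close>

definition prefix_dep :: "(nat \<Rightarrow> (nat \<Rightarrow> nat) \<Rightarrow> 'b) \<Rightarrow> bool" where
  "prefix_dep F \<longleftrightarrow> (\<forall>k \<sigma> \<tau>. (\<forall>i<k. \<sigma> i = \<tau> i) \<longrightarrow> F k \<sigma> = F k \<tau>)"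

lemma prefix_depD: "prefix_dep F \<Longrightarrow> (\<And>i. i < k \<Longrightarrow> \<sigma> i = \<tau> i) \<Longrightarrow> F k \<sigma> = F k \<tau>"
  by (auto simp: prefix_dep_def)

text \<open>Suslin's operation A: \<open>F k \<sigma>\<close> is the set attached to the finite
  sequence \<open>\<sigma> 0, ..., \<sigma> (k - 1)\<close>, and the existential over whole branches
  is an uncountable union. Finite sequences are represented by infinite ones of which only a prefix
  counts.\<close>

definition suslin :: "'x set set \<Rightarrow> 'x set \<Rightarrow> bool" where
  "suslin P E \<longleftrightarrow>
     (\<exists>F. prefix_dep F \<and> (\<forall>k \<sigma>. F k \<sigma> \<in> P) \<and> E = {z. \<exists>\<sigma>. \<forall>k. z \<in> F k \<sigma>})"

lemma suslin_basic: "E \<in> P \<Longrightarrow> suslin P E"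
  unfolding suslin_def by (rule exI[of _ "\<lambda>_ _. E"]) (auto simp: prefix_dep_def)

text \<open>The first entry of a branch chooses the index \<open>i\<close>, the remaining entries
  form a branch for \<open>E i\<close>. At level 0 no entry is visible yet, so the set there has to
  be the whole space \<Omega>.\<close>

lemma suslin_UN:
  fixes E :: "nat \<Rightarrow> 'x set"
  assumes E: "\<And>i. suslin P (E i)" and \<Omega>: "\<Omega> \<in> P" "\<And>B. B \<in> P \<Longrightarrow> B \<subseteq> \<Omega>"
  shows "suslin P (\<Union>i. E i)"
proof -
  have "\<forall>i. \<exists>F. prefix_dep F \<and> (\<forall>k \<sigma>. F k \<sigma> \<in> P) \<and> E i = {z. \<exists>\<sigma>. \<forall>k. z \<in> F k \<sigma>}"
    using E by (auto simp: suslin_def)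
  then obtain F where F: "\<And>i. prefix_dep (F i)" "\<And>i k \<sigma>. F i k \<sigma> \<in> P"
    "\<And>i. E i = {z. \<exists>\<sigma>. \<forall>k. z \<in> F i k \<sigma>}" by metis
  define F' where "F' k \<sigma> = (case k of 0 \<Rightarrow> \<Omega> | Suc k' \<Rightarrow> F (\<sigma> 0) k' (\<lambda>j. \<sigma> (Suc j)))" for k \<sigma>
  have "prefix_dep F'"
    unfolding prefix_dep_def
  proof (intro allI impI)
    fix k and \<sigma> \<tau> :: "nat \<Rightarrow> nat" assume *: "\<forall>i<k. \<sigma> i = \<tau> i"
    show "F' k \<sigma> = F' k \<tau>"
    proof (cases k)
      case (Suc k')
      then have "F (\<sigma> 0) k' (\<lambda>j. \<sigma> (Suc j)) = F (\<sigma> 0) k' (\<lambda>j. \<tau> (Suc j))"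
        using * by (intro prefix_depD[OF F(1)]) auto
      then show ?thesis using Suc * by (simp add: F'_def)
    qed (simp add: F'_def)
  qed
  moreover have "F' k \<sigma> \<in> P" for k \<sigma>
    using F(2) \<Omega>(1) by (auto simp: F'_def split: nat.split)
  moreover have "(\<Union>i. E i) = {z. \<exists>\<sigma>. \<forall>k. z \<in> F' k \<sigma>}"
  proof safe
    fix z i assume "z \<in> E i"
    then obtain \<sigma> where \<sigma>: "\<And>k. z \<in> F i k \<sigma>" using F(3) by auto
    then have "z \<in> \<Omega>" using F(2) \<Omega>(2) by blast
    then have "\<forall>k. z \<in> F' k (case_nat i \<sigma>)"
      using \<sigma> by (auto simp: F'_def split: nat.split)
    then show "\<exists>\<sigma>. \<forall>k. z \<in> F' k \<sigma>" by blast
  next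
    fix z \<sigma> assume *: "\<forall>k. z \<in> F' k \<sigma>"
    have "z \<in> F (\<sigma> 0) k (\<lambda>j. \<sigma> (Suc j))" for k
      using *[THEN spec, of "Suc k"] by (simp add: F'_def)
    then show "z \<in> (\<Union>i. E i)" using F(3) by blast
  qed
  ultimately show ?thesis unfolding suslin_def by blast
qed

text \<open>One branch has to encode a branch for every \<open>E i\<close>, and a pairing of the
  positions does this. Prefix dependence survives because \<open>prod_encode (i, j)\<close>
  increases in \<open>j\<close>: whatever level \<open>k'\<close> of the \<open>i\<close>-th scheme
  can see is stored before position \<open>prod_encode (i, k')\<close>.\<close>

lemma suslin_INT:
  fixes E :: "nat \<Rightarrow> 'x set"
  assumes E: "\<And>i. suslin P (E i)"
  shows "suslin P (\<Inter>i. E i)"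
proof -
  have "\<forall>i. \<exists>F. prefix_dep F \<and> (\<forall>k \<sigma>. F k \<sigma> \<in> P) \<and> E i = {z. \<exists>\<sigma>. \<forall>k. z \<in> F k \<sigma>}"
    using E by (auto simp: suslin_def)
  then obtain F where F: "\<And>i. prefix_dep (F i)" "\<And>i k \<sigma>. F i k \<sigma> \<in> P"
    "\<And>i. E i = {z. \<exists>\<sigma>. \<forall>k. z \<in> F i k \<sigma>}" by metis
  define F' where "F' k \<sigma> = (case prod_decode k of (i, k') \<Rightarrow> F i k' (\<lambda>j. \<sigma> (prod_encode (i, j))))"
    for k \<sigma>
  have mono: "prod_encode (i, j) < prod_encode (i, k)" if "j < k" for i j k :: nat
  proof -
    have "triangle (i + j) < triangle (i + k)"
      using that by (induction k) (auto simp: less_Suc_eq)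
    then show ?thesis by (simp add: prod_encode_def)
  qed
  have "prefix_dep F'"
    unfolding prefix_dep_def
  proof (intro allI impI)
    fix k and \<sigma> \<tau> :: "nat \<Rightarrow> nat" assume *: "\<forall>i<k. \<sigma> i = \<tau> i"
    obtain i k' where k: "prod_decode k = (i, k')" by (cases "prod_decode k")
    then have k': "k = prod_encode (i, k')" by (metis prod_decode_inverse)
    show "F' k \<sigma> = F' k \<tau>"
      unfolding F'_def k prod.case
      by (intro prefix_depD[OF F(1)]) (use * mono k' in auto)
  qed
  moreover have "F' k \<sigma> \<in> P" for k \<sigma>
    using F(2) by (auto simp: F'_def split: prod.split)
  moreover have "(\<Inter>i. E i) = {z. \<exists>\<sigma>. \<forall>k. z \<in> F' k \<sigma>}"
  proof safe
    fix z assume "z \<in> (\<Inter>i. E i)"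
    then have "\<forall>i. \<exists>\<sigma>. \<forall>k. z \<in> F i k \<sigma>" using F(3) by auto
    then obtain \<sigma> where \<sigma>: "\<And>i k. z \<in> F i k (\<sigma> i)" by metis
    have "\<forall>k. z \<in> F' k (\<lambda>n. case prod_decode n of (i, j) \<Rightarrow> \<sigma> i j)"
      using \<sigma> by (auto simp: F'_def split: prod.split)
    then show "\<exists>\<sigma>. \<forall>k. z \<in> F' k \<sigma>" by blast
  next
    fix z \<sigma> i assume *: "\<forall>k. z \<in> F' k \<sigma>"
    have "z \<in> F i k (\<lambda>j. \<sigma> (prod_encode (i, j)))" for k
      using *[THEN spec, of "prod_encode (i, k)"] by (simp add: F'_def)
    then show "z \<in> E i" using F(3) by blast
  qed
  ultimately show ?thesis unfolding suslin_def by blast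
qed

text \<open>Koenig's lemma: the tree of sequences below \<open>m\<close> branches finitely, so
  reaching every finite depth yields an infinite branch. A prefix of length \<open>j\<close> is kept
  fixed because the branch is extracted one entry at a time, and because the later selection asks
  whether a given prefix can still be extended.\<close>

lemma koenig_bounded_branch:
  assumes G: "prefix_dep G"
    and *: "\<And>n. \<exists>\<sigma>. (\<forall>i<j. \<sigma> i = \<tau> i) \<and> (\<forall>i. \<sigma> i \<le> m i) \<and> (\<forall>k\<le>n. x \<in> G k \<sigma>)"
  shows "\<exists>\<sigma>. (\<forall>i<j. \<sigma> i = \<tau> i) \<and> (\<forall>i. \<sigma> i \<le> m i) \<and> (\<forall>k. x \<in> G k \<sigma>)"
proof -
  define good where "good j \<tau> \<longleftrightarrow>
    (\<forall>n. \<exists>\<sigma>. (\<forall>i<j. \<sigma> i = \<tau> i) \<and> (\<forall>i. \<sigma> i \<le> m i) \<and> (\<forall>k\<le>n. x \<in> G k \<sigma>))" for j \<tau>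
  have step: "\<exists>v. good (Suc j) (\<tau>(j := v))" if "good j \<tau>" for j and \<tau> :: "nat \<Rightarrow> nat"
  proof (rule ccontr)
    assume "\<nexists>v. good (Suc j) (\<tau>(j := v))"
    then have "\<forall>v. \<exists>n. \<not> (\<exists>\<sigma>. (\<forall>i<Suc j. \<sigma> i = (\<tau>(j := v)) i) \<and> (\<forall>i. \<sigma> i \<le> m i) \<and> (\<forall>k\<le>n. x \<in> G k \<sigma>))"
      by (auto simp: good_def)
    then obtain n where n: "\<And>v. \<not> (\<exists>\<sigma>. (\<forall>i<Suc j. \<sigma> i = (\<tau>(j := v)) i) \<and> (\<forall>i. \<sigma> i \<le> m i) \<and> (\<forall>k\<le>n v. x \<in> G k \<sigma>))"
      by metis
    \<comment> \<open>Only the finitely many values up to \<open>m j\<close> can occur at position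
      \<open>j\<close>, so one common depth refutes all of them at once.\<close>
    define n' where "n' = Max (n ` {..m j})"
    obtain \<sigma> where \<sigma>: "\<forall>i<j. \<sigma> i = \<tau> i" "\<forall>i. \<sigma> i \<le> m i" "\<forall>k\<le>n'. x \<in> G k \<sigma>"
      using \<open>good j \<tau>\<close> unfolding good_def by blast
    have "n (\<sigma> j) \<le> n'"
      unfolding n'_def using \<sigma>(2) by (intro Max_ge) auto
    then have "\<forall>k\<le>n (\<sigma> j). x \<in> G k \<sigma>" using \<sigma>(3) by auto
    moreover have "\<forall>i<Suc j. \<sigma> i = (\<tau>(j := \<sigma> j)) i" using \<sigma>(1) by (auto simp: less_Suc_eq)
    ultimately show False using n[of "\<sigma> j"] \<sigma>(2) by blast
  qed
  define next_val where "next_val j \<tau> = (SOME v. good (Suc j) (\<tau>(j := v)))" for j \<tau>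
  have next_val: "good (Suc j) (\<tau>(j := next_val j \<tau>))" if "good j \<tau>" for j \<tau>
    unfolding next_val_def using someI_ex[OF step[OF that]] .
  define t where "t = rec_nat \<tau> (\<lambda>n \<tau>. \<tau>(j + n := next_val (j + n) \<tau>))"
  have t: "t 0 = \<tau>" "\<And>n. t (Suc n) = (t n)(j + n := next_val (j + n) (t n))"
    by (simp_all add: t_def)
  have good_t: "good (j + n) (t n)" for n
  proof (induction n)
    case 0
    then show ?case using * by (simp add: t good_def)
  next
    case (Suc n)
    show ?case using next_val[OF Suc] unfolding t add_Suc_right .
  qed
  define \<sigma> where "\<sigma> i = t (Suc i) i" for i
  have t_stable: "t (n + l) i = t n i" if "i < j + n" for i n l
    using that by (induction l) (auto simp: t)
  have t_\<sigma>: "t n i = \<sigma> i" if "i < j + n" for i n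
  proof (cases "n \<le> Suc i")
    case True
    then show ?thesis using t_stable[of i n "Suc i - n"] that by (simp add: \<sigma>_def)
  next
    case False
    then show ?thesis using t_stable[of i "Suc i" "n - Suc i"] by (simp add: \<sigma>_def)
  qed
  show ?thesis
  proof (intro exI conjI allI impI)
    fix i assume "i < j" then show "\<sigma> i = \<tau> i" using t_\<sigma>[of i 0] by (simp add: t)
  next
    fix i
    obtain s where "\<forall>i'<j + Suc i. s i' = t (Suc i) i'" "\<forall>i'. s i' \<le> m i'"
      using good_t[of "Suc i"] unfolding good_def by blast
    then show "\<sigma> i \<le> m i" by (metis \<sigma>_def add_Suc_right less_add_same_cancel1 lessI trans_less_add2)
  next
    fix k
    obtain s where s: "\<forall>i<j + k. s i = t k i" "\<forall>k'\<le>k. x \<in> G k' s"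
      using good_t[of k] unfolding good_def by blast
    have "G k s = G k \<sigma>" using s(1) t_\<sigma> by (intro prefix_depD[OF G]) auto
    then show "x \<in> G k \<sigma>" using s(2) by auto
  qed
qed

text \<open>Below a bound \<open>m\<close>, the condition on the levels up to \<open>n\<close>
  involves finitely many prefixes and is measurable; by Koenig's lemma the intersection over
  \<open>n\<close> is the condition on infinite branches. The branch selected is the
  lexicographically least one, since its entries are fixed successively by measurable
  conditions.\<close>

lemma suslin_bounded_selection:
  fixes \<mu> :: "'x measure" and m :: "nat \<Rightarrow> nat"
  assumes G: "prefix_dep G" "\<And>k \<sigma>. G k \<sigma> \<in> sets \<mu>"
  defines "E n \<equiv> {x \<in> space \<mu>. \<exists>\<sigma>. (\<forall>i. \<sigma> i \<le> m i) \<and> (\<forall>k\<le>n. x \<in> G k \<sigma>)}"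
  shows "E n \<in> sets \<mu>"
    and "(\<Inter>n. E n) = {x \<in> space \<mu>. \<exists>\<sigma>. (\<forall>i. \<sigma> i \<le> m i) \<and> (\<forall>k. x \<in> G k \<sigma>)}"
    and "\<exists>s. (\<forall>i. (\<lambda>x. s x i) \<in> \<mu> \<rightarrow>\<^sub>M count_space UNIV) \<and> (\<forall>x\<in>(\<Inter>n. E n). \<forall>k. x \<in> G k (s x))"
proof -
  have fin: "finite {\<sigma>. (\<forall>i. \<sigma> i \<le> m i) \<and> (\<forall>i\<ge>n. \<sigma> i = 0)}" for n :: nat
  proof -
    obtain b where b: "\<And>i. i < n \<Longrightarrow> m i \<le> b"
      using finite_nat_set_iff_bounded_le[of "m ` {..<n}"] by auto
    have "{\<sigma>. (\<forall>i. \<sigma> i \<le> m i) \<and> (\<forall>i\<ge>n. \<sigma> i = 0)} \<subseteq>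
        {f. \<forall>i. (i \<in> {..<n} \<longrightarrow> f i \<in> {..b}) \<and> (i \<notin> {..<n} \<longrightarrow> f i = 0)}"
      using b by (auto intro: order_trans)
    then show ?thesis
      by (rule finite_subset) (rule finite_set_of_finite_funs; simp)
  qed
  define Ext where "Ext j \<tau> n = {x \<in> space \<mu>. \<exists>\<sigma>. (\<forall>i<j. \<sigma> i = \<tau> i) \<and> (\<forall>i. \<sigma> i \<le> m i) \<and> (\<forall>k\<le>n. x \<in> G k \<sigma>)}"
    for j \<tau> n
  have Ext_sets: "Ext j \<tau> n \<in> sets \<mu>" for j \<tau> n
  proof -
    \<comment> \<open>Entries beyond \<open>max j n\<close> are neither prescribed nor seen by the
      levels up to \<open>n\<close>; resetting them to 0 leaves finitely many
      representatives.\<close>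
    define T where "T = {\<sigma>. (\<forall>i. \<sigma> i \<le> m i) \<and> (\<forall>i\<ge>max j n. \<sigma> i = 0)} \<inter> {\<sigma>. \<forall>i<j. \<sigma> i = \<tau> i}"
    have "Ext j \<tau> n = (\<Union>\<sigma>\<in>T. \<Inter>k\<in>{..n}. G k \<sigma>)"
    proof safe
      fix x assume "x \<in> Ext j \<tau> n"
      then obtain \<sigma> where \<sigma>: "\<forall>i<j. \<sigma> i = \<tau> i" "\<forall>i. \<sigma> i \<le> m i" "\<forall>k\<le>n. x \<in> G k \<sigma>"
        by (auto simp: Ext_def)
      define \<sigma>' where "\<sigma>' i = (if i < max j n then \<sigma> i else 0)" for i
      have "\<sigma>' \<in> T" using \<sigma> by (auto simp: T_def \<sigma>'_def)
      moreover have "x \<in> G k \<sigma>'" if "k \<le> n" for k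
      proof -
        have "G k \<sigma>' = G k \<sigma>" using that by (intro prefix_depD[OF G(1)]) (auto simp: \<sigma>'_def)
        then show ?thesis using \<sigma>(3) that by auto
      qed
      ultimately show "x \<in> (\<Union>\<sigma>\<in>T. \<Inter>k\<in>{..n}. G k \<sigma>)" by auto
    next
      fix x \<sigma> assume "\<sigma> \<in> T" "x \<in> (\<Inter>k\<in>{..n}. G k \<sigma>)"
      moreover from this have "x \<in> space \<mu>" using sets.sets_into_space[OF G(2)] by blast
      ultimately show "x \<in> Ext j \<tau> n" by (auto simp: Ext_def T_def)
    qed
    moreover have "finite T" unfolding T_def using fin by blast
    ultimately show ?thesis using G(2) by (auto intro!: sets.finite_UN sets.finite_INT)
  qed
  define Inf_ext where "Inf_ext j \<tau> = {x \<in> space \<mu>. \<exists>\<sigma>. (\<forall>i<j. \<sigma> i = \<tau> i) \<and> (\<forall>i. \<sigma> i \<le> m i) \<and> (\<forall>k. x \<in> G k \<sigma>)}"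
    for j \<tau>
  have Inf_ext: "(\<Inter>n. Ext j \<tau> n) = Inf_ext j \<tau>" for j \<tau>
  proof safe
    fix x assume x: "x \<in> (\<Inter>n. Ext j \<tau> n)"
    then have "\<exists>\<sigma>. (\<forall>i<j. \<sigma> i = \<tau> i) \<and> (\<forall>i. \<sigma> i \<le> m i) \<and> (\<forall>k\<le>n. x \<in> G k \<sigma>)" for n
      by (auto simp: Ext_def)
    from koenig_bounded_branch[OF G(1) this] x show "x \<in> Inf_ext j \<tau>"
      by (auto simp: Inf_ext_def Ext_def)
  qed (auto simp: Inf_ext_def Ext_def)
  have Inf_ext_sets: "Inf_ext j \<tau> \<in> sets \<mu>" for j \<tau>
    unfolding Inf_ext[symmetric] using Ext_sets by (intro sets.countable_INT) auto
  have E_Ext: "E n = Ext 0 (\<lambda>_. 0) n" for n by (simp add: E_def Ext_def)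
  show "E n \<in> sets \<mu>" using Ext_sets E_Ext by simp
  show C: "(\<Inter>n. E n) = {x \<in> space \<mu>. \<exists>\<sigma>. (\<forall>i. \<sigma> i \<le> m i) \<and> (\<forall>k. x \<in> G k \<sigma>)}"
    unfolding E_Ext Inf_ext by (simp add: Inf_ext_def)
  \<comment> \<open>The least branch, entry by entry: the smallest value after which an infinite
    bounded branch still exists.\<close>
  define t where "t x = rec_nat (\<lambda>_. 0) (\<lambda>j \<tau>. \<tau>(j := (LEAST v. x \<in> Inf_ext (Suc j) (\<tau>(j := v)))))" for x
  have t: "t x 0 = (\<lambda>_. 0)" "\<And>j. t x (Suc j) = (t x j)(j := (LEAST v. x \<in> Inf_ext (Suc j) ((t x j)(j := v))))" for x
    by (simp_all add: t_def)
  define s where "s x i = t x (Suc i) i" for x i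
  have t_s: "t x j i = (if i < j then s x i else 0)" for x i j
    by (induction j) (auto simp: t s_def less_Suc_eq)
  have s_rec: "s x j = (LEAST v. x \<in> Inf_ext (Suc j) (\<lambda>i. if i < j then s x i else if i = j then v else 0))" for x j
  proof -
    have "(t x j)(j := v) = (\<lambda>i. if i < j then s x i else if i = j then v else 0)" for v
      by (auto simp: t_s fun_eq_iff)
    then show ?thesis by (simp add: s_def t)
  qed
  have in_ext: "x \<in> Inf_ext j (s x)" if x: "x \<in> (\<Inter>n. E n)" for x j
  proof (induction j)
    case 0
    then show ?case using x unfolding C by (simp add: Inf_ext_def)
  next
    case (Suc j)
    then obtain \<sigma> where \<sigma>: "x \<in> space \<mu>" "\<forall>i<j. \<sigma> i = s x i" "\<forall>i. \<sigma> i \<le> m i" "\<forall>k. x \<in> G k \<sigma>"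
      by (auto simp: Inf_ext_def)
    have "x \<in> Inf_ext (Suc j) (\<lambda>i. if i < j then s x i else if i = j then \<sigma> j else 0)"
      unfolding Inf_ext_def using \<sigma> by (auto intro!: exI[of _ \<sigma>] simp: less_Suc_eq)
    then have "x \<in> Inf_ext (Suc j) (\<lambda>i. if i < j then s x i else if i = j then s x j else 0)"
      unfolding s_rec[of x j] by (rule LeastI)
    then show ?case by (auto simp: Inf_ext_def less_Suc_eq)
  qed
  \<comment> \<open>Each entry is a \<open>LEAST\<close> over sets that depend on the earlier
    entries. Fixing the whole prefix to a constant \<tau> turns these into fixed measurable
    sets.\<close>
  have pre: "{x \<in> space \<mu>. \<forall>i<j. s x i = \<tau> i} \<in> sets \<mu>" for j \<tau>
  proof (induction j)
    case (Suc j)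
    let ?t = "\<lambda>v i. if i < j then \<tau> i else if i = j then v else 0"
    have "{x \<in> space \<mu>. \<forall>i<Suc j. s x i = \<tau> i} =
      {x \<in> space \<mu>. \<forall>i<j. s x i = \<tau> i} \<inter> {x \<in> space \<mu>. (LEAST v. x \<in> Inf_ext (Suc j) (?t v)) = \<tau> j}"
    proof -
      have "(s x j = \<tau> j) \<longleftrightarrow> (LEAST v. x \<in> Inf_ext (Suc j) (?t v)) = \<tau> j" if "\<forall>i<j. s x i = \<tau> i" for x
      proof -
        have "(\<lambda>i. if i < j then s x i else if i = j then v else 0) = ?t v" for v
          using that by auto
        then show ?thesis by (simp add: s_rec[of x j])
      qed
      then show ?thesis by (auto simp: less_Suc_eq)
    qed
    moreover have "(\<lambda>x. LEAST v. x \<in> Inf_ext (Suc j) (?t v)) \<in> \<mu> \<rightarrow>\<^sub>M count_space UNIV"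
      using Inf_ext_sets[measurable] by measurable
    then have "{x \<in> space \<mu>. (LEAST v. x \<in> Inf_ext (Suc j) (?t v)) = \<tau> j} \<in> sets \<mu>"
      by measurable
    ultimately show ?case using sets.Int[OF Suc] by presburger
  qed simp
  have "(\<lambda>x. s x j) \<in> \<mu> \<rightarrow>\<^sub>M count_space UNIV" for j
  proof -
    have "(\<lambda>x. s x j) -` {v} \<inter> space \<mu> \<in> sets \<mu>" for v
    proof -
      \<comment> \<open>The event is split according to the values of the first \<open>j + 1\<close>
        entries, coded by lists, of which there are only countably many.\<close>
      have "(\<lambda>x. s x j) -` {v} \<inter> space \<mu> =
        (\<Union>l\<in>{l. l ! j = v}. {x \<in> space \<mu>. \<forall>i<Suc j. s x i = l ! i})" (is "?L = ?R")
      proof (intro equalityI subsetI)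
        fix x assume x: "x \<in> ?L"
        define l where "l = map (s x) [0..<Suc j]"
        have l: "l ! i = s x i" if "i < Suc j" for i
          using that by (simp add: l_def del: upt_Suc)
        show "x \<in> ?R"
        proof (rule UN_I[of l])
          show "l \<in> {l. l ! j = v}" using l[of j] x by simp
          show "x \<in> {x \<in> space \<mu>. \<forall>i<Suc j. s x i = l ! i}" using l x by simp
        qed
      next
        fix x assume "x \<in> ?R"
        then obtain l where "l ! j = v" "x \<in> space \<mu>" "\<forall>i<Suc j. s x i = l ! i" by blast
        then show "x \<in> ?L" by blast
      qed
      moreover have "?R \<in> sets \<mu>"
        by (intro sets.countable_UN' countableI_type image_subsetI pre)
      ultimately show ?thesis by (rule ssubst)
    qed
    note vimage_sets = this
    show ?thesis
    proof (rule measurable_count_space_eq2_countable[THEN iffD2], intro conjI ballI)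
      show "(\<lambda>x. s x j) \<in> space \<mu> \<rightarrow> UNIV" by simp
    qed (rule vimage_sets)
  qed
  moreover have "x \<in> G k (s x)" if x: "x \<in> (\<Inter>n. E n)" for x k
  proof -
    obtain \<sigma> where "\<forall>i<k. \<sigma> i = s x i" "\<forall>k. x \<in> G k \<sigma>"
      using in_ext[OF x, of k] by (auto simp: Inf_ext_def)
    then show ?thesis using prefix_depD[OF G(1), of k \<sigma> "s x"] by auto
  qed
  ultimately show "\<exists>s. (\<forall>i. (\<lambda>x. s x i) \<in> \<mu> \<rightarrow>\<^sub>M count_space UNIV) \<and> (\<forall>x\<in>(\<Inter>n. E n). \<forall>k. x \<in> G k (s x))"
    by (intro exI[of _ s] conjI allI ballI)
qed

text \<open>
  Bounding the branches one coordinate at a time loses arbitrarily little outer measure, by continuity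
  from below; the branches below a fixed bound form a compact set, which makes the part of \<open>S\<close>
  they reach measurable.
\<close>

theorem suslin_ae_selection:
  fixes \<mu> :: "'x measure"
  assumes fin: "finite_measure \<mu>" and G: "prefix_dep G" "\<And>k \<sigma>. G k \<sigma> \<in> sets \<mu>"
  defines "S \<equiv> {x \<in> space \<mu>. \<exists>\<sigma>. \<forall>k. x \<in> G k \<sigma>}"
  shows "\<exists>B s. B \<in> sets \<mu> \<and> B \<subseteq> S \<and> (\<exists>Z\<in>null_sets \<mu>. S - B \<subseteq> Z) \<and>
           (\<forall>i. (\<lambda>x. s x i) \<in> \<mu> \<rightarrow>\<^sub>M count_space UNIV) \<and> (\<forall>x\<in>B. \<forall>k. x \<in> G k (s x))"
proof -
  interpret finite_measure \<mu> by (rule fin)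
  define C where "C m = {x \<in> space \<mu>. \<exists>\<sigma>. (\<forall>i. \<sigma> i \<le> m i) \<and> (\<forall>k. x \<in> G k \<sigma>)}" for m :: "nat \<Rightarrow> nat"
  define E where "E m n = {x \<in> space \<mu>. \<exists>\<sigma>. (\<forall>i. \<sigma> i \<le> m i) \<and> (\<forall>k\<le>n. x \<in> G k \<sigma>)}" for m :: "nat \<Rightarrow> nat" and n :: nat
  note E_sets = suslin_bounded_selection(1)[OF G, folded E_def]
  note E_C = suslin_bounded_selection(2)[OF G, folded E_def C_def]
  note C_sel = suslin_bounded_selection(3)[OF G, folded E_def, unfolded E_C]
  have C_sets: "C m \<in> sets \<mu>" for m
    unfolding E_C[symmetric] using E_sets by (intro sets.countable_INT) auto
  have C_S: "C m \<subseteq> S" for m by (auto simp: C_def S_def)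
  have capacity: "\<exists>m. c \<le> emeasure \<mu> (C m)" if c: "c < outer_measure_of \<mu> S" for c
  proof -
    define A where "A m n = {x \<in> space \<mu>. \<exists>\<sigma>. (\<forall>i<n. \<sigma> i \<le> m i) \<and> (\<forall>k. x \<in> G k \<sigma>)}" for m :: "nat \<Rightarrow> nat" and n :: nat
    have step: "\<exists>v. c < outer_measure_of \<mu> (A (m(n := v)) (Suc n))"
      if "c < outer_measure_of \<mu> (A m n)" for m n
    proof -
      have "A m n = (\<Union>v. A (m(n := v)) (Suc n))"
      proof (intro equalityI subsetI)
        fix x assume "x \<in> A m n"
        then obtain \<sigma> where "x \<in> space \<mu>" "\<forall>i<n. \<sigma> i \<le> m i" "\<forall>k. x \<in> G k \<sigma>" by (auto simp: A_def)
        then have "x \<in> A (m(n := \<sigma> n)) (Suc n)"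
          by (auto simp: A_def less_Suc_eq intro!: exI[of _ \<sigma>])
        then show "x \<in> (\<Union>v. A (m(n := v)) (Suc n))" by blast
      next
        fix x assume "x \<in> (\<Union>v. A (m(n := v)) (Suc n))"
        then obtain v \<sigma> where "x \<in> space \<mu>" "\<forall>i<Suc n. \<sigma> i \<le> (m(n := v)) i" "\<forall>k. x \<in> G k \<sigma>"
          by (auto simp: A_def)
        moreover from this(2) have "\<forall>i<n. \<sigma> i \<le> m i" by (metis fun_upd_other less_SucI nat_neq_iff)
        ultimately show "x \<in> A m n" by (auto simp: A_def)
      qed
      moreover have "incseq (\<lambda>v. A (m(n := v)) (Suc n))"
      proof (rule incseq_SucI, rule subsetI)
        fix v x assume "x \<in> A (m(n := v)) (Suc n)"
        then obtain \<sigma> where "x \<in> space \<mu>" "\<forall>i<Suc n. \<sigma> i \<le> (m(n := v)) i" "\<forall>k. x \<in> G k \<sigma>"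
          by (auto simp: A_def)
        then show "x \<in> A (m(n := Suc v)) (Suc n)"
          by (auto simp: A_def intro!: exI[of _ \<sigma>] split: if_splits)
      qed
      moreover have "A m n \<subseteq> space \<mu>" for m n by (auto simp: A_def)
      ultimately have "outer_measure_of \<mu> (A m n) = (SUP v. outer_measure_of \<mu> (A (m(n := v)) (Suc n)))"
        using SUP_outer_measure_of_incseq[of "\<lambda>v. A (m(n := v)) (Suc n)" \<mu>] by simp
      then show ?thesis using that by (simp add: less_SUP_iff)
    qed
    define next_val where "next_val n m = (SOME v. c < outer_measure_of \<mu> (A (m(n := v)) (Suc n)))" for n m
    have next_val: "c < outer_measure_of \<mu> (A (m(n := next_val n m)) (Suc n))"
      if "c < outer_measure_of \<mu> (A m n)" for n m
      unfolding next_val_def using someI_ex[OF step[OF that]] .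
    define t where "t = rec_nat (\<lambda>_. 0 :: nat) (\<lambda>n m. m(n := next_val n m))"
    have t: "t 0 = (\<lambda>_. 0)" "\<And>n. t (Suc n) = (t n)(n := next_val n (t n))" by (simp_all add: t_def)
    define m where "m i = t (Suc i) i" for i
    have t_m: "t n i = m i" if "i < n" for i n
      using that by (induction n) (auto simp: t m_def less_Suc_eq)
    have A_t: "A (t n) n = A m n" for n by (auto simp: A_def t_m)
    have c_A: "c < outer_measure_of \<mu> (A m n)" for n
    proof (induction n)
      case 0
      then show ?case using c by (simp add: A_def S_def)
    next
      case (Suc n)
      then have "c < outer_measure_of \<mu> (A (t (Suc n)) (Suc n))"
        unfolding t using next_val[of "t n" n] A_t[of n] by simp
      then show ?case by (simp add: A_t)
    qed
    \<comment> \<open>\<open>A m n\<close> bounds the first \<open>n\<close> entries and demands an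
      infinite branch; \<open>E m n\<close> bounds all entries but looks at the levels up to
      \<open>n\<close> only, where the entries from \<open>n\<close> on may be reset to 0. This
      passes from the outer measure of an arbitrary set to the measure of a measurable one.\<close>
    have A_E: "A m n \<subseteq> E m n" for n
    proof
      fix x assume "x \<in> A m n"
      then obtain \<sigma> where \<sigma>: "x \<in> space \<mu>" "\<forall>i<n. \<sigma> i \<le> m i" "\<forall>k. x \<in> G k \<sigma>" by (auto simp: A_def)
      define \<sigma>' where "\<sigma>' i = (if i < n then \<sigma> i else 0)" for i
      have "G k \<sigma>' = G k \<sigma>" if "k \<le> n" for k
        using that by (intro prefix_depD[OF G(1)]) (auto simp: \<sigma>'_def)
      then show "x \<in> E m n" using \<sigma> by (auto simp: E_def \<sigma>'_def intro!: exI[of _ \<sigma>'])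
    qed
    have "c \<le> emeasure \<mu> (E m n)" for n
      using c_A[of n] outer_measure_of_mono[OF A_E[of n], of \<mu>] outer_measure_of_eq[OF E_sets[of m n]]
      by (metis order.strict_implies_order order.trans)
    moreover have "(INF n. emeasure \<mu> (E m n)) = emeasure \<mu> (C m)"
      unfolding E_C[symmetric]
    proof (rule INF_emeasure_decseq)
      show "decseq (E m)"
      proof (intro decseq_SucI subsetI)
        fix n x assume "x \<in> E m (Suc n)"
        then obtain \<sigma> where "x \<in> space \<mu>" "\<forall>i. \<sigma> i \<le> m i" "\<forall>k\<le>Suc n. x \<in> G k \<sigma>"
          by (auto simp: E_def)
        then show "x \<in> E m n" unfolding E_def by auto
      qed
    qed (use E_sets in auto)
    ultimately show ?thesis
      using INF_greatest[of UNIV c "\<lambda>n. emeasure \<mu> (E m n)"] by (intro exI[of _ m]) simp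
  qed
  have S_sp: "S \<subseteq> space \<mu>" by (auto simp: S_def)
  \<comment> \<open>A measurable hull of \<open>S\<close>. Measurable subsets of \<open>S\<close>
    are now shown to exhaust its measure, so that \<open>S\<close> differs from their union by a
    null set.\<close>
  obtain T where T: "T \<in> sets \<mu>" "S \<subseteq> T" "outer_measure_of \<mu> S = emeasure \<mu> T"
    using outer_measure_of_attain[OF S_sp] by blast
  have "\<exists>m. ennreal (measure \<mu> T - 1 / Suc n) \<le> emeasure \<mu> (C m)" for n
  proof (cases "measure \<mu> T - 1 / Suc n < 0")
    case True
    then show ?thesis by (simp add: ennreal_neg)
  next
    case False
    then show ?thesis by (intro capacity) (simp add: T(3) emeasure_eq_measure ennreal_less_iff)
  qed
  then obtain m where m: "\<And>n. ennreal (measure \<mu> T - 1 / Suc n) \<le> emeasure \<mu> (C (m n))" by metis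
  define B where "B = (\<Union>n. C (m n))"
  have B: "B \<in> sets \<mu>" "B \<subseteq> S" using C_sets C_S by (auto simp: B_def)
  have "measure \<mu> T - 1 / Suc n \<le> measure \<mu> B" for n
  proof -
    have "measure \<mu> T - 1 / Suc n \<le> measure \<mu> (C (m n))"
      using m[of n] by (auto simp: emeasure_eq_measure ennreal_le_iff2 intro: order_trans[OF _ measure_nonneg])
    also have "\<dots> \<le> measure \<mu> B" using B by (intro finite_measure_mono) (auto simp: B_def)
    finally show ?thesis .
  qed
  then have "measure \<mu> T \<le> measure \<mu> B + e" if e: "0 < e" for e
  proof -
    obtain n where "1 / real (Suc n) < e" using reals_Archimedean[OF e] by (auto simp: inverse_eq_divide)
    then show ?thesis using \<open>\<And>n. measure \<mu> T - 1 / Suc n \<le> measure \<mu> B\<close>[of n] by linarith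
  qed
  then have "measure \<mu> T \<le> measure \<mu> B" by (rule field_le_epsilon)
  then have "measure \<mu> (T - B) = 0"
    using finite_measure_Diff[OF T(1) B(1) subset_trans[OF B(2) T(2)]] measure_nonneg[of \<mu> "T - B"]
    by linarith
  then have TB: "T - B \<in> null_sets \<mu>" using B T by (auto simp: null_sets_def emeasure_eq_measure)
  have SB: "S - B \<subseteq> T - B" using T by auto
  have "\<exists>s. (\<forall>i. (\<lambda>x. s x i) \<in> \<mu> \<rightarrow>\<^sub>M count_space UNIV) \<and> (\<forall>x\<in>B. \<forall>k. x \<in> G k (s x))"
  proof -
    obtain s where s: "\<And>n i. (\<lambda>x. s n x i) \<in> \<mu> \<rightarrow>\<^sub>M count_space UNIV"
      "\<And>n x k. x \<in> C (m n) \<Longrightarrow> x \<in> G k (s n x)"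
      using C_sel[of "m _"] by metis
    have "(\<lambda>x. LEAST n. x \<in> C (m n)) \<in> \<mu> \<rightarrow>\<^sub>M count_space UNIV"
      using C_sets[measurable] by measurable
    then have "(\<lambda>x. s (LEAST n. x \<in> C (m n)) x i) \<in> \<mu> \<rightarrow>\<^sub>M count_space UNIV" for i
      by (rule measurable_compose_countable[where f = "\<lambda>n x. s n x i", OF s(1)])
    moreover have "x \<in> G k (s (LEAST n. x \<in> C (m n)) x)" if "x \<in> B" for x k
    proof -
      obtain n where "x \<in> C (m n)" using \<open>x \<in> B\<close> by (auto simp: B_def)
      then have "x \<in> C (m (LEAST n. x \<in> C (m n)))" by (rule LeastI)
      then show ?thesis by (rule s(2))
    qed
    ultimately show ?thesis
      by (intro exI[of _ "\<lambda>x. s (LEAST n. x \<in> C (m n)) x"] conjI allI ballI)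
  qed
  then obtain s where "(\<forall>i. (\<lambda>x. s x i) \<in> \<mu> \<rightarrow>\<^sub>M count_space UNIV) \<and> (\<forall>x\<in>B. \<forall>k. x \<in> G k (s x))" ..
  then show ?thesis
    using B TB SB by (intro exI[of _ B] exI[of _ s] conjI bexI[of _ "T - B"]) simp_all
qed

section \<open>Selection and suprema for jointly measurable functions of a state and an
  action\<close>

definition seq_closed :: "nat \<Rightarrow> rvec set \<Rightarrow> bool" where
  "seq_closed d K \<longleftrightarrow> K \<subseteq> space (leb d) \<and>
     (\<forall>u a. (\<forall>n. u n \<in> K) \<and> a \<in> space (leb d) \<and> (\<forall>i<d. (\<lambda>n. u n i) \<longlonglongrightarrow> a i) \<longrightarrow> a \<in> K)"

lemma seq_closedD:
  assumes "seq_closed d K" "\<And>n. u n \<in> K" "a \<in> space (leb d)" "\<And>i. i < d \<Longrightarrow> (\<lambda>n. u n i) \<longlonglongrightarrow> a i"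
  shows "a \<in> K"
  using assms(1)[unfolded seq_closed_def, THEN conjunct2, THEN spec, THEN spec, THEN mp, of u a] assms(2-)
  by simp

lemma seq_closedI:
  assumes "K \<subseteq> space (leb d)"
    and "\<And>u a. (\<And>n. u n \<in> K) \<Longrightarrow> a \<in> space (leb d) \<Longrightarrow>
      (\<And>i. i < d \<Longrightarrow> (\<lambda>n. u n i) \<longlonglongrightarrow> a i) \<Longrightarrow> a \<in> K"
  shows "seq_closed d K"
  unfolding seq_closed_def
proof (intro conjI allI impI assms(1))
  fix u a
  assume "(\<forall>n. u n \<in> K) \<and> a \<in> space (leb d) \<and> (\<forall>i<d. (\<lambda>n. u n i) \<longlonglongrightarrow> a i)"
  then show "a \<in> K" using assms(2)[of u a] by simp
qed

lemma seq_closed_subset: "seq_closed d K \<Longrightarrow> K \<subseteq> space (leb d)"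
  unfolding seq_closed_def by (rule conjunct1)

lemma seq_closed_le:
  assumes A: "seq_closed d A" and i: "i < d"
  shows "seq_closed d {a\<in>A. a i \<le> t}" "seq_closed d {a\<in>A. t \<le> a i}"
proof -
  show "seq_closed d {a\<in>A. a i \<le> t}"
  proof (rule seq_closedI)
    fix u a assume u: "\<And>n. u n \<in> {a\<in>A. a i \<le> t}" and a: "a \<in> space (leb d)"
      and lim: "\<And>i. i < d \<Longrightarrow> (\<lambda>n. u n i) \<longlonglongrightarrow> a i"
    have "a \<in> A" using u by (intro seq_closedD[OF A _ a lim]) auto
    moreover have "a i \<le> t" using u by (intro LIMSEQ_le_const2[OF lim[OF i]]) auto
    ultimately show "a \<in> {a\<in>A. a i \<le> t}" by simp
  qed (use seq_closed_subset[OF A] in auto)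
  show "seq_closed d {a\<in>A. t \<le> a i}"
  proof (rule seq_closedI)
    fix u a assume u: "\<And>n. u n \<in> {a\<in>A. t \<le> a i}" and a: "a \<in> space (leb d)"
      and lim: "\<And>i. i < d \<Longrightarrow> (\<lambda>n. u n i) \<longlonglongrightarrow> a i"
    have "a \<in> A" using u by (intro seq_closedD[OF A _ a lim]) auto
    moreover have "t \<le> a i" using u by (intro LIMSEQ_le_const[OF lim[OF i]]) auto
    ultimately show "a \<in> {a\<in>A. t \<le> a i}" by simp
  qed (use seq_closed_subset[OF A] in auto)
qed

text \<open>The sets that are Suslin together with their complements form a sigma-algebra. It
  therefore suffices to treat cylinders over sets of \<mu> and closed half spaces in the second
  variable; their complements are countable unions of rectangles whose second side is again closed.
  Closed second sides are what later keeps limits of actions inside the set.\<close>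

lemma suslin_pair_sets:
  fixes \<mu> :: "'x measure"
  assumes A: "seq_closed d A" and \<Gamma>: "\<Gamma> \<in> sets (\<mu> \<Otimes>\<^sub>M restrict_space (leb d) A)"
  shows "suslin {B \<times> K | B K. B \<in> sets \<mu> \<and> K \<subseteq> A \<and> seq_closed d K} \<Gamma>"
proof -
  have A_leb: "A \<subseteq> space (leb d)" using A unfolding seq_closed_def by (rule conjunct1)
  define P where "P = {B \<times> K | B K. B \<in> sets \<mu> \<and> K \<subseteq> A \<and> seq_closed d K}"
  define \<Omega> where "\<Omega> = space \<mu> \<times> A"
  have P: "B \<times> K \<in> P" if "B \<in> sets \<mu>" "K \<subseteq> A" "seq_closed d K" for B K
    using that by (auto simp: P_def)
  have \<Omega>: "\<Omega> \<in> P" "\<And>B. B \<in> P \<Longrightarrow> B \<subseteq> \<Omega>"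
    using A P[of "space \<mu>" A] by (auto simp: \<Omega>_def P_def dest: sets.sets_into_space)
  define S where "S = {E. E \<subseteq> \<Omega> \<and> suslin P E \<and> suslin P (\<Omega> - E)}"
  have sa: "sigma_algebra \<Omega> S"
    unfolding sigma_algebra_iff2
  proof (intro conjI ballI allI impI)
    show "S \<subseteq> Pow \<Omega>" by (auto simp: S_def)
    have "suslin P {}" using P[of "{}" A] A by (auto intro!: suslin_basic)
    then show "{} \<in> S" using \<Omega> by (auto simp: S_def intro: suslin_basic)
    fix E assume "E \<in> S"
    then show "\<Omega> - E \<in> S" by (auto simp: S_def double_diff)
  next
    fix E :: "nat \<Rightarrow> _" assume E: "range E \<subseteq> S"
    have E': "E i \<subseteq> \<Omega>" "suslin P (E i)" "suslin P (\<Omega> - E i)" for i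
    proof -
      have "E i \<in> S" using E by blast
      then show "E i \<subseteq> \<Omega>" "suslin P (E i)" "suslin P (\<Omega> - E i)" unfolding S_def by simp_all
    qed
    have "suslin P (\<Omega> - (\<Union>i. E i))"
    proof -
      have "\<Omega> - (\<Union>i. E i) = (\<Inter>i. \<Omega> - E i)" by blast
      then show ?thesis using suslin_INT[of P "\<lambda>i. \<Omega> - E i", OF E'(3)] by (rule ssubst)
    qed
    then show "(\<Union>i. E i) \<in> S"
      unfolding S_def by (intro CollectI conjI UN_least E'(1) suslin_UN[OF E'(2) \<Omega>])
  qed
  define W where "W = sigma \<Omega> S"
  have W: "space W = \<Omega>" "sets W = S"
    unfolding W_def by (rule sigma_algebra.space_measure_of_eq[OF sa] sigma_algebra.sets_measure_of_eq[OF sa])+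
  have rect: "suslin P (B \<times> K)" if "B \<in> sets \<mu>" "K \<subseteq> A" "seq_closed d K" for B K
    by (rule suslin_basic[OF P[OF that]])
  have "fst \<in> W \<rightarrow>\<^sub>M \<mu>"
  proof (rule measurableI)
    fix B assume B: "B \<in> sets \<mu>"
    have eq: "fst -` B \<inter> \<Omega> = B \<times> A" "\<Omega> - B \<times> A = (space \<mu> - B) \<times> A"
      using sets.sets_into_space[OF B] by (auto simp: \<Omega>_def)
    show "fst -` B \<inter> space W \<in> sets W"
      unfolding W S_def eq
    proof (intro CollectI conjI)
      show "B \<times> A \<subseteq> \<Omega>" using sets.sets_into_space[OF B] by (auto simp: \<Omega>_def)
      show "suslin P (B \<times> A)" by (rule rect[OF B order_refl A])
      show "suslin P (\<Omega> - B \<times> A)" unfolding eq by (rule rect[OF sets.compl_sets[OF B] order_refl A])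
    qed
  qed (simp add: W \<Omega>_def mem_Times_iff)
  moreover have "snd \<in> W \<rightarrow>\<^sub>M restrict_space (leb d) A"
  proof (rule measurable_restrict_space2)
    show "snd \<in> W \<rightarrow>\<^sub>M leb d"
      unfolding leb_def
    proof (rule measurable_PiM_single')
      show "snd \<in> space W \<rightarrow> ({..<d} \<rightarrow>\<^sub>E space lborel)"
      proof (rule funcsetI)
        fix z assume "z \<in> space W"
        then have "snd z \<in> A" by (simp add: W \<Omega>_def mem_Times_iff)
        then have "snd z \<in> space (leb d)" using A_leb by (rule subsetD[rotated])
        then show "snd z \<in> {..<d} \<rightarrow>\<^sub>E space lborel" by (simp add: space_leb)
      qed
      fix i assume i: "i \<in> {..<d}"
      then have i': "i < d" by simp
      have half_space: "{z \<in> \<Omega>. snd z i \<le> t} \<in> S" for t :: real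
      proof -
        have eq: "{z \<in> \<Omega>. snd z i \<le> t} = space \<mu> \<times> {a\<in>A. a i \<le> t}"
          unfolding \<Omega>_def by auto
        have eq2: "\<Omega> - {z \<in> \<Omega>. snd z i \<le> t} = (\<Union>n. space \<mu> \<times> {a\<in>A. t + 1 / Suc n \<le> a i})"
        proof (intro equalityI subsetI)
          fix z assume "z \<in> \<Omega> - {z \<in> \<Omega>. snd z i \<le> t}"
          then have z: "fst z \<in> space \<mu>" "snd z \<in> A" "0 < snd z i - t" unfolding \<Omega>_def by auto
          then obtain n where "1 / Suc n < snd z i - t" using reals_Archimedean by (metis inverse_eq_divide)
          then have "t + 1 / Suc n \<le> snd z i" by linarith
          then have "z \<in> space \<mu> \<times> {a\<in>A. t + 1 / Suc n \<le> a i}"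
            using z(1,2) by (simp add: mem_Times_iff)
          then show "z \<in> (\<Union>n. space \<mu> \<times> {a\<in>A. t + 1 / Suc n \<le> a i})" by blast
        next
          fix z assume "z \<in> (\<Union>n. space \<mu> \<times> {a\<in>A. t + 1 / Suc n \<le> a i})"
          then obtain n where n: "fst z \<in> space \<mu>" "snd z \<in> A" "t + 1 / Suc n \<le> snd z i" by auto
          have "0 < 1 / real (Suc n)" by simp
          then have "\<not> snd z i \<le> t" using n(3) by linarith
          then show "z \<in> \<Omega> - {z \<in> \<Omega>. snd z i \<le> t}" using n unfolding \<Omega>_def by (simp add: mem_Times_iff)
        qed
        show ?thesis
          unfolding S_def
        proof (intro CollectI conjI)
          show "{z \<in> \<Omega>. snd z i \<le> t} \<subseteq> \<Omega>" by blast
          show "suslin P {z \<in> \<Omega>. snd z i \<le> t}"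
            unfolding eq by (rule rect[OF sets.top _ seq_closed_le(1)[OF A i']]) blast
          show "suslin P (\<Omega> - {z \<in> \<Omega>. snd z i \<le> t})"
            unfolding eq2
            by (rule suslin_UN[OF _ \<Omega>]) (rule rect[OF sets.top _ seq_closed_le(2)[OF A i']], blast)
        qed
      qed
      have "(\<lambda>z. snd z i) \<in> borel_measurable W"
        unfolding borel_measurable_iff_le W by (intro allI half_space)
      then show "(\<lambda>z. snd z i) \<in> W \<rightarrow>\<^sub>M lborel" by simp
    qed
  qed (simp add: W \<Omega>_def mem_Times_iff)
  ultimately have "(\<lambda>z. (fst z, snd z)) \<in> W \<rightarrow>\<^sub>M \<mu> \<Otimes>\<^sub>M restrict_space (leb d) A"
    by (rule measurable_Pair)
  then have "(\<lambda>z. z) -` \<Gamma> \<inter> space W \<in> sets W"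
    unfolding prod.collapse by (rule measurable_sets[OF _ \<Gamma>])
  moreover have "\<Gamma> \<subseteq> space W"
  proof -
    have "\<Gamma> \<subseteq> space \<mu> \<times> (A \<inter> space (leb d))"
      using sets.sets_into_space[OF \<Gamma>] unfolding space_pair_measure space_restrict_space .
    then show ?thesis unfolding W \<Omega>_def by blast
  qed
  ultimately have "\<Gamma> \<in> S" unfolding W by (simp add: Int_absorb2)
  then have "suslin P \<Gamma>" unfolding S_def by simp
  then show ?thesis unfolding P_def .
qed

text \<open>Closed cubes of radius \<open>1 / 2 ^ j\<close> about grid points. The integer
  coordinates of the centre are coded by a single natural number, so that a sequence of boxes can be
  part of a branch.\<close>

definition dyadic_box :: "nat \<Rightarrow> nat \<Rightarrow> nat \<Rightarrow> rvec set" where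
  "dyadic_box d j v = {a. \<forall>i<d. \<bar>a i - real_of_int ((from_nat v :: int list) ! i) / 2 ^ j\<bar> \<le> 1 / 2 ^ j}"

lemma dyadic_box_cover: "\<exists>v. a \<in> dyadic_box d j v"
proof
  have "\<bar>a i - real_of_int \<lfloor>a i * 2 ^ j\<rfloor> / 2 ^ j\<bar> \<le> 1 / 2 ^ j" for i
  proof -
    have "a i - real_of_int \<lfloor>a i * 2 ^ j\<rfloor> / 2 ^ j = (a i * 2 ^ j - real_of_int \<lfloor>a i * 2 ^ j\<rfloor>) / 2 ^ j"
      by (simp add: field_simps)
    moreover have "\<bar>a i * 2 ^ j - real_of_int \<lfloor>a i * 2 ^ j\<rfloor>\<bar> \<le> 1" by linarith
    ultimately show ?thesis by (simp add: divide_right_mono)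
  qed
  then show "a \<in> dyadic_box d j (to_nat (map (\<lambda>i. \<lfloor>a i * 2 ^ j\<rfloor>) [0..<d]))"
    by (simp add: dyadic_box_def)
qed

text \<open>A Jankov-von Neumann selection up to a null set. Branches for \<Gamma> are interleaved
  with codes of shrinking dyadic boxes around the action, so a measurably chosen branch determines
  the action as the limit of the box centres, a measurable function of the point.\<close>

theorem measurable_selection:
  fixes \<mu> :: "'x measure"
  assumes fin: "finite_measure \<mu>" and A: "seq_closed d A" "A \<noteq> {}"
    and \<Gamma>: "\<Gamma> \<in> sets (\<mu> \<Otimes>\<^sub>M restrict_space (leb d) A)"
  shows "\<exists>B f. B \<in> sets \<mu> \<and> f \<in> \<mu> \<rightarrow>\<^sub>M restrict_space (leb d) A \<and>
    (\<exists>Z\<in>null_sets \<mu>. {x \<in> space \<mu>. \<exists>a\<in>A. (x, a) \<in> \<Gamma>} - B \<subseteq> Z) \<and> (\<forall>x\<in>B. (x, f x) \<in> \<Gamma>)"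
proof -
  have A_leb: "A \<subseteq> space (leb d)" by (rule seq_closed_subset[OF A(1)])
  obtain F where F': "prefix_dep F \<and> (\<forall>k \<sigma>. F k \<sigma> \<in> {B \<times> K | B K. B \<in> sets \<mu> \<and> K \<subseteq> A \<and> seq_closed d K}) \<and>
    \<Gamma> = {z. \<exists>\<sigma>. \<forall>k. z \<in> F k \<sigma>}"
    using suslin_pair_sets[OF A(1) \<Gamma>] unfolding suslin_def ..
  note F = F'[THEN conjunct1] F'[THEN conjunct2, THEN conjunct1, rule_format] F'[THEN conjunct2, THEN conjunct2]
  have "\<forall>k \<sigma>. \<exists>B K. F k \<sigma> = B \<times> K \<and> B \<in> sets \<mu> \<and> K \<subseteq> A \<and> seq_closed d K"
  proof (intro allI)
    fix k \<sigma> show "\<exists>B K. F k \<sigma> = B \<times> K \<and> B \<in> sets \<mu> \<and> K \<subseteq> A \<and> seq_closed d K"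
      using F(2)[of k \<sigma>] by simp
  qed
  then obtain FB FK where FBK: "\<And>k \<sigma>. F k \<sigma> = FB k \<sigma> \<times> FK k \<sigma>" "\<And>k \<sigma>. FB k \<sigma> \<in> sets \<mu>"
    "\<And>k \<sigma>. FK k \<sigma> \<subseteq> A" "\<And>k \<sigma>. seq_closed d (FK k \<sigma>)" by metis
  define l where "l \<sigma> i = fst (prod_decode (\<sigma> i))" for \<sigma> :: "nat \<Rightarrow> nat" and i
  define r where "r \<sigma> i = snd (prod_decode (\<sigma> i))" for \<sigma> :: "nat \<Rightarrow> nat" and i
  \<comment> \<open>For rectangles, the existence of an action compatible with finitely many levels
    and boxes does not depend on \<open>x\<close>. So \<open>G k \<sigma>\<close> is a finite
    intersection of first sides or empty, and no projection of a measurable set is taken.\<close>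
  define G where "G k \<sigma> = {x \<in> space \<mu>. \<exists>a. (\<forall>j\<le>k. (x, a) \<in> F j (l \<sigma>)) \<and> (\<forall>j<k. a \<in> dyadic_box d j (r \<sigma> j))}"
    for k \<sigma>
  have G_dep: "prefix_dep G"
    unfolding prefix_dep_def
  proof (intro allI impI)
    fix k and \<sigma> \<tau> :: "nat \<Rightarrow> nat" assume *: "\<forall>i<k. \<sigma> i = \<tau> i"
    have "F j (l \<sigma>) = F j (l \<tau>)" if "j \<le> k" for j
      using that * by (intro prefix_depD[OF F(1)]) (auto simp: l_def)
    moreover have "r \<sigma> j = r \<tau> j" if "j < k" for j using that * by (simp add: r_def)
    ultimately show "G k \<sigma> = G k \<tau>" unfolding G_def by (metis (mono_tags, lifting))
  qed
  have G_sets: "G k \<sigma> \<in> sets \<mu>" for k \<sigma>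
  proof -
    have "G k \<sigma> = {x \<in> (\<Inter>j\<in>{..k}. FB j (l \<sigma>)).
        \<exists>a. (\<forall>j\<le>k. a \<in> FK j (l \<sigma>)) \<and> (\<forall>j<k. a \<in> dyadic_box d j (r \<sigma> j))}"
      using sets.sets_into_space[OF FBK(2)] by (auto simp: G_def FBK(1))
    also have "\<dots> = (if \<exists>a. (\<forall>j\<le>k. a \<in> FK j (l \<sigma>)) \<and> (\<forall>j<k. a \<in> dyadic_box d j (r \<sigma> j))
        then (\<Inter>j\<in>{..k}. FB j (l \<sigma>)) else {})" by auto
    also have "\<dots> \<in> sets \<mu>" using FBK(2) by (auto intro!: sets.finite_INT)
    finally show ?thesis .
  qed
  obtain B s where Bs: "B \<in> sets \<mu> \<and> B \<subseteq> {x \<in> space \<mu>. \<exists>\<sigma>. \<forall>k. x \<in> G k \<sigma>} \<and>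
      (\<exists>Z\<in>null_sets \<mu>. {x \<in> space \<mu>. \<exists>\<sigma>. \<forall>k. x \<in> G k \<sigma>} - B \<subseteq> Z) \<and>
      (\<forall>i. (\<lambda>x. s x i) \<in> \<mu> \<rightarrow>\<^sub>M count_space UNIV) \<and> (\<forall>x\<in>B. \<forall>k. x \<in> G k (s x))"
    using suslin_ae_selection[OF fin G_dep G_sets] by (elim exE) (rule that)
  then have B: "B \<in> sets \<mu>" "\<exists>Z\<in>null_sets \<mu>. {x \<in> space \<mu>. \<exists>\<sigma>. \<forall>k. x \<in> G k \<sigma>} - B \<subseteq> Z"
    and s: "\<And>i. (\<lambda>x. s x i) \<in> \<mu> \<rightarrow>\<^sub>M count_space UNIV" "\<And>x k. x \<in> B \<Longrightarrow> x \<in> G k (s x)"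
    by simp_all
  have proj: "{x \<in> space \<mu>. \<exists>a\<in>A. (x, a) \<in> \<Gamma>} \<subseteq> {x \<in> space \<mu>. \<exists>\<sigma>. \<forall>k. x \<in> G k \<sigma>}"
  proof safe
    fix x a assume x: "x \<in> space \<mu>" "(x, a) \<in> \<Gamma>"
    then obtain \<sigma> where \<sigma>: "\<And>k. (x, a) \<in> F k \<sigma>" using F(3) by auto
    obtain \<tau> where \<tau>: "\<And>j. a \<in> dyadic_box d j (\<tau> j)" using dyadic_box_cover by metis
    define \<xi> where "\<xi> i = prod_encode (\<sigma> i, \<tau> i)" for i
    have "l \<xi> = \<sigma>" "r \<xi> = \<tau>" by (auto simp: l_def r_def \<xi>_def)
    then have "x \<in> G k \<xi>" for k using x \<sigma> \<tau> by (auto simp: G_def)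
    then show "\<exists>\<sigma>. \<forall>k. x \<in> G k \<sigma>" by blast
  qed
  obtain a0 where a0: "a0 \<in> A" using A by auto
  define c where "c x j i = real_of_int ((from_nat (r (s x) j) :: int list) ! i) / 2 ^ j" for x j i
  define f where "f x = (\<lambda>i\<in>{..<d}. if x \<in> B then lim (\<lambda>j. c x j i) else a0 i)" for x
  have f_leb: "f x \<in> space (leb d)" for x by (auto simp: f_def space_leb)
  have f: "f x \<in> A \<and> (x, f x) \<in> \<Gamma>" if x: "x \<in> B" for x
  proof -
    have "\<forall>k. \<exists>a. (\<forall>j\<le>k. (x, a) \<in> F j (l (s x))) \<and> (\<forall>j<k. a \<in> dyadic_box d j (r (s x) j))"
      using s(2)[OF x] by (auto simp: G_def)
    \<comment> \<open>The witness \<open>a k\<close> serves only the levels up to \<open>k\<close>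
      and may change with \<open>k\<close>. The box centres \<open>c x j\<close> are determined by
      the chosen branch alone and force these witnesses to converge.\<close>
    then obtain a where a: "\<And>k j. j \<le> k \<Longrightarrow> (x, a k) \<in> F j (l (s x))"
      "\<And>k j. j < k \<Longrightarrow> a k \<in> dyadic_box d j (r (s x) j)" by metis
    have ac: "\<bar>a k i - c x j i\<bar> \<le> 1 / 2 ^ j" if "j < k" "i < d" for i j k
      using a(2)[OF that(1)] that(2) by (auto simp: dyadic_box_def c_def)
    have lim: "(\<lambda>k. a k i) \<longlonglongrightarrow> f x i" if i: "i < d" for i
    proof -
      have cauchy: "Cauchy (\<lambda>j. c x j i)"
      proof (rule metric_CauchyI)
        fix e :: real assume "0 < e"
        then obtain M where M: "(1 / 2) ^ M < e / 2" using real_arch_pow_inv[of "e/2" "1/2"] by auto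
        have "dist (c x m i) (c x n i) < e" if "m \<ge> M" "n \<ge> M" for m n
        proof -
          have "1 / 2 ^ m \<le> (1 / 2 :: real) ^ M" "1 / 2 ^ n \<le> (1 / 2 :: real) ^ M"
            using that by (simp_all add: power_one_over divide_simps power_increasing)
          moreover have "\<bar>a (Suc (max m n)) i - c x m i\<bar> \<le> 1 / 2 ^ m" "\<bar>a (Suc (max m n)) i - c x n i\<bar> \<le> 1 / 2 ^ n"
            using i by (auto intro!: ac)
          ultimately show ?thesis using M unfolding dist_real_def by linarith
        qed
        then show "\<exists>M. \<forall>m\<ge>M. \<forall>n\<ge>M. dist (c x m i) (c x n i) < e" by blast
      qed
      then have c_lim: "(\<lambda>j. c x j i) \<longlonglongrightarrow> f x i"
        using i x by (simp add: f_def Cauchy_convergent convergent_LIMSEQ_iff[symmetric])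
      have "(\<lambda>j. a (Suc j) i - c x j i) \<longlonglongrightarrow> 0"
      proof (rule Lim_null_comparison)
        show "\<forall>\<^sub>F j in sequentially. norm (a (Suc j) i - c x j i) \<le> (1 / 2) ^ j"
          using ac i by (auto simp: power_one_over)
        show "(\<lambda>j. (1 / 2 :: real) ^ j) \<longlonglongrightarrow> 0" by (simp add: LIMSEQ_power_zero)
      qed
      from tendsto_add[OF this c_lim] have "(\<lambda>j. a (Suc j) i) \<longlonglongrightarrow> f x i" by simp
      then show ?thesis by (rule LIMSEQ_imp_Suc)
    qed
    have "f x \<in> FK j (l (s x))" for j
    proof (rule seq_closedD[OF FBK(4)])
      show "a (n + j) \<in> FK j (l (s x))" for n using a(1)[of j "n + j"] by (simp add: FBK(1))
      show "(\<lambda>n. a (n + j) i) \<longlonglongrightarrow> f x i" if "i < d" for i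
        using LIMSEQ_ignore_initial_segment[OF lim[OF that]] .
    qed (rule f_leb)
    moreover have "x \<in> FB j (l (s x))" for j using a(1)[of j j] by (simp add: FBK(1))
    ultimately have "(x, f x) \<in> F j (l (s x))" "f x \<in> A" for j using FBK by blast+
    then show ?thesis using F(3) by auto
  qed
  have "f x \<in> A" for x
  proof (cases "x \<in> B")
    case False
    then have "f x = a0" using a0 A_leb by (auto simp: f_def space_leb fun_eq_iff PiE_iff extensional_def)
    then show ?thesis using a0 by simp
  qed (use f in auto)
  moreover have "f \<in> \<mu> \<rightarrow>\<^sub>M leb d"
    unfolding leb_def
  proof (rule measurable_PiM_single')
    show "f \<in> space \<mu> \<rightarrow> ({..<d} \<rightarrow>\<^sub>E space lborel)" using f_leb by (auto simp: space_leb)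
    fix i assume i: "i \<in> {..<d}"
    have "(\<lambda>x. c x j i) \<in> borel_measurable \<mu>" for j
      unfolding c_def r_def
      by (rule measurable_compose[OF s(1), where g = "\<lambda>n. real_of_int ((from_nat (snd (prod_decode n)) :: int list) ! i) / 2 ^ j"]) simp
    then have "(\<lambda>x. if x \<in> B then lim (\<lambda>j. c x j i) else a0 i) \<in> borel_measurable \<mu>"
      using B(1) by (intro measurable_If_set borel_measurable_lim_metric) auto
    then show "(\<lambda>x. f x i) \<in> \<mu> \<rightarrow>\<^sub>M lborel" using i by (simp add: f_def)
  qed
  ultimately have "f \<in> \<mu> \<rightarrow>\<^sub>M restrict_space (leb d) A" by (auto intro!: measurable_restrict_space2)
  moreover obtain Z where "Z \<in> null_sets \<mu>" "{x \<in> space \<mu>. \<exists>a\<in>A. (x, a) \<in> \<Gamma>} - B \<subseteq> Z"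
    using B(2) proj by blast
  ultimately show ?thesis using B(1) f by blast
qed

text \<open>For a rational level, the points at which some action exceeds it agree up to a null set
  with the measurable set on which a selection works. The supremum of the levels reached is the
  Borel version \<open>v\<close>, and one more selection, from the set where \<open>g\<close>
  exceeds \<open>v - e\<close>, gives nearly optimal actions.\<close>

theorem measurable_sup_selection:
  fixes \<mu> :: "'x measure" and g :: "'x \<Rightarrow> rvec \<Rightarrow> real"
  assumes fin: "finite_measure \<mu>" and A: "seq_closed d A" "A \<noteq> {}"
    and g: "(\<lambda>(x, a). g x a) \<in> borel_measurable (\<mu> \<Otimes>\<^sub>M restrict_space (leb d) A)"
    and C: "\<And>x a. x \<in> space \<mu> \<Longrightarrow> a \<in> A \<Longrightarrow> \<bar>g x a\<bar> \<le> C"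
  shows "\<exists>v \<in> borel_measurable \<mu>. (AE x in \<mu>. v x = (SUP a\<in>A. g x a)) \<and>
    (\<forall>e>0. \<exists>f \<in> \<mu> \<rightarrow>\<^sub>M restrict_space (leb d) A. AE x in \<mu>. v x - e < g x (f x))"
proof -
  define A' where "A' = restrict_space (leb d) A"
  have A': "space A' = A" using seq_closed_subset[OF A(1)] by (auto simp: A'_def space_restrict_space)
  note g[folded A'_def, measurable]
  define q where "q n = real_of_rat (from_nat n :: rat)" for n
  define \<Gamma> where "\<Gamma> n = {z \<in> space (\<mu> \<Otimes>\<^sub>M A'). q n < (case z of (x, a) \<Rightarrow> g x a)}" for n
  have "\<Gamma> n \<in> sets (\<mu> \<Otimes>\<^sub>M A')" for n unfolding \<Gamma>_def by measurable
  then have sel: "\<exists>B f. B \<in> sets \<mu> \<and> f \<in> \<mu> \<rightarrow>\<^sub>M A' \<and>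
    (\<exists>Z\<in>null_sets \<mu>. {x \<in> space \<mu>. \<exists>a\<in>A. (x, a) \<in> \<Gamma> n} - B \<subseteq> Z) \<and> (\<forall>x\<in>B. (x, f x) \<in> \<Gamma> n)" for n
    unfolding A'_def by (rule measurable_selection[OF fin A])
  define Q where "Q n B f Z \<longleftrightarrow> B \<in> sets \<mu> \<and> f \<in> \<mu> \<rightarrow>\<^sub>M A' \<and> Z \<in> null_sets \<mu> \<and>
    {x \<in> space \<mu>. \<exists>a\<in>A. (x, a) \<in> \<Gamma> n} - B \<subseteq> Z \<and> (\<forall>x\<in>B. (x, f x) \<in> \<Gamma> n)" for n B f Z
  have "\<exists>B f Z. Q n B f Z" for n
    using sel[of n] unfolding Q_def Bex_def by (elim exE conjE) (intro exI conjI, assumption+)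
  then obtain B f Z where Q: "\<And>n. Q n (B n) (f n) (Z n)" by metis
  have B: "\<And>n. B n \<in> sets \<mu>" "\<And>n. Z n \<in> null_sets \<mu>"
    "\<And>n. {x \<in> space \<mu>. \<exists>a\<in>A. (x, a) \<in> \<Gamma> n} - B n \<subseteq> Z n"
    using Q by (simp_all add: Q_def)
  have f: "\<And>n. f n \<in> \<mu> \<rightarrow>\<^sub>M A'" "\<And>n x. x \<in> B n \<Longrightarrow> (x, f n x) \<in> \<Gamma> n"
    using Q by (simp_all add: Q_def)
  \<comment> \<open>\<open>- C\<close> lies below all values of \<open>g\<close>, so levels that are
    not reached do not raise the supremum.\<close>
  define u where "u n x = (if x \<in> B n then q n else - C)" for n x
  define v where "v x = (SUP n. u n x)" for x
  have bdd: "bdd_above ((\<lambda>a. g x a) ` A)" if "x \<in> space \<mu>" for x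
    using C[OF that] by (intro bdd_aboveI2[of _ _ C]) (auto simp: abs_le_iff)
  have u_le: "u n x \<le> (SUP a\<in>A. g x a)" if x: "x \<in> space \<mu>" for n x
  proof (cases "x \<in> B n")
    case True
    then have "q n < g x (f n x)" "f n x \<in> A" using f(2)[OF True] by (auto simp: \<Gamma>_def space_pair_measure A')
    then show ?thesis using True bdd[OF x] by (auto simp: u_def intro!: cSUP_upper2)
  next
    case False
    obtain a where "a \<in> A" using A by auto
    then have "- C \<le> g x a" using C[OF x] by (metis abs_le_D2 minus_le_iff)
    then show ?thesis using False bdd[OF x] \<open>a \<in> A\<close> by (auto simp: u_def intro!: cSUP_upper2)
  qed
  have v[measurable]: "v \<in> borel_measurable \<mu>"
    unfolding v_def
  proof (rule borel_measurable_cSUP)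
    show "u n \<in> borel_measurable \<mu>" for n
      using B(1)[of n] unfolding u_def by measurable
    show "bdd_above ((\<lambda>n. u n x) ` UNIV)" if "x \<in> space \<mu>" for x
      using u_le[OF that] by (auto intro!: bdd_aboveI2)
  qed simp
  have v_eq: "AE x in \<mu>. v x = (SUP a\<in>A. g x a)"
  proof -
    have "AE x in \<mu>. x \<notin> Z n" for n using B(2) by (rule AE_not_in)
    then have "AE x in \<mu>. \<forall>n. x \<notin> Z n" by (simp add: AE_all_countable)
    with AE_space show ?thesis
    proof eventually_elim
      case (elim x)
      show ?case
      proof (rule antisym)
        show "v x \<le> (SUP a\<in>A. g x a)" unfolding v_def using u_le elim by (intro cSUP_least) auto
        show "(SUP a\<in>A. g x a) \<le> v x"
        proof (rule dense_le)
          fix y assume "y < (SUP a\<in>A. g x a)"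
          then obtain a where a: "a \<in> A" "y < g x a" using less_cSUP_iff[OF A(2) bdd] elim by blast
          then obtain p where p: "y < of_rat p" "of_rat p < g x a" using of_rat_dense by blast
          define n where "n = to_nat p"
          have "q n = of_rat p" by (simp add: q_def n_def)
          then have "(x, a) \<in> \<Gamma> n" using a p elim by (auto simp: \<Gamma>_def space_pair_measure A')
          then have "x \<in> B n" using B(3)[of n] elim a by blast
          then have "u n x = of_rat p" using \<open>q n = of_rat p\<close> by (simp add: u_def)
          moreover have "u n x \<le> v x"
            unfolding v_def using u_le elim by (intro cSUP_upper) (auto intro!: bdd_aboveI2)
          ultimately show "y \<le> v x" using p by linarith
        qed
      qed
    qed
  qed
  moreover have "\<exists>f \<in> \<mu> \<rightarrow>\<^sub>M A'. AE x in \<mu>. v x - e < g x (f x)" if e: "0 < e" for e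
  proof -
    define \<Gamma>' where "\<Gamma>' = {z \<in> space (\<mu> \<Otimes>\<^sub>M A'). v (fst z) - e < (case z of (x, a) \<Rightarrow> g x a)}"
    have "\<Gamma>' \<in> sets (\<mu> \<Otimes>\<^sub>M A')" unfolding \<Gamma>'_def by measurable
    from measurable_selection[OF fin A this[unfolded A'_def], folded A'_def]
    obtain B f where Bf: "B \<in> sets \<mu> \<and> f \<in> \<mu> \<rightarrow>\<^sub>M A' \<and>
      (\<exists>Z\<in>null_sets \<mu>. {x \<in> space \<mu>. \<exists>a\<in>A. (x, a) \<in> \<Gamma>'} - B \<subseteq> Z) \<and> (\<forall>x\<in>B. (x, f x) \<in> \<Gamma>')"
      by (elim exE) (rule that)
    then obtain Z where B: "Z \<in> null_sets \<mu>" "{x \<in> space \<mu>. \<exists>a\<in>A. (x, a) \<in> \<Gamma>'} - B \<subseteq> Z" by blast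
    have f: "f \<in> \<mu> \<rightarrow>\<^sub>M A'" "\<And>x. x \<in> B \<Longrightarrow> (x, f x) \<in> \<Gamma>'" using Bf by simp_all
    have "AE x in \<mu>. v x - e < g x (f x)"
      using v_eq AE_not_in[OF B(1)] AE_space
    proof eventually_elim
      case (elim x)
      then have "v x - e < (SUP a\<in>A. g x a)" using e by simp
      then obtain a where "a \<in> A" "v x - e < g x a" using less_cSUP_iff[OF A(2) bdd] elim by blast
      then have "(x, a) \<in> \<Gamma>'" using elim by (auto simp: \<Gamma>'_def space_pair_measure A')
      then have "x \<in> B" using B(2) elim \<open>a \<in> A\<close> by blast
      then show ?case using f(2) by (auto simp: \<Gamma>'_def)
    qed
    then show ?thesis using f(1) by blast
  qed
  ultimately show ?thesis
    using v unfolding A'_def by (intro bexI[of _ v] conjI allI impI)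
qed

section \<open>Trajectories\<close>

text \<open>What the original and the reflected MDP have in common, so that the facts about
  trajectories are available for both.\<close>

locale markov_mdp =
  fixes M :: "('s, 'a) mdp"
  assumes sigma_finite_base: "sigma_finite_measure (base M)"
    and dens_measurable: "\<And>h. h \<in> {1..horizon M} \<Longrightarrow>
      (\<lambda>(x, a, y). dens M h a y x) \<in> borel_measurable (base M \<Otimes>\<^sub>M act M \<Otimes>\<^sub>M base M)"
    and dens_nonneg: "\<And>h x a y. h \<in> {1..horizon M} \<Longrightarrow> x \<in> space (base M) \<Longrightarrow> a \<in> space (act M) \<Longrightarrow>
      y \<in> space (base M) \<Longrightarrow> 0 \<le> dens M h a y x"
    and prob_space_kernel: "\<And>h x a. h \<in> {1..horizon M} \<Longrightarrow> x \<in> space (base M) \<Longrightarrow> a \<in> space (act M) \<Longrightarrow>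
      prob_space (trans_kernel M h x a)"
begin

lemma dens_measurable'[measurable (raw)]:
  assumes "h \<in> {1..horizon M}" "f \<in> N \<rightarrow>\<^sub>M base M" "g \<in> N \<rightarrow>\<^sub>M act M" "k \<in> N \<rightarrow>\<^sub>M base M"
  shows "(\<lambda>w. dens M h (g w) (k w) (f w)) \<in> borel_measurable N"
proof -
  have "(\<lambda>w. (f w, g w, k w)) \<in> N \<rightarrow>\<^sub>M base M \<Otimes>\<^sub>M act M \<Otimes>\<^sub>M base M"
    using assms by measurable
  from measurable_compose[OF this dens_measurable[OF assms(1)]] show ?thesis by simp
qed

lemma sets_trans_kernel: "sets (trans_kernel M h x a) = sets (base M)"
  by (simp add: trans_kernel_def)

lemma nn_integral_trans_kernel:
  assumes "h \<in> {1..horizon M}" "x \<in> space (base M)" "a \<in> space (act M)" "f \<in> borel_measurable (base M)"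
  shows "(\<integral>\<^sup>+y. f y \<partial>trans_kernel M h x a) = (\<integral>\<^sup>+y. ennreal (dens M h a y x) * f y \<partial>base M)"
proof -
  have "(\<lambda>y. ennreal (dens M h a y x)) \<in> borel_measurable (base M)"
    using assms by measurable
  then show ?thesis using assms by (simp add: trans_kernel_def nn_integral_density)
qed

lemma measurable_trans_kernel:
  assumes h: "h \<in> {1..horizon M}"
  shows "(\<lambda>(x, a). trans_kernel M h x a) \<in> base M \<Otimes>\<^sub>M act M \<rightarrow>\<^sub>M prob_algebra (base M)"
proof (rule measurable_prob_algebraI)
  interpret sigma_finite_measure "base M" by (rule sigma_finite_base)
  show "prob_space ((\<lambda>(x, a). trans_kernel M h x a) w)" if "w \<in> space (base M \<Otimes>\<^sub>M act M)" for w
    using that prob_space_kernel[OF h] by (auto simp: space_pair_measure)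
  show "(\<lambda>(x, a). trans_kernel M h x a) \<in> base M \<Otimes>\<^sub>M act M \<rightarrow>\<^sub>M subprob_algebra (base M)"
  proof (rule measurable_subprob_algebra)
    fix A assume A[measurable]: "A \<in> sets (base M)"
    have "(\<lambda>w. \<integral>\<^sup>+y. ennreal (dens M h (snd w) y (fst w)) * indicator A y \<partial>base M)
        \<in> borel_measurable (base M \<Otimes>\<^sub>M act M)"
      using h by measurable
    then show "(\<lambda>w. emeasure ((\<lambda>(x, a). trans_kernel M h x a) w) A) \<in> borel_measurable (base M \<Otimes>\<^sub>M act M)"
    proof (rule measurable_cong[THEN iffD1, rotated])
      fix w assume w: "w \<in> space (base M \<Otimes>\<^sub>M act M)"
      then have "(\<lambda>y. ennreal (dens M h (snd w) y (fst w))) \<in> borel_measurable (base M)"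
        using h by (auto simp: space_pair_measure)
      then show "(\<integral>\<^sup>+y. ennreal (dens M h (snd w) y (fst w)) * indicator A y \<partial>base M) =
          emeasure ((\<lambda>(x, a). trans_kernel M h x a) w) A"
        by (simp add: trans_kernel_def emeasure_density split_beta)
    qed
  qed (auto simp: sets_trans_kernel space_pair_measure intro: prob_space_imp_subprob_space prob_space_kernel[OF h])
qed

lemma measurable_hist_state[measurable]:
  assumes "i \<le> h" shows "(\<lambda>\<omega>. fst \<omega> i) \<in> hist M h \<rightarrow>\<^sub>M base M"
  unfolding hist_def using assms by (intro measurable_compose[OF measurable_fst measurable_component_singleton]) auto

lemma measurable_hist_action[measurable]:
  assumes "i < h" shows "(\<lambda>\<omega>. snd \<omega> i) \<in> hist M h \<rightarrow>\<^sub>M act M"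
  unfolding hist_def using assms by (intro measurable_compose[OF measurable_snd measurable_component_singleton]) auto

lemma measurable_hist_extend:
  assumes "f \<in> N \<rightarrow>\<^sub>M hist M h" "g \<in> N \<rightarrow>\<^sub>M act M" "k \<in> N \<rightarrow>\<^sub>M base M"
  shows "(\<lambda>w. ((fst (f w))(Suc h := k w), (snd (f w))(h := g w))) \<in> N \<rightarrow>\<^sub>M hist M (Suc h)"
  unfolding hist_def
proof (rule measurable_Pair)
  show "(\<lambda>w. (fst (f w))(Suc h := k w)) \<in> N \<rightarrow>\<^sub>M PiM {..Suc h} (\<lambda>_. base M)"
    by (rule measurable_fun_upd[where J = "{..h}"])
      (use assms in \<open>auto simp: hist_def intro: measurable_compose[OF _ measurable_fst]\<close>)
  show "(\<lambda>w. (snd (f w))(h := g w)) \<in> N \<rightarrow>\<^sub>M PiM {..<Suc h} (\<lambda>_. act M)"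
    by (rule measurable_fun_upd[where J = "{..<h}"])
      (use assms in \<open>auto simp: hist_def intro: measurable_compose[OF _ measurable_snd]\<close>)
qed

definition step_kernel where
  "step_kernel \<pi> h \<omega> = \<pi> h (fst \<omega> h) \<bind> (\<lambda>b. distr (trans_kernel M (Suc h) (fst \<omega> h) b) (hist M (Suc h))
     (\<lambda>y. ((fst \<omega>)(Suc h := y), (snd \<omega>)(h := b))))"

lemma traj_Suc: "traj M x \<pi> (Suc h) = traj M x \<pi> h \<bind> step_kernel \<pi> h"
proof -
  have "(\<lambda>(s, a). \<pi> h (s h) \<bind> (\<lambda>b. distr (trans_kernel M (Suc h) (s h) b) (hist M (Suc h))
      (\<lambda>y. (s(Suc h := y), a(h := b))))) = step_kernel \<pi> h"
    by (rule ext) (simp add: step_kernel_def split_beta)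
  then show ?thesis by simp
qed

lemma measurable_policy:
  assumes "\<pi> \<in> policies M" "h < horizon M"
  shows "\<pi> h \<in> base M \<rightarrow>\<^sub>M prob_algebra (act M)"
  using assms by (simp add: policies_def)

lemma measurable_step_distr:
  assumes h: "Suc h \<le> horizon M"
  shows "(\<lambda>(\<omega>, b). distr (trans_kernel M (Suc h) (fst \<omega> h) b) (hist M (Suc h))
     (\<lambda>y. ((fst \<omega>)(Suc h := y), (snd \<omega>)(h := b)))) \<in> hist M h \<Otimes>\<^sub>M act M \<rightarrow>\<^sub>M prob_algebra (hist M (Suc h))"
  unfolding split_beta
proof (rule measurable_distr_prob_space2[where M = "base M"])
  have "(\<lambda>w. (fst (fst w) h, snd w)) \<in> hist M h \<Otimes>\<^sub>M act M \<rightarrow>\<^sub>M base M \<Otimes>\<^sub>M act M"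
    by (intro measurable_Pair measurable_compose[OF measurable_fst measurable_hist_state] measurable_snd) simp
  from measurable_compose[OF this measurable_trans_kernel[of "Suc h"]] h
  show "(\<lambda>w. trans_kernel M (Suc h) (fst (fst w) h) (snd w)) \<in> hist M h \<Otimes>\<^sub>M act M \<rightarrow>\<^sub>M prob_algebra (base M)"
    by simp
  show "(\<lambda>(w, y). ((fst (fst w))(Suc h := y), (snd (fst w))(h := snd w)))
      \<in> (hist M h \<Otimes>\<^sub>M act M) \<Otimes>\<^sub>M base M \<rightarrow>\<^sub>M hist M (Suc h)"
    unfolding split_beta by (intro measurable_hist_extend) measurable
qed

lemma measurable_step_kernel:
  assumes h: "Suc h \<le> horizon M" and \<pi>: "\<pi> \<in> policies M"
  shows "step_kernel \<pi> h \<in> hist M h \<rightarrow>\<^sub>M prob_algebra (hist M (Suc h))"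
  unfolding step_kernel_def
proof (rule measurable_bind_prob_space2[OF _ measurable_step_distr[OF h]])
  show "(\<lambda>\<omega>. \<pi> h (fst \<omega> h)) \<in> hist M h \<rightarrow>\<^sub>M prob_algebra (act M)"
    using h by (intro measurable_compose[OF measurable_hist_state measurable_policy[OF \<pi>]]) auto
qed

lemma initial_hist:
  assumes "x \<in> space (base M)"
  shows "(\<lambda>i\<in>{..0}. x, \<lambda>_. undefined) \<in> space (hist M 0)"
  using assms by (auto simp: hist_def space_pair_measure space_PiM)

lemma traj_prob_algebra:
  assumes "x \<in> space (base M)" "\<pi> \<in> policies M" "h \<le> horizon M"
  shows "traj M x \<pi> h \<in> space (prob_algebra (hist M h))"
  using assms(3)
proof (induction h)
  case 0
  then show ?case
    using initial_hist[OF assms(1)] by (simp add: space_prob_algebra prob_space_return)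
next
  case (Suc h)
  have "(\<lambda>_. traj M x \<pi> h) \<in> count_space {()} \<rightarrow>\<^sub>M prob_algebra (hist M h)"
    using Suc by simp
  from measurable_bind_prob_space[OF this measurable_step_kernel[OF Suc.prems assms(2)]]
  show ?case unfolding traj_Suc by (auto dest: measurable_space)
qed

lemma
  assumes "x \<in> space (base M)" "\<pi> \<in> policies M" "h \<le> horizon M"
  shows sets_traj: "sets (traj M x \<pi> h) = sets (hist M h)"
    and space_traj: "space (traj M x \<pi> h) = space (hist M h)"
    and prob_space_traj: "prob_space (traj M x \<pi> h)"
  using traj_prob_algebra[OF assms] by (auto simp: space_prob_algebra dest: sets_eq_imp_space_eq)

lemma nn_integral_step_kernel:
  assumes \<pi>: "\<pi> \<in> policies M" and h: "Suc h \<le> horizon M" and \<omega>: "\<omega> \<in> space (hist M h)"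
    and f: "f \<in> borel_measurable (hist M (Suc h))"
  shows "(\<integral>\<^sup>+\<omega>'. f \<omega>' \<partial>step_kernel \<pi> h \<omega>) =
    (\<integral>\<^sup>+b. \<integral>\<^sup>+y. ennreal (dens M (Suc h) b y (fst \<omega> h)) *
        f ((fst \<omega>)(Suc h := y), (snd \<omega>)(h := b)) \<partial>base M \<partial>\<pi> h (fst \<omega> h))"
proof -
  have s: "fst \<omega> h \<in> space (base M)"
    using measurable_space[OF measurable_hist_state \<omega>, of h] by simp
  have \<pi>h: "\<pi> h (fst \<omega> h) \<in> space (prob_algebra (act M))"
    using measurable_space[OF measurable_policy[OF \<pi>] s] h by simp
  then have sets_\<pi>: "sets (\<pi> h (fst \<omega> h)) = sets (act M)" by (simp add: space_prob_algebra)
  have meas: "(\<lambda>b. distr (trans_kernel M (Suc h) (fst \<omega> h) b) (hist M (Suc h))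
     (\<lambda>y. ((fst \<omega>)(Suc h := y), (snd \<omega>)(h := b)))) \<in> \<pi> h (fst \<omega> h) \<rightarrow>\<^sub>M subprob_algebra (hist M (Suc h))"
    using measurable_compose[OF measurable_Pair1'[OF \<omega>] measurable_step_distr[OF h]]
    by (subst measurable_cong_sets[OF sets_\<pi> refl]) (auto intro: measurable_prob_algebraD)
  show ?thesis
    unfolding step_kernel_def nn_integral_bind[OF f meas]
  proof (rule nn_integral_cong)
    fix b assume "b \<in> space (\<pi> h (fst \<omega> h))"
    then have b: "b \<in> space (act M)" using sets_eq_imp_space_eq[OF sets_\<pi>] by simp
    have ext: "(\<lambda>y. ((fst \<omega>)(Suc h := y), (snd \<omega>)(h := b))) \<in> base M \<rightarrow>\<^sub>M hist M (Suc h)"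
      using measurable_hist_extend[of "\<lambda>_. \<omega>" "base M" h "\<lambda>_. b" "\<lambda>y. y"] \<omega> b by simp
    have "(\<integral>\<^sup>+\<omega>'. f \<omega>' \<partial>distr (trans_kernel M (Suc h) (fst \<omega> h) b) (hist M (Suc h))
       (\<lambda>y. ((fst \<omega>)(Suc h := y), (snd \<omega>)(h := b)))) =
       (\<integral>\<^sup>+y. f ((fst \<omega>)(Suc h := y), (snd \<omega>)(h := b)) \<partial>trans_kernel M (Suc h) (fst \<omega> h) b)"
      using ext f by (intro nn_integral_distr) (auto simp: measurable_cong_sets[OF sets_trans_kernel refl])
    also have "\<dots> = (\<integral>\<^sup>+y. ennreal (dens M (Suc h) b y (fst \<omega> h)) *
        f ((fst \<omega>)(Suc h := y), (snd \<omega>)(h := b)) \<partial>base M)"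
      using h s b measurable_compose[OF ext f] by (intro nn_integral_trans_kernel) auto
    finally show "(\<integral>\<^sup>+\<omega>'. f \<omega>' \<partial>distr (trans_kernel M (Suc h) (fst \<omega> h) b) (hist M (Suc h))
       (\<lambda>y. ((fst \<omega>)(Suc h := y), (snd \<omega>)(h := b)))) = \<dots>" .
  qed
qed

lemma nn_integral_traj_Suc:
  assumes x: "x \<in> space (base M)" and \<pi>: "\<pi> \<in> policies M" and h: "Suc h \<le> horizon M"
    and f: "f \<in> borel_measurable (hist M (Suc h))"
  shows "(\<integral>\<^sup>+\<omega>. f \<omega> \<partial>traj M x \<pi> (Suc h)) =
    (\<integral>\<^sup>+\<omega>. \<integral>\<^sup>+b. \<integral>\<^sup>+y. ennreal (dens M (Suc h) b y (fst \<omega> h)) *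
        f ((fst \<omega>)(Suc h := y), (snd \<omega>)(h := b)) \<partial>base M \<partial>\<pi> h (fst \<omega> h) \<partial>traj M x \<pi> h)"
proof -
  have T: "sets (traj M x \<pi> h) = sets (hist M h)" "space (traj M x \<pi> h) = space (hist M h)"
    using sets_traj space_traj x \<pi> h by auto
  have "(\<integral>\<^sup>+\<omega>. f \<omega> \<partial>traj M x \<pi> (Suc h)) = (\<integral>\<^sup>+\<omega>. \<integral>\<^sup>+\<omega>'. f \<omega>' \<partial>step_kernel \<pi> h \<omega> \<partial>traj M x \<pi> h)"
    unfolding traj_Suc
    using measurable_prob_algebraD[OF measurable_step_kernel[OF h \<pi>]]
    by (intro nn_integral_bind[OF f]) (simp add: measurable_cong_sets[OF T(1) refl])
  also have "\<dots> = (\<integral>\<^sup>+\<omega>. \<integral>\<^sup>+b. \<integral>\<^sup>+y. ennreal (dens M (Suc h) b y (fst \<omega> h)) *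
        f ((fst \<omega>)(Suc h := y), (snd \<omega>)(h := b)) \<partial>base M \<partial>\<pi> h (fst \<omega> h) \<partial>traj M x \<pi> h)"
    by (intro nn_integral_cong nn_integral_step_kernel[OF \<pi> h _ f]) (simp add: T)
  finally show ?thesis .
qed

lemma nn_integral_kernel_const:
  assumes "h \<in> {1..horizon M}" "x \<in> space (base M)" "a \<in> space (act M)"
  shows "(\<integral>\<^sup>+y. ennreal (dens M h a y x) * c \<partial>base M) = c"
proof -
  have "(\<integral>\<^sup>+y. c \<partial>trans_kernel M h x a) = c"
    using prob_space.emeasure_space_1[OF prob_space_kernel[OF assms]] by simp
  then show ?thesis using nn_integral_trans_kernel[OF assms, of "\<lambda>_. c"] by simp
qed

lemma nn_integral_policy_const:
  assumes "\<pi> \<in> policies M" "h < horizon M" "x \<in> space (base M)"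
  shows "(\<integral>\<^sup>+b. c \<partial>\<pi> h x) = c"
proof -
  have "\<pi> h x \<in> space (prob_algebra (act M))"
    using measurable_space[OF measurable_policy[OF assms(1,2)] assms(3)] .
  then have "prob_space (\<pi> h x)" by (simp add: space_prob_algebra)
  then show ?thesis using prob_space.emeasure_space_1 by fastforce
qed

lemma space_policy:
  assumes "\<pi> \<in> policies M" "h < horizon M" "x \<in> space (base M)"
  shows "space (\<pi> h x) = space (act M)" "sets (\<pi> h x) = sets (act M)" "prob_space (\<pi> h x)"
  using measurable_space[OF measurable_policy[OF assms(1,2)] assms(3)]
  by (auto simp: space_prob_algebra dest: sets_eq_imp_space_eq)

text \<open>Later steps are probability kernels and integrate to one. This is needed because exit
  probabilities and mesh are defined through trajectories over the full horizon, whereas the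
  recursion for \<open>traj\<close> describes one further step.\<close>

lemma nn_integral_traj_marginal:
  assumes x: "x \<in> space (base M)" and \<pi>: "\<pi> \<in> policies M" and n: "h \<le> n" "n \<le> horizon M"
    and f: "f \<in> borel_measurable (hist M h)"
  shows "(\<integral>\<^sup>+\<omega>. f (restrict (fst \<omega>) {..h}, restrict (snd \<omega>) {..<h}) \<partial>traj M x \<pi> n) =
    (\<integral>\<^sup>+\<omega>. f \<omega> \<partial>traj M x \<pi> h)"
  using n
proof (induction n rule: dec_induct)
  case base
  then have T: "space (traj M x \<pi> h) = space (hist M h)" using space_traj x \<pi> by auto
  show ?case
  proof (rule nn_integral_cong)
    fix \<omega> assume "\<omega> \<in> space (traj M x \<pi> h)"
    then have "restrict (fst \<omega>) {..h} = fst \<omega>" "restrict (snd \<omega>) {..<h} = snd \<omega>"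
      unfolding T hist_def space_pair_measure space_PiM by (auto intro: restrict_extensional simp: PiE_def)
    then show "f (restrict (fst \<omega>) {..h}, restrict (snd \<omega>) {..<h}) = f \<omega>" by simp
  qed
next
  case (step n)
  have n: "Suc n \<le> horizon M" using step by simp
  have T: "space (traj M x \<pi> n) = space (hist M n)" using space_traj x \<pi> n by auto
  define F where "F \<omega> = f (restrict (fst \<omega>) {..h}, restrict (snd \<omega>) {..<h})" for \<omega>
  have "(\<lambda>\<omega>. (restrict (fst \<omega>) {..h}, restrict (snd \<omega>) {..<h})) \<in> hist M (Suc n) \<rightarrow>\<^sub>M hist M h"
    unfolding hist_def using step(1)
    by (intro measurable_Pair measurable_compose[OF measurable_fst] measurable_compose[OF measurable_snd]
        measurable_restrict_subset) auto
  then have F: "F \<in> borel_measurable (hist M (Suc n))"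
    unfolding F_def by (rule measurable_compose[OF _ f])
  have "(\<integral>\<^sup>+\<omega>. F \<omega> \<partial>traj M x \<pi> (Suc n)) = (\<integral>\<^sup>+\<omega>. F \<omega> \<partial>traj M x \<pi> n)"
    unfolding nn_integral_traj_Suc[OF x \<pi> n F]
  proof (rule nn_integral_cong)
    fix \<omega> assume "\<omega> \<in> space (traj M x \<pi> n)"
    then have s: "fst \<omega> n \<in> space (base M)"
      unfolding T using measurable_space[OF measurable_hist_state, of n n] by simp
    have upd: "F ((fst \<omega>)(Suc n := y), (snd \<omega>)(n := b)) = F \<omega>" for y b
    proof -
      have "restrict ((fst \<omega>)(Suc n := y)) {..h} = restrict (fst \<omega>) {..h}"
        "restrict ((snd \<omega>)(n := b)) {..<h} = restrict (snd \<omega>) {..<h}"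
        using step(1) by (auto simp: restrict_def fun_eq_iff)
      then show ?thesis by (simp add: F_def)
    qed
    have "(\<integral>\<^sup>+b. \<integral>\<^sup>+y. ennreal (dens M (Suc n) b y (fst \<omega> n)) * F \<omega> \<partial>base M \<partial>\<pi> n (fst \<omega> n)) =
       (\<integral>\<^sup>+b. F \<omega> \<partial>\<pi> n (fst \<omega> n))"
      using n s by (intro nn_integral_cong nn_integral_kernel_const) (auto simp: space_policy[OF \<pi>])
    also have "\<dots> = F \<omega>" using n s by (intro nn_integral_policy_const[OF \<pi>]) auto
    finally show "(\<integral>\<^sup>+b. \<integral>\<^sup>+y. ennreal (dens M (Suc n) b y (fst \<omega> n)) *
      F ((fst \<omega>)(Suc n := y), (snd \<omega>)(n := b)) \<partial>base M \<partial>\<pi> n (fst \<omega> n)) = F \<omega>"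
      unfolding upd .
  qed
  also have "\<dots> = (\<integral>\<^sup>+\<omega>. f \<omega> \<partial>traj M x \<pi> h)"
    unfolding F_def by (rule step.IH[OF Suc_leD[OF n]])
  finally show ?case unfolding F_def .
qed

lemma nn_integral_traj_state:
  assumes x: "x \<in> space (base M)" and \<pi>: "\<pi> \<in> policies M" and n: "h \<le> n" "n \<le> horizon M"
    and g: "g \<in> borel_measurable (base M)"
  shows "(\<integral>\<^sup>+\<omega>. g (fst \<omega> h) \<partial>traj M x \<pi> n) = (\<integral>\<^sup>+\<omega>. g (fst \<omega> h) \<partial>traj M x \<pi> h)"
proof -
  have "(\<lambda>\<omega>. g (fst \<omega> h)) \<in> borel_measurable (hist M h)"
    using g by (intro measurable_compose[OF measurable_hist_state]) auto
  from nn_integral_traj_marginal[OF x \<pi> n this] show ?thesis by simp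
qed

text \<open>From time 1 on the state has a conditional density with respect to the base measure. At
  time 0 the law is a point mass, hence the \<open>Suc h\<close>.\<close>

lemma AE_traj_state:
  assumes x: "x \<in> space (base M)" and \<pi>: "\<pi> \<in> policies M" and n: "Suc h \<le> n" "n \<le> horizon M"
    and Z: "Z \<in> null_sets (base M)"
  shows "AE \<omega> in traj M x \<pi> n. fst \<omega> (Suc h) \<notin> Z"
proof -
  have Zs[measurable]: "Z \<in> sets (base M)" using Z by auto
  have h: "Suc h \<le> horizon M" using n by simp
  have "(\<lambda>\<omega>. indicator Z (fst \<omega> (Suc h)) :: ennreal) \<in> borel_measurable (hist M (Suc h))"
    by (rule measurable_compose[OF measurable_hist_state]) simp_all
  from nn_integral_traj_Suc[OF x \<pi> h this]
  have "(\<integral>\<^sup>+\<omega>. indicator Z (fst \<omega> (Suc h)) \<partial>traj M x \<pi> (Suc h)) =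
    (\<integral>\<^sup>+\<omega>. \<integral>\<^sup>+b. \<integral>\<^sup>+y. ennreal (dens M (Suc h) b y (fst \<omega> h)) * indicator Z y
      \<partial>base M \<partial>\<pi> h (fst \<omega> h) \<partial>traj M x \<pi> h)" by simp
  also have "\<dots> = (\<integral>\<^sup>+\<omega>. \<integral>\<^sup>+b. 0 \<partial>\<pi> h (fst \<omega> h) \<partial>traj M x \<pi> h)"
  proof (intro nn_integral_cong)
    fix \<omega> b
    have "AE y in base M. ennreal (dens M (Suc h) b y (fst \<omega> h)) * indicator Z y = 0"
      using AE_not_in[OF Z] by eventually_elim simp
    from nn_integral_cong_AE[OF this]
    show "(\<integral>\<^sup>+y. ennreal (dens M (Suc h) b y (fst \<omega> h)) * indicator Z y \<partial>base M) = 0" by simp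
  qed
  finally have "(\<integral>\<^sup>+\<omega>. indicator Z (fst \<omega> (Suc h)) \<partial>traj M x \<pi> n) = 0"
    using nn_integral_traj_state[OF x \<pi> n(1,2), of "indicator Z"] by simp
  moreover have "(\<lambda>\<omega>. indicator Z (fst \<omega> (Suc h)) :: ennreal) \<in> borel_measurable (traj M x \<pi> n)"
    unfolding measurable_cong_sets[OF sets_traj[OF x \<pi> n(2)] refl]
    using n by (intro measurable_compose[OF measurable_hist_state]) simp_all
  ultimately have "AE \<omega> in traj M x \<pi> n. (indicator Z (fst \<omega> (Suc h)) :: ennreal) = 0"
    by (subst (asm) nn_integral_0_iff_AE)
  then show ?thesis by eventually_elim (simp add: indicator_def split: if_splits)
qed

lemma const_policy:
  assumes "\<And>t. t < horizon M \<Longrightarrow> b t \<in> space (act M)"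
  shows "(\<lambda>t _. return (act M) (b t)) \<in> policies M"
  unfolding policies_def
  using assms by (auto intro!: measurable_const simp: space_prob_algebra prob_space_return)

text \<open>By Fubini, under fixed controls the next state has the mixture density of
  \<open>y\<close> given by the expectation of \<open>p(y|S)\<close> over the current state
  \<open>S\<close>. This mixture is the ideal denominator of the weights, of which the leave-one-out
  sums are empirical versions.\<close>

lemma nn_integral_traj_const_policy:
  assumes x: "x \<in> space (base M)" and b: "\<And>t. t < horizon M \<Longrightarrow> b t \<in> space (act M)"
    and h: "Suc h \<le> horizon M" and g: "g \<in> borel_measurable (base M)"
  defines "T \<equiv> traj M x (\<lambda>t _. return (act M) (b t)) (horizon M)"
  shows "(\<integral>\<^sup>+\<omega>. g (fst \<omega> (Suc h)) \<partial>T) =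
    (\<integral>\<^sup>+y. (\<integral>\<^sup>+\<omega>. ennreal (dens M (Suc h) (b h) y (fst \<omega> h)) \<partial>T) * g y \<partial>base M)"
proof -
  note \<pi> = const_policy[OF b]
  define Th where "Th = traj M x (\<lambda>t _. return (act M) (b t)) h"
  have hH: "h \<le> horizon M" using h by simp
  have sets_Th: "sets Th = sets (hist M h)" "space Th = space (hist M h)" "prob_space Th"
    using sets_traj[OF x \<pi> hH] space_traj[OF x \<pi> hH] prob_space_traj[OF x \<pi> hH] by (auto simp: Th_def)
  interpret Th: prob_space Th by (rule sets_Th)
  interpret B: sigma_finite_measure "base M" by (rule sigma_finite_base)
  interpret P: pair_sigma_finite Th "base M" ..
  have bh: "b h \<in> space (act M)" using b h by simp
  have h': "Suc h \<in> {1..horizon M}" using h by simp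
  note [measurable] = g
  have state[measurable]: "(\<lambda>\<omega>. fst \<omega> h) \<in> Th \<rightarrow>\<^sub>M base M"
    unfolding measurable_cong_sets[OF sets_Th(1) refl] by (rule measurable_hist_state) simp
  have "(\<integral>\<^sup>+\<omega>. g (fst \<omega> (Suc h)) \<partial>T) = (\<integral>\<^sup>+\<omega>. g (fst \<omega> (Suc h)) \<partial>traj M x (\<lambda>t _. return (act M) (b t)) (Suc h))"
    unfolding T_def by (rule nn_integral_traj_state[OF x \<pi> h order_refl g])
  also have "\<dots> = (\<integral>\<^sup>+\<omega>. \<integral>\<^sup>+b'. \<integral>\<^sup>+y. ennreal (dens M (Suc h) b' y (fst \<omega> h)) * g y
      \<partial>base M \<partial>return (act M) (b h) \<partial>Th)"
  proof -
    have "(\<lambda>\<omega>. g (fst \<omega> (Suc h))) \<in> borel_measurable (hist M (Suc h))"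
      by (rule measurable_compose[OF measurable_hist_state]) simp_all
    from nn_integral_traj_Suc[OF x \<pi> h this] show ?thesis by (simp add: Th_def)
  qed
  also have "\<dots> = (\<integral>\<^sup>+\<omega>. \<integral>\<^sup>+y. ennreal (dens M (Suc h) (b h) y (fst \<omega> h)) * g y \<partial>base M \<partial>Th)"
  proof (rule nn_integral_cong)
    fix \<omega> assume "\<omega> \<in> space Th"
    then have s: "fst \<omega> h \<in> space (base M)" using measurable_space[OF state] by simp
    have "(\<lambda>b'. \<integral>\<^sup>+y. ennreal (dens M (Suc h) b' y (fst \<omega> h)) * g y \<partial>base M) \<in> borel_measurable (act M)"
      using h' s by measurable
    then show "(\<integral>\<^sup>+b'. \<integral>\<^sup>+y. ennreal (dens M (Suc h) b' y (fst \<omega> h)) * g y \<partial>base M \<partial>return (act M) (b h)) =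
       (\<integral>\<^sup>+y. ennreal (dens M (Suc h) (b h) y (fst \<omega> h)) * g y \<partial>base M)"
      using bh by (subst nn_integral_return) auto
  qed
  also have "\<dots> = (\<integral>\<^sup>+y. \<integral>\<^sup>+\<omega>. ennreal (dens M (Suc h) (b h) y (fst \<omega> h)) * g y \<partial>Th \<partial>base M)"
    using h' bh by (intro P.Fubini'[symmetric]) measurable
  also have "\<dots> = (\<integral>\<^sup>+y. (\<integral>\<^sup>+\<omega>. ennreal (dens M (Suc h) (b h) y (fst \<omega> h)) \<partial>Th) * g y \<partial>base M)"
    using h' bh by (intro nn_integral_cong nn_integral_multc) measurable
  also have "\<dots> = (\<integral>\<^sup>+y. (\<integral>\<^sup>+\<omega>. ennreal (dens M (Suc h) (b h) y (fst \<omega> h)) \<partial>T) * g y \<partial>base M)"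
  proof (rule nn_integral_cong)
    fix y assume "y \<in> space (base M)"
    then have "(\<lambda>s. ennreal (dens M (Suc h) (b h) y s)) \<in> borel_measurable (base M)"
      using h' bh by measurable
    from nn_integral_traj_state[OF x \<pi> hH order_refl this]
    show "(\<integral>\<^sup>+\<omega>. ennreal (dens M (Suc h) (b h) y (fst \<omega> h)) \<partial>Th) * g y =
      (\<integral>\<^sup>+\<omega>. ennreal (dens M (Suc h) (b h) y (fst \<omega> h)) \<partial>T) * g y"
      by (simp add: Th_def T_def)
  qed
  finally show ?thesis .
qed

end

section \<open>Comparing the value of a policy with candidate value functions\<close>

context markov_mdp
begin

lemma integrable_dens:
  assumes "h \<in> {1..horizon M}" "x \<in> space (base M)" "a \<in> space (act M)"
  shows "integrable (base M) (\<lambda>y. dens M h a y x)" "(LINT y|base M. dens M h a y x) = 1"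
proof -
  have nn: "(\<integral>\<^sup>+y. ennreal (dens M h a y x) \<partial>base M) = ennreal 1"
    using nn_integral_kernel_const[OF assms, of 1] by simp
  have m: "(\<lambda>y. dens M h a y x) \<in> borel_measurable (base M)" using assms by measurable
  have pos: "AE y in base M. 0 \<le> dens M h a y x" using dens_nonneg[OF assms] by auto
  show "integrable (base M) (\<lambda>y. dens M h a y x)"
    by (rule integrableI_nn_integral_finite[OF m pos nn])
  show "(LINT y|base M. dens M h a y x) = 1"
    using integral_eq_nn_integral[OF m pos] nn by simp
qed

lemma integrable_dens_mult:
  assumes "h \<in> {1..horizon M}" "x \<in> space (base M)" "a \<in> space (act M)"
    and f: "f \<in> borel_measurable (base M)" "\<And>y. y \<in> space (base M) \<Longrightarrow> \<bar>f y\<bar> \<le> C"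
  shows "integrable (base M) (\<lambda>y. dens M h a y x * f y)"
proof (rule Bochner_Integration.integrable_bound)
  show "integrable (base M) (\<lambda>y. dens M h a y x * C)" using integrable_dens[OF assms(1-3)] by simp
  show "(\<lambda>y. dens M h a y x * f y) \<in> borel_measurable (base M)" using assms by measurable
  show "AE y in base M. norm (dens M h a y x * f y) \<le> norm (dens M h a y x * C)"
  proof (rule AE_I2)
    fix y assume y: "y \<in> space (base M)"
    have "\<bar>f y\<bar> \<le> \<bar>C\<bar>" using f(2)[OF y] by linarith
    then show "norm (dens M h a y x * f y) \<le> norm (dens M h a y x * C)"
      by (simp add: abs_mult mult_left_mono)
  qed
qed

lemma emeasure_outside:
  assumes x: "x \<in> space (base M)" and \<pi>: "\<pi> \<in> policies M" and h: "h \<le> horizon M"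
    and D: "D \<in> sets (base M)"
  shows "ennreal (outside_prob M x \<pi> h D) = (\<integral>\<^sup>+\<omega>. indicator (- D) (fst \<omega> h) \<partial>traj M x \<pi> h)"
proof -
  interpret T: prob_space "traj M x \<pi> (horizon M)" by (rule prob_space_traj[OF x \<pi> order_refl])
  have sets_T: "sets (traj M x \<pi> (horizon M)) = sets (hist M (horizon M))"
    by (rule sets_traj[OF x \<pi> order_refl])
  have st: "(\<lambda>\<omega>. fst \<omega> h) \<in> traj M x \<pi> (horizon M) \<rightarrow>\<^sub>M base M"
    unfolding measurable_cong_sets[OF sets_T refl] by (rule measurable_hist_state[OF h])
  have ind: "(indicator (space (base M) - D) :: _ \<Rightarrow> ennreal) \<in> borel_measurable (base M)" using D by simp
  have E: "{\<omega> \<in> space (traj M x \<pi> (horizon M)). fst \<omega> h \<notin> D} \<in> sets (traj M x \<pi> (horizon M))"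
  proof -
    have "(\<lambda>\<omega>. fst \<omega> h) -` (space (base M) - D) \<inter> space (traj M x \<pi> (horizon M)) \<in> sets (traj M x \<pi> (horizon M))"
      by (rule measurable_sets[OF st sets.compl_sets[OF D]])
    moreover have "(\<lambda>\<omega>. fst \<omega> h) -` (space (base M) - D) \<inter> space (traj M x \<pi> (horizon M)) =
      {\<omega> \<in> space (traj M x \<pi> (horizon M)). fst \<omega> h \<notin> D}"
      using measurable_space[OF st] by auto
    ultimately show ?thesis by simp
  qed
  have "ennreal (outside_prob M x \<pi> h D) = emeasure (traj M x \<pi> (horizon M)) {\<omega> \<in> space (traj M x \<pi> (horizon M)). fst \<omega> h \<notin> D}"
    by (simp add: outside_prob_def T.emeasure_eq_measure)
  also have "\<dots> = (\<integral>\<^sup>+\<omega>. indicator {\<omega> \<in> space (traj M x \<pi> (horizon M)). fst \<omega> h \<notin> D} \<omega> \<partial>traj M x \<pi> (horizon M))"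
    using E by simp
  also have "\<dots> = (\<integral>\<^sup>+\<omega>. indicator (space (base M) - D) (fst \<omega> h) \<partial>traj M x \<pi> (horizon M))"
    using measurable_space[OF st] by (intro nn_integral_cong) (auto simp: indicator_def)
  also have "\<dots> = (\<integral>\<^sup>+\<omega>. indicator (space (base M) - D) (fst \<omega> h) \<partial>traj M x \<pi> h)"
    by (rule nn_integral_traj_state[OF x \<pi> h order_refl ind])
  also have "\<dots> = (\<integral>\<^sup>+\<omega>. indicator (- D) (fst \<omega> h) \<partial>traj M x \<pi> h)"
    using measurable_space[OF measurable_hist_state[OF order_refl], of _ h] space_traj[OF x \<pi> h]
    by (intro nn_integral_cong) (auto simp: indicator_def)
  finally show ?thesis .
qed

text \<open>The shift by \<open>K\<close> keeps all integrands nonnegative, so that the Giry monad laws for \<open>\<integral>\<^sup>+\<close> apply.\<close>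

lemma telescoped_value_bound:
  fixes r :: "nat \<Rightarrow> 's \<Rightarrow> 'a \<Rightarrow> real" and W :: "nat \<Rightarrow> 's \<Rightarrow> real"
  assumes x: "x \<in> space (base M)" and \<pi>: "\<pi> \<in> policies M" and D: "D \<in> sets (base M)"
    and r: "\<And>t. t < horizon M \<Longrightarrow> (\<lambda>(s, a). r t s a) \<in> borel_measurable (base M \<Otimes>\<^sub>M act M)"
      "\<And>t s a. t < horizon M \<Longrightarrow> s \<in> space (base M) \<Longrightarrow> a \<in> space (act M) \<Longrightarrow> \<bar>r t s a\<bar> \<le> C"
    and W: "\<And>t. t \<le> horizon M \<Longrightarrow> W t \<in> borel_measurable (base M)"
      "\<And>t s. t \<le> horizon M \<Longrightarrow> s \<in> space (base M) \<Longrightarrow> \<bar>W t s\<bar> \<le> C"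
    and \<kappa>: "0 \<le> \<kappa>" and e: "0 \<le> e"
    and step: "\<And>t. t < horizon M \<Longrightarrow> AE \<omega> in traj M x \<pi> t. AE b in \<pi> t (fst \<omega> t).
      r t (fst \<omega> t) b + (LINT y|base M. dens M (Suc t) b y (fst \<omega> t) * W (Suc t) y)
        \<le> W t (fst \<omega> t) + \<kappa> * (LINT y|base M. dens M (Suc t) b y (fst \<omega> t) * indicator (- D) y) + e"
  shows "(LINT \<omega>|traj M x \<pi> (horizon M). (\<Sum>t<horizon M. r t (fst \<omega> t) (snd \<omega> t)) + W (horizon M) (fst \<omega> (horizon M)))
    \<le> W 0 x + \<kappa> * (\<Sum>h=1..horizon M. outside_prob M x \<pi> h D) + real (horizon M) * e"
proof -
  have C: "0 \<le> C" using W(2)[OF _ x, of 0] by auto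
  define K where "K = (real (horizon M) + 1) * C"
  \<comment> \<open>Rewards collected so far plus the continuation value. By the assumption
    \<open>step\<close> this is a supermartingale up to \<open>e\<close> and \<kappa> times the
    probability of being outside \<open>D\<close> after the next step.\<close>
  define U where "U t \<omega> = (\<Sum>i<t. r i (fst \<omega> i) (snd \<omega> i)) + W t (fst \<omega> t)" for t \<omega>
  have state: "fst \<omega> i \<in> space (base M)" if "\<omega> \<in> space (hist M t)" "i \<le> t" for \<omega> i t
    using measurable_space[OF measurable_hist_state that(1)] that(2) by simp
  have action: "snd \<omega> i \<in> space (act M)" if "\<omega> \<in> space (hist M t)" "i < t" for \<omega> i t
    using measurable_space[OF measurable_hist_action that(1)] that(2) by simp
  have sum_bound: "\<bar>\<Sum>i<t. r i (fst \<omega> i) (snd \<omega> i)\<bar> \<le> real t * C"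
    if "t \<le> horizon M" "\<omega> \<in> space (hist M t)" for t \<omega>
  proof -
    have "\<bar>\<Sum>i<t. r i (fst \<omega> i) (snd \<omega> i)\<bar> \<le> (\<Sum>i<t. \<bar>r i (fst \<omega> i) (snd \<omega> i)\<bar>)" by (rule sum_abs)
    also have "\<dots> \<le> (\<Sum>i<t. C)" using that state action by (intro sum_mono r(2)) auto
    finally show ?thesis by simp
  qed
  have KU: "(\<Sum>i<t. r i (fst \<omega> i) (snd \<omega> i)) + K \<ge> (real (horizon M) + 1 - real t) * C"
    if "t \<le> horizon M" "\<omega> \<in> space (hist M t)" for t \<omega>
    using sum_bound[OF that] by (simp add: K_def algebra_simps)
  have U_meas: "U t \<in> borel_measurable (hist M t)" if t: "t \<le> horizon M" for t
  proof -
    have "(\<lambda>\<omega>. r i (fst \<omega> i) (snd \<omega> i)) \<in> borel_measurable (hist M t)" if i: "i < t" for i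
    proof -
      have "(\<lambda>\<omega>. (fst \<omega> i, snd \<omega> i)) \<in> hist M t \<rightarrow>\<^sub>M base M \<Otimes>\<^sub>M act M"
        using i by (intro measurable_Pair measurable_hist_state measurable_hist_action) auto
      from measurable_compose[OF this r(1)] show ?thesis using i t by simp
    qed
    then show ?thesis
      unfolding U_def using t
      by (intro borel_measurable_add borel_measurable_sum measurable_compose[OF measurable_hist_state W(1)]) auto
  qed
  define \<Psi> where "\<Psi> t = (\<integral>\<^sup>+\<omega>. ennreal (U t \<omega> + K) \<partial>traj M x \<pi> t)" for t
  define out where "out t = (\<integral>\<^sup>+\<omega>. indicator (- D) (fst \<omega> t) \<partial>traj M x \<pi> t)" for t
  have \<Psi>_step: "\<Psi> (Suc t) \<le> \<Psi> t + ennreal \<kappa> * out (Suc t) + ennreal e" if t: "t < horizon M" for t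
  proof -
    have h: "Suc t \<in> {1..horizon M}" and t': "Suc t \<le> horizon M" "t \<le> horizon M" using t by auto
    interpret T: prob_space "traj M x \<pi> t" by (rule prob_space_traj[OF x \<pi> t'(2)])
    have sp: "space (traj M x \<pi> t) = space (hist M t)" "sets (traj M x \<pi> t) = sets (hist M t)"
      using space_traj[OF x \<pi> t'(2)] sets_traj[OF x \<pi> t'(2)] by auto
    define pout where "pout \<omega> b = (LINT y|base M. dens M (Suc t) b y (fst \<omega> t) * indicator (- D) y)"
      for \<omega> :: "(nat \<Rightarrow> 's) \<times> (nat \<Rightarrow> 'a)" and b
    have ind_meas: "(\<lambda>y. indicator (- D) y :: real) \<in> borel_measurable (base M)"
    proof -
      have "(\<lambda>y. indicator (space (base M) - D) y :: real) \<in> borel_measurable (base M)" using D by simp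
      then show ?thesis by (rule measurable_cong[THEN iffD1, rotated]) (auto simp: indicator_def)
    qed
    have pout_nn: "ennreal (pout \<omega> b) = (\<integral>\<^sup>+y. ennreal (dens M (Suc t) b y (fst \<omega> t)) * indicator (- D) y \<partial>base M)"
      and pout_nonneg: "0 \<le> pout \<omega> b"
      if "fst \<omega> t \<in> space (base M)" "b \<in> space (act M)" for \<omega> b
    proof -
      have int: "integrable (base M) (\<lambda>y. dens M (Suc t) b y (fst \<omega> t) * indicator (- D) y)"
        using ind_meas by (intro integrable_dens_mult[OF h that, where C = 1]) (auto simp: indicator_def)
      have pos: "AE y in base M. 0 \<le> dens M (Suc t) b y (fst \<omega> t) * indicator (- D) y"
        using dens_nonneg[OF h that] by auto
      have "ennreal (pout \<omega> b) = (\<integral>\<^sup>+y. ennreal (dens M (Suc t) b y (fst \<omega> t) * indicator (- D) y) \<partial>base M)"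
        unfolding pout_def using nn_integral_eq_integral[OF int pos] by simp
      also have "\<dots> = (\<integral>\<^sup>+y. ennreal (dens M (Suc t) b y (fst \<omega> t)) * indicator (- D) y \<partial>base M)"
        by (intro nn_integral_cong) (auto simp: indicator_def)
      finally show "ennreal (pout \<omega> b) = \<dots>" .
      show "0 \<le> pout \<omega> b" unfolding pout_def using pos by (rule integral_nonneg_AE)
    qed
    have out_eq: "out (Suc t) = (\<integral>\<^sup>+\<omega>. \<integral>\<^sup>+b. ennreal (pout \<omega> b) \<partial>\<pi> t (fst \<omega> t) \<partial>traj M x \<pi> t)"
    proof -
      have "(\<lambda>y. indicator (- D) y :: ennreal) \<in> borel_measurable (base M)"
      proof -
        have "(\<lambda>y. indicator (space (base M) - D) y :: ennreal) \<in> borel_measurable (base M)" using D by simp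
        then show ?thesis by (rule measurable_cong[THEN iffD1, rotated]) (auto simp: indicator_def)
      qed
      then have "(\<lambda>\<omega>. indicator (- D) (fst \<omega> (Suc t)) :: ennreal) \<in> borel_measurable (hist M (Suc t))"
        by (rule measurable_compose[OF measurable_hist_state[OF order_refl]])
      from nn_integral_traj_Suc[OF x \<pi> t'(1) this]
      have "out (Suc t) = (\<integral>\<^sup>+\<omega>. \<integral>\<^sup>+b. \<integral>\<^sup>+y. ennreal (dens M (Suc t) b y (fst \<omega> t)) * indicator (- D) y
          \<partial>base M \<partial>\<pi> t (fst \<omega> t) \<partial>traj M x \<pi> t)"
        by (simp add: out_def)
      also have "\<dots> = (\<integral>\<^sup>+\<omega>. \<integral>\<^sup>+b. ennreal (pout \<omega> b) \<partial>\<pi> t (fst \<omega> t) \<partial>traj M x \<pi> t)"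
      proof (intro nn_integral_cong)
        fix \<omega> b assume \<omega>: "\<omega> \<in> space (traj M x \<pi> t)" and b: "b \<in> space (\<pi> t (fst \<omega> t))"
        have s: "fst \<omega> t \<in> space (base M)" using \<omega> state sp by auto
        then show "(\<integral>\<^sup>+y. ennreal (dens M (Suc t) b y (fst \<omega> t)) * indicator (- D) y \<partial>base M) = ennreal (pout \<omega> b)"
          using b pout_nn[OF s] space_policy[OF \<pi> t s] by simp
      qed
      finally show ?thesis .
    qed
    have f_meas: "(\<lambda>\<omega>. ennreal (U (Suc t) \<omega> + K)) \<in> borel_measurable (hist M (Suc t))"
      using U_meas[OF t'(1)] by simp
    have pout_meas: "(\<lambda>(\<omega>, b). ennreal (pout \<omega> b)) \<in> borel_measurable (traj M x \<pi> t \<Otimes>\<^sub>M act M)"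
    proof -
      interpret sigma_finite_measure "base M" by (rule sigma_finite_base)
      have st: "(\<lambda>w. fst (fst w) t) \<in> traj M x \<pi> t \<Otimes>\<^sub>M act M \<rightarrow>\<^sub>M base M"
        using measurable_hist_state[OF order_refl, of t]
        by (intro measurable_compose[OF measurable_fst]) (simp add: measurable_cong_sets[OF sp(2) refl])
      show ?thesis
        unfolding pout_def split_beta using h st ind_meas
        by (intro measurable_compose[OF _ measurable_ennreal] borel_measurable_lebesgue_integral
            borel_measurable_times measurable_compose[OF measurable_snd] dens_measurable'
            measurable_compose[OF measurable_fst] | simp)+
    qed
    have "\<Psi> (Suc t) = (\<integral>\<^sup>+\<omega>. \<integral>\<^sup>+b. \<integral>\<^sup>+y. ennreal (dens M (Suc t) b y (fst \<omega> t)) *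
        ennreal (U (Suc t) ((fst \<omega>)(Suc t := y), (snd \<omega>)(t := b)) + K) \<partial>base M \<partial>\<pi> t (fst \<omega> t) \<partial>traj M x \<pi> t)"
      unfolding \<Psi>_def by (rule nn_integral_traj_Suc[OF x \<pi> t'(1) f_meas])
    also have "\<dots> \<le> (\<integral>\<^sup>+\<omega>. \<integral>\<^sup>+b. (ennreal (U t \<omega> + K) + ennreal e) + ennreal \<kappa> * ennreal (pout \<omega> b)
        \<partial>\<pi> t (fst \<omega> t) \<partial>traj M x \<pi> t)"
    proof (rule nn_integral_mono_AE, use step[OF t] AE_space in eventually_elim)
      case (elim \<omega>)
      then have s: "fst \<omega> t \<in> space (base M)" and \<omega>: "\<omega> \<in> space (hist M t)" using state sp by auto
      show ?case
      proof (rule nn_integral_mono_AE, use elim(1) AE_space in eventually_elim)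
        case (elim b)
        then have b: "b \<in> space (act M)" using space_policy[OF \<pi> t s] by simp
        define X where "X = (\<Sum>i<t. r i (fst \<omega> i) (snd \<omega> i)) + K"
        \<comment> \<open>As \<open>t\<close> is below the horizon, the shift leaves room for two
          more terms of size \<open>C\<close>: the reward of this step and the next continuation
          value.\<close>
        have X: "2 * C \<le> X"
        proof -
          have "(real (horizon M) + 1 - real t) * C \<le> X" unfolding X_def by (rule KU[OF t'(2) \<omega>])
          moreover have "2 * C \<le> (real (horizon M) + 1 - real t) * C"
            using C t by (intro mult_right_mono) auto
          ultimately show ?thesis by linarith
        qed
        have U_upd: "U (Suc t) ((fst \<omega>)(Suc t := y), (snd \<omega>)(t := b)) + K = X + r t (fst \<omega> t) b + W (Suc t) y" for y
        proof -
          have "(\<Sum>i<t. r i (((fst \<omega>)(Suc t := y)) i) (((snd \<omega>)(t := b)) i)) = (\<Sum>i<t. r i (fst \<omega> i) (snd \<omega> i))"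
            by (intro sum.cong) auto
          then show ?thesis by (simp add: U_def X_def)
        qed
        have rb: "\<bar>r t (fst \<omega> t) b\<bar> \<le> C" by (rule r(2)[OF t s b])
        have int: "integrable (base M) (\<lambda>y. dens M (Suc t) b y (fst \<omega> t) * (X + r t (fst \<omega> t) b + W (Suc t) y))"
        proof (rule integrable_dens_mult[OF h s b, where C = "\<bar>X\<bar> + C + C"])
          show "(\<lambda>y. X + r t (fst \<omega> t) b + W (Suc t) y) \<in> borel_measurable (base M)"
            using W(1)[OF t'(1)] by simp
          show "\<bar>X + r t (fst \<omega> t) b + W (Suc t) y\<bar> \<le> \<bar>X\<bar> + C + C" if "y \<in> space (base M)" for y
            using rb W(2)[OF t'(1) that] by linarith
        qed
        have intW: "integrable (base M) (\<lambda>y. dens M (Suc t) b y (fst \<omega> t) * W (Suc t) y)"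
          by (rule integrable_dens_mult[OF h s b W(1)[OF t'(1)] W(2)[OF t'(1)]])
        have "(\<integral>\<^sup>+y. ennreal (dens M (Suc t) b y (fst \<omega> t)) *
            ennreal (U (Suc t) ((fst \<omega>)(Suc t := y), (snd \<omega>)(t := b)) + K) \<partial>base M) =
          (\<integral>\<^sup>+y. ennreal (dens M (Suc t) b y (fst \<omega> t) * (X + r t (fst \<omega> t) b + W (Suc t) y)) \<partial>base M)"
          unfolding U_upd using dens_nonneg[OF h s b] by (intro nn_integral_cong) (simp add: ennreal_mult')
        also have "\<dots> = ennreal (LINT y|base M. dens M (Suc t) b y (fst \<omega> t) * (X + r t (fst \<omega> t) b + W (Suc t) y))"
        proof (rule nn_integral_eq_integral[OF int], rule AE_I2)
          fix y assume y: "y \<in> space (base M)"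
          have "0 \<le> X + r t (fst \<omega> t) b + W (Suc t) y" using X rb W(2)[OF t'(1) y] by linarith
          then show "0 \<le> dens M (Suc t) b y (fst \<omega> t) * (X + r t (fst \<omega> t) b + W (Suc t) y)"
            using dens_nonneg[OF h s b y] by simp
        qed
        also have "(LINT y|base M. dens M (Suc t) b y (fst \<omega> t) * (X + r t (fst \<omega> t) b + W (Suc t) y)) =
            (X + r t (fst \<omega> t) b) + (LINT y|base M. dens M (Suc t) b y (fst \<omega> t) * W (Suc t) y)"
        proof -
          have "(LINT y|base M. dens M (Suc t) b y (fst \<omega> t) * (X + r t (fst \<omega> t) b + W (Suc t) y)) =
            (LINT y|base M. (X + r t (fst \<omega> t) b) * dens M (Suc t) b y (fst \<omega> t) + dens M (Suc t) b y (fst \<omega> t) * W (Suc t) y)"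
            by (intro Bochner_Integration.integral_cong) (auto simp: algebra_simps)
          then show ?thesis using intW integrable_dens[OF h s b] by simp
        qed
        also have "ennreal \<dots> \<le> ennreal ((U t \<omega> + K + e) + \<kappa> * pout \<omega> b)"
          using elim(1) by (intro ennreal_leI) (simp add: U_def X_def pout_def)
        also have "\<dots> = (ennreal (U t \<omega> + K) + ennreal e) + ennreal \<kappa> * ennreal (pout \<omega> b)"
        proof -
          have "0 \<le> U t \<omega> + K" using X W(2)[OF t'(2) s] C by (simp add: U_def X_def)
          then show ?thesis using e \<kappa> pout_nonneg[OF s b] by (simp add: ennreal_mult)
        qed
        finally show ?case .
      qed
    qed
    also have "\<dots> = (\<integral>\<^sup>+\<omega>. (ennreal (U t \<omega> + K) + ennreal e) + ennreal \<kappa> * (\<integral>\<^sup>+b. ennreal (pout \<omega> b) \<partial>\<pi> t (fst \<omega> t)) \<partial>traj M x \<pi> t)"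
    proof (rule nn_integral_cong)
      fix \<omega> assume \<omega>: "\<omega> \<in> space (traj M x \<pi> t)"
      have s: "fst \<omega> t \<in> space (base M)" using \<omega> state sp by auto
      have m: "(\<lambda>b. ennreal (pout \<omega> b)) \<in> borel_measurable (\<pi> t (fst \<omega> t))"
        using measurable_Pair2[OF pout_meas \<omega>] by (simp add: measurable_cong_sets[OF space_policy(2)[OF \<pi> t s] refl])
      show "(\<integral>\<^sup>+b. (ennreal (U t \<omega> + K) + ennreal e) + ennreal \<kappa> * ennreal (pout \<omega> b) \<partial>\<pi> t (fst \<omega> t)) =
        (ennreal (U t \<omega> + K) + ennreal e) + ennreal \<kappa> * (\<integral>\<^sup>+b. ennreal (pout \<omega> b) \<partial>\<pi> t (fst \<omega> t))"
        using m prob_space.emeasure_space_1[OF space_policy(3)[OF \<pi> t s]]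
        by (simp add: nn_integral_add nn_integral_cmult)
    qed
    also have "\<dots> = \<Psi> t + ennreal e + ennreal \<kappa> * out (Suc t)"
    proof -
      have m1: "(\<lambda>\<omega>. ennreal (U t \<omega> + K)) \<in> borel_measurable (traj M x \<pi> t)"
        using U_meas[OF t'(2)] by (simp add: measurable_cong_sets[OF sp(2) refl])
      have "(\<lambda>\<omega>. \<integral>\<^sup>+b. ennreal (pout \<omega> b) \<partial>\<pi> t (fst \<omega> t)) \<in> borel_measurable (traj M x \<pi> t)"
      proof (rule nn_integral_measurable_subprob_algebra2[where N = "act M"])
        show "(\<lambda>(\<omega>, b). ennreal (pout \<omega> b)) \<in> borel_measurable (traj M x \<pi> t \<Otimes>\<^sub>M act M)" by (rule pout_meas)
        have "(\<lambda>\<omega>. \<pi> t (fst \<omega> t)) \<in> hist M t \<rightarrow>\<^sub>M prob_algebra (act M)"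
          using t by (intro measurable_compose[OF measurable_hist_state measurable_policy[OF \<pi>]]) auto
        then show "(\<lambda>\<omega>. \<pi> t (fst \<omega> t)) \<in> traj M x \<pi> t \<rightarrow>\<^sub>M subprob_algebra (act M)"
          by (auto simp: measurable_cong_sets[OF sp(2) refl] intro: measurable_prob_algebraD)
      qed
      then show ?thesis
        using m1 by (simp add: nn_integral_add nn_integral_cmult \<Psi>_def out_eq T.emeasure_space_1)
    qed
    finally show ?thesis by (simp add: ac_simps)
  qed
  have \<Psi>_bound: "\<Psi> t \<le> \<Psi> 0 + ennreal \<kappa> * (\<Sum>h=1..t. out h) + of_nat t * ennreal e" if "t \<le> horizon M" for t
    using that
  proof (induction t)
    case (Suc t)
    have "\<Psi> (Suc t) \<le> \<Psi> t + ennreal \<kappa> * out (Suc t) + ennreal e" using Suc.prems by (intro \<Psi>_step) simp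
    also have "\<dots> \<le> (\<Psi> 0 + ennreal \<kappa> * (\<Sum>h=1..t. out h) + of_nat t * ennreal e) + ennreal \<kappa> * out (Suc t) + ennreal e"
      using Suc by (intro add_mono) auto
    also have "\<dots> = \<Psi> 0 + ennreal \<kappa> * (\<Sum>h=1..Suc t. out h) + of_nat (Suc t) * ennreal e"
      by (simp add: distrib_left distrib_right ac_simps)
    finally show ?case .
  qed simp
  have W0: "0 \<le> W 0 x + K"
  proof -
    have "0 \<le> real (horizon M) * C" using C by simp
    moreover have "\<bar>W 0 x\<bar> \<le> C" using W(2)[OF _ x, of 0] by simp
    ultimately show ?thesis unfolding K_def distrib_right by linarith
  qed
  have "\<Psi> 0 = ennreal (W 0 x + K)"
  proof -
    have "(\<lambda>\<omega>. ennreal (U 0 \<omega> + K)) \<in> borel_measurable (hist M 0)" using U_meas[of 0] by simp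
    then show ?thesis
      unfolding \<Psi>_def traj.simps(1) using initial_hist[OF x]
      by (subst nn_integral_return) (simp_all add: U_def)
  qed
  moreover have "out h = ennreal (outside_prob M x \<pi> h D)" if "h \<in> {1..horizon M}" for h
    unfolding out_def using that by (intro emeasure_outside[OF x \<pi> _ D, symmetric]) simp
  ultimately have "\<Psi> (horizon M) \<le> ennreal (W 0 x + K) + ennreal \<kappa> * (\<Sum>h=1..horizon M. ennreal (outside_prob M x \<pi> h D)) + of_nat (horizon M) * ennreal e"
    using \<Psi>_bound[OF order_refl] by simp
  also have "\<dots> = ennreal ((W 0 x + K) + \<kappa> * (\<Sum>h=1..horizon M. outside_prob M x \<pi> h D) + real (horizon M) * e)"
  proof -
    have nonneg: "0 \<le> outside_prob M x \<pi> h D" for h by (simp add: outside_prob_def)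
    then have "0 \<le> (\<Sum>h=1..horizon M. outside_prob M x \<pi> h D)" by (intro sum_nonneg) auto
    moreover from this have "0 \<le> \<kappa> * (\<Sum>h=1..horizon M. outside_prob M x \<pi> h D)" "0 \<le> real (horizon M) * e"
      using \<kappa> e by simp_all
    ultimately show ?thesis
      using W0 \<kappa> e nonneg
      by (simp only: sum_ennreal ennreal_mult ennreal_plus ennreal_of_nat_eq_real_of_nat of_nat_0_le_iff add_nonneg_nonneg)
  qed
  finally have fin: "\<Psi> (horizon M) \<le> ennreal ((W 0 x + K) + \<kappa> * (\<Sum>h=1..horizon M. outside_prob M x \<pi> h D) + real (horizon M) * e)" .
  interpret T: prob_space "traj M x \<pi> (horizon M)" by (rule prob_space_traj[OF x \<pi> order_refl])
  have spH: "space (traj M x \<pi> (horizon M)) = space (hist M (horizon M))" "sets (traj M x \<pi> (horizon M)) = sets (hist M (horizon M))"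
    using space_traj[OF x \<pi> order_refl] sets_traj[OF x \<pi> order_refl] by auto
  have UH: "\<bar>U (horizon M) \<omega>\<bar> \<le> K" if "\<omega> \<in> space (hist M (horizon M))" for \<omega>
    using sum_bound[OF order_refl that] W(2)[OF order_refl state[OF that order_refl]]
    unfolding U_def K_def distrib_right by linarith
  have intU: "integrable (traj M x \<pi> (horizon M)) (U (horizon M))"
    using U_meas[OF order_refl] UH spH
    by (intro T.integrable_const_bound[of _ K]) (auto simp: measurable_cong_sets[OF spH(2) refl])
  have "\<Psi> (horizon M) = ennreal (LINT \<omega>|traj M x \<pi> (horizon M). U (horizon M) \<omega> + K)"
    unfolding \<Psi>_def
  proof (rule nn_integral_eq_integral)
    show "integrable (traj M x \<pi> (horizon M)) (\<lambda>\<omega>. U (horizon M) \<omega> + K)" using intU by simp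
    show "AE \<omega> in traj M x \<pi> (horizon M). 0 \<le> U (horizon M) \<omega> + K"
      using UH spH by (intro AE_I2) (simp, smt (verit))
  qed
  also have "(LINT \<omega>|traj M x \<pi> (horizon M). U (horizon M) \<omega> + K) = (LINT \<omega>|traj M x \<pi> (horizon M). U (horizon M) \<omega>) + K"
    using intU by (simp add: T.prob_space)
  finally have *: "ennreal ((LINT \<omega>|traj M x \<pi> (horizon M). U (horizon M) \<omega>) + K) \<le>
    ennreal ((W 0 x + K) + \<kappa> * (\<Sum>h=1..horizon M. outside_prob M x \<pi> h D) + real (horizon M) * e)" using fin by simp
  have "0 \<le> (W 0 x + K) + \<kappa> * (\<Sum>h=1..horizon M. outside_prob M x \<pi> h D) + real (horizon M) * e"
    using W0 \<kappa> e by (intro add_nonneg_nonneg[of "W 0 x + K + _"] add_nonneg_nonneg[of "W 0 x + K"] mult_nonneg_nonneg sum_nonneg)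
      (auto simp: outside_prob_def)
  with * have "(LINT \<omega>|traj M x \<pi> (horizon M). U (horizon M) \<omega>) + K \<le>
    (W 0 x + K) + \<kappa> * (\<Sum>h=1..horizon M. outside_prob M x \<pi> h D) + real (horizon M) * e"
    by (rule ennreal_le_iff[THEN iffD1, rotated])
  then show ?thesis by (simp add: U_def)
qed

end

section \<open>Reflection and truncation error\<close>

text \<open>\<open>measure\<close> has the value 0 both for sets that are not measurable and for
  sets of infinite measure, so positivity excludes both.\<close>

lemma measure_pos_imp_sets:
  assumes "0 < measure M D" shows "D \<in> sets M" "emeasure M D < \<infinity>"
proof -
  show "D \<in> sets M" using assms measure_notin_sets by fastforce
  show "emeasure M D < \<infinity>"
  proof (rule ccontr)
    assume "\<not> emeasure M D < \<infinity>"
    then have "emeasure M D = \<infinity>" by (simp add: less_top[symmetric])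
    then have "measure M D = 0" by (simp add: measure_def)
    with assms show False by simp
  qed
qed

lemma sigma_finite_leb: "sigma_finite_measure (leb d)"
proof -
  interpret product_sigma_finite "\<lambda>_::nat. lborel :: real measure" ..
  show ?thesis unfolding leb_def by (rule sigma_finite) simp
qed

lemma edist_tendsto_0:
  assumes "\<And>i. i < d \<Longrightarrow> (\<lambda>n. u n i) \<longlonglongrightarrow> a i"
  shows "(\<lambda>n. edist d (u n) a) \<longlonglongrightarrow> 0"
proof -
  have "(\<lambda>n. sqrt (\<Sum>i<d. (u n i - a i)\<^sup>2)) \<longlonglongrightarrow> sqrt (\<Sum>i<d. (a i - a i)\<^sup>2)"
    using assms by (intro tendsto_intros) auto
  then show ?thesis by (simp add: edist_def L2_set_def)
qed

lemma compactin_euclid_seq_closed: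
  assumes "compactin (euclid_top d) A"
  shows "seq_closed d A"
proof -
  interpret E: Metric_space "space (leb d)" "edist d" by (rule Metric_space_edist)
  have "closedin E.mtopology A"
    using compactin_imp_closedin[OF E.Hausdorff_space_mtopology] assms by (simp add: euclid_top_def)
  then have A: "A \<subseteq> space (leb d)" "\<And>\<sigma> l. range \<sigma> \<subseteq> A \<Longrightarrow> limitin E.mtopology \<sigma> l sequentially \<Longrightarrow> l \<in> A"
    unfolding E.metric_closedin_iff_sequentially_closed by auto
  show ?thesis
  proof (rule seq_closedI[OF A(1)])
    fix u a assume u: "\<And>n. u n \<in> A" and a: "a \<in> space (leb d)"
      and lim: "\<And>i. i < d \<Longrightarrow> (\<lambda>n. u n i) \<longlonglongrightarrow> a i"
    have "u n \<in> space (leb d)" for n using u[of n] A(1) by (rule subsetD[rotated])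
    then have "limitin E.mtopology u a sequentially"
      unfolding E.limitin_metric_dist_null by (intro conjI a always_eventually allI edist_tendsto_0 lim)
    then show "a \<in> A" by (rule A(2)[rotated]) (rule image_subsetI, rule u)
  qed
qed

text \<open>Provides compact sets of arbitrarily large volume. On each of them the density
  conditions give a positive lower bound, which is how the truncation sets are shown to
  grow.\<close>

lemma compactin_cube: "compactin (euclid_top d) ({..<d} \<rightarrow>\<^sub>E {a..b})"
proof -
  interpret E: Metric_space "space (leb d)" "edist d" by (rule Metric_space_edist)
  \<comment> \<open>Outside \<open>{..<d}\<close> an extensional function has the single value
    \<open>undefined\<close>. The cube is thus a product of compact sets over all of
    \<open>nat\<close>, and compactness of products applies.\<close>
  define S where "S i = (if i < d then {a..b} else {undefined :: real})" for i :: nat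
  have S: "{..<d} \<rightarrow>\<^sub>E {a..b} = PiE UNIV S"
  proof (rule set_eqI)
    fix f
    show "f \<in> {..<d} \<rightarrow>\<^sub>E {a..b} \<longleftrightarrow> f \<in> PiE UNIV S"
      unfolding PiE_UNIV_domain PiE_iff extensional_def S_def Pi_iff
      by auto
  qed
  have "compactin (product_topology (\<lambda>_. euclidean) UNIV) (PiE UNIV S)"
    unfolding compactin_PiE by (simp add: S_def)
  then have "compact (PiE UNIV S)" by (simp add: euclidean_product_topology)
  then have sc: "seq_compact (PiE UNIV S)" by (rule compact_imp_seq_compact)
  show ?thesis
    unfolding euclid_top_def E.compactin_sequentially
  proof (intro conjI allI impI)
    show "{..<d} \<rightarrow>\<^sub>E {a..b} \<subseteq> space (leb d)" by (auto simp: space_leb)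
    fix f :: "nat \<Rightarrow> rvec" assume f: "range f \<subseteq> {..<d} \<rightarrow>\<^sub>E {a..b}"
    then have "\<forall>n. f n \<in> PiE UNIV S" unfolding S by auto
    with sc obtain l r where l: "l \<in> PiE UNIV S" "strict_mono (r :: nat \<Rightarrow> nat)" "(f \<circ> r) \<longlonglongrightarrow> l"
      by (rule seq_compactE)
    have "(\<lambda>n. (f \<circ> r) n i) \<longlonglongrightarrow> l i" for i
      using l(3) by (rule continuous_on_tendsto_compose[OF continuous_on_product_coordinates[of i]]) auto
    then have "(\<lambda>n. edist d ((f \<circ> r) n) l) \<longlonglongrightarrow> 0" by (rule edist_tendsto_0)
    moreover have "{..<d} \<rightarrow>\<^sub>E {a..b} \<subseteq> space (leb d)" by (auto simp: space_leb)
    then have "l \<in> space (leb d)" "\<And>n. (f \<circ> r) n \<in> space (leb d)"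
      using l(1) f unfolding S[symmetric] by (simp_all add: subset_iff image_subset_iff)
    ultimately have "limitin E.mtopology (f \<circ> r) l sequentially"
      unfolding E.limitin_metric_dist_null by (intro conjI always_eventually allI)
    then show "\<exists>l r. l \<in> {..<d} \<rightarrow>\<^sub>E {a..b} \<and> strict_mono r \<and> limitin E.mtopology (f \<circ> r) l sequentially"
      using l(1,2) unfolding S[symmetric] by blast
  qed
qed

lemma measure_cube:
  assumes "a \<le> b" shows "emeasure (leb d) ({..<d} \<rightarrow>\<^sub>E {a..b}) = ennreal ((b - a) ^ d)"
proof -
  interpret product_sigma_finite "\<lambda>_::nat. lborel :: real measure" ..
  have "emeasure (leb d) ({..<d} \<rightarrow>\<^sub>E {a..b}) = (\<Prod>i<d. emeasure lborel {a..b})"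
    unfolding leb_def by (rule emeasure_PiM) auto
  then show ?thesis using assms by (simp add: ennreal_power)
qed

lemma euclidean_mdpD:
  assumes "euclidean_mdp d H G M \<rho>"
  shows "base M = leb d" "horizon M = H" "space (act M) \<noteq> {}" "compactin (euclid_top d) (space (act M))"
    "sets (act M) = sets (restrict_space (leb d) (space (act M)))" "Metric_space (space (act M)) \<rho>"
    "Metric_space.mtopology (space (act M)) \<rho> = subtopology (euclid_top d) (space (act M))"
    "\<And>h. h \<in> {1..H} \<Longrightarrow> (\<lambda>(x, a, y). dens M h a y x) \<in> borel_measurable (leb d \<Otimes>\<^sub>M act M \<Otimes>\<^sub>M leb d)"
    "\<And>h x a y. h \<in> {1..H} \<Longrightarrow> x \<in> space (leb d) \<Longrightarrow> a \<in> space (act M) \<Longrightarrow> y \<in> space (leb d) \<Longrightarrow> 0 \<le> dens M h a y x"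
    "\<And>h x a. h \<in> {1..H} \<Longrightarrow> x \<in> space (leb d) \<Longrightarrow> a \<in> space (act M) \<Longrightarrow> prob_space (trans_kernel M h x a)"
    "\<And>t. t < H \<Longrightarrow> (\<lambda>(x, a). reward M t x a) \<in> borel_measurable (leb d \<Otimes>\<^sub>M act M)"
    "\<And>t x a. t < H \<Longrightarrow> x \<in> space (leb d) \<Longrightarrow> a \<in> space (act M) \<Longrightarrow> \<bar>reward M t x a\<bar> \<le> G"
    "final M \<in> borel_measurable (leb d)" "\<And>x. x \<in> space (leb d) \<Longrightarrow> \<bar>final M x\<bar> \<le> G"
  using assms unfolding euclidean_mdp_def by simp_all

lemma euclidean_mdp_markov:
  assumes "euclidean_mdp d H G M \<rho>" shows "markov_mdp M"
  by (rule markov_mdp.intro) (simp_all add: euclidean_mdpD[OF assms] sigma_finite_leb)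

definition reflected_mass :: "('s, 'a) mdp \<Rightarrow> 's set \<Rightarrow> nat \<Rightarrow> 'a \<Rightarrow> 's \<Rightarrow> real" where
  "reflected_mass M D h a x = (LINT z:space (base M) - D|base M. dens M h a z x)"

lemma reflect_simps:
  "base (reflect D M) = restrict_space (base M) D" "act (reflect D M) = act M"
  "horizon (reflect D M) = horizon M" "reward (reflect D M) = reward M" "final (reflect D M) = final M"
  "dens (reflect D M) h a y x = dens M h a y x + 1 / measure (base M) D * reflected_mass M D h a x"
  by (simp_all add: reflect_def reflected_mass_def)

context markov_mdp
begin

lemma reflected_mass:
  assumes D: "0 < measure (base M) D" and h: "h \<in> {1..horizon M}"
    and x: "x \<in> space (base M)" and a: "a \<in> space (act M)"
  shows "ennreal (reflected_mass M D h a x) = (\<integral>\<^sup>+y\<in>space (base M) - D. ennreal (dens M h a y x) \<partial>base M)"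
    and "0 \<le> reflected_mass M D h a x"
    and "(\<integral>\<^sup>+y\<in>D. ennreal (dens M h a y x) \<partial>base M) + ennreal (reflected_mass M D h a x) = 1"
proof -
  note Ds = measure_pos_imp_sets(1)[OF D]
  have m[measurable]: "(\<lambda>y. dens M h a y x) \<in> borel_measurable (base M)" using h x a by measurable
  have nn: "(\<integral>\<^sup>+y. ennreal (dens M h a y x) \<partial>base M) = 1"
    using nn_integral_kernel_const[OF h x a, of 1] by simp
  have pos: "AE y in base M. 0 \<le> indicator (space (base M) - D) y * dens M h a y x"
    using dens_nonneg[OF h x a] by auto
  have eq: "(\<integral>\<^sup>+y. ennreal (indicator (space (base M) - D) y * dens M h a y x) \<partial>base M) =
     (\<integral>\<^sup>+y\<in>space (base M) - D. ennreal (dens M h a y x) \<partial>base M)"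
    by (intro nn_integral_cong) (auto simp: indicator_def)
  have le: "(\<integral>\<^sup>+y\<in>space (base M) - D. ennreal (dens M h a y x) \<partial>base M) \<le> 1"
    unfolding nn[symmetric] by (intro nn_integral_mono) (auto simp: indicator_def)
  have int: "integrable (base M) (\<lambda>y. indicator (space (base M) - D) y * dens M h a y x)"
  proof (rule integrableI_nonneg)
    show "(\<integral>\<^sup>+y. ennreal (indicator (space (base M) - D) y * dens M h a y x) \<partial>base M) < \<infinity>"
      unfolding eq using order_le_less_trans[OF le ennreal_one_less_top] by simp
  qed (use Ds pos in auto)
  show 1: "ennreal (reflected_mass M D h a x) = (\<integral>\<^sup>+y\<in>space (base M) - D. ennreal (dens M h a y x) \<partial>base M)"
    unfolding reflected_mass_def set_lebesgue_integral_def
    using nn_integral_eq_integral[OF int pos] eq by simp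
  show "0 \<le> reflected_mass M D h a x"
    unfolding reflected_mass_def set_lebesgue_integral_def using pos by (intro integral_nonneg_AE) simp
  have "(\<integral>\<^sup>+y\<in>D. ennreal (dens M h a y x) \<partial>base M) + (\<integral>\<^sup>+y\<in>space (base M) - D. ennreal (dens M h a y x) \<partial>base M) =
     (\<integral>\<^sup>+y. ennreal (dens M h a y x) * indicator D y + ennreal (dens M h a y x) * indicator (space (base M) - D) y \<partial>base M)"
    using Ds by (subst nn_integral_add) auto
  also have "\<dots> = (\<integral>\<^sup>+y. ennreal (dens M h a y x) \<partial>base M)"
    by (intro nn_integral_cong) (auto simp: indicator_def)
  finally show "(\<integral>\<^sup>+y\<in>D. ennreal (dens M h a y x) \<partial>base M) + ennreal (reflected_mass M D h a x) = 1"
    unfolding 1 nn .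
qed

lemma reflect_markov:
  assumes D: "0 < measure (base M) D"
  shows "markov_mdp (reflect D M)"
proof (rule markov_mdp.intro)
  note Ds = measure_pos_imp_sets[OF D]
  have Dsp: "D \<subseteq> space (base M)" using Ds(1) by (rule sets.sets_into_space)
  have sp: "space (restrict_space (base M) D) = D" using Dsp by (auto simp: space_restrict_space)
  have fin: "finite_measure (restrict_space (base M) D)"
    using Ds Dsp by (intro finite_measureI) (simp add: emeasure_restrict_space sp less_top[symmetric])
  interpret F: finite_measure "restrict_space (base M) D" by (rule fin)
  interpret B: sigma_finite_measure "base M" by (rule sigma_finite_base)
  show "sigma_finite_measure (base (reflect D M))"
    unfolding reflect_simps by (rule F.sigma_finite_measure_axioms)
  have incl: "(\<lambda>x. x) \<in> restrict_space (base M) D \<rightarrow>\<^sub>M base M"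
    by (rule measurable_restrict_space1) simp
  fix h assume "h \<in> {1..horizon (reflect D M)}"
  then have h: "h \<in> {1..horizon M}" by (simp add: reflect_simps)
  show "(\<lambda>(x, a, y). dens (reflect D M) h a y x)
      \<in> borel_measurable (base (reflect D M) \<Otimes>\<^sub>M act (reflect D M) \<Otimes>\<^sub>M base (reflect D M))"
    unfolding reflect_simps split_beta
  proof (intro borel_measurable_add borel_measurable_times measurable_const)
    have fx: "fst \<in> restrict_space (base M) D \<Otimes>\<^sub>M act M \<Otimes>\<^sub>M restrict_space (base M) D \<rightarrow>\<^sub>M base M"
      by (rule measurable_compose[OF measurable_fst incl])
    have fy: "(\<lambda>w. snd (snd w)) \<in> restrict_space (base M) D \<Otimes>\<^sub>M act M \<Otimes>\<^sub>M restrict_space (base M) D \<rightarrow>\<^sub>M base M"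
      by (rule measurable_compose[OF measurable_snd measurable_compose[OF measurable_snd incl]])
    have fa: "(\<lambda>w. fst (snd w)) \<in> restrict_space (base M) D \<Otimes>\<^sub>M act M \<Otimes>\<^sub>M restrict_space (base M) D \<rightarrow>\<^sub>M act M"
      by measurable
    show "(\<lambda>w. dens M h (fst (snd w)) (snd (snd w)) (fst w))
      \<in> borel_measurable (restrict_space (base M) D \<Otimes>\<^sub>M act M \<Otimes>\<^sub>M restrict_space (base M) D)"
      by (rule dens_measurable'[OF h fx fa fy])
    have "(\<lambda>w. LINT z|base M. indicator (space (base M) - D) z *\<^sub>R dens M h (fst (snd w)) z (fst w))
      \<in> borel_measurable (restrict_space (base M) D \<Otimes>\<^sub>M act M \<Otimes>\<^sub>M restrict_space (base M) D)"
    proof (rule B.borel_measurable_lebesgue_integral)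
      show "(\<lambda>(w, z). indicator (space (base M) - D) z *\<^sub>R dens M h (fst (snd w)) z (fst w))
        \<in> borel_measurable ((restrict_space (base M) D \<Otimes>\<^sub>M act M \<Otimes>\<^sub>M restrict_space (base M) D) \<Otimes>\<^sub>M base M)"
        unfolding split_beta using Ds(1)
        by (intro borel_measurable_scaleR measurable_compose[OF measurable_snd borel_measurable_indicator]
            dens_measurable'[OF h measurable_compose[OF measurable_fst fx] measurable_compose[OF measurable_fst fa] measurable_snd]) auto
    qed
    then show "(\<lambda>w. reflected_mass M D h (fst (snd w)) (fst w))
      \<in> borel_measurable (restrict_space (base M) D \<Otimes>\<^sub>M act M \<Otimes>\<^sub>M restrict_space (base M) D)"
      unfolding reflected_mass_def set_lebesgue_integral_def .
  qed simp
  fix x a assume "x \<in> space (base (reflect D M))" "a \<in> space (act (reflect D M))"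
  then have x: "x \<in> D" "x \<in> space (base M)" and a: "a \<in> space (act M)" using Dsp by (auto simp: reflect_simps sp)
  note mass = reflected_mass[OF D h x(2) a]
  have nonneg: "0 \<le> dens (reflect D M) h a y x" if "y \<in> D" for y
    using that Dsp mass(2) dens_nonneg[OF h x(2) a, of y] unfolding reflect_simps by auto
  then show "0 \<le> dens (reflect D M) h a y x" if "y \<in> space (base (reflect D M))" for y
    using that by (simp add: reflect_simps(1) sp)
  show "prob_space (trans_kernel (reflect D M) h x a)"
  proof
    have m[measurable]: "(\<lambda>y. dens M h a y x) \<in> borel_measurable (base M)" using h x a by measurable
    have m': "(\<lambda>y. dens (reflect D M) h a y x) \<in> borel_measurable (restrict_space (base M) D)"
      unfolding reflect_simps by (intro borel_measurable_add borel_measurable_const measurable_restrict_space1 m)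
    have "emeasure (trans_kernel (reflect D M) h x a) (space (trans_kernel (reflect D M) h x a)) =
      (\<integral>\<^sup>+y. ennreal (dens (reflect D M) h a y x) \<partial>restrict_space (base M) D)"
      unfolding trans_kernel_def reflect_simps(1) using m'
      by (subst emeasure_density) (auto intro!: nn_integral_cong simp: indicator_def)
    also have "\<dots> = (\<integral>\<^sup>+y\<in>D. ennreal (dens (reflect D M) h a y x) \<partial>base M)"
      using Ds(1) by (subst nn_integral_restrict_space) auto
    also have "\<dots> = (\<integral>\<^sup>+y. ennreal (dens M h a y x) * indicator D y +
        ennreal (1 / measure (base M) D * reflected_mass M D h a x) * indicator D y \<partial>base M)"
      using mass(2) dens_nonneg[OF h x(2) a] Dsp
      by (intro nn_integral_cong) (auto simp: indicator_def reflect_simps)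
    also have "\<dots> = (\<integral>\<^sup>+y\<in>D. ennreal (dens M h a y x) \<partial>base M) +
        ennreal (1 / measure (base M) D * reflected_mass M D h a x) * emeasure (base M) D"
      using Ds(1) by (subst nn_integral_add) (auto simp: nn_integral_cmult_indicator)
    also have "ennreal (1 / measure (base M) D * reflected_mass M D h a x) * emeasure (base M) D =
        ennreal (reflected_mass M D h a x)"
      using D Ds(2) mass(2) by (simp add: emeasure_eq_ennreal_measure ennreal_mult[symmetric] less_top[symmetric])
    finally show "emeasure (trans_kernel (reflect D M) h x a) (space (trans_kernel (reflect D M) h x a)) = 1"
      using mass(3) by simp
  qed
qed

end

section \<open>Dynamic programming in the reflected MDP\<close>

definition bellman ::
  "('s, 'a) mdp \<Rightarrow> 's set \<Rightarrow> nat \<Rightarrow> ('s \<Rightarrow> real) \<Rightarrow> 's \<Rightarrow> 'a \<Rightarrow> real" where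
  "bellman M D t W x a = reward M t x a
     + (LINT y|restrict_space (base M) D. dens (reflect D M) (Suc t) a y x * W y)"

text \<open>
  Since \<open>reward\<close> is only jointly measurable, the pointwise supremum over the actions need not be Borel;
  the value functions are Borel versions of it, exact at the starting point \<open>x\<close>.
\<close>

definition bellman_step ::
  "('s, 'a) mdp \<Rightarrow> 's set \<Rightarrow> 's \<Rightarrow> nat \<Rightarrow> ('s \<Rightarrow> real) \<Rightarrow> ('s \<Rightarrow> real) \<Rightarrow> bool" where
  "bellman_step M D x t W V \<longleftrightarrow>
     (AE s in restrict_space (base M) D. V s = (SUP a\<in>space (act M). bellman M D t W s a)) \<and>
     V x = (SUP a\<in>space (act M). bellman M D t W x a) \<and>
     (\<forall>e>0. \<exists>f \<in> restrict_space (base M) D \<rightarrow>\<^sub>M act M.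
        (AE s in restrict_space (base M) D. V s - e < bellman M D t W s (f s)) \<and>
        V x - e < bellman M D t W x (f x))"

text \<open>The bound counts what can still be collected from time \<open>t\<close> on:
  \<open>horizon M - t\<close> rewards and the final one, each at most \<open>G\<close>.\<close>

definition dp_values :: "('s, 'a) mdp \<Rightarrow> 's set \<Rightarrow> 's \<Rightarrow> real \<Rightarrow> (nat \<Rightarrow> 's \<Rightarrow> real) \<Rightarrow> bool" where
  "dp_values M D x G V \<longleftrightarrow> V (horizon M) = final M \<and>
     (\<forall>t\<le>horizon M. V t \<in> borel_measurable (restrict_space (base M) D) \<and>
        (\<forall>s\<in>D. \<bar>V t s\<bar> \<le> G * (real (horizon M) + 1 - real t))) \<and>
     (\<forall>t<horizon M. bellman_step M D x t (V (Suc t)) (V t))"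

lemma singleton_sets_leb:
  assumes "x \<in> space (leb d)" shows "{x} \<in> sets (leb d)"
proof -
  have "x \<in> extensional {..<d}" using assms by (simp add: space_leb PiE_def)
  then have "{x} = PiE {..<d} (\<lambda>i. {x i})" by (simp add: PiE_singleton)
  also have "\<dots> \<in> sets (leb d)" unfolding leb_def by (intro sets_PiM_I_finite) simp_all
  finally show ?thesis .
qed

text \<open>Equations that hold almost everywhere can be used along trajectories as soon as they
  hold at the start: there the law is a point mass, and later it charges no null set. This is why
  the value functions are made exact at \<open>x\<close>.\<close>

lemma (in markov_mdp) AE_traj_good:
  assumes x: "x \<in> space (base M)" "{x} \<in> sets (base M)" and \<pi>: "\<pi> \<in> policies M"
    and t: "t \<le> n" "n \<le> horizon M" and P: "AE s in base M. P s" "P x"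
  shows "AE \<omega> in traj M x \<pi> n. P (fst \<omega> t)"
proof -
  obtain Z where Z: "Z \<in> sets (base M)" "{s \<in> space (base M). \<not> P s} \<subseteq> Z" "emeasure (base M) Z = 0"
    using P(1) by (rule AE_E)
  have bad: "P s" if "s \<in> space (base M)" "s \<notin> Z - {x}" for s
    using that Z(2) P(2) by auto
  have null: "Z - {x} \<in> null_sets (base M)"
    using Z x(2) by (intro null_set_Diff null_setsI) simp_all
  have "AE \<omega> in traj M x \<pi> n. fst \<omega> t \<notin> Z - {x}"
  proof (cases t)
    case 0
    have ind: "(indicator (Z - {x}) :: _ \<Rightarrow> ennreal) \<in> borel_measurable (base M)" using Z x by simp
    have "(\<integral>\<^sup>+\<omega>. indicator (Z - {x}) (fst \<omega> 0) \<partial>traj M x \<pi> n) = (\<integral>\<^sup>+\<omega>. indicator (Z - {x}) (fst \<omega> 0) \<partial>traj M x \<pi> 0)"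
      using t 0 by (intro nn_integral_traj_state[OF x(1) \<pi> _ _ ind]) auto
    also have "\<dots> = 0"
    proof -
      have "(\<lambda>\<omega>. indicator (Z - {x}) (fst \<omega> 0) :: ennreal) \<in> borel_measurable (hist M 0)"
        by (rule measurable_compose[OF measurable_hist_state ind]) simp
      then show ?thesis using initial_hist[OF x(1)] by (simp add: nn_integral_return)
    qed
    finally have "(\<integral>\<^sup>+\<omega>. indicator (Z - {x}) (fst \<omega> 0) \<partial>traj M x \<pi> n) = 0" .
    moreover have "(\<lambda>\<omega>. indicator (Z - {x}) (fst \<omega> 0) :: ennreal) \<in> borel_measurable (traj M x \<pi> n)"
      unfolding measurable_cong_sets[OF sets_traj[OF x(1) \<pi> t(2)] refl]
      by (rule measurable_compose[OF measurable_hist_state ind]) simp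
    ultimately have "AE \<omega> in traj M x \<pi> n. (indicator (Z - {x}) (fst \<omega> 0) :: ennreal) = 0"
      by (subst (asm) nn_integral_0_iff_AE)
    then show ?thesis by eventually_elim (simp add: 0 indicator_def split: if_splits)
  next
    case (Suc h)
    show ?thesis using AE_traj_state[OF x(1) \<pi> t(1)[unfolded Suc] t(2) null] unfolding Suc .
  qed
  then show ?thesis using AE_space
  proof eventually_elim
    case (elim \<omega>)
    then have "fst \<omega> t \<in> space (base M)"
      using measurable_space[OF measurable_hist_state[OF t(1)]] space_traj[OF x(1) \<pi> t(2)] by auto
    then show ?case using elim(1) by (rule bad)
  qed
qed

lemma restrict_leb:
  assumes D: "0 < measure (leb d) D"
  shows "space (restrict_space (leb d) D) = D" "finite_measure (restrict_space (leb d) D)"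
    "D \<subseteq> space (leb d)" "measure (restrict_space (leb d) D) D = measure (leb d) D"
proof -
  note Ds = measure_pos_imp_sets[OF D]
  show sub: "D \<subseteq> space (leb d)" using Ds(1) by (rule sets.sets_into_space)
  then show sp: "space (restrict_space (leb d) D) = D" by (auto simp: space_restrict_space)
  show "finite_measure (restrict_space (leb d) D)"
    using Ds sub by (intro finite_measureI) (simp add: emeasure_restrict_space sp less_top[symmetric])
  show "measure (restrict_space (leb d) D) D = measure (leb d) D"
    using Ds(1) by (simp add: measure_restrict_space)
qed

context
  fixes d :: nat and H :: nat and G :: real and M :: "(rvec, rvec) mdp" and \<rho> :: "rvec \<Rightarrow> rvec \<Rightarrow> real"
    and D :: "rvec set" and x :: rvec
  assumes EM: "euclidean_mdp d H G M \<rho>" and D: "0 < measure (leb d) D" and x: "x \<in> D"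
begin

lemmas mdp_facts = euclidean_mdpD[OF EM]

lemma markov: "markov_mdp M" by (rule euclidean_mdp_markov[OF EM])

lemma markov_reflected: "markov_mdp (reflect D M)"
  by (rule markov_mdp.reflect_markov[OF markov]) (simp add: mdp_facts D)

lemma seq_closed_actions: "seq_closed d (space (act M))"
  by (rule compactin_euclid_seq_closed[OF mdp_facts(4)])

lemma G_nonneg: "0 \<le> G"
proof -
  have "x \<in> space (leb d)" using x restrict_leb(3)[OF D] by (rule subsetD[rotated])
  then show ?thesis using mdp_facts(14)[of x] abs_ge_zero[of "final M x"] by linarith
qed

lemma bellman_bound:
  assumes t: "t < H" and W: "W \<in> borel_measurable (restrict_space (leb d) D)" "\<And>s. s \<in> D \<Longrightarrow> \<bar>W s\<bar> \<le> B"
    and s: "s \<in> D" and a: "a \<in> space (act M)"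
  shows "\<bar>bellman M D t W s a\<bar> \<le> G + B"
proof -
  interpret R: markov_mdp "reflect D M" by (rule markov_reflected)
  have b: "base (reflect D M) = restrict_space (leb d) D" by (simp add: reflect_simps mdp_facts)
  have h: "Suc t \<in> {1..horizon (reflect D M)}" using t by (simp add: reflect_simps mdp_facts)
  have s': "s \<in> space (base (reflect D M))" "a \<in> space (act (reflect D M))"
    using s a by (simp_all add: restrict_leb(1)[OF D] reflect_simps mdp_facts(1))
  note int = R.integrable_dens[OF h s']
  have "\<bar>LINT y|base (reflect D M). dens (reflect D M) (Suc t) a y s * W y\<bar>
      \<le> (LINT y|base (reflect D M). \<bar>dens (reflect D M) (Suc t) a y s * W y\<bar>)" by (rule integral_abs_bound)
  also have "\<dots> \<le> (LINT y|base (reflect D M). dens (reflect D M) (Suc t) a y s * B)"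
  proof (rule integral_mono)
    show "integrable (base (reflect D M)) (\<lambda>y. \<bar>dens (reflect D M) (Suc t) a y s * W y\<bar>)"
      using W by (intro integrable_abs R.integrable_dens_mult[OF h s', where C = B])
        (auto simp: b restrict_leb(1)[OF D])
    fix y assume y: "y \<in> space (base (reflect D M))"
    then have "\<bar>W y\<bar> \<le> B" using W(2) by (simp add: b restrict_leb(1)[OF D])
    then show "\<bar>dens (reflect D M) (Suc t) a y s * W y\<bar> \<le> dens (reflect D M) (Suc t) a y s * B"
      using R.dens_nonneg[OF h s' y] by (simp add: abs_mult mult_left_mono)
  qed (use int in simp)
  also have "\<dots> = B" using int by simp
  finally show ?thesis
    using mdp_facts(12)[OF t _ a, of s] subsetD[OF restrict_leb(3)[OF D] s]
    unfolding bellman_def b[symmetric] mdp_facts(1) by (simp add: reflect_simps mdp_facts(1))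
qed

lemma bellman_step_exists:
  assumes t: "t < H" and W: "W \<in> borel_measurable (restrict_space (leb d) D)" "\<And>s. s \<in> D \<Longrightarrow> \<bar>W s\<bar> \<le> B"
  shows "\<exists>V \<in> borel_measurable (restrict_space (leb d) D). (\<forall>s\<in>D. \<bar>V s\<bar> \<le> G + B) \<and> bellman_step M D x t W V"
proof -
  interpret R: markov_mdp "reflect D M" by (rule markov_reflected)
  define \<mu> where "\<mu> = restrict_space (leb d) D"
  define A where "A = space (act M)"
  interpret \<mu>: finite_measure \<mu> unfolding \<mu>_def by (rule restrict_leb(2)[OF D])
  note sp = restrict_leb(1)[OF D, folded \<mu>_def]
  have b: "base (reflect D M) = \<mu>" "act (reflect D M) = act M" by (simp_all add: reflect_simps mdp_facts \<mu>_def)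
  have h: "Suc t \<in> {1..horizon (reflect D M)}" using t by (simp add: reflect_simps mdp_facts)
  have sets_act: "sets (\<mu> \<Otimes>\<^sub>M act M) = sets (\<mu> \<Otimes>\<^sub>M restrict_space (leb d) A)"
    using mdp_facts(5) unfolding A_def by (intro sets_pair_measure_cong refl) 
  have A: "seq_closed d A" "A \<noteq> {}" using seq_closed_actions mdp_facts(3) by (simp_all add: A_def)
  have incl: "(\<lambda>s. s) \<in> \<mu> \<rightarrow>\<^sub>M leb d" unfolding \<mu>_def by (rule measurable_restrict_space1) simp
  note Wm[measurable] = W(1)[folded \<mu>_def]
  have bell_meas: "(\<lambda>(s, a). bellman M D t W s a) \<in> borel_measurable (\<mu> \<Otimes>\<^sub>M act M)"
    unfolding bellman_def split_beta mdp_facts(1) \<mu>_def[symmetric]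
  proof (rule borel_measurable_add)
    have "(\<lambda>w. (fst w, snd w)) \<in> \<mu> \<Otimes>\<^sub>M act M \<rightarrow>\<^sub>M leb d \<Otimes>\<^sub>M act M"
      by (intro measurable_Pair measurable_compose[OF measurable_fst incl] measurable_snd)
    from measurable_compose[OF this mdp_facts(11)[OF t]]
    show "(\<lambda>w. reward M t (fst w) (snd w)) \<in> borel_measurable (\<mu> \<Otimes>\<^sub>M act M)" by (simp add: split_beta)
    have "(\<lambda>(w, y). dens (reflect D M) (Suc t) (snd w) y (fst w) * W y) \<in> borel_measurable ((\<mu> \<Otimes>\<^sub>M act M) \<Otimes>\<^sub>M \<mu>)"
      unfolding split_beta
    proof (rule borel_measurable_times)
      show "(\<lambda>w. dens (reflect D M) (Suc t) (snd (fst w)) (snd w) (fst (fst w))) \<in> borel_measurable ((\<mu> \<Otimes>\<^sub>M act M) \<Otimes>\<^sub>M \<mu>)"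
        by (rule R.dens_measurable'[OF h, unfolded b]) measurable
      show "(\<lambda>w. W (snd w)) \<in> borel_measurable ((\<mu> \<Otimes>\<^sub>M act M) \<Otimes>\<^sub>M \<mu>)" by measurable
    qed
    then show "(\<lambda>w. LINT y|\<mu>. dens (reflect D M) (Suc t) (snd w) y (fst w) * W y) \<in> borel_measurable (\<mu> \<Otimes>\<^sub>M act M)"
      by (rule \<mu>.borel_measurable_lebesgue_integral)
  qed
  have bound: "\<bar>bellman M D t W s a\<bar> \<le> G + B" if "s \<in> space \<mu>" "a \<in> A" for s a
    using that t W unfolding sp A_def by (intro bellman_bound)
  have "\<exists>v\<in>borel_measurable \<mu>. (AE s in \<mu>. v s = (SUP a\<in>A. bellman M D t W s a)) \<and>
    (\<forall>e>0. \<exists>f \<in> \<mu> \<rightarrow>\<^sub>M restrict_space (leb d) A. AE s in \<mu>. v s - e < bellman M D t W s (f s))"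
    by (rule measurable_sup_selection[OF \<mu>.finite_measure_axioms A bell_meas[unfolded measurable_cong_sets[OF sets_act refl]]])
      (rule bound)
  then obtain v where v: "v \<in> borel_measurable \<mu>" and v': "(AE s in \<mu>. v s = (SUP a\<in>A. bellman M D t W s a)) \<and>
    (\<forall>e>0. \<exists>f \<in> \<mu> \<rightarrow>\<^sub>M restrict_space (leb d) A. AE s in \<mu>. v s - e < bellman M D t W s (f s))"
    by (elim bexE) (rule that)
  note v = v v'[THEN conjunct1]
  note sel = v'[THEN conjunct2, rule_format]
  have bdd: "bdd_above (bellman M D t W s ` A)" if "s \<in> D" for s
    using bound[of s] that unfolding sp by (intro bdd_aboveI2[of _ _ "G + B"]) (auto simp: abs_le_iff)
  have sup_bound: "\<bar>SUP a\<in>A. bellman M D t W s a\<bar> \<le> G + B" if s: "s \<in> D" for s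
  proof -
    obtain a where a: "a \<in> A" using A by auto
    have "(SUP a\<in>A. bellman M D t W s a) \<le> G + B"
      using A bound[of s] s unfolding sp by (intro cSUP_least) (auto simp: abs_le_iff)
    moreover have "bellman M D t W s a \<le> (SUP a\<in>A. bellman M D t W s a)"
      by (rule cSUP_upper[OF a bdd[OF s]])
    moreover have "- (G + B) \<le> bellman M D t W s a" using bound[of s a] s a unfolding sp by (simp add: abs_le_iff)
    ultimately show ?thesis by linarith
  qed
  \<comment> \<open>At \<open>x\<close>, the atom of the initial law, the exact supremum is
    inserted. Elsewhere \<open>v\<close> is clipped so that the bound holds on all of
    \<open>D\<close>; almost everywhere the clipping changes nothing.\<close>
  define V where "V s = (if s \<in> {x} then (SUP a\<in>A. bellman M D t W x a) else max (- (G + B)) (min (G + B) (v s)))" for s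
  have xs: "{x} \<inter> space \<mu> \<in> sets \<mu>"
  proof -
    have "{x} \<in> sets (leb d)" using x restrict_leb(3)[OF D] by (intro singleton_sets_leb) auto
    then show ?thesis
      unfolding \<mu>_def sets_restrict_space using x restrict_leb(3)[OF D]
      by (intro image_eqI[of _ _ "{x}"]) (auto simp: space_restrict_space)
  qed
  have V: "V \<in> borel_measurable \<mu>"
    unfolding V_def using v(1) xs by (intro measurable_If_set) auto
  have B: "0 \<le> G + B" using sup_bound[OF x] by (rule order_trans[OF abs_ge_zero])
  have V_bound: "\<bar>V s\<bar> \<le> G + B" if "s \<in> D" for s
    using sup_bound[OF x] B by (auto simp: V_def)
  have V_AE: "AE s in \<mu>. V s = (SUP a\<in>A. bellman M D t W s a) \<and> V s = v s \<or> s = x"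
    using v(2) AE_space
  proof eventually_elim
    case (elim s)
    then have "\<bar>v s\<bar> \<le> G + B" using sup_bound[of s] sp by simp
    then show ?case using elim(1) by (auto simp: V_def)
  qed
  have Vx: "V x = (SUP a\<in>A. bellman M D t W x a)" by (simp add: V_def)
  have "\<exists>f \<in> \<mu> \<rightarrow>\<^sub>M act M. (AE s in \<mu>. V s - e < bellman M D t W s (f s)) \<and> V x - e < bellman M D t W x (f x)"
    if e: "0 < e" for e
  proof -
    obtain f where f: "f \<in> \<mu> \<rightarrow>\<^sub>M restrict_space (leb d) A" "AE s in \<mu>. v s - e < bellman M D t W s (f s)"
      using sel[OF e] by blast
    have "V x - e < (SUP a\<in>A. bellman M D t W x a)" using e by (simp add: Vx)
    then obtain a where a: "a \<in> A" "V x - e < bellman M D t W x a"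
      using less_cSUP_iff[OF A(2) bdd[OF x]] by blast
    define f' where "f' s = (if s \<in> {x} then a else f s)" for s
    have "f \<in> \<mu> \<rightarrow>\<^sub>M act M"
      using f(1) measurable_cong_sets[OF refl mdp_facts(5), of \<mu>] by (simp add: A_def)
    then have "f' \<in> \<mu> \<rightarrow>\<^sub>M act M"
      unfolding f'_def using a xs by (intro measurable_If_set) (auto simp: A_def)
    moreover have "AE s in \<mu>. V s - e < bellman M D t W s (f' s)"
      using V_AE f(2)
    proof eventually_elim
      case (elim s)
      then show ?case using a by (auto simp: f'_def)
    qed
    moreover have "V x - e < bellman M D t W x (f' x)" using a by (simp add: f'_def)
    ultimately show ?thesis by blast
  qed
  moreover have "AE s in \<mu>. V s = (SUP a\<in>A. bellman M D t W s a)"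
    using V_AE by eventually_elim (use Vx in auto)
  ultimately have "bellman_step M D x t W V"
    unfolding bellman_step_def mdp_facts(1) \<mu>_def[symmetric] A_def[symmetric] using Vx by simp
  then show ?thesis using V V_bound unfolding \<mu>_def by blast
qed

lemma dp_values_exist: "\<exists>V. dp_values M D x G V"
proof -
  define \<mu> where "\<mu> = restrict_space (leb d) D"
  define P where "P k U \<longleftrightarrow> (k \<le> H \<longrightarrow> U \<in> borel_measurable \<mu> \<and> (\<forall>s\<in>D. \<bar>U s\<bar> \<le> G * (real k + 1))) \<and>
    (k = 0 \<longrightarrow> U = final M)" for k :: nat and U :: "rvec \<Rightarrow> real"
  define Q where "Q k U U' \<longleftrightarrow> (k < H \<longrightarrow> bellman_step M D x (H - Suc k) U U')" for k U U'
  have "\<exists>f. \<forall>n. P n (f n) \<and> Q n (f n) (f (Suc n))"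
  proof (rule dependent_nat_choice)
    have "final M \<in> borel_measurable \<mu>"
      unfolding \<mu>_def by (rule measurable_restrict_space1[OF mdp_facts(13)])
    then show "\<exists>U. P 0 U" using mdp_facts(14) restrict_leb(3)[OF D] by (auto simp: P_def)
    fix U k assume U: "P k U"
    show "\<exists>U'. P (Suc k) U' \<and> Q k U U'"
    proof (cases "k < H")
      case True
      then have "H - Suc k < H" "U \<in> borel_measurable (restrict_space (leb d) D)" "\<And>s. s \<in> D \<Longrightarrow> \<bar>U s\<bar> \<le> G * (real k + 1)"
        using U by (auto simp: P_def \<mu>_def)
      from bellman_step_exists[OF this] obtain U' where "U' \<in> borel_measurable \<mu>"
        "\<forall>s\<in>D. \<bar>U' s\<bar> \<le> G + G * (real k + 1)" "bellman_step M D x (H - Suc k) U U'"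
        unfolding \<mu>_def by blast
      moreover have "G + G * (real k + 1) = G * (real (Suc k) + 1)" by (simp add: algebra_simps)
      ultimately show ?thesis by (auto simp: P_def Q_def)
    qed (auto simp: P_def Q_def)
  qed
  then obtain f where f: "\<And>n. P n (f n)" "\<And>n. Q n (f n) (f (Suc n))" by blast
  have "dp_values M D x G (\<lambda>t. f (H - t))"
    unfolding dp_values_def mdp_facts(1,2) \<mu>_def[symmetric]
  proof (intro conjI allI impI)
    show "f (H - H) = final M" using f(1)[of 0] by (simp add: P_def)
    fix t assume t: "t \<le> H"
    show "f (H - t) \<in> borel_measurable \<mu>" using f(1)[of "H - t"] by (simp add: P_def)
    have "real (H - t) + 1 = real H + 1 - real t" using t by (simp add: of_nat_diff)
    from f(1)[of "H - t", unfolded P_def this]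
    show "\<forall>s\<in>D. \<bar>f (H - t) s\<bar> \<le> G * (real H + 1 - real t)" by simp
  next
    fix t assume t: "t < H"
    then have "H - Suc (H - Suc t) = t" "Suc (H - Suc t) = H - t" "H - Suc t < H" by auto
    then show "bellman_step M D x t (f (H - Suc t)) (f (H - t))" using f(2)[of "H - Suc t"] by (simp add: Q_def)
  qed
  then show ?thesis by blast
qed

text \<open>Let \<open>m\<close> be the probability of leaving \<open>D\<close> in this step. The
  two kernels differ only in the place of this mass: the original one puts it outside
  \<open>D\<close>, the reflected one spreads it uniformly over \<open>D\<close>. Each placement
  contributes at most \<open>B * m\<close>.\<close>

lemma reflection_error:
  assumes h: "Suc t \<le> H" and W: "W \<in> borel_measurable (leb d)" "\<And>s. s \<in> space (leb d) \<Longrightarrow> \<bar>W s\<bar> \<le> B"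
    and s: "s \<in> D" and a: "a \<in> space (act M)"
  shows "\<bar>(LINT y|leb d. dens M (Suc t) a y s * W y) - (LINT y|restrict_space (leb d) D. dens (reflect D M) (Suc t) a y s * W y)\<bar>
    \<le> 2 * B * (LINT y|leb d. dens M (Suc t) a y s * indicator (- D) y)"
proof -
  interpret M: markov_mdp M by (rule markov)
  define \<mu> where "\<mu> = restrict_space (leb d) D"
  interpret \<mu>: finite_measure \<mu> unfolding \<mu>_def by (rule restrict_leb(2)[OF D])
  note sp = restrict_leb(1)[OF D, folded \<mu>_def]
  note Ds = measure_pos_imp_sets[OF D]
  have hM: "Suc t \<in> {1..horizon M}" using h by (simp add: mdp_facts)
  have s': "s \<in> space (base M)" using s restrict_leb(3)[OF D] by (auto simp: mdp_facts)
  define p where "p y = dens M (Suc t) a y s" for y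
  define m where "m = reflected_mass M D (Suc t) a s"
  have p_nonneg: "0 \<le> p y" if "y \<in> space (leb d)" for y
    using M.dens_nonneg[OF hM s' a] that by (simp add: p_def mdp_facts)
  have pint: "integrable (leb d) (\<lambda>y. p y * f y)"
    if "f \<in> borel_measurable (leb d)" "\<And>y. y \<in> space (leb d) \<Longrightarrow> \<bar>f y\<bar> \<le> C" for f C
    using M.integrable_dens_mult[OF hM s' a, of f C] that unfolding p_def mdp_facts(1) by simp
  have ind: "(\<lambda>y. indicator D y :: real) \<in> borel_measurable (leb d)"
    "(\<lambda>y. indicator (space (leb d) - D) y :: real) \<in> borel_measurable (leb d)" using Ds(1) by auto
  have ind': "(\<lambda>y. indicator (- D) y :: real) \<in> borel_measurable (leb d)"
    using ind(2) by (rule measurable_cong[THEN iffD1, rotated]) (auto simp: indicator_def)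
  have i1: "integrable (leb d) (\<lambda>y. p y * (indicator D y * W y))"
    using W ind by (intro pint[where C = "\<bar>B\<bar>"]) (auto simp: indicator_def intro: order_trans[OF _ abs_ge_self])
  have i2: "integrable (leb d) (\<lambda>y. p y * (indicator (- D) y * W y))"
    using W ind' by (intro pint[where C = "\<bar>B\<bar>"]) (auto simp: indicator_def intro: order_trans[OF _ abs_ge_self])
  have i3: "integrable (leb d) (\<lambda>y. p y * indicator (- D) y)"
    using ind' by (intro pint[where C = 1]) (auto simp: indicator_def)
  have m_eq: "m = (LINT y|leb d. p y * indicator (- D) y)"
    unfolding m_def reflected_mass_def set_lebesgue_integral_def mdp_facts(1) p_def
    by (intro Bochner_Integration.integral_cong) (auto simp: indicator_def)
  have m_nonneg: "0 \<le> m" unfolding m_def using M.reflected_mass(2)[OF _ hM s' a] D by (simp add: mdp_facts)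
  have Wmu: "W \<in> borel_measurable \<mu>" unfolding \<mu>_def by (rule measurable_restrict_space1[OF W(1)])
  have Wint: "integrable \<mu> W"
    using Wmu W(2)[OF subsetD[OF restrict_leb(3)[OF D]]]
    by (intro \<mu>.integrable_const_bound[of _ B] AE_I2) (simp_all add: sp)
  have "(LINT y|leb d. p y * W y) = (LINT y|leb d. p y * (indicator D y * W y) + p y * (indicator (- D) y * W y))"
    by (intro Bochner_Integration.integral_cong) (auto simp: indicator_def)
  then have split1: "(LINT y|leb d. p y * W y) = (LINT y|leb d. p y * (indicator D y * W y)) + (LINT y|leb d. p y * (indicator (- D) y * W y))"
    using i1 i2 by simp
  have pD: "(LINT y|\<mu>. p y * W y) = (LINT y|leb d. p y * (indicator D y * W y))" "integrable \<mu> (\<lambda>y. p y * W y)"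
  proof -
    have "(LINT y|\<mu>. p y * W y) = (LINT y|leb d. indicator D y *\<^sub>R (p y * W y))"
      unfolding \<mu>_def using Ds(1) by (intro integral_restrict_space) auto
    then show "(LINT y|\<mu>. p y * W y) = (LINT y|leb d. p y * (indicator D y * W y))" by (simp add: ac_simps)
    have "integrable (leb d) (\<lambda>y. indicator D y *\<^sub>R (p y * W y))" using i1 by (simp add: ac_simps)
    then show "integrable \<mu> (\<lambda>y. p y * W y)" unfolding \<mu>_def using Ds(1) by (subst integrable_restrict_space) auto
  qed
  have "(LINT y|\<mu>. dens (reflect D M) (Suc t) a y s * W y) = (LINT y|\<mu>. p y * W y + 1 / measure (leb d) D * m * W y)"
    by (intro Bochner_Integration.integral_cong) (auto simp: reflect_simps mdp_facts p_def m_def algebra_simps)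
  then have split2: "(LINT y|\<mu>. dens (reflect D M) (Suc t) a y s * W y) = (LINT y|leb d. p y * (indicator D y * W y)) + 1 / measure (leb d) D * m * (LINT y|\<mu>. W y)"
    using pD Wint by simp
  have b1: "\<bar>LINT y|leb d. p y * (indicator (- D) y * W y)\<bar> \<le> B * m"
  proof -
    have "\<bar>LINT y|leb d. p y * (indicator (- D) y * W y)\<bar> \<le> (LINT y|leb d. \<bar>p y * (indicator (- D) y * W y)\<bar>)"
      by (rule integral_abs_bound)
    also have "\<dots> \<le> (LINT y|leb d. B * (p y * indicator (- D) y))"
    proof (rule integral_mono)
      fix y assume y: "y \<in> space (leb d)"
      show "\<bar>p y * (indicator (- D) y * W y)\<bar> \<le> B * (p y * indicator (- D) y)"
        using mult_right_mono[OF W(2)[OF y] p_nonneg[OF y]] p_nonneg[OF y]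
          by (simp add: indicator_def abs_mult mult.commute)
    qed (use i2 i3 in auto)
    finally show ?thesis by (simp add: m_eq)
  qed
  have b2: "\<bar>1 / measure (leb d) D * m * (LINT y|\<mu>. W y)\<bar> \<le> B * m"
  proof -
    have "\<bar>LINT y|\<mu>. W y\<bar> \<le> (LINT y|\<mu>. \<bar>W y\<bar>)" by (rule integral_abs_bound)
    also have "\<dots> \<le> (LINT y|\<mu>. B)"
      using Wint W(2)[OF subsetD[OF restrict_leb(3)[OF D]]] by (intro integral_mono) (simp_all add: sp)
    also have "\<dots> = B * measure (leb d) D" using restrict_leb(4)[OF D] by (simp add: sp \<mu>_def[symmetric])
    finally have "1 / measure (leb d) D * m * \<bar>LINT y|\<mu>. W y\<bar> \<le> 1 / measure (leb d) D * m * (B * measure (leb d) D)"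
      using m_nonneg by (intro mult_left_mono) auto
    then show ?thesis using D m_nonneg by (simp add: abs_mult mult.commute)
  qed
  have "\<bar>(LINT y|leb d. p y * W y) - (LINT y|\<mu>. dens (reflect D M) (Suc t) a y s * W y)\<bar> \<le> 2 * B * m"
  proof -
    have "2 * B * m = B * m + B * m" by simp
    then show ?thesis unfolding split1 split2 using b1 b2 by (simp only: abs_le_iff) linarith
  qed
  then show ?thesis by (simp add: p_def m_eq \<mu>_def)
qed

text \<open>For the upper bound on the optimal value, every policy is telescoped against the value
  functions. For the lower bound, nearly optimal selections of the reflected MDP are played in the
  original one, and the same telescoping inequality is applied to the negated rewards. A step is in
  error only by the mass with which it leaves \<open>D\<close>.\<close>

lemma truncation_error:
  assumes V: "dp_values M D x G V"
  shows "\<bar>V 0 x - opt_value M x\<bar> \<le>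
    2 * G * real H * (\<Sum>h=1..H. SUP \<pi>\<in>policies M. outside_prob M x \<pi> h D)"
proof -
  interpret M: markov_mdp M by (rule markov)
  note Dsets = measure_pos_imp_sets(1)[OF D]
  have Dsub: "D \<subseteq> space (leb d)" by (rule restrict_leb(3)[OF D])
  have x': "x \<in> space (base M)" using x Dsub by (auto simp: mdp_facts(1))
  have x'': "{x} \<in> sets (base M)" using x' singleton_sets_leb by (simp add: mdp_facts(1))
  have DM: "D \<in> sets (base M)" using Dsets by (simp add: mdp_facts(1))
  define S where "S = (\<Sum>h=1..H. SUP \<pi>\<in>policies M. outside_prob M x \<pi> h D)"
  \<comment> \<open>The factor \<open>2 * B\<close> of \<open>reflection_error\<close>, where
    \<open>B\<close> bounds the continuation value after at least one step and is at most
    \<open>G * H\<close>.\<close>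
  define \<kappa> where "\<kappa> = 2 * G * real H"
  have \<kappa>: "0 \<le> \<kappa>" using G_nonneg by (simp add: \<kappa>_def)
  have out_le: "(\<Sum>h=1..horizon M. outside_prob M x \<pi> h D) \<le> S" if \<pi>: "\<pi> \<in> policies M" for \<pi>
    unfolding S_def mdp_facts(2)
  proof (rule sum_mono, rule cSUP_upper[OF \<pi>])
    fix h
    show "bdd_above ((\<lambda>\<pi>. outside_prob M x \<pi> h D) ` policies M)"
    proof (rule bdd_aboveI2)
      fix \<pi> assume "\<pi> \<in> policies M"
      then interpret T: prob_space "traj M x \<pi> (horizon M)" by (rule M.prob_space_traj[OF x' _ order_refl])
      show "outside_prob M x \<pi> h D \<le> 1" unfolding outside_prob_def by (rule T.prob_le_1)
    qed
  qed
  have VH: "V H = final M" and V_meas: "\<And>t. t \<le> H \<Longrightarrow> V t \<in> borel_measurable (restrict_space (leb d) D)"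
    and V_bound: "\<And>t s. t \<le> H \<Longrightarrow> s \<in> D \<Longrightarrow> \<bar>V t s\<bar> \<le> G * (real H + 1 - real t)"
    and V_step: "\<And>t. t < H \<Longrightarrow> bellman_step M D x t (V (Suc t)) (V t)"
    using V by (simp_all add: dp_values_def mdp_facts(1,2))
  text \<open>Outside \<open>D\<close> the value functions are continued by the extreme values \<open>\<plusminus> G (H + 1 - t)\<close>, which no
    policy can beat, so that only the steps leaving \<open>D\<close> contribute to the error.\<close>
  define W where "W c t s = (if t = H then final M s else if s \<in> D then V t s else c * G * (real H + 1 - real t))"
    for c :: real and t :: nat and s :: rvec
  have W_D: "W c t s = V t s" if "s \<in> D" for c t s using that VH by (simp add: W_def)
  have W_meas: "W c t \<in> borel_measurable (leb d)" if t: "t \<le> H" for c t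
  proof (cases "t = H")
    case False
    have eq: "{s \<in> space (leb d). s \<in> D} = D" using Dsub by auto
    have "(\<lambda>s. if s \<in> D then V t s else c * G * (real H + 1 - real t)) \<in> borel_measurable (leb d)"
      using Dsets V_meas[OF t]
      by (subst measurable_If_restrict_space_iff)
        (auto simp: eq restrict_space_def Int_absorb1 Int_absorb2 Collect_mem_eq)
    then show ?thesis using False by (simp add: W_def[abs_def])
  qed (use mdp_facts(13) in \<open>simp add: W_def[abs_def]\<close>)
  have W_bound: "\<bar>W c t s\<bar> \<le> G * (real H + 1 - real t)" if "t \<le> H" "s \<in> space (leb d)" "\<bar>c\<bar> = 1" for c t s
    using that V_bound[of t s] mdp_facts(14)[of s] G_nonneg
    by (auto simp: W_def abs_mult)
  define C where "C = G * (real H + 1)"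
  have W_C: "\<bar>W c t s\<bar> \<le> C" if "t \<le> H" "s \<in> space (leb d)" "\<bar>c\<bar> = 1" for c t s
  proof -
    have "G * (real H + 1 - real t) \<le> C" unfolding C_def using G_nonneg by (intro mult_left_mono) auto
    then show ?thesis using W_bound[OF that] by linarith
  qed
  have GC: "G \<le> C" unfolding C_def using G_nonneg by (simp add: algebra_simps)
  define pout where "pout t s b = (LINT y|leb d. dens M (Suc t) b y s * indicator (- D) y)" for t s b
  have pout_nonneg: "0 \<le> pout t s b" if "t < H" "s \<in> space (leb d)" "b \<in> space (act M)" for t s b
    unfolding pout_def using M.dens_nonneg[of "Suc t" s b] that
    by (intro integral_nonneg_AE AE_I2) (auto simp: mdp_facts(1,2) indicator_def)
  have intW: "\<bar>LINT y|leb d. dens M (Suc t) b y s * W c (Suc t) y\<bar> \<le> G * (real H - real t)"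
    if t: "t < H" and s: "s \<in> space (leb d)" and b: "b \<in> space (act M)" and c: "\<bar>c\<bar> = 1" for t s b c
  proof -
    have h: "Suc t \<in> {1..horizon M}" "s \<in> space (base M)" using t s by (simp_all add: mdp_facts(1,2))
    note id = M.integrable_dens[OF h b, unfolded mdp_facts(1)]
    have Wb: "\<bar>W c (Suc t) y\<bar> \<le> G * (real H - real t)" if "y \<in> space (leb d)" for y
      using W_bound[of "Suc t" y c] t c that by simp
    have "\<bar>LINT y|leb d. dens M (Suc t) b y s * W c (Suc t) y\<bar> \<le> (LINT y|leb d. \<bar>dens M (Suc t) b y s * W c (Suc t) y\<bar>)"
      by (rule integral_abs_bound)
    also have "\<dots> \<le> (LINT y|leb d. dens M (Suc t) b y s * (G * (real H - real t)))"
    proof (rule integral_mono)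
      show "integrable (leb d) (\<lambda>y. \<bar>dens M (Suc t) b y s * W c (Suc t) y\<bar>)"
        using W_meas[of "Suc t" c] t Wb
        by (intro integrable_abs M.integrable_dens_mult[OF h b, unfolded mdp_facts(1), where C = "G * (real H - real t)"]) auto
      fix y assume y: "y \<in> space (leb d)"
      then show "\<bar>dens M (Suc t) b y s * W c (Suc t) y\<bar> \<le> dens M (Suc t) b y s * (G * (real H - real t))"
        using M.dens_nonneg[OF h b, of y] Wb[OF y] by (simp add: abs_mult mdp_facts(1) mult_left_mono)
    qed (use id in simp)
    also have "\<dots> = G * (real H - real t)" using id by simp
    finally show ?thesis .
  qed
  have refl_err: "\<bar>(reward M t s b + (LINT y|leb d. dens M (Suc t) b y s * W c (Suc t) y)) - bellman M D t (V (Suc t)) s b\<bar>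
      \<le> \<kappa> * pout t s b"
    if t: "t < H" and s: "s \<in> D" and b: "b \<in> space (act M)" and c: "\<bar>c\<bar> = 1" for t s b c
  proof -
    have eq: "(LINT y|restrict_space (leb d) D. dens (reflect D M) (Suc t) b y s * W c (Suc t) y) =
      (LINT y|restrict_space (leb d) D. dens (reflect D M) (Suc t) b y s * V (Suc t) y)"
      by (intro Bochner_Integration.integral_cong) (auto simp: restrict_leb(1)[OF D] W_D)
    have b': "\<bar>W c (Suc t) y\<bar> \<le> G * (real H - real t)" if "y \<in> space (leb d)" for y
      using W_bound[of "Suc t" y c] t c that by simp
    have "\<bar>(LINT y|leb d. dens M (Suc t) b y s * W c (Suc t) y) -
        (LINT y|restrict_space (leb d) D. dens (reflect D M) (Suc t) b y s * W c (Suc t) y)\<bar>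
      \<le> 2 * (G * (real H - real t)) * pout t s b"
      unfolding pout_def using t s b W_meas b' by (intro reflection_error) auto
    also have "\<dots> \<le> \<kappa> * pout t s b"
    proof (rule mult_right_mono)
      have "G * (real H - real t) \<le> G * real H" using G_nonneg by (intro mult_left_mono) auto
      then show "2 * (G * (real H - real t)) \<le> \<kappa>" by (simp add: \<kappa>_def)
      show "0 \<le> pout t s b" using pout_nonneg[OF t subsetD[OF Dsub s] b] .
    qed
    finally show ?thesis unfolding bellman_def mdp_facts(1) eq by simp
  qed
  have AE_leb: "AE s in leb d. s \<in> D \<longrightarrow> P s" if "AE s in restrict_space (leb d) D. P s" for P
  proof -
    have "D \<inter> space (leb d) \<in> sets (leb d)" using Dsets by auto
    from AE_restrict_space_iff[OF this, of P] show ?thesis using that by simp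
  qed
  have reward_meas: "(\<lambda>(s, a). reward M t s a) \<in> borel_measurable (base M \<Otimes>\<^sub>M act M)" if "t < horizon M" for t
    using mdp_facts(11)[of t] that by (simp add: mdp_facts(1,2))
  have reward_bound: "\<bar>reward M t s a\<bar> \<le> C" if "t < horizon M" "s \<in> space (base M)" "a \<in> space (act M)" for t s a
    using mdp_facts(12)[of t s a] that GC by (simp add: mdp_facts(1,2))
  have upper: "policy_value M x \<pi> \<le> V 0 x + \<kappa> * S" if \<pi>: "\<pi> \<in> policies M" for \<pi>
  proof -
    have "(LINT \<omega>|traj M x \<pi> (horizon M). (\<Sum>t<horizon M. reward M t (fst \<omega> t) (snd \<omega> t)) + W 1 (horizon M) (fst \<omega> (horizon M)))
      \<le> W 1 0 x + \<kappa> * (\<Sum>h=1..horizon M. outside_prob M x \<pi> h D) + real (horizon M) * 0"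
    proof (rule M.telescoped_value_bound[OF x' \<pi> DM reward_meas reward_bound])
      fix t assume t: "t < horizon M"
      have tH: "t < H" using t by (simp add: mdp_facts(2))
      define good where "good s \<longleftrightarrow> (s \<in> D \<longrightarrow> V t s = (SUP a\<in>space (act M). bellman M D t (V (Suc t)) s a))" for s
      have "AE s in base M. good s"
        using V_step[OF tH] unfolding bellman_step_def mdp_facts(1) good_def by (intro AE_leb) blast
      moreover have "good x" using V_step[OF tH] unfolding bellman_step_def good_def by blast
      ultimately have "AE \<omega> in traj M x \<pi> t. good (fst \<omega> t)"
        using t by (intro M.AE_traj_good[OF x' x'' \<pi>]) auto
      then show "AE \<omega> in traj M x \<pi> t. AE b in \<pi> t (fst \<omega> t).
        reward M t (fst \<omega> t) b + (LINT y|base M. dens M (Suc t) b y (fst \<omega> t) * W 1 (Suc t) y)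
        \<le> W 1 t (fst \<omega> t) + \<kappa> * (LINT y|base M. dens M (Suc t) b y (fst \<omega> t) * indicator (- D) y) + 0"
        using AE_space
      proof eventually_elim
        case (elim \<omega>)
        have s: "fst \<omega> t \<in> space (base M)"
          using measurable_space[OF M.measurable_hist_state[OF order_refl]] elim(2) M.space_traj[OF x' \<pi>, of t] t by auto
        then have s': "fst \<omega> t \<in> space (leb d)" by (simp add: mdp_facts(1))
        show ?case
        proof (rule AE_I2)
          fix b assume "b \<in> space (\<pi> t (fst \<omega> t))"
          then have b: "b \<in> space (act M)" using M.space_policy[OF \<pi> t s] by simp
          show "reward M t (fst \<omega> t) b + (LINT y|base M. dens M (Suc t) b y (fst \<omega> t) * W 1 (Suc t) y)
            \<le> W 1 t (fst \<omega> t) + \<kappa> * (LINT y|base M. dens M (Suc t) b y (fst \<omega> t) * indicator (- D) y) + 0"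
          proof (cases "fst \<omega> t \<in> D")
            case True
            have "bdd_above (bellman M D t (V (Suc t)) (fst \<omega> t) ` space (act M))"
            proof (rule bdd_aboveI2)
              fix a assume a: "a \<in> space (act M)"
              have "\<bar>bellman M D t (V (Suc t)) (fst \<omega> t) a\<bar> \<le> G + G * (real H + 1 - real (Suc t))"
                using tH V_meas V_bound[of "Suc t"] True a by (intro bellman_bound) simp_all
              then show "bellman M D t (V (Suc t)) (fst \<omega> t) a \<le> G + G * (real H + 1 - real (Suc t))" by linarith
            qed
            then have "bellman M D t (V (Suc t)) (fst \<omega> t) b \<le> V t (fst \<omega> t)"
              using elim(1) True b by (auto simp: good_def intro: cSUP_upper)
            then show ?thesis using refl_err[OF tH True b, of 1] True
              by (simp add: W_D pout_def mdp_facts(1))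
          next
            case False
            have "reward M t (fst \<omega> t) b \<le> G" using mdp_facts(12)[OF tH s' b] by (simp add: abs_le_iff)
            moreover have "(LINT y|leb d. dens M (Suc t) b y (fst \<omega> t) * W 1 (Suc t) y) \<le> G * (real H - real t)"
              using intW[OF tH s' b, of 1] by (simp add: abs_le_iff)
            moreover have "0 \<le> \<kappa> * pout t (fst \<omega> t) b" using \<kappa> pout_nonneg[OF tH s' b] by simp
            ultimately show ?thesis using False tH by (simp add: W_def pout_def mdp_facts(1) algebra_simps)
          qed
        qed
      qed
    qed (use W_meas W_C \<kappa> in \<open>auto simp: mdp_facts(1,2)\<close>)
    also have "\<dots> \<le> W 1 0 x + \<kappa> * S" using \<kappa> out_le[OF \<pi>] by (simp add: mult_left_mono)
    finally show ?thesis
      using x unfolding policy_value_def case_prod_beta' by (simp add: mdp_facts(2) W_D) (simp add: W_def)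
  qed
  have lower: "V 0 x \<le> opt_value M x + \<kappa> * S"
  proof (rule field_le_epsilon)
    fix e' :: real assume e': "0 < e'"
    define e where "e = e' / (real H + 1)"
    have e: "0 < e" using e' by (simp add: e_def)
    have "\<forall>t. \<exists>f. t < H \<longrightarrow> (f \<in> restrict_space (leb d) D \<rightarrow>\<^sub>M act M \<and>
        (AE s in restrict_space (leb d) D. V t s - e < bellman M D t (V (Suc t)) s (f s)) \<and>
        V t x - e < bellman M D t (V (Suc t)) x (f x))"
    proof
      fix t
      show "\<exists>f. t < H \<longrightarrow> (f \<in> restrict_space (leb d) D \<rightarrow>\<^sub>M act M \<and>
        (AE s in restrict_space (leb d) D. V t s - e < bellman M D t (V (Suc t)) s (f s)) \<and>
        V t x - e < bellman M D t (V (Suc t)) x (f x))"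
        using V_step[of t] e unfolding bellman_step_def mdp_facts(1) by blast
    qed
    from choice[OF this] obtain f where f: "\<forall>t. t < H \<longrightarrow> (f t \<in> restrict_space (leb d) D \<rightarrow>\<^sub>M act M \<and>
        (AE s in restrict_space (leb d) D. V t s - e < bellman M D t (V (Suc t)) s (f t s)) \<and>
        V t x - e < bellman M D t (V (Suc t)) x (f t x))" ..
    obtain a0 where a0: "a0 \<in> space (act M)" using mdp_facts(3) by auto
    define g where "g t s = (if s \<in> D then f t s else a0)" for t s
    have g_meas: "g t \<in> leb d \<rightarrow>\<^sub>M act M" if t: "t < H" for t
    proof -
      have eq: "{s \<in> space (leb d). s \<in> D} = D" using Dsub by auto
      show ?thesis
        unfolding g_def using Dsets f t a0
        by (subst measurable_If_restrict_space_iff)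
          (auto simp: eq restrict_space_def Int_absorb1 Int_absorb2 Collect_mem_eq)
    qed
    define \<pi> where "\<pi> t s = return (act M) (g t s)" for t s
    have \<pi>: "\<pi> \<in> policies M"
      unfolding policies_def \<pi>_def
      using g_meas by (auto simp: mdp_facts(1,2) intro: measurable_compose[OF _ measurable_return_prob_space])
    have "(LINT \<omega>|traj M x \<pi> (horizon M). (\<Sum>t<horizon M. - reward M t (fst \<omega> t) (snd \<omega> t)) + - W (-1) (horizon M) (fst \<omega> (horizon M)))
      \<le> - W (-1) 0 x + \<kappa> * (\<Sum>h=1..horizon M. outside_prob M x \<pi> h D) + real (horizon M) * e"
    proof (rule M.telescoped_value_bound[OF x' \<pi> DM, where C = C])
      show "(\<lambda>(s, a). - reward M t s a) \<in> borel_measurable (base M \<Otimes>\<^sub>M act M)" if "t < horizon M" for t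
        using reward_meas[OF that] by (simp add: split_beta)
      show "\<bar>- reward M t s a\<bar> \<le> C" if "t < horizon M" "s \<in> space (base M)" "a \<in> space (act M)" for t s a
        using reward_bound[OF that] by simp
      fix t assume t: "t < horizon M"
      have tH: "t < H" using t by (simp add: mdp_facts(2))
      define good where "good s \<longleftrightarrow> (s \<in> D \<longrightarrow> V t s - e < bellman M D t (V (Suc t)) s (f t s))" for s
      have "AE s in base M. good s"
        using f tH unfolding mdp_facts(1) good_def by (intro AE_leb) blast
      moreover have "good x" using f tH unfolding good_def by blast
      ultimately have "AE \<omega> in traj M x \<pi> t. good (fst \<omega> t)"
        using t by (intro M.AE_traj_good[OF x' x'' \<pi>]) auto
      then show "AE \<omega> in traj M x \<pi> t. AE b in \<pi> t (fst \<omega> t).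
        - reward M t (fst \<omega> t) b + (LINT y|base M. dens M (Suc t) b y (fst \<omega> t) * - W (-1) (Suc t) y)
        \<le> - W (-1) t (fst \<omega> t) + \<kappa> * (LINT y|base M. dens M (Suc t) b y (fst \<omega> t) * indicator (- D) y) + e"
        using AE_space
      proof eventually_elim
        case (elim \<omega>)
        have s: "fst \<omega> t \<in> space (base M)"
          using measurable_space[OF M.measurable_hist_state[OF order_refl]] elim(2) M.space_traj[OF x' \<pi>, of t] t by auto
        then have s': "fst \<omega> t \<in> space (leb d)" by (simp add: mdp_facts(1))
        define b where "b = g t (fst \<omega> t)"
        have b: "b \<in> space (act M)" unfolding b_def using measurable_space[OF g_meas[OF tH] s'] .
        have ineq: "- reward M t (fst \<omega> t) b + (LINT y|base M. dens M (Suc t) b y (fst \<omega> t) * - W (-1) (Suc t) y)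
          \<le> - W (-1) t (fst \<omega> t) + \<kappa> * (LINT y|base M. dens M (Suc t) b y (fst \<omega> t) * indicator (- D) y) + e"
        proof (cases "fst \<omega> t \<in> D")
          case True
          then have "V t (fst \<omega> t) - e < bellman M D t (V (Suc t)) (fst \<omega> t) b"
            using elim(1) by (simp add: good_def b_def g_def)
          then show ?thesis using refl_err[OF tH True b, of "-1"] True
            by (simp add: W_D pout_def mdp_facts(1))
        next
          case False
          have "- reward M t (fst \<omega> t) b \<le> G" using mdp_facts(12)[OF tH s' b] by (simp add: abs_le_iff)
          moreover have "- (LINT y|leb d. dens M (Suc t) b y (fst \<omega> t) * W (-1) (Suc t) y) \<le> G * (real H - real t)"
            using intW[OF tH s' b, of "-1"] by (simp add: abs_le_iff)
          moreover have "0 \<le> \<kappa> * pout t (fst \<omega> t) b" using \<kappa> pout_nonneg[OF tH s' b] by simp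
          ultimately show ?thesis using False tH e by (simp add: W_def pout_def mdp_facts(1) algebra_simps)
        qed
        have "{b} \<in> sets (act M)"
        proof -
          have "b \<in> space (leb d)" using b seq_closed_subset[OF seq_closed_actions] by (rule subsetD[rotated])
          then have "{b} \<in> sets (leb d)" by (rule singleton_sets_leb)
          moreover have "{b} = space (act M) \<inter> {b}" using b by simp
          ultimately show ?thesis unfolding mdp_facts(5) sets_restrict_space by (rule image_eqI[rotated])
        qed
        moreover have "{b' \<in> space (act M). b' = b} = {b}" using b by auto
        ultimately have "AE b' in return (act M) b. b' = b"
          using b by (subst AE_return) (simp_all add: pred_def)
        then show ?case unfolding \<pi>_def b_def[symmetric] by eventually_elim (use ineq in simp)
      qed
    qed (use W_meas W_C \<kappa> e in \<open>auto simp: mdp_facts(1,2)\<close>)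
    also have "\<dots> \<le> - W (-1) 0 x + \<kappa> * S + real H * e"
      using \<kappa> out_le[OF \<pi>] by (simp add: mult_left_mono mdp_facts(2))
    finally have "(LINT \<omega>|traj M x \<pi> (horizon M). (\<Sum>t<horizon M. - reward M t (fst \<omega> t) (snd \<omega> t)) + - W (-1) (horizon M) (fst \<omega> (horizon M)))
        \<le> - W (-1) 0 x + \<kappa> * S + real H * e" .
    moreover have "(LINT \<omega>|traj M x \<pi> (horizon M). (\<Sum>t<horizon M. - reward M t (fst \<omega> t) (snd \<omega> t)) + - W (-1) (horizon M) (fst \<omega> (horizon M)))
        = - policy_value M x \<pi>"
      unfolding policy_value_def Bochner_Integration.integral_minus[symmetric]
      by (intro Bochner_Integration.integral_cong) (auto simp: mdp_facts(2) W_def sum_negf)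
    moreover have "real H * e \<le> e'" using e' by (simp add: e_def field_simps)
    ultimately have "- policy_value M x \<pi> \<le> - V 0 x + \<kappa> * S + e'" using x by (simp add: W_D)
    moreover have "policy_value M x \<pi> \<le> opt_value M x"
      unfolding opt_value_def using \<pi> upper by (intro cSUP_upper bdd_aboveI2[of _ _ "V 0 x + \<kappa> * S"]) auto
    ultimately show "V 0 x \<le> opt_value M x + \<kappa> * S + e'" by linarith
  qed
  have "policies M \<noteq> {}"
    using M.const_policy[of "\<lambda>_. SOME a. a \<in> space (act M)"] some_in_eq mdp_facts(3) by auto
  then have "opt_value M x \<le> V 0 x + \<kappa> * S"
    unfolding opt_value_def using upper by (intro cSUP_least) auto
  then show ?thesis using lower unfolding \<kappa>_def S_def by (simp add: abs_le_iff)
qed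

end

section \<open>Maximal inequalities\<close>

lemma exp_abs_le: "exp (l * \<bar>z\<bar>) \<le> exp (l * z) + exp (- l * z :: real)"
  by (cases "0 \<le> z") auto

text \<open>The classical argument with Jensen's inequality for the logarithm, written with the
  tangent of \<open>ln\<close> at \<open>K\<close> instead. Only expectations of exponentials
  appear, and they are taken in \<open>ennreal\<close>.\<close>

lemma Max_subgaussian_expectation:
  fixes Z :: "'i \<Rightarrow> 'w \<Rightarrow> real"
  assumes P: "prob_space P" and I: "finite I" "I \<noteq> {}" and Z[measurable]: "\<And>i. i \<in> I \<Longrightarrow> Z i \<in> borel_measurable P"
    and s: "0 < s"
    and mgf: "\<And>i l. i \<in> I \<Longrightarrow> 0 < l \<Longrightarrow>
      (\<integral>\<^sup>+\<omega>. ennreal (exp (l * \<bar>Z i \<omega>\<bar>)) \<partial>P) \<le> ennreal (2 * exp (l\<^sup>2 * s\<^sup>2 / 2))"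
  shows "(\<integral>\<^sup>+\<omega>. ennreal (Max ((\<lambda>i. \<bar>Z i \<omega>\<bar>) ` I)) \<partial>P) \<le> ennreal (s * sqrt (2 * ln (2 * card I)))"
proof -
  interpret prob_space P by (rule P)
  define n where "n = 2 * real (card I)"
  have n: "2 \<le> n" using I by (simp add: n_def Suc_le_eq card_gt_0_iff)
  define x where "x = sqrt (2 * ln n)"
  have x: "0 < x" "x\<^sup>2 = 2 * ln n" using n by (simp_all add: x_def)
  define l where "l = x / s"
  have l: "0 < l" "l\<^sup>2 * s\<^sup>2 / 2 = ln n" "l * s = x" using x s by (simp_all add: l_def power_divide)
  \<comment> \<open>\<open>l\<close> is chosen so that
    \<open>exp (l\<^sup>2 * s\<^sup>2 / 2) = n\<close>. The sum of the exponentials then has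
    expectation at most \<open>n * n\<close>, and taking the tangent at exactly this value loses
    nothing.\<close>
  define K where "K = n * n"
  have K: "1 < K" "0 < K" using n by (simp_all add: K_def less_1_mult)
  have lnK: "ln K = 2 * ln n" using n by (simp add: K_def ln_mult)
  have lnK1: "1 \<le> ln K"
  proof -
    have "exp 1 \<le> (3 :: real)" using exp_le by simp
    also have "3 \<le> 2 * (2 :: real)" by simp
    also have "\<dots> \<le> K" unfolding K_def using n by (intro mult_mono) auto
    finally show ?thesis using K by (simp add: ln_ge_iff)
  qed
  have pt: "l * Max ((\<lambda>i. \<bar>Z i \<omega>\<bar>) ` I) \<le> (ln K - 1) + (\<Sum>i\<in>I. exp (l * \<bar>Z i \<omega>\<bar>)) / K" for \<omega>
  proof -
    obtain i where i: "i \<in> I" "Max ((\<lambda>i. \<bar>Z i \<omega>\<bar>) ` I) = \<bar>Z i \<omega>\<bar>"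
    proof -
      have "Max ((\<lambda>i. \<bar>Z i \<omega>\<bar>) ` I) \<in> (\<lambda>i. \<bar>Z i \<omega>\<bar>) ` I" using I by (intro Max_in) auto
      then show ?thesis by (elim imageE) (rule that)
    qed
    have "ln (exp (l * \<bar>Z i \<omega>\<bar>) / K) \<le> exp (l * \<bar>Z i \<omega>\<bar>) / K - 1" using K by (intro ln_le_minus_one) simp
    then have "l * \<bar>Z i \<omega>\<bar> \<le> (ln K - 1) + exp (l * \<bar>Z i \<omega>\<bar>) / K"
      using K by (simp add: ln_div)
    moreover have "exp (l * \<bar>Z i \<omega>\<bar>) \<le> (\<Sum>i\<in>I. exp (l * \<bar>Z i \<omega>\<bar>))"
      using I i by (intro member_le_sum) auto
    then have "exp (l * \<bar>Z i \<omega>\<bar>) / K \<le> (\<Sum>i\<in>I. exp (l * \<bar>Z i \<omega>\<bar>)) / K"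
      using K by (intro divide_right_mono) auto
    ultimately show ?thesis unfolding i(2) by linarith
  qed
  have Max_nonneg: "0 \<le> Max ((\<lambda>i. \<bar>Z i \<omega>\<bar>) ` I)" for \<omega>
  proof -
    obtain i where i: "i \<in> I" using I by auto
    have "\<bar>Z i \<omega>\<bar> \<le> Max ((\<lambda>i. \<bar>Z i \<omega>\<bar>) ` I)" using I i by (intro Max_ge) auto
    then show ?thesis by (rule order_trans[OF abs_ge_zero])
  qed
  have Max_meas: "(\<lambda>\<omega>. Max ((\<lambda>i. \<bar>Z i \<omega>\<bar>) ` I)) \<in> borel_measurable P"
    using borel_measurable_Max[OF I(1), of "\<lambda>i \<omega>. \<bar>Z i \<omega>\<bar>" P] Z by simp
  have "ennreal l * (\<integral>\<^sup>+\<omega>. ennreal (Max ((\<lambda>i. \<bar>Z i \<omega>\<bar>) ` I)) \<partial>P) =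
     (\<integral>\<^sup>+\<omega>. ennreal (l * Max ((\<lambda>i. \<bar>Z i \<omega>\<bar>) ` I)) \<partial>P)"
    using l Max_nonneg Max_meas by (simp add: nn_integral_cmult ennreal_mult)
  also have "\<dots> \<le> (\<integral>\<^sup>+\<omega>. ennreal (ln K - 1) + ennreal (1 / K) * (\<Sum>i\<in>I. ennreal (exp (l * \<bar>Z i \<omega>\<bar>))) \<partial>P)"
  proof (rule nn_integral_mono)
    fix \<omega>
    have "ennreal (l * Max ((\<lambda>i. \<bar>Z i \<omega>\<bar>) ` I)) \<le> ennreal ((ln K - 1) + (1 / K) * (\<Sum>i\<in>I. exp (l * \<bar>Z i \<omega>\<bar>)))"
      using pt[of \<omega>] by (intro ennreal_leI) simp
    also have "\<dots> = ennreal (ln K - 1) + ennreal (1 / K) * (\<Sum>i\<in>I. ennreal (exp (l * \<bar>Z i \<omega>\<bar>)))"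
      using lnK1 K sum_nonneg[of I "\<lambda>i. exp (l * \<bar>Z i \<omega>\<bar>)"]
      by (subst ennreal_plus) (auto simp: ennreal_mult[symmetric] sum_ennreal sum_nonneg)
    finally show "ennreal (l * Max ((\<lambda>i. \<bar>Z i \<omega>\<bar>) ` I)) \<le> \<dots>" .
  qed
  also have "\<dots> = ennreal (ln K - 1) + ennreal (1 / K) * (\<Sum>i\<in>I. \<integral>\<^sup>+\<omega>. ennreal (exp (l * \<bar>Z i \<omega>\<bar>)) \<partial>P)"
    using Z by (simp add: nn_integral_add nn_integral_cmult nn_integral_sum emeasure_space_1 del: sum_ennreal)
  also have "\<dots> \<le> ennreal (ln K - 1) + ennreal (1 / K) * (\<Sum>i\<in>I. ennreal (2 * exp (l\<^sup>2 * s\<^sup>2 / 2)))"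
    using mgf l(1) by (intro add_mono mult_left_mono sum_mono) auto
  also have "(\<Sum>i\<in>I. ennreal (2 * exp (l\<^sup>2 * s\<^sup>2 / 2))) = ennreal K"
    unfolding l(2) using n by (simp add: n_def K_def ennreal_of_nat_eq_real_of_nat ennreal_mult[symmetric] algebra_simps)
  also have "ennreal (ln K - 1) + ennreal (1 / K) * ennreal K = ennreal (2 * ln n)"
  proof -
    have "ennreal (1 / K) * ennreal K = ennreal 1" using K by (simp add: ennreal_mult[symmetric])
    moreover have "ennreal (ln K - 1) + ennreal 1 = ennreal ((ln K - 1) + 1)"
      using lnK1 by (intro ennreal_plus[symmetric]) auto
    ultimately show ?thesis by (simp only: lnK diff_add_cancel)
  qed
  also have "2 * ln n = l * (s * x)" using l(3) x(2) by (simp add: power2_eq_square mult.assoc[symmetric])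
  also have "ennreal (l * (s * x)) = ennreal l * ennreal (s * x)" using l s x by (simp add: ennreal_mult)
  finally have "ennreal l * (\<integral>\<^sup>+\<omega>. ennreal (Max ((\<lambda>i. \<bar>Z i \<omega>\<bar>) ` I)) \<partial>P) \<le> ennreal l * ennreal (s * x)" .
  then have "(\<integral>\<^sup>+\<omega>. ennreal (Max ((\<lambda>i. \<bar>Z i \<omega>\<bar>) ` I)) \<partial>P) \<le> ennreal (s * x)"
    using l(1) by (simp add: ennreal_mult_le_mult_iff)
  then show ?thesis by (simp add: x_def n_def)
qed

lemma mgf_iid_sum:
  assumes T: "prob_space T" and J: "finite J" and g: "g \<in> borel_measurable T" "AE w in T. \<bar>g w\<bar> \<le> c"
    and mean: "integral\<^sup>L T g = 0" and l: "0 < l"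
  shows "(\<integral>\<^sup>+\<omega>. ennreal (exp (l * (\<Sum>n\<in>J. g (\<omega> n)))) \<partial>PiM J (\<lambda>_. T)) \<le> ennreal (exp (l\<^sup>2 * (real (card J) * c\<^sup>2) / 2))"
proof -
  interpret T: prob_space T by (rule T)
  interpret product_sigma_finite "\<lambda>_. T" ..
  interpret interval_bounded_random_variable T g "- c" c
  proof
    show "g \<in> borel_measurable T" by (rule g)
    show "AE x in T. g x \<in> {- c..c}" using g(2) by eventually_elim (auto simp: abs_le_iff)
  qed
  \<comment> \<open>The interval has width \<open>2 * c\<close>, so the exponent of Hoeffding's
    lemma, squared width over 8, becomes \<open>c\<^sup>2 / 2\<close>.\<close>
  have one: "(\<integral>\<^sup>+w. ennreal (exp (l * g w)) \<partial>T) \<le> ennreal (exp (l\<^sup>2 * c\<^sup>2 / 2))"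
    using Hoeffdings_lemma_nn_integral_0[OF l mean] by (simp add: power2_eq_square algebra_simps)
  have "(\<integral>\<^sup>+\<omega>. ennreal (exp (l * (\<Sum>n\<in>J. g (\<omega> n)))) \<partial>PiM J (\<lambda>_. T)) = (\<integral>\<^sup>+\<omega>. (\<Prod>n\<in>J. ennreal (exp (l * g (\<omega> n)))) \<partial>PiM J (\<lambda>_. T))"
    using J by (simp add: sum_distrib_left exp_sum prod_ennreal)
  also have "\<dots> = (\<Prod>n\<in>J. \<integral>\<^sup>+w. ennreal (exp (l * g w)) \<partial>T)"
    using J g(1) by (intro product_nn_integral_prod) auto
  also have "\<dots> \<le> (\<Prod>n\<in>J. ennreal (exp (l\<^sup>2 * c\<^sup>2 / 2)))"
  proof -
    obtain v where v: "0 \<le> v" "(\<integral>\<^sup>+w. ennreal (exp (l * g w)) \<partial>T) = ennreal v"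
      using one by (cases "\<integral>\<^sup>+w. ennreal (exp (l * g w)) \<partial>T") (auto simp: top_unique)
    then have "v \<le> exp (l\<^sup>2 * c\<^sup>2 / 2)" using one by simp
    then show ?thesis unfolding v(2) using v(1)
      by (simp add: ennreal_power power_mono)
  qed
  also have "\<dots> = ennreal (exp (l\<^sup>2 * (real (card J) * c\<^sup>2) / 2))"
    by (simp add: ennreal_power exp_of_nat_mult[symmetric] algebra_simps)
  finally show ?thesis .
qed

text \<open>Fubini with coordinate \<open>r\<close> integrated last: once \<open>\<omega> r\<close>
  is frozen, the other summands are independent, centred and bounded. The factor 2 accounts for the
  two signs of the absolute value.\<close>

lemma mgf_leave_one_out:
  assumes T: "prob_space T" and J: "finite J" "r \<in> J"
    and g[measurable]: "(\<lambda>(z, w). g z w) \<in> borel_measurable (T \<Otimes>\<^sub>M T)"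
    and c: "\<And>z. z \<in> space T \<Longrightarrow> AE w in T. \<bar>g z w\<bar> \<le> c"
    and mean: "\<And>z. z \<in> space T \<Longrightarrow> integral\<^sup>L T (g z) = 0" and l: "0 < l"
  shows "(\<integral>\<^sup>+\<omega>. ennreal (exp (l * \<bar>\<Sum>n\<in>J - {r}. g (\<omega> r) (\<omega> n)\<bar>)) \<partial>PiM J (\<lambda>_. T))
    \<le> ennreal (2 * exp (l\<^sup>2 * (real (card J) * c\<^sup>2) / 2))"
proof -
  interpret T: prob_space T by (rule T)
  interpret product_sigma_finite "\<lambda>_. T" ..
  define J' where "J' = J - {r}"
  have J': "finite J'" "r \<notin> J'" "insert r J' = J" using J by (auto simp: J'_def)
  define f where "f \<omega> = ennreal (exp (l * \<bar>\<Sum>n\<in>J'. g (\<omega> r) (\<omega> n)\<bar>))" for \<omega>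
  have g_comp: "(\<lambda>\<omega>. g (\<omega> r) (\<omega> n)) \<in> borel_measurable (PiM J (\<lambda>_. T))" if "n \<in> J'" for n
  proof -
    have "(\<lambda>\<omega>. (\<omega> r, \<omega> n)) \<in> PiM J (\<lambda>_. T) \<rightarrow>\<^sub>M T \<Otimes>\<^sub>M T"
      using J that by (intro measurable_Pair measurable_component_singleton) (auto simp: J'_def)
    from measurable_compose[OF this g] show ?thesis by simp
  qed
  have f: "f \<in> borel_measurable (PiM (insert r J') (\<lambda>_. T))"
    unfolding f_def J'(3) using g_comp by measurable
  have "(\<integral>\<^sup>+\<omega>. f \<omega> \<partial>PiM (insert r J') (\<lambda>_. T)) = (\<integral>\<^sup>+z. \<integral>\<^sup>+\<omega>. f (fun_upd \<omega> r z) \<partial>PiM J' (\<lambda>_. T) \<partial>T)"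
    by (rule product_nn_integral_insert_rev[OF J'(1,2) f])
  also have "\<dots> \<le> (\<integral>\<^sup>+z. ennreal (2 * exp (l\<^sup>2 * (real (card J) * c\<^sup>2) / 2)) \<partial>T)"
  proof (rule nn_integral_mono)
    fix z assume z: "z \<in> space T"
    have gz: "g z \<in> borel_measurable T" using measurable_Pair2[OF g z] by simp
    have upd: "f (fun_upd \<omega> r z) = ennreal (exp (l * \<bar>\<Sum>n\<in>J'. g z (\<omega> n)\<bar>))" for \<omega>
    proof -
      have "(\<Sum>n\<in>J'. g z ((fun_upd \<omega> r z) n)) = (\<Sum>n\<in>J'. g z (\<omega> n))"
        using J'(2) by (intro sum.cong) auto
      then show ?thesis by (simp add: f_def)
    qed
    have meas: "(\<lambda>\<omega>. \<Sum>n\<in>J'. h (\<omega> n)) \<in> borel_measurable (PiM J' (\<lambda>_. T))" if "h \<in> borel_measurable T" for h :: "_ \<Rightarrow> real"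
      using that by (intro borel_measurable_sum measurable_compose[OF measurable_component_singleton]) auto
    have "(\<integral>\<^sup>+\<omega>. f (fun_upd \<omega> r z) \<partial>PiM J' (\<lambda>_. T)) \<le>
      (\<integral>\<^sup>+\<omega>. ennreal (exp (l * (\<Sum>n\<in>J'. g z (\<omega> n)))) + ennreal (exp (l * (\<Sum>n\<in>J'. - g z (\<omega> n)))) \<partial>PiM J' (\<lambda>_. T))"
      unfolding upd
      by (intro nn_integral_mono) (use exp_abs_le in \<open>simp add: sum_negf ennreal_plus[symmetric] del: ennreal_plus\<close>)
    also have "\<dots> = (\<integral>\<^sup>+\<omega>. ennreal (exp (l * (\<Sum>n\<in>J'. g z (\<omega> n)))) \<partial>PiM J' (\<lambda>_. T)) +
      (\<integral>\<^sup>+\<omega>. ennreal (exp (l * (\<Sum>n\<in>J'. - g z (\<omega> n)))) \<partial>PiM J' (\<lambda>_. T))"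
      using meas[OF gz] meas[of "\<lambda>w. - g z w"] gz by (intro nn_integral_add) auto
    also have "\<dots> \<le> ennreal (exp (l\<^sup>2 * (real (card J') * c\<^sup>2) / 2)) + ennreal (exp (l\<^sup>2 * (real (card J') * c\<^sup>2) / 2))"
      using gz c[OF z] mean[OF z] by (intro add_mono mgf_iid_sum[OF T J'(1) _ _ _ l]) auto
    also have "\<dots> = ennreal (2 * exp (l\<^sup>2 * (real (card J') * c\<^sup>2) / 2))"
      by (simp add: ennreal_plus[symmetric] del: ennreal_plus)
    also have "\<dots> \<le> ennreal (2 * exp (l\<^sup>2 * (real (card J) * c\<^sup>2) / 2))"
      using J by (intro ennreal_leI) (auto simp: J'_def intro!: mult_right_mono mult_left_mono)
    finally show "(\<integral>\<^sup>+\<omega>. f (fun_upd \<omega> r z) \<partial>PiM J' (\<lambda>_. T)) \<le> \<dots>" .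
  qed
  also have "\<dots> = ennreal (2 * exp (l\<^sup>2 * (real (card J) * c\<^sup>2) / 2))" by (simp add: T.emeasure_space_1)
  finally show ?thesis unfolding f_def J'(3) by (simp add: J'_def)
qed

text \<open>
  The summands may depend on the sample \<open>\<omega> (r i)\<close> that is left out, because they are centred
  conditionally on it.
\<close>

lemma Max_leave_one_out_sums:
  fixes N :: nat
  assumes T: "prob_space T" and N: "1 \<le> N" and I: "finite I" "I \<noteq> {}" and r: "\<And>i. i \<in> I \<Longrightarrow> r i \<in> {1..N}"
    and g: "\<And>i. i \<in> I \<Longrightarrow> (\<lambda>(z, w). g i z w) \<in> borel_measurable (T \<Otimes>\<^sub>M T)"
    and c: "\<And>i z. i \<in> I \<Longrightarrow> z \<in> space T \<Longrightarrow> AE w in T. \<bar>g i z w\<bar> \<le> c" "0 < c"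
    and mean: "\<And>i z. i \<in> I \<Longrightarrow> z \<in> space T \<Longrightarrow> integral\<^sup>L T (g i z) = 0"
  defines "\<Phi> \<equiv> \<lambda>\<omega>. Max ((\<lambda>i. \<bar>\<Sum>n\<in>{1..N} - {r i}. g i (\<omega> (r i)) (\<omega> n)\<bar>) ` I)"
  shows "(\<integral>\<^sup>+\<omega>. ennreal (\<Phi> \<omega>) \<partial>PiM {1..N} (\<lambda>_. T)) \<le> ennreal (c * sqrt N * sqrt (2 * ln (2 * card I)))"
    and "\<Phi> \<in> borel_measurable (PiM {1..N} (\<lambda>_. T))" and "0 \<le> \<Phi> \<omega>"
proof -
  interpret T: prob_space T by (rule T)
  interpret product_prob_space "\<lambda>_. T" "{1..N}" ..
  have meas: "(\<lambda>\<omega>. \<Sum>n\<in>{1..N} - {r i}. g i (\<omega> (r i)) (\<omega> n)) \<in> borel_measurable (PiM {1..N} (\<lambda>_. T))" if i: "i \<in> I" for i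
  proof (rule borel_measurable_sum)
    fix n assume n: "n \<in> {1..N} - {r i}"
    have "(\<lambda>\<omega>. (\<omega> (r i), \<omega> n)) \<in> PiM {1..N} (\<lambda>_. T) \<rightarrow>\<^sub>M T \<Otimes>\<^sub>M T"
      using r[OF i] n by (intro measurable_Pair measurable_component_singleton) auto
    from measurable_compose[OF this g[OF i]]
    show "(\<lambda>\<omega>. g i (\<omega> (r i)) (\<omega> n)) \<in> borel_measurable (PiM {1..N} (\<lambda>_. T))" by simp
  qed
  show "(\<integral>\<^sup>+\<omega>. ennreal (\<Phi> \<omega>) \<partial>PiM {1..N} (\<lambda>_. T)) \<le> ennreal (c * sqrt N * sqrt (2 * ln (2 * card I)))"
    unfolding \<Phi>_def
  proof (rule Max_subgaussian_expectation[OF prob_space_axioms I meas])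
    show "0 < c * sqrt N" using c N by simp
    fix i l :: _ assume i: "i \<in> I" and l: "0 < (l :: real)"
    have "(\<integral>\<^sup>+\<omega>. ennreal (exp (l * \<bar>\<Sum>n\<in>{1..N} - {r i}. g i (\<omega> (r i)) (\<omega> n)\<bar>)) \<partial>PiM {1..N} (\<lambda>_. T))
      \<le> ennreal (2 * exp (l\<^sup>2 * (real (card {1..N}) * c\<^sup>2) / 2))"
      by (rule mgf_leave_one_out[OF T _ r[OF i] g[OF i] c(1)[OF i] mean[OF i] l]) simp_all
    then show "(\<integral>\<^sup>+\<omega>. ennreal (exp (l * \<bar>\<Sum>n\<in>{1..N} - {r i}. g i (\<omega> (r i)) (\<omega> n)\<bar>)) \<partial>PiM {1..N} (\<lambda>_. T))
      \<le> ennreal (2 * exp (l\<^sup>2 * (c * sqrt N)\<^sup>2 / 2))"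
      by (simp add: power_mult_distrib mult.commute)
  qed
  show "\<Phi> \<in> borel_measurable (PiM {1..N} (\<lambda>_. T))"
    unfolding \<Phi>_def using I meas by (intro borel_measurable_Max) auto
  obtain i where i: "i \<in> I" using I by auto
  have "\<bar>\<Sum>n\<in>{1..N} - {r i}. g i (\<omega> (r i)) (\<omega> n)\<bar> \<le> \<Phi> \<omega>"
    unfolding \<Phi>_def using I i by (intro Max_ge) auto
  then show "0 \<le> \<Phi> \<omega>" by (rule order_trans[OF abs_ge_zero])
qed

section \<open>Self-normalised importance sampling\<close>

text \<open>A deterministic estimate: \<open>q / m\<close> are the ideal weights,
  \<open>q / m'\<close> those with an estimated denominator. If the ideal weights sum to at least
  \<open>N / 2\<close> and \<Delta> is at most \<delta>, the normalising sum is at least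
  \<open>N / 4\<close>, whence the factors 4. Otherwise one of the error terms already exceeds
  \<open>2 * B\<close>, the trivial bound for a convex combination.\<close>

lemma self_normalised_weights_error:
  fixes v g m m' :: "nat \<Rightarrow> real"
  assumes N: "1 \<le> N" and v: "\<And>n. n \<in> {1..N} \<Longrightarrow> \<bar>v n\<bar> \<le> B" and i: "\<bar>i\<bar> \<le> B"
    and q: "\<And>n. n \<in> {1..N} \<Longrightarrow> 0 < q n" and m: "\<And>n. n \<in> {1..N} \<Longrightarrow> \<delta> \<le> m n"
    and m': "\<And>n. n \<in> {1..N} \<Longrightarrow> 0 < m' n" and \<delta>: "0 < \<delta>"
    and \<Delta>: "\<And>n. n \<in> {1..N} \<Longrightarrow> \<bar>m' n - m n\<bar> \<le> \<Delta>"
  shows "\<bar>(\<Sum>n=1..N. v n * (q n / m' n / (\<Sum>k=1..N. q k / m' k))) - i\<bar> \<le>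
    4 * \<bar>(\<Sum>n=1..N. v n * q n / m n - i) / N\<bar> + 4 * B * \<bar>(\<Sum>n=1..N. q n / m n - 1) / N\<bar> + 2 * B * \<Delta> / \<delta>"
    (is "\<bar>?S - i\<bar> \<le> 4 * \<bar>?Z1\<bar> + 4 * B * \<bar>?Z2\<bar> + _")
proof -
  define g where "g n = q n / m n" for n
  define g' where "g' n = q n / m' n" for n
  define S where "S = (\<Sum>k=1..N. g' k)"
  define z1 where "z1 = ?Z1"
  define z2 where "z2 = ?Z2"
  define e where "e = 2 * B * \<Delta> / \<delta>"
  define num where "num = (\<Sum>n=1..N. (v n - i) * g' n)"
  have B: "0 \<le> B" using i by simp
  have Np: "0 < real N" using N by simp
  have mpos: "0 < m n" if "n \<in> {1..N}" for n using m[OF that] \<delta> by linarith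
  have g': "0 < g' n" if "n \<in> {1..N}" for n using q[OF that] m'[OF that] by (simp add: g'_def)
  have S: "0 < S" unfolding S_def using N g' by (intro sum_pos) auto
  have \<Delta>0: "0 \<le> \<Delta>"
  proof -
    have "\<bar>m' 1 - m 1\<bar> \<le> \<Delta>" using N by (intro \<Delta>) simp
    then show ?thesis by (rule order_trans[OF abs_ge_zero])
  qed
  have eq: "?S - i = num / S"
  proof -
    have "num = (\<Sum>n=1..N. v n * g' n) - i * S"
      by (simp add: num_def S_def sum_subtractf left_diff_distrib sum_distrib_left)
    then have "num / S = (\<Sum>n=1..N. v n * (g' n / S)) - i"
      using S by (simp add: diff_divide_distrib sum_divide_distrib)
    then show ?thesis by (simp add: g'_def S_def)
  qed
  have abs_eq: "\<bar>?S - i\<bar> = \<bar>num\<bar> / S"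
    unfolding eq by (rule abs_div_pos[OF S, symmetric])
  have vi: "\<bar>v n - i\<bar> \<le> 2 * B" if "n \<in> {1..N}" for n using v[OF that] i by linarith
  have trivial: "\<bar>?S - i\<bar> \<le> 2 * B"
  proof -
    have "\<bar>num\<bar> \<le> (\<Sum>n=1..N. \<bar>(v n - i) * g' n\<bar>)" unfolding num_def by (rule sum_abs)
    also have "\<dots> \<le> (\<Sum>n=1..N. 2 * B * g' n)"
    proof (rule sum_mono)
      fix n assume n: "n \<in> {1..N}"
      show "\<bar>(v n - i) * g' n\<bar> \<le> 2 * B * g' n"
        unfolding abs_mult using vi[OF n] g'[OF n] by (simp add: mult_right_mono)
    qed
    also have "\<dots> = 2 * B * S" by (simp add: S_def sum_distrib_left)
    finally show ?thesis unfolding abs_eq pos_divide_le_eq[OF S] .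
  qed
  have nonneg: "0 \<le> 4 * \<bar>z1\<bar>" "0 \<le> 4 * B * \<bar>z2\<bar>" "0 \<le> e"
    using B \<Delta>0 \<delta> by (simp_all add: e_def)
  have "\<bar>?S - i\<bar> \<le> 4 * \<bar>z1\<bar> + 4 * B * \<bar>z2\<bar> + e"
  proof (cases "\<bar>z2\<bar> \<le> 1 / 2 \<and> \<Delta> \<le> \<delta>")
    case False
    then consider "1 / 2 \<le> \<bar>z2\<bar>" | "\<delta> \<le> \<Delta>" by linarith
    then have "2 * B \<le> 4 * B * \<bar>z2\<bar> \<or> 2 * B \<le> e"
    proof cases
      case 1
      then have "4 * B * (1 / 2) \<le> 4 * B * \<bar>z2\<bar>" using B by (intro mult_left_mono) auto
      then show ?thesis by simp
    next
      case 2
      then have "2 * B * 1 \<le> 2 * B * (\<Delta> / \<delta>)" using B \<delta> by (intro mult_left_mono) auto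
      then show ?thesis by (simp add: e_def)
    qed
    then show ?thesis using trivial nonneg by linarith
  next
    case True
    have "(\<Sum>n=1..N. g n) = (\<Sum>n=1..N. q n / m n - 1) + N"
      by (simp add: g_def sum_subtractf)
    then have sum_g: "(\<Sum>n=1..N. g n) = N * (1 + z2)"
      using Np by (simp add: z2_def distrib_left)
    have "1 / 2 \<le> 1 + z2" using conjunct1[OF True] by linarith
    then have "N * (1 / 2) \<le> N * (1 + z2)" by (intro mult_left_mono) auto
    then have half: "real N / 2 \<le> (\<Sum>n=1..N. g n)" unfolding sum_g by simp
    have "g n / 2 \<le> g' n" if n: "n \<in> {1..N}" for n
    proof -
      have "\<bar>m' n - m n\<bar> \<le> \<Delta>" "\<Delta> \<le> \<delta>" "\<delta> \<le> m n" using \<Delta>[OF n] True m[OF n] by auto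
      then have "m' n \<le> 2 * m n" by linarith
      then have "q n / (2 * m n) \<le> q n / m' n"
        using q[OF n] m'[OF n] mpos[OF n] by (intro divide_left_mono) simp_all
      then show ?thesis by (simp add: g_def g'_def)
    qed
    then have "(\<Sum>n=1..N. g n / 2) \<le> S" unfolding S_def by (rule sum_mono)
    then have S4: "real N / 4 \<le> S" using half by (simp add: sum_divide_distrib[symmetric])
    have diff: "\<bar>\<Sum>n=1..N. (v n - i) * (g' n - g n)\<bar> \<le> e * S"
    proof -
      have one: "\<bar>(v n - i) * (g' n - g n)\<bar> \<le> e * g' n" if n: "n \<in> {1..N}" for n
      proof -
        have "g' n - g n = g' n * ((m n - m' n) / m n)"
          using m'[OF n] mpos[OF n] by (simp add: g_def g'_def field_simps)
        then have "\<bar>g' n - g n\<bar> = g' n * (\<bar>m n - m' n\<bar> / m n)"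
          using g'[OF n] mpos[OF n] by (simp add: abs_mult)
        also have "\<dots> \<le> g' n * (\<Delta> / \<delta>)"
        proof (rule mult_left_mono)
          have "\<bar>m n - m' n\<bar> \<le> \<Delta>" using \<Delta>[OF n] by (simp add: abs_minus_commute)
          then show "\<bar>m n - m' n\<bar> / m n \<le> \<Delta> / \<delta>" by (rule frac_le[OF \<Delta>0 _ \<delta> m[OF n]])
        qed (use g'[OF n] in simp)
        finally have "\<bar>v n - i\<bar> * \<bar>g' n - g n\<bar> \<le> (2 * B) * (g' n * (\<Delta> / \<delta>))"
          using B by (intro mult_mono vi[OF n]) simp_all
        then show ?thesis unfolding abs_mult by (simp add: e_def ac_simps)
      qed
      have "\<bar>\<Sum>n=1..N. (v n - i) * (g' n - g n)\<bar> \<le> (\<Sum>n=1..N. \<bar>(v n - i) * (g' n - g n)\<bar>)" by (rule sum_abs)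
      also have "\<dots> \<le> (\<Sum>n=1..N. e * g' n)" by (rule sum_mono[OF one])
      finally show ?thesis by (simp add: S_def sum_distrib_left)
    qed
    have main: "\<bar>\<Sum>n=1..N. (v n - i) * g n\<bar> \<le> N * (\<bar>z1\<bar> + B * \<bar>z2\<bar>)"
    proof -
      have "(v n - i) * g n = (v n * q n / m n - i) - i * (q n / m n - 1)" for n
      proof -
        have *: "v n * q n / m n = v n * g n" "q n / m n = g n" by (simp_all add: g_def)
        show ?thesis unfolding * by algebra
      qed
      then have "(\<Sum>n=1..N. (v n - i) * g n) = (\<Sum>n=1..N. (v n * q n / m n - i) - i * (q n / m n - 1))"
        by (rule sum.cong[OF refl])
      also have "\<dots> = (\<Sum>n=1..N. v n * q n / m n - i) - i * (\<Sum>n=1..N. q n / m n - 1)"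
        unfolding sum_distrib_left by (rule sum_subtractf)
      also have "\<dots> = N * (z1 - i * z2)" using Np unfolding z1_def z2_def right_diff_distrib by simp
      finally have "\<bar>\<Sum>n=1..N. (v n - i) * g n\<bar> = N * \<bar>z1 - i * z2\<bar>" by (simp add: abs_mult)
      also have "\<dots> \<le> N * (\<bar>z1\<bar> + B * \<bar>z2\<bar>)"
      proof (rule mult_left_mono)
        have "\<bar>i * z2\<bar> \<le> B * \<bar>z2\<bar>" unfolding abs_mult using i by (rule mult_right_mono) simp
        then show "\<bar>z1 - i * z2\<bar> \<le> \<bar>z1\<bar> + B * \<bar>z2\<bar>" by linarith
      qed simp
      finally show ?thesis .
    qed
    have "num = (\<Sum>n=1..N. (v n - i) * g n) + (\<Sum>n=1..N. (v n - i) * (g' n - g n))"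
      unfolding num_def sum.distrib[symmetric] by (intro sum.cong refl) (simp add: right_diff_distrib)
    then have "\<bar>num\<bar> \<le> N * (\<bar>z1\<bar> + B * \<bar>z2\<bar>) + e * S"
      using main diff by linarith
    also have "N * (\<bar>z1\<bar> + B * \<bar>z2\<bar>) \<le> (4 * S) * (\<bar>z1\<bar> + B * \<bar>z2\<bar>)"
      using S4 B by (intro mult_right_mono) simp_all
    finally have "\<bar>num\<bar> \<le> (4 * \<bar>z1\<bar> + 4 * B * \<bar>z2\<bar> + e) * S"
      by (simp add: algebra_simps)
    then show ?thesis unfolding abs_eq pos_divide_le_eq[OF S] .
  qed
  then show ?thesis unfolding z1_def z2_def e_def .
qed

text \<open>\<open>T\<close> is the law of one simulated chain, \<open>X\<close> and
  \<open>Y\<close> are its states at two successive times, \<open>q a x y\<close> is the transition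
  density and \<open>b0\<close> the control of the simulation. The Lipschitz bound holds only for
  almost every \<open>y\<close>, because its constant comes from an essential supremum.\<close>

locale importance_step =
  fixes T :: "'c measure" and \<mu> :: "'y measure" and X Y :: "'c \<Rightarrow> 'y"
    and q :: "'a \<Rightarrow> 'y \<Rightarrow> 'y \<Rightarrow> real" and A :: "'a set" and b0 :: 'a
    and \<rho> :: "'a \<Rightarrow> 'a \<Rightarrow> real" and \<delta> \<Lambda> L :: real
  assumes T: "prob_space T" and \<mu>: "finite_measure \<mu>"
    and X[measurable]: "X \<in> T \<rightarrow>\<^sub>M \<mu>" and Y[measurable]: "Y \<in> T \<rightarrow>\<^sub>M \<mu>"
    and q_meas: "\<And>a. a \<in> A \<Longrightarrow> (\<lambda>(x, y). q a x y) \<in> borel_measurable (\<mu> \<Otimes>\<^sub>M \<mu>)"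
    and b0: "b0 \<in> A" and \<delta>: "0 < \<delta>" and L: "0 < L"
    and q_bounds: "\<And>a x y. a \<in> A \<Longrightarrow> x \<in> space \<mu> \<Longrightarrow> y \<in> space \<mu> \<Longrightarrow> \<delta> \<le> q a x y \<and> q a x y \<le> \<Lambda>"
    and q_int: "\<And>a x. a \<in> A \<Longrightarrow> x \<in> space \<mu> \<Longrightarrow> (LINT y|\<mu>. q a x y) = 1"
    and q_Lip: "AE y in \<mu>. \<forall>x\<in>space \<mu>. \<forall>a\<in>A. \<forall>a'\<in>A. \<bar>q a x y - q a' x y\<bar> \<le> L * \<rho> a a'"
    and law: "distr T \<mu> Y = density \<mu> (\<lambda>y. ennreal (LINT c|T. q b0 (X c) y))"
begin

sublocale T: prob_space T by (rule T)
sublocale \<mu>: finite_measure \<mu> by (rule \<mu>)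

definition m where "m y = (LINT c|T. q b0 (X c) y)"

lemma q_meas': 
  assumes "a \<in> A" "f \<in> N \<rightarrow>\<^sub>M \<mu>" "g \<in> N \<rightarrow>\<^sub>M \<mu>"
  shows "(\<lambda>w. q a (f w) (g w)) \<in> borel_measurable N"
  using measurable_compose[OF measurable_Pair[OF assms(2,3)] q_meas[OF assms(1)]] by simp

lemma m_meas[measurable]: "m \<in> borel_measurable \<mu>"
proof -
  have "(\<lambda>(y, c). q b0 (X c) y) \<in> borel_measurable (\<mu> \<Otimes>\<^sub>M T)"
    unfolding split_beta by (intro q_meas'[OF b0]) measurable
  then show ?thesis unfolding m_def by (rule T.borel_measurable_lebesgue_integral)
qed

lemma q_integrable: "integrable T (\<lambda>c. q b0 (X c) y)" if y: "y \<in> space \<mu>"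
proof (rule T.integrable_const_bound[of _ \<Lambda>])
  show "AE c in T. norm (q b0 (X c) y) \<le> \<Lambda>"
    using q_bounds[OF b0 measurable_space[OF X] y] \<delta> by (intro AE_I2) fastforce
  show "(\<lambda>c. q b0 (X c) y) \<in> borel_measurable T" using y by (intro q_meas'[OF b0]) auto
qed

lemma m_bounds: "\<delta> \<le> m y \<and> m y \<le> \<Lambda>" if y: "y \<in> space \<mu>"
proof
  have "(LINT c|T. \<delta>) \<le> m y" unfolding m_def
    using q_bounds[OF b0 measurable_space[OF X] y] q_integrable[OF y] by (intro integral_mono) auto
  then show "\<delta> \<le> m y" by (simp add: T.prob_space)
  have "m y \<le> (LINT c|T. \<Lambda>)" unfolding m_def
    using q_bounds[OF b0 measurable_space[OF X] y] q_integrable[OF y] by (intro integral_mono) auto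
  then show "m y \<le> \<Lambda>" by (simp add: T.prob_space)
qed

lemma importance_integral:
  assumes f: "f \<in> borel_measurable \<mu>"
  shows "(LINT c|T. f (Y c) / m (Y c)) = (LINT y|\<mu>. f y)"
proof -
  have fm: "(\<lambda>y. f y / m y) \<in> borel_measurable \<mu>" using f by measurable
  have "(LINT c|T. f (Y c) / m (Y c)) = (LINT y|distr T \<mu> Y. f y / m y)"
    using fm by (intro integral_distr[symmetric]) auto
  also have "\<dots> = (LINT y|\<mu>. m y *\<^sub>R (f y / m y))"
    unfolding law m_def[symmetric] using fm m_bounds \<delta>
    by (intro integral_density) (auto intro!: AE_I2 order_trans[OF less_imp_le[OF \<delta>]])
  also have "\<dots> = (LINT y|\<mu>. f y)"
    using m_bounds \<delta> by (intro Bochner_Integration.integral_cong refl) fastforce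
  finally show ?thesis .
qed

lemma law_AE: "AE y in \<mu>. P y \<Longrightarrow> AE c in T. P (Y c)"
proof -
  assume P: "AE y in \<mu>. P y"
  have "(\<lambda>y. ennreal (LINT c|T. q b0 (X c) y)) \<in> borel_measurable \<mu>"
    using m_meas unfolding m_def[abs_def] by simp
  then have "AE y in distr T \<mu> Y. P y"
    unfolding law using P by (subst AE_density) auto
  then show "AE c in T. P (Y c)" by (rule AE_distrD[OF Y])
qed

text \<open>The error of a single ideal importance sample \<open>w\<close> for the step out of the
  state \<open>X z\<close>. It is centred in \<open>w\<close> for each fixed \<open>z\<close>, which
  is what lets \<open>z\<close> be one of the samples itself.\<close>

definition \<psi> where
  "\<psi> \<phi> a z w = \<phi> (Y w) * q a (X z) (Y w) / m (Y w) - (LINT y|\<mu>. \<phi> y * q a (X z) y)"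

lemma \<Lambda>: "0 < \<Lambda>" "\<delta> \<le> \<Lambda>"
proof -
  obtain z where "z \<in> space T" using T.not_empty by auto
  then show "\<delta> \<le> \<Lambda>" using q_bounds[OF b0, of "X z" "X z"] measurable_space[OF X] by fastforce
  then show "0 < \<Lambda>" using \<delta> by linarith
qed

context
  fixes \<phi> :: "'y \<Rightarrow> real" and b :: real
  assumes \<phi>[measurable]: "\<phi> \<in> borel_measurable \<mu>" and b: "0 < b" and \<phi>b: "\<And>y. y \<in> space \<mu> \<Longrightarrow> \<bar>\<phi> y\<bar> \<le> b"
begin

lemma \<psi>_meas: "(\<lambda>(z, w). \<psi> \<phi> a z w) \<in> borel_measurable (T \<Otimes>\<^sub>M T)" if a: "a \<in> A"
  unfolding \<psi>_def split_beta
proof (rule borel_measurable_diff)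
  show "(\<lambda>x. \<phi> (Y (snd x)) * q a (X (fst x)) (Y (snd x)) / m (Y (snd x))) \<in> borel_measurable (T \<Otimes>\<^sub>M T)"
    by (intro borel_measurable_divide borel_measurable_times q_meas'[OF a]) measurable
  have "(\<lambda>(x, y). \<phi> y * q a (X (fst x)) y) \<in> borel_measurable ((T \<Otimes>\<^sub>M T) \<Otimes>\<^sub>M \<mu>)"
    unfolding split_beta by (intro borel_measurable_times q_meas'[OF a]) measurable
  then show "(\<lambda>x. LINT y|\<mu>. \<phi> y * q a (X (fst x)) y) \<in> borel_measurable (T \<Otimes>\<^sub>M T)"
    by (rule \<mu>.borel_measurable_lebesgue_integral)
qed

lemma ratio_bound: "\<bar>\<phi> y * q a x y / m y\<bar> \<le> b * \<Lambda> / \<delta>"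
  if "a \<in> A" "x \<in> space \<mu>" "y \<in> space \<mu>"
proof -
  have "0 \<le> q a x y" "q a x y \<le> \<Lambda>" "0 < m y" "\<delta> \<le> m y"
    using q_bounds[OF that] m_bounds[OF that(3)] \<delta> by auto
  moreover have "\<bar>\<phi> y * q a x y / m y\<bar> = \<bar>\<phi> y\<bar> * q a x y / m y"
    using calculation by (simp add: abs_mult)
  moreover have "\<bar>\<phi> y\<bar> * q a x y / m y \<le> b * \<Lambda> / \<delta>"
    using calculation \<phi>b[OF that(3)] b \<delta> \<Lambda> by (intro frac_le mult_mono) auto
  ultimately show ?thesis by simp
qed

lemma integral_ratio: "(LINT c|T. \<phi> (Y c) * q a x (Y c) / m (Y c)) = (LINT y|\<mu>. \<phi> y * q a x y)"
  if "a \<in> A" "x \<in> space \<mu>"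
  using that by (intro importance_integral borel_measurable_times q_meas' \<phi>) auto

lemma ratio_integrable: "integrable T (\<lambda>c. \<phi> (Y c) * q a x (Y c) / m (Y c))" if "a \<in> A" "x \<in> space \<mu>"
proof (rule T.integrable_const_bound[of _ "b * \<Lambda> / \<delta>"])
  show "AE c in T. norm (\<phi> (Y c) * q a x (Y c) / m (Y c)) \<le> b * \<Lambda> / \<delta>"
    using ratio_bound[OF that] measurable_space[OF Y] by auto
  show "(\<lambda>c. \<phi> (Y c) * q a x (Y c) / m (Y c)) \<in> borel_measurable T"
    using that by (intro borel_measurable_divide borel_measurable_times q_meas' measurable_compose[OF Y \<phi>]
      measurable_compose[OF Y m_meas] Y) auto
qed

lemma \<psi>_mean: "integral\<^sup>L T (\<psi> \<phi> a z) = 0" if "a \<in> A" "z \<in> space T"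
  using ratio_integrable[OF that(1) measurable_space[OF X that(2)]] integral_ratio[OF that(1) measurable_space[OF X that(2)]]
  unfolding \<psi>_def by (simp add: T.prob_space)

lemma \<psi>_integrable: "integrable T (\<psi> \<phi> a z)" if "a \<in> A" "z \<in> space T"
  unfolding \<psi>_def using ratio_integrable[OF that(1) measurable_space[OF X that(2)]] by simp

lemma \<psi>_bound: "\<bar>\<psi> \<phi> a z w\<bar> \<le> 2 * b * \<Lambda> / \<delta>" if a: "a \<in> A" and z: "z \<in> space T" and w: "w \<in> space T"
proof -
  have x: "X z \<in> space \<mu>" by (rule measurable_space[OF X z])
  have "\<bar>LINT y|\<mu>. \<phi> y * q a (X z) y\<bar> \<le> b * \<Lambda> / \<delta>"
    unfolding integral_ratio[OF a x, symmetric]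
  proof -
    have "\<bar>LINT c|T. \<phi> (Y c) * q a (X z) (Y c) / m (Y c)\<bar> \<le> (LINT c|T. \<bar>\<phi> (Y c) * q a (X z) (Y c) / m (Y c)\<bar>)"
      by (rule integral_abs_bound)
    also have "\<dots> \<le> (LINT c|T. b * \<Lambda> / \<delta>)"
    proof (rule integral_mono[OF integrable_abs[OF ratio_integrable[OF a x]]])
      fix c assume "c \<in> space T"
      then show "\<bar>\<phi> (Y c) * q a (X z) (Y c) / m (Y c)\<bar> \<le> b * \<Lambda> / \<delta>"
        by (intro ratio_bound[OF a x] measurable_space[OF Y])
    qed simp
    finally show "\<bar>LINT c|T. \<phi> (Y c) * q a (X z) (Y c) / m (Y c)\<bar> \<le> b * \<Lambda> / \<delta>" by (simp add: T.prob_space)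
  qed
  moreover have "2 * b * \<Lambda> / \<delta> = b * \<Lambda> / \<delta> + b * \<Lambda> / \<delta>" by simp
  ultimately show ?thesis
    using ratio_bound[OF a x measurable_space[OF Y w]] unfolding \<psi>_def by linarith
qed

text \<open>The exceptional null set does not depend on \<open>z\<close>, \<open>a\<close> or
  \<open>a'\<close>, so the uncountably many actions at the finest scale can be treated together.
  The subtracted integral is rewritten as a \<open>T\<close>-expectation of the same ratio and obeys
  the same bound, hence the factor 2.\<close>

lemma \<psi>_Lip: "AE w in T. \<forall>z\<in>space T. \<forall>a\<in>A. \<forall>a'\<in>A. \<bar>\<psi> \<phi> a z w - \<psi> \<phi> a' z w\<bar> \<le> 2 * b * (L * \<rho> a a') / \<delta>"
proof -
  have r: "AE c in T. \<forall>x\<in>space \<mu>. \<forall>a\<in>A. \<forall>a'\<in>A.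
      \<bar>\<phi> (Y c) * q a x (Y c) / m (Y c) - \<phi> (Y c) * q a' x (Y c) / m (Y c)\<bar> \<le> b * (L * \<rho> a a') / \<delta>"
    using law_AE[OF q_Lip] AE_space
  proof eventually_elim
    case (elim c)
    have y: "Y c \<in> space \<mu>" using elim(2) measurable_space[OF Y] by auto
    show ?case
    proof (intro ballI)
      fix x a a' assume x: "x \<in> space \<mu>" "a \<in> A" "a' \<in> A"
      have L: "\<bar>q a x (Y c) - q a' x (Y c)\<bar> \<le> L * \<rho> a a'" using elim(1) x by blast
      have "\<bar>\<phi> (Y c) * q a x (Y c) / m (Y c) - \<phi> (Y c) * q a' x (Y c) / m (Y c)\<bar> =
          \<bar>\<phi> (Y c) * (q a x (Y c) - q a' x (Y c)) / m (Y c)\<bar>"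
        by (simp add: right_diff_distrib diff_divide_distrib)
      also have "\<dots> = \<bar>\<phi> (Y c)\<bar> * \<bar>q a x (Y c) - q a' x (Y c)\<bar> / m (Y c)"
        using m_bounds[OF y] \<delta> by (simp add: abs_mult)
      also have "\<dots> \<le> b * (L * \<rho> a a') / \<delta>"
      proof -
        have "0 \<le> L * \<rho> a a'" using L by (rule order_trans[OF abs_ge_zero])
        then have "0 \<le> b * (L * \<rho> a a')" by (rule mult_nonneg_nonneg[OF less_imp_le[OF b]])
        moreover have "\<bar>\<phi> (Y c)\<bar> * \<bar>q a x (Y c) - q a' x (Y c)\<bar> \<le> b * (L * \<rho> a a')"
          by (rule mult_mono[OF \<phi>b[OF y] L less_imp_le[OF b] abs_ge_zero])
        ultimately show ?thesis by (rule frac_le[OF _ _ \<delta> conjunct1[OF m_bounds[OF y]]])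
      qed
      finally show "\<bar>\<phi> (Y c) * q a x (Y c) / m (Y c) - \<phi> (Y c) * q a' x (Y c) / m (Y c)\<bar> \<le> b * (L * \<rho> a a') / \<delta>" .
    qed
  qed
  have I: "\<bar>(LINT y|\<mu>. \<phi> y * q a x y) - (LINT y|\<mu>. \<phi> y * q a' x y)\<bar> \<le> b * (L * \<rho> a a') / \<delta>"
    if x: "x \<in> space \<mu>" and a: "a \<in> A" "a' \<in> A" for x a a'
  proof -
    have int: "integrable T (\<lambda>c. \<phi> (Y c) * q a x (Y c) / m (Y c) - \<phi> (Y c) * q a' x (Y c) / m (Y c))"
      using ratio_integrable[OF a(1) x] ratio_integrable[OF a(2) x] by simp
    have diff_eq: "(LINT y|\<mu>. \<phi> y * q a x y) - (LINT y|\<mu>. \<phi> y * q a' x y) =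
      (LINT c|T. \<phi> (Y c) * q a x (Y c) / m (Y c) - \<phi> (Y c) * q a' x (Y c) / m (Y c))"
      using ratio_integrable[OF a(1) x] ratio_integrable[OF a(2) x] integral_ratio[OF a(1) x] integral_ratio[OF a(2) x] by simp
    have "\<bar>LINT c|T. \<phi> (Y c) * q a x (Y c) / m (Y c) - \<phi> (Y c) * q a' x (Y c) / m (Y c)\<bar> \<le>
      (LINT c|T. \<bar>\<phi> (Y c) * q a x (Y c) / m (Y c) - \<phi> (Y c) * q a' x (Y c) / m (Y c)\<bar>)"
      by (rule integral_abs_bound)
    also have "\<dots> \<le> (LINT c|T. b * (L * \<rho> a a') / \<delta>)"
    proof (rule integral_mono_AE[OF integrable_abs[OF int] T.integrable_const])
      show "AE c in T. \<bar>\<phi> (Y c) * q a x (Y c) / m (Y c) - \<phi> (Y c) * q a' x (Y c) / m (Y c)\<bar> \<le> b * (L * \<rho> a a') / \<delta>"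
        using r
        by (rule eventually_mono) (drule bspec[OF _ x], drule bspec[OF _ a(1)], drule bspec[OF _ a(2)], assumption)
    qed
    also have "\<dots> = b * (L * \<rho> a a') / \<delta>" by (simp add: T.prob_space)
    finally show ?thesis unfolding diff_eq .
  qed
  show ?thesis
    using r
  proof eventually_elim
    case (elim w)
    show ?case
    proof (intro ballI)
      fix z a a' assume z: "z \<in> space T" "a \<in> A" "a' \<in> A"
      have x: "X z \<in> space \<mu>" by (rule measurable_space[OF X z(1)])
      have "2 * b * (L * \<rho> a a') / \<delta> = b * (L * \<rho> a a') / \<delta> + b * (L * \<rho> a a') / \<delta>" by simp
      then show "\<bar>\<psi> \<phi> a z w - \<psi> \<phi> a' z w\<bar> \<le> 2 * b * (L * \<rho> a a') / \<delta>"
        using I[OF x z(2,3)] bspec[OF bspec[OF bspec[OF elim x] z(2)] z(3)] unfolding \<psi>_def by linarith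
    qed
  qed
qed

end

end

text \<open>With the common factor \<open>2 * b / \<delta>\<close> taken out: the maximum over the
  coarsest net \<open>C j0\<close>; the links between consecutive nets up to level \<open>J\<close>;
  the rest below scale \<open>J\<close>, together with one \<Lambda> for the diagonal term. The
  cardinalities carry a factor \<open>N\<close> because every maximum also runs over the
  \<open>N\<close> starting points. Doubling \<open>(1 / 2) ^ j\<close> accounts for a link to the
  previous, coarser net.\<close>

definition chaining_cost :: "real \<Rightarrow> real \<Rightarrow> (nat \<Rightarrow> 'a set) \<Rightarrow> nat \<Rightarrow> nat \<Rightarrow> nat \<Rightarrow> real" where
  "chaining_cost \<Lambda> L C j0 J N = \<Lambda> * (sqrt N * sqrt (2 * ln (2 * (real N * card (C j0)))))
     + (\<Sum>j\<in>{j0<..J}. 2 * L * (1 / 2) ^ j * (sqrt N * sqrt (2 * ln (2 * (real N * card (C j))))))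
     + (real N * (L * (1 / 2) ^ J) + \<Lambda>)"

lemma chaining_cost_nonneg:
  assumes \<Lambda>: "0 \<le> \<Lambda>" and L: "0 \<le> L" and N: "1 \<le> N" and C: "\<And>j. finite (C j)" "\<And>j. C j \<noteq> {}"
  shows "0 \<le> chaining_cost \<Lambda> L C j0 J N"
proof -
  have "0 \<le> sqrt (2 * ln (2 * (real N * card (C j))))" for j
  proof -
    have "1 \<le> real (card (C j))" using C by (simp add: Suc_le_eq card_gt_0_iff)
    then have "1 * 1 \<le> real N * card (C j)" using N by (intro mult_mono) auto
    then have "1 \<le> 2 * (real N * card (C j))" by linarith
    then show ?thesis by (intro real_sqrt_ge_zero mult_nonneg_nonneg ln_ge_zero) simp_all
  qed
  then show ?thesis
    unfolding chaining_cost_def using \<Lambda> L by (intro add_nonneg_nonneg sum_nonneg mult_nonneg_nonneg) auto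
qed

section \<open>Chaining over the actions and the error of one step\<close>

context importance_step
begin

text \<open>The supremum over the actions is not known to be measurable, so the bound is expressed
  by a measurable majorant built from finitely many maxima. Chaining runs over the actions only: the
  starting points are the samples themselves and enter as a finite index.\<close>

lemma process_bound:
  fixes \<phi> :: "'y \<Rightarrow> real" and b :: real and N j0 J :: nat
  assumes \<phi>: "\<phi> \<in> borel_measurable \<mu>" and b: "0 < b" and \<phi>b: "\<And>y. y \<in> space \<mu> \<Longrightarrow> \<bar>\<phi> y\<bar> \<le> b"
    and N: "1 \<le> N" and J: "j0 \<le> J"
    and C: "\<And>j. finite (C j)" "\<And>j. C j \<noteq> {}" "\<And>j. C j \<subseteq> A"
      "\<And>j a. a \<in> A \<Longrightarrow> \<exists>c\<in>C j. \<rho> a c \<le> (1 / 2) ^ j"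
  defines "P \<equiv> PiM {1..N} (\<lambda>_. T)"
  shows "\<exists>\<Psi>\<in>borel_measurable P. (\<forall>\<omega>. 0 \<le> \<Psi> \<omega>) \<and>
    (AE \<omega> in P. \<forall>r\<in>{1..N}. \<forall>a\<in>A. \<bar>\<Sum>n=1..N. \<psi> \<phi> a (\<omega> r) (\<omega> n)\<bar> \<le> \<Psi> \<omega>) \<and>
    (\<integral>\<^sup>+\<omega>. ennreal (\<Psi> \<omega>) \<partial>P) \<le> ennreal (2 * b / \<delta> * chaining_cost \<Lambda> L C j0 J N)"
proof -
  interpret PP: product_prob_space "\<lambda>_. T" "{1..N}" ..
  have psi_meas: "(\<lambda>(z, w). \<psi> \<phi> a z w) \<in> borel_measurable (T \<Otimes>\<^sub>M T)" if "a \<in> A" for a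
    by (rule \<psi>_meas[OF \<phi> b \<phi>b that])
  have psi_mean: "integral\<^sup>L T (\<psi> \<phi> a z) = 0" if "a \<in> A" "z \<in> space T" for a z
    by (rule \<psi>_mean[OF \<phi> b \<phi>b that])
  have psi_int: "integrable T (\<psi> \<phi> a z)" if "a \<in> A" "z \<in> space T" for a z
    by (rule \<psi>_integrable[OF \<phi> b \<phi>b that])
  have psi_bound: "\<bar>\<psi> \<phi> a z w\<bar> \<le> 2 * b * \<Lambda> / \<delta>" if "a \<in> A" "z \<in> space T" "w \<in> space T" for a z w
    by (rule \<psi>_bound[OF \<phi> b \<phi>b that])
  have psi_Lip: "AE w in T. \<forall>z\<in>space T. \<forall>a\<in>A. \<forall>a'\<in>A. \<bar>\<psi> \<phi> a z w - \<psi> \<phi> a' z w\<bar> \<le> 2 * b * (L * \<rho> a a') / \<delta>"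
    by (rule \<psi>_Lip[OF \<phi> b \<phi>b])
  define \<pi> where "\<pi> j a = (SOME c. c \<in> C j \<and> \<rho> a c \<le> (1 / 2) ^ j)" for j a
  have \<pi>: "\<pi> j a \<in> C j \<and> \<rho> a (\<pi> j a) \<le> (1 / 2) ^ j" if "a \<in> A" for j a
  proof -
    have "\<exists>c. c \<in> C j \<and> \<rho> a c \<le> (1 / 2) ^ j" using C(4)[OF that, of j] by blast
    from someI_ex[OF this] show ?thesis unfolding \<pi>_def .
  qed
  have \<pi>A: "\<pi> j a \<in> A" if "a \<in> A" for j a using \<pi>[OF that, of j] C(3)[of j] by blast
  define c0 where "c0 = 2 * b * \<Lambda> / \<delta>"
  define cj where "cj j = 2 * b * (L * (1 / 2) ^ j) / \<delta>" for j
  have c0: "0 < c0" using b \<Lambda> \<delta> by (simp add: c0_def)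
  have cj: "0 < cj j" for j using b L \<delta> by (simp add: cj_def)
  have card_I: "real (card ({1..N} \<times> C j)) = real N * card (C j)" for j
    by (simp add: card_cartesian_product)
  have fin_I: "finite ({1..N} \<times> C j)" "{1..N} \<times> C j \<noteq> {}" for j using C(1,2) N by auto
  define F0 where "F0 \<omega> = Max ((\<lambda>i. \<bar>\<Sum>n\<in>{1..N} - {fst i}. \<psi> \<phi> (snd i) (\<omega> (fst i)) (\<omega> n)\<bar>) ` ({1..N} \<times> C j0))" for \<omega>
  define F where "F j \<omega> = Max ((\<lambda>i. \<bar>\<Sum>n\<in>{1..N} - {fst i}.
    \<psi> \<phi> (snd i) (\<omega> (fst i)) (\<omega> n) - \<psi> \<phi> (\<pi> (j - 1) (snd i)) (\<omega> (fst i)) (\<omega> n)\<bar>) ` ({1..N} \<times> C j))" for j \<omega>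
  have in_A: "snd i \<in> A" "fst i \<in> {1..N}" if "i \<in> {1..N} \<times> C j" for i j using that C(3)[of j] by auto
  have F0: "(\<integral>\<^sup>+\<omega>. ennreal (F0 \<omega>) \<partial>P) \<le> ennreal (c0 * sqrt N * sqrt (2 * ln (2 * card ({1..N} \<times> C j0))))"
    "F0 \<in> borel_measurable P" "0 \<le> F0 \<omega>" for \<omega>
    unfolding F0_def P_def
    by (rule Max_leave_one_out_sums[where g = "\<lambda>i. \<psi> \<phi> (snd i)" and c = c0 and r = fst, OF T N fin_I];
        use in_A psi_meas psi_mean psi_bound c0 in \<open>auto simp: c0_def intro!: AE_I2\<close>)+
  have Lip': "AE w in T. \<bar>\<psi> \<phi> a z w - \<psi> \<phi> (\<pi> j a) z w\<bar> \<le> cj j" if a: "a \<in> A" and z: "z \<in> space T" for a z j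
    using psi_Lip
  proof (rule eventually_mono)
    fix w assume "\<forall>z\<in>space T. \<forall>a\<in>A. \<forall>a'\<in>A. \<bar>\<psi> \<phi> a z w - \<psi> \<phi> a' z w\<bar> \<le> 2 * b * (L * \<rho> a a') / \<delta>"
    then have "\<bar>\<psi> \<phi> a z w - \<psi> \<phi> (\<pi> j a) z w\<bar> \<le> 2 * b * (L * \<rho> a (\<pi> j a)) / \<delta>"
      using a z \<pi>A[OF a, of j] by blast
    also have "\<dots> \<le> cj j"
      unfolding cj_def using \<pi>[OF a, of j] b L \<delta> by (intro divide_right_mono mult_left_mono) auto
    finally show "\<bar>\<psi> \<phi> a z w - \<psi> \<phi> (\<pi> j a) z w\<bar> \<le> cj j" .
  qed
  have F: "(\<integral>\<^sup>+\<omega>. ennreal (F j \<omega>) \<partial>P) \<le> ennreal (cj (j - 1) * sqrt N * sqrt (2 * ln (2 * card ({1..N} \<times> C j))))"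
    "F j \<in> borel_measurable P" "0 \<le> F j \<omega>" for j \<omega>
  proof -
    let ?g = "\<lambda>i z w. \<psi> \<phi> (snd i) z w - \<psi> \<phi> (\<pi> (j - 1) (snd i)) z w"
    have g: "(\<lambda>(z, w). ?g i z w) \<in> borel_measurable (T \<Otimes>\<^sub>M T)" "z \<in> space T \<Longrightarrow> integral\<^sup>L T (?g i z) = 0"
      "z \<in> space T \<Longrightarrow> AE w in T. \<bar>?g i z w\<bar> \<le> cj (j - 1)"
      if i: "i \<in> {1..N} \<times> C j" for i z
    proof -
      note a = in_A(1)[OF i]
      show "(\<lambda>(z, w). ?g i z w) \<in> borel_measurable (T \<Otimes>\<^sub>M T)"
        using borel_measurable_diff[OF psi_meas[OF a] psi_meas[OF \<pi>A[OF a, of "j - 1"]]] by (simp add: split_beta)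
      show "integral\<^sup>L T (?g i z) = 0" if z: "z \<in> space T"
        using psi_int[OF a z] psi_int[OF \<pi>A[OF a, of "j - 1"] z] psi_mean[OF a z] psi_mean[OF \<pi>A[OF a, of "j - 1"] z] by simp
      show "AE w in T. \<bar>?g i z w\<bar> \<le> cj (j - 1)" if z: "z \<in> space T" by (rule Lip'[OF a z])
    qed
    note M = Max_leave_one_out_sums[where g = ?g and c = "cj (j - 1)" and r = fst, OF T N fin_I(1) fin_I(2) in_A(2) g(1) g(3) cj g(2)]
    show "(\<integral>\<^sup>+\<omega>. ennreal (F j \<omega>) \<partial>P) \<le> ennreal (cj (j - 1) * sqrt N * sqrt (2 * ln (2 * card ({1..N} \<times> C j))))"
      unfolding F_def P_def by (rule M(1))
    show "F j \<in> borel_measurable P" unfolding F_def[abs_def] P_def by (rule M(2))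
    show "0 \<le> F j \<omega>" unfolding F_def by (rule M(3))
  qed
  define R where "R = real N * cj J + c0"
  have R: "0 \<le> R" using c0 cj[of J] by (simp add: R_def)
  define \<Psi> where "\<Psi> \<omega> = F0 \<omega> + (\<Sum>j\<in>{j0<..J}. F j \<omega>) + R" for \<omega>
  have meas: "\<Psi> \<in> borel_measurable P"
    unfolding \<Psi>_def using F0(2) F(2) by (intro borel_measurable_add borel_measurable_sum) auto
  have nonneg: "0 \<le> \<Psi> \<omega>" for \<omega>
    unfolding \<Psi>_def using F0(3) F(3) R by (intro add_nonneg_nonneg sum_nonneg) auto
  \<comment> \<open>A point of a net is linked to a nearby point of the net one level coarser. The
    links between two levels are all covered by one maximum, so the bound grows by one summand per
    level.\<close>
  have net: "\<bar>\<Sum>n\<in>{1..N} - {r}. \<psi> \<phi> a (\<omega> r) (\<omega> n)\<bar> \<le> F0 \<omega> + (\<Sum>j\<in>{j0<..J'}. F j \<omega>)"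
    if "r \<in> {1..N}" "j0 \<le> J'" "a \<in> C J'" for r a J' \<omega>
    using that(2,3)
  proof (induction J' arbitrary: a rule: dec_induct)
    case base
    have "\<bar>\<Sum>n\<in>{1..N} - {fst (r, a)}. \<psi> \<phi> (snd (r, a)) (\<omega> (fst (r, a))) (\<omega> n)\<bar> \<le> F0 \<omega>"
      unfolding F0_def using fin_I that(1) base by (intro Max_ge finite_imageI imageI) auto
    then show ?case by simp
  next
    case (step J')
    have a: "a \<in> A" using step.prems C(3) by blast
    have "(\<Sum>n\<in>{1..N} - {r}. \<psi> \<phi> a (\<omega> r) (\<omega> n)) =
      (\<Sum>n\<in>{1..N} - {r}. \<psi> \<phi> a (\<omega> r) (\<omega> n) - \<psi> \<phi> (\<pi> J' a) (\<omega> r) (\<omega> n)) +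
      (\<Sum>n\<in>{1..N} - {r}. \<psi> \<phi> (\<pi> J' a) (\<omega> r) (\<omega> n))"
      by (simp add: sum_subtractf)
    moreover have "\<bar>\<Sum>n\<in>{1..N} - {fst (r, a)}. \<psi> \<phi> (snd (r, a)) (\<omega> (fst (r, a))) (\<omega> n)
        - \<psi> \<phi> (\<pi> (Suc J' - 1) (snd (r, a))) (\<omega> (fst (r, a))) (\<omega> n)\<bar> \<le> F (Suc J') \<omega>"
      unfolding F_def using fin_I that(1) step.prems by (intro Max_ge finite_imageI imageI) auto
    moreover have "\<bar>\<Sum>n\<in>{1..N} - {r}. \<psi> \<phi> (\<pi> J' a) (\<omega> r) (\<omega> n)\<bar> \<le> F0 \<omega> + (\<Sum>j\<in>{j0<..J'}. F j \<omega>)"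
      using \<pi>[OF a, of J'] by (intro step.IH) simp
    moreover have "{j0<..Suc J'} = insert (Suc J') {j0<..J'}" using step.hyps by auto
    then have "(\<Sum>j\<in>{j0<..Suc J'}. F j \<omega>) = F (Suc J') \<omega> + (\<Sum>j\<in>{j0<..J'}. F j \<omega>)" by simp
    ultimately show ?case by simp
  qed
  have AE_bound: "AE \<omega> in P. \<forall>r\<in>{1..N}. \<forall>a\<in>A. \<bar>\<Sum>n=1..N. \<psi> \<phi> a (\<omega> r) (\<omega> n)\<bar> \<le> \<Psi> \<omega>"
  proof -
    have "AE w in T. w \<in> space T \<and> (\<forall>z\<in>space T. \<forall>a\<in>A. \<forall>a'\<in>A. \<bar>\<psi> \<phi> a z w - \<psi> \<phi> a' z w\<bar> \<le> 2 * b * (L * \<rho> a a') / \<delta>)"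
      using AE_space psi_Lip by (rule AE_conjI)
    from PP.AE_component[OF _ this]
    have "AE \<omega> in P. \<forall>n\<in>{1..N}. \<omega> n \<in> space T \<and>
      (\<forall>z\<in>space T. \<forall>a\<in>A. \<forall>a'\<in>A. \<bar>\<psi> \<phi> a z (\<omega> n) - \<psi> \<phi> a' z (\<omega> n)\<bar> \<le> 2 * b * (L * \<rho> a a') / \<delta>)"
      unfolding P_def by (intro AE_finite_allI) auto
    then show ?thesis
    proof (rule eventually_mono)
      fix \<omega> assume \<omega>: "\<forall>n\<in>{1..N}. \<omega> n \<in> space T \<and>
        (\<forall>z\<in>space T. \<forall>a\<in>A. \<forall>a'\<in>A. \<bar>\<psi> \<phi> a z (\<omega> n) - \<psi> \<phi> a' z (\<omega> n)\<bar> \<le> 2 * b * (L * \<rho> a a') / \<delta>)"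
      show "\<forall>r\<in>{1..N}. \<forall>a\<in>A. \<bar>\<Sum>n=1..N. \<psi> \<phi> a (\<omega> r) (\<omega> n)\<bar> \<le> \<Psi> \<omega>"
      proof (intro ballI)
        fix r a assume r: "r \<in> {1..N}" and a: "a \<in> A"
        have \<omega>r: "\<omega> r \<in> space T" using \<omega> r by blast
        have one: "\<bar>\<psi> \<phi> a (\<omega> r) (\<omega> n) - \<psi> \<phi> (\<pi> J a) (\<omega> r) (\<omega> n)\<bar> \<le> cj J" if n: "n \<in> {1..N}" for n
        proof -
          have "\<bar>\<psi> \<phi> a (\<omega> r) (\<omega> n) - \<psi> \<phi> (\<pi> J a) (\<omega> r) (\<omega> n)\<bar> \<le> 2 * b * (L * \<rho> a (\<pi> J a)) / \<delta>"
            using \<omega> n \<omega>r a \<pi>A[OF a, of J] by blast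
          also have "\<dots> \<le> cj J"
            unfolding cj_def using \<pi>[OF a, of J] b L \<delta> by (intro divide_right_mono mult_left_mono) auto
          finally show ?thesis .
        qed
        have "\<bar>\<Sum>n\<in>{1..N} - {r}. \<psi> \<phi> a (\<omega> r) (\<omega> n) - \<psi> \<phi> (\<pi> J a) (\<omega> r) (\<omega> n)\<bar>
          \<le> (\<Sum>n\<in>{1..N} - {r}. \<bar>\<psi> \<phi> a (\<omega> r) (\<omega> n) - \<psi> \<phi> (\<pi> J a) (\<omega> r) (\<omega> n)\<bar>)" by (rule sum_abs)
        also have "\<dots> \<le> (\<Sum>n\<in>{1..N} - {r}. cj J)" by (rule sum_mono[OF one]) simp
        also have "\<dots> \<le> real N * cj J"
          using r cj[of J] by (simp add: card_Diff_singleton mult_right_mono)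
        finally have d: "\<bar>\<Sum>n\<in>{1..N} - {r}. \<psi> \<phi> a (\<omega> r) (\<omega> n) - \<psi> \<phi> (\<pi> J a) (\<omega> r) (\<omega> n)\<bar> \<le> real N * cj J" .
        \<comment> \<open>The summand \<open>n = r\<close> is not centred once
          \<open>\<omega> r\<close> is given. It is split off and bounded by its supremum
          \<open>c0\<close>.\<close>
        have "(\<Sum>n=1..N. \<psi> \<phi> a (\<omega> r) (\<omega> n)) = \<psi> \<phi> a (\<omega> r) (\<omega> r) + (\<Sum>n\<in>{1..N} - {r}. \<psi> \<phi> a (\<omega> r) (\<omega> n))"
          using r by (intro sum.remove) auto
        moreover have "(\<Sum>n\<in>{1..N} - {r}. \<psi> \<phi> a (\<omega> r) (\<omega> n) - \<psi> \<phi> (\<pi> J a) (\<omega> r) (\<omega> n)) =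
          (\<Sum>n\<in>{1..N} - {r}. \<psi> \<phi> a (\<omega> r) (\<omega> n)) - (\<Sum>n\<in>{1..N} - {r}. \<psi> \<phi> (\<pi> J a) (\<omega> r) (\<omega> n))"
          by (rule sum_subtractf)
        moreover have "\<bar>\<psi> \<phi> a (\<omega> r) (\<omega> r)\<bar> \<le> c0" unfolding c0_def by (rule psi_bound[OF a \<omega>r \<omega>r])
        moreover have "\<bar>\<Sum>n\<in>{1..N} - {r}. \<psi> \<phi> (\<pi> J a) (\<omega> r) (\<omega> n)\<bar> \<le> F0 \<omega> + (\<Sum>j\<in>{j0<..J}. F j \<omega>)"
          using \<pi>[OF a, of J] by (intro net[OF r J]) simp
        ultimately show "\<bar>\<Sum>n=1..N. \<psi> \<phi> a (\<omega> r) (\<omega> n)\<bar> \<le> \<Psi> \<omega>"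
          using d unfolding \<Psi>_def R_def by linarith
      qed
    qed
  qed
  have "(\<integral>\<^sup>+\<omega>. ennreal (\<Psi> \<omega>) \<partial>P) = (\<integral>\<^sup>+\<omega>. ennreal (F0 \<omega>) + (\<Sum>j\<in>{j0<..J}. ennreal (F j \<omega>)) + ennreal R \<partial>P)"
  proof (rule nn_integral_cong)
    fix \<omega>
    have "0 \<le> (\<Sum>j\<in>{j0<..J}. F j \<omega>)" using F(3) by (intro sum_nonneg) simp
    then show "ennreal (\<Psi> \<omega>) = ennreal (F0 \<omega>) + (\<Sum>j\<in>{j0<..J}. ennreal (F j \<omega>)) + ennreal R"
      unfolding \<Psi>_def using F0(3) F(3) R by (simp add: sum_ennreal)
  qed
  also have "\<dots> = (\<integral>\<^sup>+\<omega>. ennreal (F0 \<omega>) \<partial>P) + (\<Sum>j\<in>{j0<..J}. \<integral>\<^sup>+\<omega>. ennreal (F j \<omega>) \<partial>P) + ennreal R"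
    using F0(2) F(2) PP.emeasure_space_1
    by (simp add: nn_integral_add nn_integral_sum P_def del: sum_ennreal)
  also have "\<dots> \<le> ennreal (c0 * sqrt N * sqrt (2 * ln (2 * card ({1..N} \<times> C j0)))) +
      (\<Sum>j\<in>{j0<..J}. ennreal (cj (j - 1) * sqrt N * sqrt (2 * ln (2 * card ({1..N} \<times> C j))))) + ennreal R"
    using F0(1) F(1) by (intro add_mono sum_mono) auto
  also have "\<dots> = ennreal (2 * b / \<delta> * chaining_cost \<Lambda> L C j0 J N)"
  proof -
    have card1: "1 \<le> real N * card (C j)" for j
    proof -
      have "1 \<le> real (card (C j))" using C(1,2) by (simp add: Suc_le_eq card_gt_0_iff)
      then have "1 * 1 \<le> real N * card (C j)" using N by (intro mult_mono) auto
      then show ?thesis by simp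
    qed
    have sq: "0 \<le> sqrt (2 * ln (2 * (real N * card (C j))))" for j
      using card1[of j] by (intro real_sqrt_ge_zero mult_nonneg_nonneg ln_ge_zero) auto
    have p0: "0 \<le> c0 * sqrt N * sqrt (2 * ln (2 * (real N * card (C j0))))"
      using c0 sq by (intro mult_nonneg_nonneg) auto
    have pj: "0 \<le> cj (j - 1) * sqrt N * sqrt (2 * ln (2 * (real N * card (C j))))" for j
      using cj[of "j - 1"] sq by (intro mult_nonneg_nonneg) auto
    have "c0 * sqrt N * sqrt (2 * ln (2 * (real N * card (C j0)))) +
      (\<Sum>j\<in>{j0<..J}. cj (j - 1) * sqrt N * sqrt (2 * ln (2 * (real N * card (C j))))) + R =
      2 * b / \<delta> * chaining_cost \<Lambda> L C j0 J N"
    proof -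
      have "cj (j - 1) = 2 * b / \<delta> * (2 * L * (1 / 2) ^ j)" if "j \<in> {j0<..J}" for j
        using that by (cases j) (auto simp: cj_def)
      then have "(\<Sum>j\<in>{j0<..J}. cj (j - 1) * sqrt N * sqrt (2 * ln (2 * (real N * card (C j))))) =
        (\<Sum>j\<in>{j0<..J}. 2 * b / \<delta> * (2 * L * (1 / 2) ^ j * (sqrt N * sqrt (2 * ln (2 * (real N * card (C j)))))))"
        by (intro sum.cong refl) (simp only: mult.assoc)
      also have "\<dots> = 2 * b / \<delta> * (\<Sum>j\<in>{j0<..J}. 2 * L * (1 / 2) ^ j * (sqrt N * sqrt (2 * ln (2 * (real N * card (C j))))))"
        by (rule sum_distrib_left[symmetric])
      finally have sum_eq: "(\<Sum>j\<in>{j0<..J}. cj (j - 1) * sqrt N * sqrt (2 * ln (2 * (real N * card (C j))))) = \<dots>" .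
      have "c0 = 2 * b / \<delta> * \<Lambda>" "R = 2 * b / \<delta> * (real N * (L * (1 / 2) ^ J) + \<Lambda>)"
        by (simp_all add: c0_def R_def cj_def distrib_left)
      then show ?thesis unfolding sum_eq chaining_cost_def distrib_left by (simp only: mult.assoc)
    qed
    then show ?thesis
      unfolding of_nat_mult of_nat_numeral card_I using p0 pj R
      by (simp add: sum_nonneg ennreal_plus[symmetric] del: ennreal_plus)
  qed
  finally have "(\<integral>\<^sup>+\<omega>. ennreal (\<Psi> \<omega>) \<partial>P) \<le> ennreal (2 * b / \<delta> * chaining_cost \<Lambda> L C j0 J N)" .
  then show ?thesis using meas nonneg AE_bound by (intro bexI[of _ \<Psi>] conjI allI)
qed

text \<open>\<open>process_bound\<close> is used for \<open>V\<close>, the numerator, and for the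
  constant 1, the normalisation; each contributes 8 to the factor 16. The last term is the deviation
  of the empirical denominators from the mixture density.\<close>

lemma step_error:
  fixes V :: "'y \<Rightarrow> real" and B :: real and N j0 J :: nat
  assumes V: "V \<in> borel_measurable \<mu>" and B: "0 < B" and VB: "\<And>y. y \<in> space \<mu> \<Longrightarrow> \<bar>V y\<bar> \<le> B"
    and N: "2 \<le> N" and J: "j0 \<le> J"
    and C: "\<And>j. finite (C j)" "\<And>j. C j \<noteq> {}" "\<And>j. C j \<subseteq> A"
      "\<And>j a. a \<in> A \<Longrightarrow> \<exists>c\<in>C j. \<rho> a c \<le> (1 / 2) ^ j"
  defines "P \<equiv> PiM {1..N} (\<lambda>_. T)"
    and "raw \<equiv> \<lambda>\<omega> n x a. q a x (Y (\<omega> n)) / (\<Sum>k\<in>{1..N} - {n}. q b0 (X (\<omega> k)) (Y (\<omega> n)))"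
  shows "\<exists>\<Psi>\<in>borel_measurable P. (\<forall>\<omega>. 0 \<le> \<Psi> \<omega>) \<and>
    (AE \<omega> in P. \<forall>r\<in>{1..N}. \<forall>a\<in>A.
      \<bar>(\<Sum>n=1..N. V (Y (\<omega> n)) * (raw \<omega> n (X (\<omega> r)) a / (\<Sum>k=1..N. raw \<omega> k (X (\<omega> r)) a)))
         - (LINT y|\<mu>. V y * q a (X (\<omega> r)) y)\<bar> \<le> \<Psi> \<omega>) \<and>
    (\<integral>\<^sup>+\<omega>. ennreal (\<Psi> \<omega>) \<partial>P) \<le> ennreal (16 * B / (\<delta> * N) * chaining_cost \<Lambda> L C j0 J N
      + 2 * B / \<delta> * (\<Lambda> * sqrt N * sqrt (2 * ln (2 * N)) / (real N - 1)))"
proof -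
  interpret PP: product_prob_space "\<lambda>_. T" "{1..N}" ..
  have N1: "1 \<le> N" and Np: "0 < real N" "0 < real N - 1" using N by auto
  define Q where "Q \<phi> b \<Psi> \<longleftrightarrow> \<Psi> \<in> borel_measurable P \<and> (\<forall>\<omega>. 0 \<le> \<Psi> \<omega>) \<and>
    (AE \<omega> in P. \<forall>r\<in>{1..N}. \<forall>a\<in>A. \<bar>\<Sum>n=1..N. \<psi> \<phi> a (\<omega> r) (\<omega> n)\<bar> \<le> \<Psi> \<omega>) \<and>
    (\<integral>\<^sup>+\<omega>. ennreal (\<Psi> \<omega>) \<partial>P) \<le> ennreal (2 * b / \<delta> * chaining_cost \<Lambda> L C j0 J N)" for \<phi> b \<Psi>
  have pb: "\<exists>\<Psi>. Q \<phi> b \<Psi>"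
    if "\<phi> \<in> borel_measurable \<mu>" "0 < b" "\<And>y. y \<in> space \<mu> \<Longrightarrow> \<bar>\<phi> y\<bar> \<le> b" for \<phi> b
    unfolding Q_def P_def Bex_def[symmetric] by (rule process_bound[OF that N1 J C]) assumption+
  obtain \<Psi>V where Q: "Q V B \<Psi>V" using pb V B VB by blast
  have \<Psi>V: "\<Psi>V \<in> borel_measurable P" "\<And>\<omega>. 0 \<le> \<Psi>V \<omega>"
    "AE \<omega> in P. \<forall>r\<in>{1..N}. \<forall>a\<in>A. \<bar>\<Sum>n=1..N. \<psi> V a (\<omega> r) (\<omega> n)\<bar> \<le> \<Psi>V \<omega>"
    "(\<integral>\<^sup>+\<omega>. ennreal (\<Psi>V \<omega>) \<partial>P) \<le> ennreal (2 * B / \<delta> * chaining_cost \<Lambda> L C j0 J N)"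
    using Q unfolding Q_def by simp_all
  obtain \<Psi>1 where Q1: "Q (\<lambda>_. 1) 1 \<Psi>1" using pb[of "\<lambda>_. 1" 1] by auto
  have \<Psi>1: "\<Psi>1 \<in> borel_measurable P" "\<And>\<omega>. 0 \<le> \<Psi>1 \<omega>"
    "AE \<omega> in P. \<forall>r\<in>{1..N}. \<forall>a\<in>A. \<bar>\<Sum>n=1..N. \<psi> (\<lambda>_. 1) a (\<omega> r) (\<omega> n)\<bar> \<le> \<Psi>1 \<omega>"
    "(\<integral>\<^sup>+\<omega>. ennreal (\<Psi>1 \<omega>) \<partial>P) \<le> ennreal (2 * 1 / \<delta> * chaining_cost \<Lambda> L C j0 J N)"
    using Q1 unfolding Q_def by simp_all
  define g where "g z w = q b0 (X w) (Y z) - m (Y z)" for z w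
  \<comment> \<open>Given \<open>Y (\<omega> n)\<close>, the other chains supply independent terms
    with mean \<open>m\<close>. This is where leaving out the chain \<open>n\<close> in the
    denominator matters.\<close>
  define Fd where "Fd \<omega> = Max ((\<lambda>i. \<bar>\<Sum>n\<in>{1..N} - {i}. g (\<omega> i) (\<omega> n)\<bar>) ` {1..N})" for \<omega>
  have I: "finite {1..N}" "{1..N} \<noteq> {}" using N1 by auto
  have g_meas: "(\<lambda>(z, w). g z w) \<in> borel_measurable (T \<Otimes>\<^sub>M T)"
    unfolding g_def split_beta
    by (intro borel_measurable_diff q_meas'[OF b0] measurable_compose[OF measurable_fst] measurable_compose[OF measurable_snd]
        measurable_compose[OF Y m_meas] X Y measurable_compose[OF _ m_meas])
  have g_bound: "AE w in T. \<bar>g z w\<bar> \<le> \<Lambda>" if z: "z \<in> space T" for z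
  proof (rule AE_I2)
    fix w assume w: "w \<in> space T"
    have y: "Y z \<in> space \<mu>" "X w \<in> space \<mu>" using measurable_space[OF Y z] measurable_space[OF X w] by auto
    show "\<bar>g z w\<bar> \<le> \<Lambda>"
      using q_bounds[OF b0 y(2) y(1)] m_bounds[OF y(1)] \<delta> unfolding g_def by linarith
  qed
  have g_mean: "integral\<^sup>L T (g z) = 0" if z: "z \<in> space T" for z
    unfolding g_def using q_integrable[OF measurable_space[OF Y z]] by (simp add: T.prob_space m_def)
  note M = Max_leave_one_out_sums[where g = "\<lambda>_. g" and c = \<Lambda> and r = "\<lambda>i. i", OF T N1 I _ g_meas g_bound \<Lambda>(1) g_mean]
  have Fd: "(\<integral>\<^sup>+\<omega>. ennreal (Fd \<omega>) \<partial>P) \<le> ennreal (\<Lambda> * sqrt N * sqrt (2 * ln (2 * N)))"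
    "Fd \<in> borel_measurable P" "\<And>\<omega>. 0 \<le> Fd \<omega>"
  proof -
    have "(\<integral>\<^sup>+\<omega>. ennreal (Fd \<omega>) \<partial>P) \<le> ennreal (\<Lambda> * sqrt N * sqrt (2 * ln (2 * card {1..N})))"
      unfolding Fd_def P_def by (rule M(1))
    then show "(\<integral>\<^sup>+\<omega>. ennreal (Fd \<omega>) \<partial>P) \<le> ennreal (\<Lambda> * sqrt N * sqrt (2 * ln (2 * N)))" by simp
    show "Fd \<in> borel_measurable P" unfolding Fd_def[abs_def] P_def by (rule M(2))
    show "0 \<le> Fd \<omega>" for \<omega> unfolding Fd_def by (rule M(3))
  qed
  define \<Psi> where "\<Psi> \<omega> = 4 / N * \<Psi>V \<omega> + 4 * B / N * \<Psi>1 \<omega> + 2 * B / \<delta> / (real N - 1) * Fd \<omega>" for \<omega>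
  have meas: "\<Psi> \<in> borel_measurable P"
    unfolding \<Psi>_def using \<Psi>V(1) \<Psi>1(1) Fd(2) by measurable
  have nonneg: "0 \<le> \<Psi> \<omega>" for \<omega>
    unfolding \<Psi>_def using \<Psi>V(2) \<Psi>1(2) Fd(3) B \<delta> Np by simp
  have "AE \<omega> in P. \<forall>n\<in>{1..N}. \<omega> n \<in> space T"
    using PP.AE_component[OF _ AE_space] unfolding P_def by (intro AE_finite_allI) auto
  with \<Psi>V(3) \<Psi>1(3) have AE_bound: "AE \<omega> in P. \<forall>r\<in>{1..N}. \<forall>a\<in>A.
      \<bar>(\<Sum>n=1..N. V (Y (\<omega> n)) * (raw \<omega> n (X (\<omega> r)) a / (\<Sum>k=1..N. raw \<omega> k (X (\<omega> r)) a)))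
         - (LINT y|\<mu>. V y * q a (X (\<omega> r)) y)\<bar> \<le> \<Psi> \<omega>"
  proof eventually_elim
    case (elim \<omega>)
    have \<omega>: "\<omega> n \<in> space T" if "n \<in> {1..N}" for n using elim(3) that by blast
    have XY: "X (\<omega> n) \<in> space \<mu>" "Y (\<omega> n) \<in> space \<mu>" if "n \<in> {1..N}" for n
      using measurable_space[OF X \<omega>[OF that]] measurable_space[OF Y \<omega>[OF that]] by auto
    show ?case
    proof (intro ballI)
      fix r a assume r: "r \<in> {1..N}" and a: "a \<in> A"
      define i where "i = (LINT y|\<mu>. V y * q a (X (\<omega> r)) y)"
      define v where "v n = V (Y (\<omega> n))" for n
      define qq where "qq n = q a (X (\<omega> r)) (Y (\<omega> n))" for n
      define mm where "mm n = m (Y (\<omega> n))" for n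
      \<comment> \<open>The leave-one-out sum becomes an average over its \<open>N - 1\<close>
        terms, comparable with \<open>m\<close>; the factor cancels in the normalised
        weights.\<close>
      define m' where "m' n = (\<Sum>k\<in>{1..N} - {n}. q b0 (X (\<omega> k)) (Y (\<omega> n))) / (real N - 1)" for n
      have i_bound: "\<bar>i\<bar> \<le> B"
      proof -
        have qint: "integrable \<mu> (\<lambda>y. q a (X (\<omega> r)) y)"
          using q_int[OF a XY(1)[OF r]] by (metis not_integrable_integral_eq zero_neq_one)
        have dom: "AE y in \<mu>. \<bar>V y * q a (X (\<omega> r)) y\<bar> \<le> B * q a (X (\<omega> r)) y"
        proof (rule AE_I2)
          fix y assume y: "y \<in> space \<mu>"
          have "0 \<le> q a (X (\<omega> r)) y" using q_bounds[OF a XY(1)[OF r] y] \<delta> by linarith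
          then show "\<bar>V y * q a (X (\<omega> r)) y\<bar> \<le> B * q a (X (\<omega> r)) y"
            unfolding abs_mult using VB[OF y] by (simp add: mult_right_mono)
        qed
        have "\<bar>i\<bar> \<le> (LINT y|\<mu>. \<bar>V y * q a (X (\<omega> r)) y\<bar>)" unfolding i_def by (rule integral_abs_bound)
        moreover have "(LINT y|\<mu>. \<bar>V y * q a (X (\<omega> r)) y\<bar>) \<le> (LINT y|\<mu>. B * q a (X (\<omega> r)) y)"
        proof (rule integral_mono_AE'[OF integrable_mult_right[OF qint] dom])
          show "AE y in \<mu>. 0 \<le> B * q a (X (\<omega> r)) y" using dom by (rule eventually_mono) linarith
        qed
        moreover have "(LINT y|\<mu>. B * q a (X (\<omega> r)) y) = B" using q_int[OF a XY(1)[OF r]] by simp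
        ultimately show ?thesis by linarith
      qed
      have card: "real (card ({1..N} - {n})) = real N - 1" if "n \<in> {1..N}" for n
        using that N1 by (simp add: card_Diff_singleton of_nat_diff)
      have m'_pos: "0 < m' n" if n: "n \<in> {1..N}" for n
      proof -
        have "0 < (\<Sum>k\<in>{1..N} - {n}. q b0 (X (\<omega> k)) (Y (\<omega> n)))"
        proof (rule sum_pos)
          show "{1..N} - {n} \<noteq> {}" using card[OF n] Np(2) by (metis card.empty of_nat_0 less_irrefl)
          show "0 < q b0 (X (\<omega> k)) (Y (\<omega> n))" if "k \<in> {1..N} - {n}" for k
            using q_bounds[OF b0 XY(1) XY(2)[OF n], of k] that \<delta> by auto
        qed simp
        then show ?thesis using Np by (simp add: m'_def)
      qed
      have m'_mm: "\<bar>m' n - mm n\<bar> \<le> Fd \<omega> / (real N - 1)" if n: "n \<in> {1..N}" for n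
      proof -
        have "(\<Sum>k\<in>{1..N} - {n}. g (\<omega> n) (\<omega> k)) = (\<Sum>k\<in>{1..N} - {n}. q b0 (X (\<omega> k)) (Y (\<omega> n))) - (real N - 1) * mm n"
          unfolding g_def sum_subtractf mm_def using card[OF n] by simp
        then have "m' n - mm n = (\<Sum>k\<in>{1..N} - {n}. g (\<omega> n) (\<omega> k)) / (real N - 1)"
          using Np unfolding m'_def by (simp add: diff_divide_distrib)
        moreover have "\<bar>\<Sum>k\<in>{1..N} - {n}. g (\<omega> n) (\<omega> k)\<bar> \<le> Fd \<omega>"
          unfolding Fd_def using n by (intro Max_ge) auto
        ultimately show ?thesis using Np by (simp add: divide_right_mono)
      qed
      have raw_eq: "raw \<omega> n (X (\<omega> r)) a = qq n / m' n / (real N - 1)" for n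
        using Np by (simp add: raw_def qq_def m'_def)
      have w_eq: "raw \<omega> n (X (\<omega> r)) a / (\<Sum>k=1..N. raw \<omega> k (X (\<omega> r)) a) = qq n / m' n / (\<Sum>k=1..N. qq k / m' k)" for n
        unfolding raw_eq sum_divide_distrib[symmetric] using Np by simp
      have "\<bar>(\<Sum>n=1..N. v n * (qq n / m' n / (\<Sum>k=1..N. qq k / m' k))) - i\<bar> \<le>
        4 * \<bar>(\<Sum>n=1..N. v n * qq n / mm n - i) / N\<bar> + 4 * B * \<bar>(\<Sum>n=1..N. qq n / mm n - 1) / N\<bar> + 2 * B * (Fd \<omega> / (real N - 1)) / \<delta>"
      proof (rule self_normalised_weights_error[OF N1 _ i_bound _ _ m'_pos \<delta> m'_mm])
        fix n assume n: "n \<in> {1..N}"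
        show "\<bar>v n\<bar> \<le> B" unfolding v_def by (rule VB[OF XY(2)[OF n]])
        show "0 < qq n" using q_bounds[OF a XY(1)[OF r] XY(2)[OF n]] \<delta> unfolding qq_def by linarith
        show "\<delta> \<le> mm n" using m_bounds[OF XY(2)[OF n]] unfolding mm_def by simp
      qed
      also have "(\<Sum>n=1..N. v n * qq n / mm n - i) = (\<Sum>n=1..N. \<psi> V a (\<omega> r) (\<omega> n))"
        by (simp add: \<psi>_def v_def qq_def mm_def i_def)
      also have "(\<Sum>n=1..N. qq n / mm n - 1) = (\<Sum>n=1..N. \<psi> (\<lambda>_. 1) a (\<omega> r) (\<omega> n))"
        using q_int[OF a XY(1)[OF r]] by (simp add: \<psi>_def qq_def mm_def)
      finally have main: "\<bar>(\<Sum>n=1..N. v n * (qq n / m' n / (\<Sum>k=1..N. qq k / m' k))) - i\<bar> \<le>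
        4 * \<bar>(\<Sum>n=1..N. \<psi> V a (\<omega> r) (\<omega> n)) / N\<bar> + 4 * B * \<bar>(\<Sum>n=1..N. \<psi> (\<lambda>_. 1) a (\<omega> r) (\<omega> n)) / N\<bar>
        + 2 * B * (Fd \<omega> / (real N - 1)) / \<delta>" .
      have "4 * \<bar>(\<Sum>n=1..N. \<psi> V a (\<omega> r) (\<omega> n)) / N\<bar> \<le> 4 / N * \<Psi>V \<omega>"
        using elim(1) r a Np by (simp add: divide_right_mono)
      moreover have "4 * B * \<bar>(\<Sum>n=1..N. \<psi> (\<lambda>_. 1) a (\<omega> r) (\<omega> n)) / N\<bar> \<le> 4 * B / N * \<Psi>1 \<omega>"
      proof -
        have "4 * B / N * \<bar>\<Sum>n=1..N. \<psi> (\<lambda>_. 1) a (\<omega> r) (\<omega> n)\<bar> \<le> 4 * B / N * \<Psi>1 \<omega>"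
          using elim(2) r a Np B by (intro mult_left_mono) auto
        then show ?thesis using Np by (simp add: abs_div_pos[symmetric])
      qed
      moreover have "2 * B * (Fd \<omega> / (real N - 1)) / \<delta> = 2 * B / \<delta> / (real N - 1) * Fd \<omega>" by simp
      ultimately have "\<bar>(\<Sum>n=1..N. v n * (qq n / m' n / (\<Sum>k=1..N. qq k / m' k))) - i\<bar> \<le> \<Psi> \<omega>"
        using main unfolding \<Psi>_def by linarith
      then show "\<bar>(\<Sum>n=1..N. V (Y (\<omega> n)) * (raw \<omega> n (X (\<omega> r)) a / (\<Sum>k=1..N. raw \<omega> k (X (\<omega> r)) a)))
         - (LINT y|\<mu>. V y * q a (X (\<omega> r)) y)\<bar> \<le> \<Psi> \<omega>"
        unfolding w_eq v_def i_def .
    qed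
  qed
  define cc where "cc = chaining_cost \<Lambda> L C j0 J N"
  define f where "f = \<Lambda> * sqrt N * sqrt (2 * ln (2 * N))"
  have f0: "0 \<le> f" using \<Lambda> N1 by (simp add: f_def)
  have cc0: "0 \<le> cc"
    unfolding cc_def using \<Lambda> L N1 C(1,2) by (intro chaining_cost_nonneg) auto
  have "(\<integral>\<^sup>+\<omega>. ennreal (\<Psi> \<omega>) \<partial>P) = (\<integral>\<^sup>+\<omega>. ennreal (4 / N) * ennreal (\<Psi>V \<omega>) + ennreal (4 * B / N) * ennreal (\<Psi>1 \<omega>)
      + ennreal (2 * B / \<delta> / (real N - 1)) * ennreal (Fd \<omega>) \<partial>P)"
    unfolding \<Psi>_def using \<Psi>V(2) \<Psi>1(2) Fd(3) B \<delta> Np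
    by (intro nn_integral_cong) (simp add: ennreal_mult[symmetric] ennreal_plus[symmetric] del: ennreal_plus)
  also have "\<dots> = ennreal (4 / N) * (\<integral>\<^sup>+\<omega>. ennreal (\<Psi>V \<omega>) \<partial>P) + ennreal (4 * B / N) * (\<integral>\<^sup>+\<omega>. ennreal (\<Psi>1 \<omega>) \<partial>P)
      + ennreal (2 * B / \<delta> / (real N - 1)) * (\<integral>\<^sup>+\<omega>. ennreal (Fd \<omega>) \<partial>P)"
    using \<Psi>V(1) \<Psi>1(1) Fd(2) by (simp add: nn_integral_add nn_integral_cmult)
  also have "\<dots> \<le> ennreal (4 / N) * ennreal (2 * B / \<delta> * cc) + ennreal (4 * B / N) * ennreal (2 * 1 / \<delta> * cc)
      + ennreal (2 * B / \<delta> / (real N - 1)) * ennreal f"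
    using \<Psi>V(4) \<Psi>1(4) Fd(1) unfolding cc_def f_def by (intro add_mono mult_left_mono) auto
  also have "\<dots> = ennreal (4 / N * (2 * B / \<delta> * cc) + 4 * B / N * (2 * 1 / \<delta> * cc) + 2 * B / \<delta> / (real N - 1) * f)"
    using B \<delta> Np cc0 f0 by (simp add: ennreal_mult[symmetric] ennreal_plus[symmetric] del: ennreal_plus)
  also have "4 / N * (2 * B / \<delta> * cc) + 4 * B / N * (2 * 1 / \<delta> * cc) + 2 * B / \<delta> / (real N - 1) * f =
      16 * B / (\<delta> * N) * cc + 2 * B / \<delta> * (f / (real N - 1))"
    by (simp add: mult.commute)
  finally show ?thesis using meas nonneg AE_bound unfolding cc_def f_def by (intro bexI[of _ \<Psi>] conjI allI)
qed

end

section \<open>Error of the mesh\<close>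

lemma SUP_diff_le:
  fixes f g :: "'a \<Rightarrow> real"
  assumes A: "A \<noteq> {}" and g: "\<And>a. a \<in> A \<Longrightarrow> \<bar>g a\<bar> \<le> K" and d: "\<And>a. a \<in> A \<Longrightarrow> \<bar>f a - g a\<bar> \<le> e"
  shows "\<bar>(SUP a\<in>A. f a) - (SUP a\<in>A. g a)\<bar> \<le> e"
proof -
  have bg: "bdd_above (g ` A)"
  proof (rule bdd_aboveI2)
    fix a assume "a \<in> A" then show "g a \<le> K" using g[of a] by linarith
  qed
  have bf: "bdd_above (f ` A)"
  proof (rule bdd_aboveI2)
    fix a assume "a \<in> A" then show "f a \<le> K + e" using g[of a] d[of a] by linarith
  qed
  have "(SUP a\<in>A. f a) \<le> (SUP a\<in>A. g a) + e"
  proof (rule cSUP_least[OF A])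
    fix a assume a: "a \<in> A"
    show "f a \<le> (SUP a\<in>A. g a) + e" using cSUP_upper[OF a bg] d[OF a] by linarith
  qed
  moreover have "(SUP a\<in>A. g a) \<le> (SUP a\<in>A. f a) + e"
  proof (rule cSUP_least[OF A])
    fix a assume a: "a \<in> A"
    show "g a \<le> (SUP a\<in>A. f a) + e" using cSUP_upper[OF a bf] d[OF a] by linarith
  qed
  ultimately show ?thesis by linarith
qed

lemma (in markov_mdp) AE_traj_initial:
  assumes x: "x \<in> space (base M)" "{x} \<in> sets (base M)" and \<pi>: "\<pi> \<in> policies M" and n: "n \<le> horizon M"
  shows "AE \<omega> in traj M x \<pi> n. fst \<omega> 0 = x"
proof -
  have ind: "(indicator (space (base M) - {x}) :: _ \<Rightarrow> ennreal) \<in> borel_measurable (base M)" using x by simp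
  have "(\<integral>\<^sup>+\<omega>. indicator (space (base M) - {x}) (fst \<omega> 0) \<partial>traj M x \<pi> n) =
      (\<integral>\<^sup>+\<omega>. indicator (space (base M) - {x}) (fst \<omega> 0) \<partial>traj M x \<pi> 0)"
    using n by (intro nn_integral_traj_state[OF x(1) \<pi> _ _ ind]) auto
  also have "\<dots> = 0"
  proof -
    have "(\<lambda>\<omega>. indicator (space (base M) - {x}) (fst \<omega> 0) :: ennreal) \<in> borel_measurable (hist M 0)"
      by (rule measurable_compose[OF measurable_hist_state ind]) simp
    then show ?thesis using initial_hist[OF x(1)] by (simp add: nn_integral_return)
  qed
  finally have "(\<integral>\<^sup>+\<omega>. indicator (space (base M) - {x}) (fst \<omega> 0) \<partial>traj M x \<pi> n) = 0" .
  moreover have "(\<lambda>\<omega>. indicator (space (base M) - {x}) (fst \<omega> 0) :: ennreal) \<in> borel_measurable (traj M x \<pi> n)"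
    unfolding measurable_cong_sets[OF sets_traj[OF x(1) \<pi> n] refl]
    by (rule measurable_compose[OF measurable_hist_state ind]) simp
  ultimately have "AE \<omega> in traj M x \<pi> n. (indicator (space (base M) - {x}) (fst \<omega> 0) :: ennreal) = 0"
    by (subst (asm) nn_integral_0_iff_AE)
  then show ?thesis using AE_space
  proof eventually_elim
    case (elim \<omega>)
    then have "fst \<omega> 0 \<in> space (base M)"
      using measurable_space[OF measurable_hist_state[of 0 n]] space_traj[OF x(1) \<pi> n] by auto
    then show ?case using elim(1) by (simp add: indicator_def split: if_splits)
  qed
qed

section \<open>From the error of one step to the L1 error of the algorithm\<close>

context
  fixes d :: nat and H :: nat and G :: real and M :: "(rvec, rvec) mdp" and \<rho> :: "rvec \<Rightarrow> rvec \<Rightarrow> real"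
    and D :: "rvec set" and x :: rvec and b :: "nat \<Rightarrow> rvec" and \<delta> \<Lambda> L :: real
  assumes EM: "euclidean_mdp d H G M \<rho>" and D: "0 < measure (leb d) D" and x: "x \<in> D"
    and b: "\<And>h. h < H \<Longrightarrow> b h \<in> space (act M)"
    and \<delta>: "0 < \<delta>" and L: "0 < L"
    and bounds: "\<And>h a s y. h \<in> {1..H} \<Longrightarrow> a \<in> space (act M) \<Longrightarrow> s \<in> D \<Longrightarrow> y \<in> D \<Longrightarrow>
      \<delta> \<le> dens (reflect D M) h a y s \<and> dens (reflect D M) h a y s \<le> \<Lambda>"
    and Lip: "\<And>h. h \<in> {1..H} \<Longrightarrow> AE y in restrict_space (leb d) D. \<forall>s\<in>D. \<forall>a\<in>space (act M). \<forall>a'\<in>space (act M).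
      \<bar>dens (reflect D M) h a y s - dens (reflect D M) h a' y s\<bar> \<le> L * \<rho> a a'"
begin

interpretation R: markov_mdp "reflect D M" by (rule markov_reflected[OF EM D x])

lemmas mdp_facts_reflected = euclidean_mdpD[OF EM]

private abbreviation "\<mu> \<equiv> restrict_space (leb d) D"

private abbreviation "trj \<equiv> traj (reflect D M) x (\<lambda>t _. return (act (reflect D M)) (b t)) (horizon (reflect D M))"

definition chain_law :: "(nat \<Rightarrow> rvec) measure" where
  "chain_law = distr trj (PiM {..H} (\<lambda>_. \<mu>)) fst"

lemma base_reflect: "base (reflect D M) = \<mu>" "act (reflect D M) = act M" "horizon (reflect D M) = H"
  by (simp_all add: reflect_simps mdp_facts_reflected)

lemma mesh_law_eq: "mesh_law (reflect D M) b x N = PiM {1..N} (\<lambda>_. chain_law)"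
  unfolding mesh_law_def chain_law_def base_reflect by simp

lemma \<mu>_space: "space \<mu> = D" and \<mu>_finite: "finite_measure \<mu>"
  using restrict_leb[OF D] by simp_all

lemma x_base: "x \<in> space (base (reflect D M))" "{x} \<in> sets (base (reflect D M))"
proof -
  show "x \<in> space (base (reflect D M))" using x by (simp add: base_reflect \<mu>_space)
  have xs: "x \<in> space (leb d)" using x restrict_leb(3)[OF D] by (rule subsetD[rotated])
  have "{x} = D \<inter> {x}" using x by simp
  then show "{x} \<in> sets (base (reflect D M))"
    unfolding base_reflect sets_restrict_space using singleton_sets_leb[OF xs] by (rule image_eqI)
qed

lemma mesh_policy: "(\<lambda>t _. return (act (reflect D M)) (b t)) \<in> policies (reflect D M)"
  using b by (intro R.const_policy) (simp add: base_reflect)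

lemma fst_traj: "fst \<in> trj \<rightarrow>\<^sub>M PiM {..H} (\<lambda>_. \<mu>)"
  unfolding measurable_cong_sets[OF R.sets_traj[OF x_base(1) mesh_policy order_refl] refl]
  unfolding hist_def base_reflect by (rule measurable_fst)

lemma chain_prob: "prob_space chain_law"
proof -
  interpret P: prob_space trj by (rule R.prob_space_traj[OF x_base(1) mesh_policy order_refl])
  show ?thesis unfolding chain_law_def by (rule P.prob_space_distr[OF fst_traj])
qed

lemma chain_component: "h \<le> H \<Longrightarrow> (\<lambda>c. c h) \<in> chain_law \<rightarrow>\<^sub>M \<mu>"
  unfolding chain_law_def measurable_distr_eq1 by (rule measurable_component_singleton) simp

text \<open>The sample is a whole chain, observed at two successive times. The identity
  \<open>law\<close> is the mixture formula for fixed controls, carried from the trajectories to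
  their state component.\<close>

lemma importance_step_mesh:
  assumes h: "h < H"
  shows "importance_step chain_law \<mu> (\<lambda>c. c h) (\<lambda>c. c (Suc h)) (\<lambda>a s y. dens (reflect D M) (Suc h) a y s)
    (space (act M)) (b h) \<rho> \<delta> \<Lambda> L"
proof (rule importance_step.intro[OF chain_prob \<mu>_finite])
  have hh: "Suc h \<in> {1..horizon (reflect D M)}" "Suc h \<in> {1..H}" using h by (auto simp: base_reflect)
  show X: "(\<lambda>c. c h) \<in> chain_law \<rightarrow>\<^sub>M \<mu>" and Y: "(\<lambda>c. c (Suc h)) \<in> chain_law \<rightarrow>\<^sub>M \<mu>"
    using h by (auto intro!: chain_component)
  show "(\<lambda>(s, y). dens (reflect D M) (Suc h) a y s) \<in> borel_measurable (\<mu> \<Otimes>\<^sub>M \<mu>)" if a: "a \<in> space (act M)" for a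
    unfolding split_beta
    by (rule R.dens_measurable'[OF hh(1)]) (use a in \<open>simp_all add: base_reflect\<close>)
  show "b h \<in> space (act M)" by (rule b[OF h])
  show "\<delta> \<le> dens (reflect D M) (Suc h) a y s \<and> dens (reflect D M) (Suc h) a y s \<le> \<Lambda>"
    if "a \<in> space (act M)" "s \<in> space \<mu>" "y \<in> space \<mu>" for a s y
    using that unfolding \<mu>_space by (rule bounds[OF hh(2)])
  show "(LINT y|\<mu>. dens (reflect D M) (Suc h) a y s) = 1" if "a \<in> space (act M)" "s \<in> space \<mu>" for a s
    using R.integrable_dens(2)[OF hh(1), of s a] that by (simp add: base_reflect)
  show "AE y in \<mu>. \<forall>s\<in>space \<mu>. \<forall>a\<in>space (act M). \<forall>a'\<in>space (act M).
      \<bar>dens (reflect D M) (Suc h) a y s - dens (reflect D M) (Suc h) a' y s\<bar> \<le> L * \<rho> a a'"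
    unfolding \<mu>_space by (rule Lip[OF hh(2)])
  interpret T: prob_space chain_law by (rule chain_prob)
  have dm: "(\<lambda>c. dens (reflect D M) (Suc h) (b h) y (c h)) \<in> borel_measurable chain_law" if "y \<in> D" for y
    by (rule R.dens_measurable'[OF hh(1)]) (use X b[OF h] that in \<open>simp_all add: base_reflect \<mu>_space\<close>)
  show "distr chain_law \<mu> (\<lambda>c. c (Suc h)) = density \<mu> (\<lambda>y. ennreal (LINT c|chain_law. dens (reflect D M) (Suc h) (b h) y (c h)))"
  proof (rule measure_eqI)
    fix E assume "E \<in> sets (distr chain_law \<mu> (\<lambda>c. c (Suc h)))"
    then have Em: "E \<in> sets \<mu>" by simp
    have ind: "(indicator E :: _ \<Rightarrow> ennreal) \<in> borel_measurable (base (reflect D M))"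
      using Em by (simp add: base_reflect)
    have ind': "(\<lambda>c. indicator E (c (Suc h)) :: ennreal) \<in> borel_measurable (PiM {..H} (\<lambda>_. \<mu>))"
      using h Em by (intro measurable_compose[OF measurable_component_singleton]) auto
    have inner: "(\<integral>\<^sup>+\<omega>. ennreal (dens (reflect D M) (Suc h) (b h) y (fst \<omega> h)) \<partial>trj) =
      ennreal (LINT c|chain_law. dens (reflect D M) (Suc h) (b h) y (c h))" if y: "y \<in> D" for y
    proof -
      have bd: "\<delta> \<le> dens (reflect D M) (Suc h) (b h) y (c h) \<and> dens (reflect D M) (Suc h) (b h) y (c h) \<le> \<Lambda>"
        if "c \<in> space chain_law" for c
        using measurable_space[OF X that] y by (intro bounds[OF hh(2) b[OF h]]) (simp_all add: \<mu>_space)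
      have int: "integrable chain_law (\<lambda>c. dens (reflect D M) (Suc h) (b h) y (c h))"
      proof (rule T.integrable_const_bound[of _ \<Lambda>])
        show "AE c in chain_law. norm (dens (reflect D M) (Suc h) (b h) y (c h)) \<le> \<Lambda>"
        proof (rule AE_I2)
          fix c assume "c \<in> space chain_law"
          from bd[OF this] \<delta> show "norm (dens (reflect D M) (Suc h) (b h) y (c h)) \<le> \<Lambda>"
            unfolding real_norm_def by linarith
        qed
      qed (rule dm[OF y])
      have nonneg: "AE c in chain_law. 0 \<le> dens (reflect D M) (Suc h) (b h) y (c h)"
      proof (rule AE_I2)
        fix c assume "c \<in> space chain_law"
        from bd[OF this] \<delta> show "0 \<le> dens (reflect D M) (Suc h) (b h) y (c h)" by linarith
      qed
      have "(\<integral>\<^sup>+\<omega>. ennreal (dens (reflect D M) (Suc h) (b h) y (fst \<omega> h)) \<partial>trj) =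
        (\<integral>\<^sup>+c. ennreal (dens (reflect D M) (Suc h) (b h) y (c h)) \<partial>chain_law)"
        unfolding chain_law_def
        by (rule nn_integral_distr[OF fst_traj, symmetric])
          (use dm[OF y] in \<open>simp add: chain_law_def measurable_distr_eq1\<close>)
      also have "\<dots> = ennreal (LINT c|chain_law. dens (reflect D M) (Suc h) (b h) y (c h))"
        by (rule nn_integral_eq_integral[OF int nonneg])
      finally show ?thesis .
    qed
    have "emeasure (distr chain_law \<mu> (\<lambda>c. c (Suc h))) E = (\<integral>\<^sup>+c. indicator E (c (Suc h)) \<partial>chain_law)"
      using Em Y nn_integral_distr[OF Y, of "indicator E"] by simp
    also have "\<dots> = (\<integral>\<^sup>+\<omega>. indicator E (fst \<omega> (Suc h)) \<partial>trj)"
      unfolding chain_law_def by (rule nn_integral_distr[OF fst_traj]) (simp add: measurable_distr_eq1 ind')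
    also have "\<dots> = (\<integral>\<^sup>+y. (\<integral>\<^sup>+\<omega>. ennreal (dens (reflect D M) (Suc h) (b h) y (fst \<omega> h)) \<partial>trj) * indicator E y \<partial>base (reflect D M))"
      using h b by (intro R.nn_integral_traj_const_policy[OF x_base(1) _ _ ind]) (simp_all add: base_reflect)
    also have "\<dots> = (\<integral>\<^sup>+y. ennreal (LINT c|chain_law. dens (reflect D M) (Suc h) (b h) y (c h)) * indicator E y \<partial>\<mu>)"
      unfolding base_reflect(1) by (intro nn_integral_cong) (simp add: inner \<mu>_space)
    also have "\<dots> = emeasure (density \<mu> (\<lambda>y. ennreal (LINT c|chain_law. dens (reflect D M) (Suc h) (b h) y (c h)))) E"
    proof (rule emeasure_density[OF _ Em, symmetric])
      have "(\<lambda>(y, c). dens (reflect D M) (Suc h) (b h) y (c h)) \<in> borel_measurable (\<mu> \<Otimes>\<^sub>M chain_law)"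
        unfolding split_beta
        by (rule R.dens_measurable'[OF hh(1)])
          (use X b[OF h] in \<open>simp_all add: base_reflect measurable_compose[OF measurable_snd X]\<close>)
      then show "(\<lambda>y. ennreal (LINT c|chain_law. dens (reflect D M) (Suc h) (b h) y (c h))) \<in> borel_measurable \<mu>"
        by (intro measurable_compose[OF _ measurable_ennreal] T.borel_measurable_lebesgue_integral)
    qed
    finally show "emeasure (distr chain_law \<mu> (\<lambda>c. c (Suc h))) E = \<dots>" .
  qed simp
qed (use \<delta> L in simp_all)

lemma chain_start: "AE c in chain_law. c 0 = x"
proof -
  have "AE \<omega> in trj. fst \<omega> 0 \<in> {x}"
    using R.AE_traj_initial[OF x_base mesh_policy order_refl] by simp
  moreover have "{c \<in> space (PiM {..H} (\<lambda>_. \<mu>)). c 0 \<in> {x}} \<in> sets (PiM {..H} (\<lambda>_. \<mu>))"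
  proof -
    have "(\<lambda>c. c 0) -` {x} \<inter> space (PiM {..H} (\<lambda>_. \<mu>)) \<in> sets (PiM {..H} (\<lambda>_. \<mu>))"
      using x_base(2) unfolding base_reflect by (intro measurable_sets[OF measurable_component_singleton]) auto
    moreover have "(\<lambda>c. c 0) -` {x} \<inter> space (PiM {..H} (\<lambda>_. \<mu>)) = {c \<in> space (PiM {..H} (\<lambda>_. \<mu>)). c 0 \<in> {x}}"
      by blast
    ultimately show ?thesis by simp
  qed
  ultimately have "AE c in chain_law. c 0 \<in> {x}"
    unfolding chain_law_def by (subst AE_distr_iff[OF fst_traj])
  then show ?thesis by simp
qed

text \<open>A pathwise backward induction. The weights are nonnegative and sum to one and a supremum
  over actions is 1-Lipschitz, so errors from later times are handed down without amplification and
  the one-step errors simply add up.\<close>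

lemma mesh_recursion_error:
  fixes S :: "nat \<Rightarrow> nat \<Rightarrow> rvec" and \<Psi> :: "nat \<Rightarrow> real"
  assumes N: "2 \<le> N" and V: "dp_values M D x G V"
    and S: "\<And>n h. n \<in> {1..N} \<Longrightarrow> h \<le> H \<Longrightarrow> S n h \<in> D"
    and good: "\<And>n h. n \<in> {1..N} \<Longrightarrow> h < H \<Longrightarrow> V h (S n h) = (SUP a\<in>space (act M). bellman M D h (V (Suc h)) (S n h) a)"
    and step: "\<And>h r a. h < H \<Longrightarrow> r \<in> {1..N} \<Longrightarrow> a \<in> space (act M) \<Longrightarrow>
      \<bar>(\<Sum>n=1..N. V (Suc h) (S n (Suc h)) * weight (reflect D M) b N S h n (S r h) a)
        - (LINT y|\<mu>. V (Suc h) y * dens (reflect D M) (Suc h) a y (S r h))\<bar> \<le> \<Psi> h"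
    and k: "k \<le> H" and r: "r \<in> {1..N}"
  shows "\<bar>mesh_value (reflect D M) b N S k (S r (H - k)) - V (H - k) (S r (H - k))\<bar> \<le> (\<Sum>h\<in>{H - k..<H}. \<Psi> h)"
  using k r
proof (induction k arbitrary: r)
  case 0
  then show ?case using V by (simp add: dp_values_def mdp_facts_reflected(2) reflect_simps)
next
  case (Suc k)
  define h where "h = H - Suc k"
  have h: "h < H" "H - k = Suc h" "k \<le> H" using Suc.prems by (auto simp: h_def)
  have hh: "Suc h \<in> {1..H}" using h by auto
  define e where "e = (\<Sum>h\<in>{Suc h..<H}. \<Psi> h)"
  have IH: "\<bar>mesh_value (reflect D M) b N S k (S n (Suc h)) - V (Suc h) (S n (Suc h))\<bar> \<le> e" if "n \<in> {1..N}" for n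
    using Suc.IH[OF h(3) that] unfolding h(2) e_def .
  let ?x = "S r h"
  have xD: "?x \<in> D" using S[OF Suc.prems(2)] h by simp
  have Vb: "\<And>s. s \<in> D \<Longrightarrow> \<bar>V (Suc h) s\<bar> \<le> G * (real H + 1 - real (Suc h))" "V (Suc h) \<in> borel_measurable \<mu>"
    using V Suc_leI[OF h(1)] unfolding dp_values_def mdp_facts_reflected(1,2) by blast+
  have "\<bar>(SUP a\<in>space (act M). reward M h ?x a + (\<Sum>n=1..N. mesh_value (reflect D M) b N S k (S n (Suc h)) * weight (reflect D M) b N S h n ?x a))
      - (SUP a\<in>space (act M). bellman M D h (V (Suc h)) ?x a)\<bar> \<le> e + \<Psi> h"
  proof (rule SUP_diff_le[OF mdp_facts_reflected(3)])
    fix a assume a: "a \<in> space (act M)"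
    show "\<bar>bellman M D h (V (Suc h)) ?x a\<bar> \<le> G + G * (real H + 1 - real (Suc h))"
      by (rule bellman_bound[OF EM D x h(1) Vb(2) Vb(1) xD a])
    define w where "w n = weight (reflect D M) b N S h n ?x a" for n
    have raw_pos: "0 < raw_weight (reflect D M) b N S h n ?x a" if n: "n \<in> {1..N}" for n
      unfolding raw_weight_def
    proof (rule divide_pos_pos)
      have Sn: "S n (Suc h) \<in> D" using S[OF n] h by simp
      show "0 < dens (reflect D M) (Suc h) a (S n (Suc h)) ?x"
        using bounds[OF hh a xD Sn] \<delta> by linarith
      show "0 < (\<Sum>k\<in>{1..N} - {n}. dens (reflect D M) (Suc h) (b h) (S n (Suc h)) (S k h))"
      proof (rule sum_pos)
        \<comment> \<open>\<open>2 \<le> N\<close> provides an index other than \<open>n\<close>, so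
          the leave-one-out sum is not empty.\<close>
        have "(if n = 1 then 2 else 1) \<in> {1..N} - {n}" using N by auto
        then show "{1..N} - {n} \<noteq> {}" by blast
        fix k assume "k \<in> {1..N} - {n}"
        then have "S k h \<in> D" using S h by simp
        from bounds[OF hh b[OF h(1)] this Sn] \<delta>
        show "0 < dens (reflect D M) (Suc h) (b h) (S n (Suc h)) (S k h)" by linarith
      qed simp
    qed
    have sum_pos: "0 < (\<Sum>n=1..N. raw_weight (reflect D M) b N S h n ?x a)"
      using N raw_pos by (intro sum_pos) auto
    have w_nonneg: "0 \<le> w n" if "n \<in> {1..N}" for n
      unfolding w_def weight_def using raw_pos[OF that] sum_pos by simp
    have w_sum: "(\<Sum>n=1..N. w n) = 1"
      unfolding w_def weight_def sum_divide_distrib[symmetric] using sum_pos by simp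
    have "\<bar>\<Sum>n=1..N. (mesh_value (reflect D M) b N S k (S n (Suc h)) - V (Suc h) (S n (Suc h))) * w n\<bar> \<le>
      (\<Sum>n=1..N. \<bar>(mesh_value (reflect D M) b N S k (S n (Suc h)) - V (Suc h) (S n (Suc h))) * w n\<bar>)" by (rule sum_abs)
    also have "\<dots> \<le> (\<Sum>n=1..N. e * w n)"
    proof (rule sum_mono)
      fix n assume n: "n \<in> {1..N}"
      show "\<bar>(mesh_value (reflect D M) b N S k (S n (Suc h)) - V (Suc h) (S n (Suc h))) * w n\<bar> \<le> e * w n"
        unfolding abs_mult using mult_right_mono[OF IH[OF n] w_nonneg[OF n]] w_nonneg[OF n] by simp
    qed
    also have "\<dots> = e" using w_sum by (simp add: sum_distrib_left[symmetric])
    finally have d1: "\<bar>\<Sum>n=1..N. (mesh_value (reflect D M) b N S k (S n (Suc h)) - V (Suc h) (S n (Suc h))) * w n\<bar> \<le> e" .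
    have d2: "(\<Sum>n=1..N. (mesh_value (reflect D M) b N S k (S n (Suc h)) - V (Suc h) (S n (Suc h))) * w n) =
      (\<Sum>n=1..N. mesh_value (reflect D M) b N S k (S n (Suc h)) * w n) - (\<Sum>n=1..N. V (Suc h) (S n (Suc h)) * w n)"
      by (simp add: left_diff_distrib sum_subtractf)
    have d3: "bellman M D h (V (Suc h)) ?x a = reward M h ?x a + (LINT y|\<mu>. V (Suc h) y * dens (reflect D M) (Suc h) a y ?x)"
      unfolding bellman_def mdp_facts_reflected(1) by (simp add: mult.commute)
    show "\<bar>(reward M h ?x a + (\<Sum>n=1..N. mesh_value (reflect D M) b N S k (S n (Suc h)) * weight (reflect D M) b N S h n ?x a))
      - bellman M D h (V (Suc h)) ?x a\<bar> \<le> e + \<Psi> h"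
      using step[OF h(1) Suc.prems(2) a] d1[unfolded d2] unfolding d3 w_def by linarith
  qed
  moreover have "(\<Sum>h\<in>{H - Suc k..<H}. \<Psi> h) = e + \<Psi> h"
    using h(1) unfolding e_def h_def[symmetric] by (simp add: sum.atLeast_Suc_lessThan)
  moreover have "mesh_value (reflect D M) b N S (Suc k) ?x =
    (SUP a\<in>space (act M). reward M h ?x a + (\<Sum>n=1..N. mesh_value (reflect D M) b N S k (S n (Suc h)) * weight (reflect D M) b N S h n ?x a))"
    by (simp add: Let_def reflect_simps mdp_facts_reflected(2) h_def[symmetric])
  moreover have "V h ?x = (SUP a\<in>space (act M). bellman M D h (V (Suc h)) ?x a)"
    by (rule good[OF Suc.prems(2) h(1)])
  ultimately show ?case unfolding h_def[symmetric] by simp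
qed

text \<open>One step error for each of the \<open>H\<close> steps plus the truncation error. The
  \<open>+ 1\<close> in \<open>B\<close> keeps it positive for \<open>G = 0\<close>. The mesh value
  is not known to be measurable, so its error is integrated through an almost sure measurable
  majorant.\<close>

theorem mesh_error_le:
  fixes C :: "nat \<Rightarrow> rvec set" and N j0 J :: nat
  assumes H: "1 \<le> H" and N: "2 \<le> N" and J: "j0 \<le> J"
    and C: "\<And>j. finite (C j)" "\<And>j. C j \<noteq> {}" "\<And>j. C j \<subseteq> space (act M)"
      "\<And>j a. a \<in> space (act M) \<Longrightarrow> \<exists>c\<in>C j. \<rho> a c \<le> (1 / 2) ^ j"
  defines "B \<equiv> G * (real H + 1) + 1"
  shows "mesh_error M b x D N \<le> ennreal (real H * (16 * B / (\<delta> * N) * chaining_cost \<Lambda> L C j0 J N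
      + 2 * B / \<delta> * (\<Lambda> * sqrt N * sqrt (2 * ln (2 * N)) / (real N - 1)))
      + 2 * G * real H * (\<Sum>h=1..H. SUP \<pi>\<in>policies M. outside_prob M x \<pi> h D))"
proof -
  obtain V where V: "dp_values M D x G V" using dp_values_exist[OF EM D x] by blast
  define P where "P = PiM {1..N} (\<lambda>_. chain_law)"
  interpret T: prob_space chain_law by (rule chain_prob)
  interpret PP: product_prob_space "\<lambda>_. chain_law" "{1..N}" ..
  have G: "0 \<le> G" by (rule G_nonneg[OF EM D x])
  have B: "0 < B" using G by (simp add: B_def add_nonneg_pos)
  define K where "K = 16 * B / (\<delta> * N) * chaining_cost \<Lambda> L C j0 J N
      + 2 * B / \<delta> * (\<Lambda> * sqrt N * sqrt (2 * ln (2 * N)) / (real N - 1))"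
  define good where "good h \<Psi> \<longleftrightarrow> \<Psi> \<in> borel_measurable P \<and> (\<forall>S. 0 \<le> \<Psi> S) \<and>
    (AE S in P. \<forall>r\<in>{1..N}. \<forall>a\<in>space (act M).
      \<bar>(\<Sum>n=1..N. V (Suc h) (S n (Suc h)) * weight (reflect D M) b N S h n (S r h) a)
        - (LINT y|\<mu>. V (Suc h) y * dens (reflect D M) (Suc h) a y (S r h))\<bar> \<le> \<Psi> S) \<and>
    (\<integral>\<^sup>+S. ennreal (\<Psi> S) \<partial>P) \<le> ennreal K" for h \<Psi>
  have "\<exists>\<Psi>. good h \<Psi>" if h: "h < H" for h
  proof -
    interpret I: importance_step chain_law \<mu> "\<lambda>c. c h" "\<lambda>c. c (Suc h)" "\<lambda>a s y. dens (reflect D M) (Suc h) a y s"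
      "space (act M)" "b h" \<rho> \<delta> \<Lambda> L by (rule importance_step_mesh[OF h])
    have VB: "\<bar>V (Suc h) s\<bar> \<le> B" if s: "s \<in> space \<mu>" for s
    proof -
      have "\<bar>V (Suc h) s\<bar> \<le> G * (real H + 1 - real (Suc h))"
        using V Suc_leI[OF h] s unfolding dp_values_def mdp_facts_reflected(1,2) \<mu>_space by blast
      also have "\<dots> \<le> G * (real H + 1)" using G by (intro mult_left_mono) auto
      finally show ?thesis by (simp add: B_def)
    qed
    have Vm: "V (Suc h) \<in> borel_measurable \<mu>" using V Suc_leI[OF h] unfolding dp_values_def mdp_facts_reflected(1,2) by blast
    show ?thesis
      unfolding good_def P_def K_def weight_def raw_weight_def Bex_def[symmetric]
      by (rule I.step_error[OF Vm B VB N J C]) assumption+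
  qed
  then have "\<forall>h. \<exists>\<Psi>. h < H \<longrightarrow> good h \<Psi>" by blast
  from choice[OF this] obtain \<Psi> where \<Psi>: "\<And>h. h < H \<Longrightarrow> good h (\<Psi> h)" by blast
  have AE_step: "AE S in P. \<forall>h\<in>{..<H}. \<forall>r\<in>{1..N}. \<forall>a\<in>space (act M).
      \<bar>(\<Sum>n=1..N. V (Suc h) (S n (Suc h)) * weight (reflect D M) b N S h n (S r h) a)
        - (LINT y|\<mu>. V (Suc h) y * dens (reflect D M) (Suc h) a y (S r h))\<bar> \<le> \<Psi> h S"
  proof (rule AE_finite_allI[OF finite_lessThan])
    fix h assume "h \<in> {..<H}"
    then have "good h (\<Psi> h)" using \<Psi> by simp
    then show "AE S in P. \<forall>r\<in>{1..N}. \<forall>a\<in>space (act M).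
      \<bar>(\<Sum>n=1..N. V (Suc h) (S n (Suc h)) * weight (reflect D M) b N S h n (S r h) a)
        - (LINT y|\<mu>. V (Suc h) y * dens (reflect D M) (Suc h) a y (S r h))\<bar> \<le> \<Psi> h S"
      unfolding good_def by (elim conjE)
  qed
  define ok where "ok h s \<longleftrightarrow> V h s = (SUP a\<in>space (act M). bellman M D h (V (Suc h)) s a)" for h s
  have ok: "AE s in \<mu>. ok h s" "ok h x" if "h < H" for h
    using V that unfolding dp_values_def bellman_step_def ok_def mdp_facts_reflected(1,2) by blast+
  \<comment> \<open>At time 0 the chain sits in \<open>x\<close>, where the Bellman equation is
    exact; later states have a density, so an equation valid almost everywhere holds almost
    surely.\<close>
  have chain_ok: "AE c in chain_law. ok h (c h)" if h: "h < H" for h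
  proof (cases h)
    case 0
    from chain_start show ?thesis
      unfolding 0 by (rule eventually_mono) (use ok(2)[OF h] 0 in simp)
  next
    case (Suc h')
    then have h': "h' < H" using h by simp
    interpret I: importance_step chain_law \<mu> "\<lambda>c. c h'" "\<lambda>c. c (Suc h')" "\<lambda>a s y. dens (reflect D M) (Suc h') a y s"
      "space (act M)" "b h'" \<rho> \<delta> \<Lambda> L by (rule importance_step_mesh[OF h'])
    show ?thesis unfolding Suc by (rule I.law_AE) (use ok(1)[OF h] Suc in simp)
  qed
  have "AE c in chain_law. (\<forall>h\<in>{..<H}. ok h (c h)) \<and> (\<forall>h\<in>{..H}. c h \<in> D) \<and> c 0 = x"
  proof (intro AE_conjI chain_start)
    show "AE c in chain_law. \<forall>h\<in>{..<H}. ok h (c h)" using chain_ok by (intro AE_finite_allI) auto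
    show "AE c in chain_law. \<forall>h\<in>{..H}. c h \<in> D"
      using measurable_space[OF chain_component] by (intro AE_I2) (auto simp: \<mu>_space)
  qed
  from PP.AE_component[OF _ this]
  have "AE S in P. \<forall>n\<in>{1..N}. (\<forall>h\<in>{..<H}. ok h (S n h)) \<and> (\<forall>h\<in>{..H}. S n h \<in> D) \<and> S n 0 = x"
    unfolding P_def by (intro AE_finite_allI) auto
  with AE_step have AE_final: "AE S in P. \<bar>mesh_value (reflect D M) b N S H x - V 0 x\<bar> \<le> (\<Sum>h<H. \<Psi> h S)"
  proof eventually_elim
    case (elim S)
    have one: "1 \<in> {1..N}" using N by simp
    have "\<bar>mesh_value (reflect D M) b N S H (S 1 (H - H)) - V (H - H) (S 1 (H - H))\<bar> \<le> (\<Sum>h\<in>{H - H..<H}. \<Psi> h S)"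
    proof (rule mesh_recursion_error[where \<Psi> = "\<lambda>h. \<Psi> h S", OF N V _ _ _ order_refl one])
      show "S n h \<in> D" if "n \<in> {1..N}" "h \<le> H" for n h using elim(2) that by simp
      show "V h (S n h) = (SUP a\<in>space (act M). bellman M D h (V (Suc h)) (S n h) a)" if "n \<in> {1..N}" "h < H" for n h
        using elim(2) that unfolding ok_def by simp
      show "\<bar>(\<Sum>n=1..N. V (Suc h) (S n (Suc h)) * weight (reflect D M) b N S h n (S r h) a)
        - (LINT y|\<mu>. V (Suc h) y * dens (reflect D M) (Suc h) a y (S r h))\<bar> \<le> \<Psi> h S"
        if "h < H" "r \<in> {1..N}" "a \<in> space (act M)" for h r a
        using elim(1) that by blast
    qed
    moreover have "S 1 0 = x" using elim(2) one by blast
    ultimately show ?case by (simp add: atLeast0LessThan)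
  qed
  define E2 where "E2 = 2 * G * real H * (\<Sum>h=1..H. SUP \<pi>\<in>policies M. outside_prob M x \<pi> h D)"
  have E2: "\<bar>V 0 x - opt_value M x\<bar> \<le> E2" unfolding E2_def by (rule truncation_error[OF EM D x V])
  then have E2_nonneg: "0 \<le> E2" by (rule order_trans[OF abs_ge_zero])
  have "mesh_error M b x D N = (\<integral>\<^sup>+S. ennreal \<bar>mesh_value (reflect D M) b N S H x - opt_value M x\<bar> \<partial>P)"
    unfolding mesh_error_def mesh_law_eq mdp_facts_reflected(2) P_def ..
  also have "\<dots> \<le> (\<integral>\<^sup>+S. (\<Sum>h<H. ennreal (\<Psi> h S)) + ennreal E2 \<partial>P)"
    using AE_final
  proof (intro nn_integral_mono_AE, eventually_elim)
    case (elim S)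
    have "\<bar>mesh_value (reflect D M) b N S H x - opt_value M x\<bar> \<le> (\<Sum>h<H. \<Psi> h S) + E2" using elim E2 by linarith
    then have "ennreal \<bar>mesh_value (reflect D M) b N S H x - opt_value M x\<bar> \<le> ennreal ((\<Sum>h<H. \<Psi> h S) + E2)"
      by (rule ennreal_leI)
    also have "\<dots> = (\<Sum>h<H. ennreal (\<Psi> h S)) + ennreal E2"
    proof -
      have nn: "0 \<le> \<Psi> h S" if "h \<in> {..<H}" for h using \<Psi>[of h] that unfolding good_def by blast
      have "ennreal ((\<Sum>h<H. \<Psi> h S) + E2) = ennreal (\<Sum>h<H. \<Psi> h S) + ennreal E2"
        using nn E2_nonneg by (intro ennreal_plus sum_nonneg)
      also have "ennreal (\<Sum>h<H. \<Psi> h S) = (\<Sum>h<H. ennreal (\<Psi> h S))"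
        using nn by (intro sum_ennreal[symmetric])
      finally show ?thesis .
    qed
    finally show ?case .
  qed
  also have "\<dots> = (\<Sum>h<H. \<integral>\<^sup>+S. ennreal (\<Psi> h S) \<partial>P) + ennreal E2"
  proof -
    have "\<Psi> h \<in> borel_measurable P" if "h < H" for h using \<Psi>[OF that] unfolding good_def by simp
    then show ?thesis
      using PP.emeasure_space_1 unfolding P_def[symmetric]
      by (subst nn_integral_add, simp, simp, subst nn_integral_sum) simp_all
  qed
  also have "\<dots> \<le> (\<Sum>h<H. ennreal K) + ennreal E2"
    using \<Psi> unfolding good_def by (intro add_mono sum_mono) auto
  also have "\<dots> = ennreal (real H * K + E2)"
  proof -
    have "0 < \<Lambda>" using bounds[of 1 "b 0" x x] b[of 0] H x \<delta> by simp
    then have "0 \<le> K"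
      unfolding K_def using chaining_cost_nonneg[of \<Lambda> L N C j0 J] B \<delta> L C N by simp
    then show ?thesis using E2_nonneg by (simp add: ennreal_of_nat_eq_real_of_nat ennreal_mult[symmetric])
  qed
  finally show ?thesis unfolding K_def E2_def .
qed

end

section \<open>Covering numbers and the Dudley integral\<close>

definition finite_net :: "'x set \<Rightarrow> ('x \<Rightarrow> 'x \<Rightarrow> real) \<Rightarrow> real \<Rightarrow> 'x set \<Rightarrow> bool" where
  "finite_net X \<rho> u C \<longleftrightarrow> finite C \<and> C \<subseteq> X \<and> X \<subseteq> (\<Union>x\<in>C. {y \<in> X. \<rho> x y \<le> u})"

definition precompact :: "'x set \<Rightarrow> ('x \<Rightarrow> 'x \<Rightarrow> real) \<Rightarrow> bool" where
  "precompact X \<rho> \<longleftrightarrow> (\<forall>u>0. \<exists>C. finite_net X \<rho> u C)"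

lemma covering_number_attained:
  assumes "precompact X \<rho>" "0 < u"
  shows "\<exists>C. finite_net X \<rho> u C \<and> card C = covering_number X \<rho> u"
proof -
  have "\<exists>n C. finite_net X \<rho> u C \<and> card C = n" using assms unfolding precompact_def by blast
  from LeastI_ex[OF this] show ?thesis
    unfolding covering_number_def finite_net_def by (simp add: conj_ac)
qed

lemma covering_number_le:
  assumes "finite_net X \<rho> u C" shows "covering_number X \<rho> u \<le> card C"
  unfolding covering_number_def
proof (rule Least_le)
  show "\<exists>E. finite E \<and> E \<subseteq> X \<and> card E = card C \<and> X \<subseteq> (\<Union>x\<in>E. {y \<in> X. \<rho> x y \<le> u})"
    using assms unfolding finite_net_def by (intro exI[of _ C]) simp
qed

lemma finite_net_nonempty: "finite_net X \<rho> u C \<Longrightarrow> X \<noteq> {} \<Longrightarrow> C \<noteq> {}"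
  unfolding finite_net_def by (cases "C = {}") simp_all

lemma covering_number_pos:
  assumes "precompact X \<rho>" "0 < u" "X \<noteq> {}" shows "1 \<le> covering_number X \<rho> u"
proof -
  obtain C where C: "finite_net X \<rho> u C" "card C = covering_number X \<rho> u"
    using covering_number_attained[OF assms(1,2)] by blast
  have "finite C" "C \<noteq> {}" using C(1) finite_net_nonempty[OF C(1) assms(3)] by (auto simp: finite_net_def)
  then show ?thesis unfolding C(2)[symmetric] by (simp add: Suc_le_eq card_gt_0_iff)
qed

lemma covering_number_antimono:
  assumes "precompact X \<rho>" "0 < u" "u \<le> v"
  shows "covering_number X \<rho> v \<le> covering_number X \<rho> u"
proof -
  obtain C where C: "finite_net X \<rho> u C" "card C = covering_number X \<rho> u"
    using covering_number_attained[OF assms(1,2)] by blast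
  have "{y \<in> X. \<rho> x y \<le> u} \<subseteq> {y \<in> X. \<rho> x y \<le> v}" for x using assms(3) by auto
  then have "(\<Union>x\<in>C. {y \<in> X. \<rho> x y \<le> u}) \<subseteq> (\<Union>x\<in>C. {y \<in> X. \<rho> x y \<le> v})" by (intro UN_mono) auto
  then have "finite_net X \<rho> v C" using C(1) unfolding finite_net_def by (meson subset_trans)
  then show ?thesis unfolding C(2)[symmetric] by (rule covering_number_le)
qed

lemma (in Metric_space) precompact_compact:
  assumes "compactin mtopology S" shows "precompact S d"
  unfolding precompact_def
proof (intro allI impI)
  fix u :: real assume u: "0 < u"
  have "mtotally_bounded S" by (rule compactin_imp_mtotally_bounded[OF assms])
  then obtain K where K: "finite K" "K \<subseteq> S" "S \<subseteq> (\<Union>x\<in>K. mball x u)"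
    using u unfolding mtotally_bounded_def by (elim allE impE exE conjE) assumption+
  have "finite_net S d u K"
    unfolding finite_net_def
  proof (intro conjI subsetI)
    fix y assume y: "y \<in> S"
    then obtain x where x: "x \<in> K" "y \<in> mball x u" using K(3) by blast
    then have "d x y \<le> u" by (simp add: in_mball)
    then show "y \<in> (\<Union>x\<in>K. {y \<in> S. d x y \<le> u})" using x(1) y by blast
  qed (use K in auto)
  then show "\<exists>C. finite_net S d u C" ..
qed

lemma precompact_sum_metric:
  assumes X: "precompact X \<rho>" and Y: "precompact Y \<sigma>"
  shows "precompact (X \<times> Y) (sum_metric \<rho> \<sigma>)"
  unfolding precompact_def
proof (intro allI impI)
  fix u :: real assume "0 < u"
  then have u: "0 < u / 2" by simp
  obtain C where C: "finite_net X \<rho> (u / 2) C" using X u unfolding precompact_def by blast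
  obtain E where E: "finite_net Y \<sigma> (u / 2) E" using Y u unfolding precompact_def by blast
  have "finite_net (X \<times> Y) (sum_metric \<rho> \<sigma>) u (C \<times> E)"
    unfolding finite_net_def
  proof (intro conjI subsetI)
    fix z assume z: "z \<in> X \<times> Y"
    have "fst z \<in> X" "snd z \<in> Y" using z by auto
    obtain c where c: "c \<in> C" "\<rho> c (fst z) \<le> u / 2" using C \<open>fst z \<in> X\<close> unfolding finite_net_def by blast
    obtain e where e: "e \<in> E" "\<sigma> e (snd z) \<le> u / 2" using E \<open>snd z \<in> Y\<close> unfolding finite_net_def by blast
    have "sum_metric \<rho> \<sigma> (c, e) z \<le> u" using c(2) e(2) by (simp add: sum_metric_def split_beta)
    then show "z \<in> (\<Union>x\<in>C \<times> E. {y \<in> X \<times> Y. sum_metric \<rho> \<sigma> x y \<le> u})" using c(1) e(1) z by blast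
  qed (use C E in \<open>auto simp: finite_net_def\<close>)
  then show "\<exists>C. finite_net (X \<times> Y) (sum_metric \<rho> \<sigma>) u C" ..
qed

lemma bdd_above_precompact:
  assumes M: "Metric_space U \<rho>" "X \<subseteq> U" and X: "precompact X \<rho>"
  shows "\<exists>K. \<forall>x\<in>X. \<forall>y\<in>X. \<rho> x y \<le> K"
proof -
  interpret Metric_space U \<rho> by (rule M)
  obtain C where C: "finite_net X \<rho> 1 C" using X zero_less_one unfolding precompact_def by blast
  define K where "K = (\<Sum>c\<in>C. \<Sum>e\<in>C. \<rho> c e)"
  have "\<rho> x y \<le> 1 + K + 1" if xy: "x \<in> X" "y \<in> X" for x y
  proof -
    obtain c where c: "c \<in> C" "\<rho> c x \<le> 1" using C xy unfolding finite_net_def by blast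
    obtain e where e: "e \<in> C" "\<rho> e y \<le> 1" using C xy unfolding finite_net_def by blast
    have fin: "finite C" and sub: "C \<subseteq> U" using C M unfolding finite_net_def by auto
    have "\<rho> c e \<le> (\<Sum>e\<in>C. \<rho> c e)" using fin e by (intro member_le_sum) auto
    also have "\<dots> \<le> K" unfolding K_def
      using fin c by (intro member_le_sum[of c C "\<lambda>c. \<Sum>e\<in>C. \<rho> c e"]) (auto intro: sum_nonneg)
    finally have ce: "\<rho> c e \<le> K" .
    have U: "x \<in> U" "y \<in> U" "c \<in> U" "e \<in> U" using xy c e sub M by auto
    have "\<rho> x y \<le> \<rho> x c + \<rho> c y" using U by (intro triangle)
    also have "\<rho> c y \<le> \<rho> c e + \<rho> e y" using U by (intro triangle)
    also have "\<rho> x c = \<rho> c x" by (rule commute)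
    finally show ?thesis using c e ce by linarith
  qed
  then show ?thesis by blast
qed

text \<open>The hypothesis concerns states and actions jointly, while chaining needs the actions
  alone. A fixed state \<open>x0\<close> gives the comparison of the diameters, and projecting a net
  of the product gives a net of \<open>Y\<close> that is no larger.\<close>

lemma dudley_snd_le:
  fixes \<rho> :: "'x \<Rightarrow> 'x \<Rightarrow> real" and \<sigma> :: "'y \<Rightarrow> 'y \<Rightarrow> real"
  assumes MX: "Metric_space U \<rho>" "X \<subseteq> U" "precompact X \<rho>" "X \<noteq> {}"
    and MY: "Metric_space W \<sigma>" "Y \<subseteq> W" "precompact Y \<sigma>" "Y \<noteq> {}"
  shows "dudley Y \<sigma> \<le> dudley (X \<times> Y) (sum_metric \<rho> \<sigma>)"
proof -
  interpret U: Metric_space U \<rho> by (rule MX)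
  interpret W: Metric_space W \<sigma> by (rule MY)
  note pc = precompact_sum_metric[OF MX(3) MY(3)]
  obtain x0 where x0: "x0 \<in> X" using MX by blast
  obtain K1 where K1: "\<forall>x\<in>X. \<forall>y\<in>X. \<rho> x y \<le> K1" using bdd_above_precompact[OF MX(1,2,3)] by blast
  obtain K2 where K2: "\<forall>x\<in>Y. \<forall>y\<in>Y. \<sigma> x y \<le> K2" using bdd_above_precompact[OF MY(1,2,3)] by blast
  have diam: "mdiam Y \<sigma> \<le> mdiam (X \<times> Y) (sum_metric \<rho> \<sigma>)"
    unfolding mdiam_def
  proof (rule cSUP_least)
    show "Y \<times> Y \<noteq> {}" using MY by blast
    fix p assume p: "p \<in> Y \<times> Y"
    have "bdd_above ((\<lambda>(x, y). sum_metric \<rho> \<sigma> x y) ` ((X \<times> Y) \<times> (X \<times> Y)))"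
    proof (rule bdd_aboveI2)
      fix q assume q: "q \<in> (X \<times> Y) \<times> (X \<times> Y)"
      then have "\<rho> (fst (fst q)) (fst (snd q)) \<le> K1" "\<sigma> (snd (fst q)) (snd (snd q)) \<le> K2" using K1 K2 by auto
      then show "(case q of (x, y) \<Rightarrow> sum_metric \<rho> \<sigma> x y) \<le> K1 + K2" by (simp add: sum_metric_def split_beta)
    qed
    then have up: "(case q of (x, y) \<Rightarrow> sum_metric \<rho> \<sigma> x y) \<le> (SUP (x, y)\<in>(X \<times> Y) \<times> (X \<times> Y). sum_metric \<rho> \<sigma> x y)"
      if "q \<in> (X \<times> Y) \<times> (X \<times> Y)" for q using that by (rule cSUP_upper[rotated])
    have "((x0, fst p), (x0, snd p)) \<in> (X \<times> Y) \<times> (X \<times> Y)" using p x0 by auto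
    from up[OF this] have "\<rho> x0 x0 + \<sigma> (fst p) (snd p) \<le> (SUP (x, y)\<in>(X \<times> Y) \<times> (X \<times> Y). sum_metric \<rho> \<sigma> x y)"
      unfolding prod.case sum_metric_def[of \<rho> \<sigma>, THEN fun_cong, THEN fun_cong, of "(x0, fst p)" "(x0, snd p)"] .
    moreover have "0 \<le> \<rho> x0 x0" by (rule U.nonneg)
    moreover have "(case p of (x, y) \<Rightarrow> \<sigma> x y) = \<sigma> (fst p) (snd p)" by (rule split_beta)
    ultimately show "(case p of (x, y) \<Rightarrow> \<sigma> x y) \<le> (SUP (x, y)\<in>(X \<times> Y) \<times> (X \<times> Y). sum_metric \<rho> \<sigma> x y)" by linarith
  qed
  have cov: "covering_number Y \<sigma> u \<le> covering_number (X \<times> Y) (sum_metric \<rho> \<sigma>) u" if u: "0 < u" for u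
  proof -
    obtain C where C: "finite_net (X \<times> Y) (sum_metric \<rho> \<sigma>) u C" "card C = covering_number (X \<times> Y) (sum_metric \<rho> \<sigma>) u"
      using covering_number_attained[OF pc u] by blast
    have "finite_net Y \<sigma> u (snd ` C)"
      unfolding finite_net_def
    proof (intro conjI subsetI)
      fix y assume y: "y \<in> Y"
      then obtain c where c: "c \<in> C" "sum_metric \<rho> \<sigma> c (x0, y) \<le> u"
        using C(1) x0 unfolding finite_net_def by blast
      have "\<sigma> (snd c) y \<le> u" using c(2) U.nonneg[of "fst c" x0] unfolding sum_metric_def split_beta fst_conv snd_conv by linarith
      then show "y \<in> (\<Union>x\<in>snd ` C. {y \<in> Y. \<sigma> x y \<le> u})" using c(1) y by blast
    qed (use C in \<open>auto simp: finite_net_def\<close>)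
    then have "covering_number Y \<sigma> u \<le> card (snd ` C)" by (rule covering_number_le)
    also have "\<dots> \<le> card C" using C(1) by (intro card_image_le) (simp add: finite_net_def)
    finally show ?thesis using C(2) by simp
  qed
  show ?thesis
    unfolding dudley_def
  proof (rule nn_integral_mono)
    fix u :: real
    show "ennreal (sqrt (ln (real (covering_number Y \<sigma> u)))) * indicator {0<..<mdiam Y \<sigma>} u
      \<le> ennreal (sqrt (ln (real (covering_number (X \<times> Y) (sum_metric \<rho> \<sigma>) u)))) * indicator {0<..<mdiam (X \<times> Y) (sum_metric \<rho> \<sigma>)} u"
    proof (cases "u \<in> {0<..<mdiam Y \<sigma>}")
      case True
      then have u: "0 < u" "u \<in> {0<..<mdiam (X \<times> Y) (sum_metric \<rho> \<sigma>)}" using diam by auto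
      have "ln (real (covering_number Y \<sigma> u)) \<le> ln (real (covering_number (X \<times> Y) (sum_metric \<rho> \<sigma>) u))"
        using cov[OF u(1)] covering_number_pos[OF MY(3) u(1) MY(4)] by (subst ln_le_cancel_iff) auto
      then show ?thesis using True u by (simp add: ennreal_leI)
    qed simp
  qed
qed

text \<open>At radii below half the distance of two points no single ball contains both, so the
  integrand is at least \<open>sqrt (ln 2)\<close> there. A positive Dudley integral turns the
  growth condition on its product with \<open>L\<close> into one on \<open>L\<close> itself.\<close>

lemma dudley_pos:
  assumes M: "Metric_space W \<sigma>" "Y \<subseteq> W" "precompact Y \<sigma>" and y: "y \<in> Y" "y' \<in> Y" "y \<noteq> y'"
  shows "0 < dudley Y \<sigma>"
proof -
  interpret W: Metric_space W \<sigma> by (rule M)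
  define r where "r = \<sigma> y y'"
  have r: "0 < r" unfolding r_def using M y by (intro W.mdist_pos_less) auto
  obtain K where K: "\<forall>x\<in>Y. \<forall>y\<in>Y. \<sigma> x y \<le> K" using bdd_above_precompact[OF M(1,2,3)] by blast
  have bdd: "bdd_above ((\<lambda>(x, y). \<sigma> x y) ` (Y \<times> Y))" using K by (intro bdd_aboveI2[where M = K]) auto
  have diam: "r \<le> mdiam Y \<sigma>"
    unfolding mdiam_def r_def using cSUP_upper[OF _ bdd, of "(y, y')"] y by auto
  have two: "2 \<le> covering_number Y \<sigma> u" if u: "0 < u" "u < r / 2" for u
  proof (rule ccontr)
    assume "\<not> 2 \<le> covering_number Y \<sigma> u"
    then have c1: "covering_number Y \<sigma> u = 1" using covering_number_pos[OF M(3) u(1)] y by fastforce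
    obtain C where C: "finite_net Y \<sigma> u C" "card C = 1"
      using covering_number_attained[OF M(3) u(1)] c1 by metis
    obtain c where c: "C = {c}" using C(2) by (rule card_1_singletonE)
    have "\<sigma> c y \<le> u" "\<sigma> c y' \<le> u" "c \<in> Y" using C(1) y unfolding c finite_net_def by auto
    moreover have "\<sigma> y y' \<le> \<sigma> y c + \<sigma> c y'" using \<open>c \<in> Y\<close> y M by (intro W.triangle) auto
    ultimately show False using u W.commute[of y c] unfolding r_def by linarith
  qed
  have "0 < ennreal (sqrt (ln 2)) * ennreal (r / 2)" using r by (simp add: ennreal_mult[symmetric])
  also have "\<dots> = (\<integral>\<^sup>+u. ennreal (sqrt (ln 2)) * indicator {0<..<r / 2} u \<partial>lborel)"
    using r by (subst nn_integral_cmult_indicator) auto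
  also have "\<dots> \<le> dudley Y \<sigma>"
    unfolding dudley_def
  proof (rule nn_integral_mono)
    fix u :: real
    show "ennreal (sqrt (ln 2)) * indicator {0<..<r / 2} u \<le>
        ennreal (sqrt (ln (real (covering_number Y \<sigma> u)))) * indicator {0<..<mdiam Y \<sigma>} u"
    proof (cases "u \<in> {0<..<r / 2}")
      case True
      then have u: "u \<in> {0<..<mdiam Y \<sigma>}" and t: "2 \<le> covering_number Y \<sigma> u" using diam r two by auto
      have "sqrt (ln 2) \<le> sqrt (ln (real (covering_number Y \<sigma> u)))"
        using t by (intro real_sqrt_le_mono) (simp add: ln_le_cancel_iff)
      then show ?thesis using True u by (simp add: ennreal_leI)
    qed simp
  qed
  finally show ?thesis .
qed

text \<open>The integrand decreases in the radius, so on each dyadic interval it is at least its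
  value at the upper end. Only summability is used later: the tail beyond a moving level tends to
  zero, which no bound on the total would give.\<close>

lemma dudley_summable:
  assumes M: "Metric_space W \<sigma>" "Y \<subseteq> W" "precompact Y \<sigma>" "Y \<noteq> {}" and fin: "dudley Y \<sigma> < \<infinity>"
  shows "summable (\<lambda>j. (1 / 2) ^ j * sqrt (ln (real (covering_number Y \<sigma> ((1 / 2) ^ j)))))"
proof -
  interpret W: Metric_space W \<sigma> by (rule M)
  define \<phi> where "\<phi> u = sqrt (ln (real (covering_number Y \<sigma> u)))" for u
  have \<phi>0: "0 \<le> \<phi> u" if "0 < u" for u
    unfolding \<phi>_def using covering_number_pos[OF M(3) that M(4)] by simp
  have \<phi>mono: "\<phi> v \<le> \<phi> u" if "0 < u" "u \<le> v" for u v
    unfolding \<phi>_def using covering_number_antimono[OF M(3) that] covering_number_pos[OF M(3) _ M(4), of v] that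
    by (intro real_sqrt_le_mono) (simp add: ln_le_cancel_iff)
  show ?thesis
  proof (cases "0 < mdiam Y \<sigma>")
    case True
    obtain k where k: "(1 / 2) ^ k < mdiam Y \<sigma>" using real_arch_pow_inv[OF True, of "1 / 2"] by auto
    \<comment> \<open>The intervals with \<open>j\<close> at least \<open>k\<close> lie below the
      diameter, where the integral stops; the finitely many earlier levels do not affect
      summability.\<close>
    define I where "I j = {(1 / 2 :: real) ^ Suc j..<(1 / 2) ^ j}" for j :: nat
    have disj: "j = i" if "u \<in> I j" "u \<in> I i" for i j u
    proof (rule ccontr)
      assume "j \<noteq> i"
      then consider "Suc j \<le> i" | "Suc i \<le> j" by linarith
      then show False
      proof cases
        case 1
        then have "(1 / 2 :: real) ^ i \<le> (1 / 2) ^ Suc j" by (intro power_decreasing) auto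
        then show False using that by (simp add: I_def)
      next
        case 2
        then have "(1 / 2 :: real) ^ j \<le> (1 / 2) ^ Suc i" by (intro power_decreasing) auto
        then show False using that by (simp add: I_def)
      qed
    qed
    have "(\<Sum>j\<in>{k..<n}. ennreal (\<phi> ((1 / 2) ^ j) * (1 / 2) ^ Suc j)) \<le> dudley Y \<sigma>" for n
    proof -
      have "(\<Sum>j\<in>{k..<n}. ennreal (\<phi> ((1 / 2) ^ j) * (1 / 2) ^ Suc j)) =
        (\<Sum>j\<in>{k..<n}. \<integral>\<^sup>+u. ennreal (\<phi> ((1 / 2) ^ j)) * indicator (I j) u \<partial>lborel)"
      proof (rule sum.cong[OF refl])
        fix j
        have "(1 / 2 :: real) ^ Suc j \<le> (1 / 2) ^ j" by simp
        then show "ennreal (\<phi> ((1 / 2) ^ j) * (1 / 2) ^ Suc j) =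
            (\<integral>\<^sup>+u. ennreal (\<phi> ((1 / 2) ^ j)) * indicator (I j) u \<partial>lborel)"
          using \<phi>0[of "(1 / 2) ^ j"] unfolding I_def
          by (subst nn_integral_cmult_indicator) (auto simp: ennreal_mult[symmetric])
      qed
      also have "\<dots> = (\<integral>\<^sup>+u. (\<Sum>j\<in>{k..<n}. ennreal (\<phi> ((1 / 2) ^ j)) * indicator (I j) u) \<partial>lborel)"
        by (subst nn_integral_sum) (auto simp: I_def)
      also have "\<dots> \<le> dudley Y \<sigma>"
        unfolding dudley_def \<phi>_def[symmetric]
      proof (rule nn_integral_mono)
        fix u :: real
        show "(\<Sum>j\<in>{k..<n}. ennreal (\<phi> ((1 / 2) ^ j)) * indicator (I j) u) \<le> ennreal (\<phi> u) * indicator {0<..<mdiam Y \<sigma>} u"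
        proof (cases "\<exists>j\<in>{k..<n}. u \<in> I j")
          case True
          then obtain j where j: "j \<in> {k..<n}" "u \<in> I j" by blast
          have "(\<Sum>i\<in>{k..<n}. ennreal (\<phi> ((1 / 2) ^ i)) * indicator (I i) u) =
            (\<Sum>i\<in>{k..<n}. if i = j then ennreal (\<phi> ((1 / 2) ^ j)) else 0)"
          proof (rule sum.cong[OF refl])
            fix i show "ennreal (\<phi> ((1 / 2) ^ i)) * indicator (I i) u = (if i = j then ennreal (\<phi> ((1 / 2) ^ j)) else 0)"
            proof (cases "i = j")
              case True then show ?thesis using j(2) by simp
            next
              case False
              then have "u \<notin> I i" using disj[OF j(2), of i] by blast
              then show ?thesis using False by simp
            qed
          qed
          also have "\<dots> = ennreal (\<phi> ((1 / 2) ^ j))" using j(1) by simp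
          also have "\<dots> \<le> ennreal (\<phi> u) * indicator {0<..<mdiam Y \<sigma>} u"
          proof -
            have "(0::real) < (1 / 2) ^ Suc j" by simp
            then have u: "0 < u" "u \<le> (1 / 2) ^ j" using j(2) unfolding I_def by auto
            have "(1 / 2 :: real) ^ j \<le> (1 / 2) ^ k" using j(1) by (intro power_decreasing) auto
            then have "u < mdiam Y \<sigma>" using u(2) k by linarith
            then show ?thesis using \<phi>mono[OF u] u(1) by (simp add: ennreal_leI)
          qed
          finally show ?thesis .
        next
          case False
          then have "(\<Sum>j\<in>{k..<n}. ennreal (\<phi> ((1 / 2) ^ j)) * indicator (I j) u) = 0" by (intro sum.neutral) auto
          then show ?thesis by simp
        qed
      qed
      finally show ?thesis .
    qed
    moreover obtain e where e: "0 \<le> e" "dudley Y \<sigma> = ennreal e" using fin by (cases "dudley Y \<sigma>") auto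
    moreover have nn: "0 \<le> \<phi> ((1 / 2) ^ j) * (1 / 2) ^ Suc j" for j using \<phi>0[of "(1 / 2) ^ j"] by simp
    ultimately have bound: "(\<Sum>j\<in>{k..<n}. \<phi> ((1 / 2) ^ j) * (1 / 2) ^ Suc j) \<le> e" for n by simp
    have "summable (\<lambda>j. \<phi> ((1 / 2) ^ (j + k)) * (1 / 2) ^ Suc (j + k))"
    proof (rule bounded_imp_summable)
      show "0 \<le> \<phi> ((1 / 2) ^ (j + k)) * (1 / 2) ^ Suc (j + k)" for j by (rule nn)
      show "(\<Sum>j\<le>n. \<phi> ((1 / 2) ^ (j + k)) * (1 / 2) ^ Suc (j + k)) \<le> e" for n
      proof -
        have "(\<Sum>j\<le>n. \<phi> ((1 / 2) ^ (j + k)) * (1 / 2) ^ Suc (j + k)) =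
            (\<Sum>j\<in>{0..<Suc n}. \<phi> ((1 / 2) ^ (j + k)) * (1 / 2) ^ Suc (j + k))"
          by (simp add: atLeast0LessThan lessThan_Suc_atMost)
        also have "\<dots> = (\<Sum>j\<in>{0 + k..<Suc n + k}. \<phi> ((1 / 2) ^ j) * (1 / 2) ^ Suc j)"
          by (rule sum.shift_bounds_nat_ivl[symmetric])
        also have "\<dots> \<le> e" using bound[of "Suc n + k"] unfolding add_0 .
        finally show ?thesis .
      qed
    qed
    then have "summable (\<lambda>j. \<phi> ((1 / 2) ^ j) * (1 / 2) ^ Suc j)" by (rule summable_iff_shift[THEN iffD1])
    then have "summable (\<lambda>j. 2 * (\<phi> ((1 / 2) ^ j) * (1 / 2) ^ Suc j))" by (rule summable_mult)
    then show ?thesis unfolding \<phi>_def by (simp add: mult.commute)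
  next
    case False
    obtain K where K: "\<forall>x\<in>Y. \<forall>y\<in>Y. \<sigma> x y \<le> K" using bdd_above_precompact[OF M(1,2,3)] by blast
    have bdd: "bdd_above ((\<lambda>(x, y). \<sigma> x y) ` (Y \<times> Y))" using K by (intro bdd_aboveI2[where M = K]) auto
    obtain y where y: "y \<in> Y" using M(4) by blast
    have small: "\<sigma> y z \<le> u" if "z \<in> Y" "0 < u" for z u
      using cSUP_upper[OF _ bdd, of "(y, z)"] y that False unfolding mdiam_def by fastforce
    have "covering_number Y \<sigma> ((1 / 2) ^ j) = 1" for j
    proof -
      have "finite_net Y \<sigma> ((1 / 2) ^ j) {y}" unfolding finite_net_def using y small by auto
      then have "covering_number Y \<sigma> ((1 / 2) ^ j) \<le> 1" using covering_number_le by fastforce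
      then show ?thesis using covering_number_pos[OF M(3) _ M(4), of "(1 / 2) ^ j"] by simp
    qed
    then show ?thesis by simp
  qed
qed

section \<open>Consequences of the density conditions\<close>

lemma density_conditionsD:
  assumes "density_conditions d M \<rho> \<delta> \<Lambda> L Lip" and "compactin (euclid_top d) D" "0 < measure (leb d) D"
  shows "0 < \<Lambda>" "0 < \<delta> D" "0 < L D" "Lip D \<in> borel_measurable (leb d)" "\<And>y. y \<in> space (leb d) \<Longrightarrow> 0 \<le> Lip D y"
    "\<And>h a x z. h \<in> {1..horizon M} \<Longrightarrow> a \<in> space (act M) \<Longrightarrow> x \<in> D \<Longrightarrow> z \<in> D \<Longrightarrow> \<delta> D \<le> dens M h a z x \<and> dens M h a z x \<le> \<Lambda>"
    "\<And>h a a' x x' y. h \<in> {1..horizon M} \<Longrightarrow> a \<in> space (act M) \<Longrightarrow> a' \<in> space (act M) \<Longrightarrow> x \<in> D \<Longrightarrow> x' \<in> D \<Longrightarrow>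
      y \<in> space (leb d) \<Longrightarrow> \<bar>dens M h a y x - dens M h a' y x'\<bar> \<le> Lip D y * (edist d x x' + \<rho> a a')"
    "esssup (restrict_space (leb d) D) (\<lambda>y. ennreal (Lip D y))
      + (\<integral>\<^sup>+y\<in>space (leb d) - D. ennreal (Lip D y) \<partial>leb d) / emeasure (leb d) D \<le> ennreal (L D)"
proof -
  show "0 < \<Lambda>" using assms(1) unfolding density_conditions_def by (rule conjunct1)
  note c = assms(1)[unfolded density_conditions_def, THEN conjunct2, THEN spec, THEN mp, OF conjI[OF assms(2,3)]]
  note c' = c[THEN conjunct2] note c3 = c'[THEN conjunct2] note c4 = c3[THEN conjunct2]
  note c5 = c4[THEN conjunct2] note c6 = c5[THEN conjunct2] note c7 = c6[THEN conjunct2]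
  show "0 < \<delta> D" by (rule c[THEN conjunct1])
  show "0 < L D" by (rule c'[THEN conjunct1])
  show "Lip D \<in> borel_measurable (leb d)" by (rule c3[THEN conjunct1])
  show "0 \<le> Lip D y" if "y \<in> space (leb d)" for y by (rule c4[THEN conjunct1, THEN bspec, OF that])
  show "\<delta> D \<le> dens M h a z x \<and> dens M h a z x \<le> \<Lambda>"
    if "h \<in> {1..horizon M}" "a \<in> space (act M)" "x \<in> D" "z \<in> D" for h a x z
    by (rule c5[THEN conjunct1, THEN bspec, THEN bspec, THEN bspec, THEN bspec, OF that])
  show "\<bar>dens M h a y x - dens M h a' y x'\<bar> \<le> Lip D y * (edist d x x' + \<rho> a a')"
    if "h \<in> {1..horizon M}" "a \<in> space (act M)" "a' \<in> space (act M)" "x \<in> D" "x' \<in> D" "y \<in> space (leb d)"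
    for h a a' x x' y
    by (rule c6[THEN conjunct1, THEN bspec, THEN bspec, THEN bspec, THEN bspec, THEN bspec, THEN bspec, OF that])
  show "esssup (restrict_space (leb d) D) (\<lambda>y. ennreal (Lip D y))
      + (\<integral>\<^sup>+y\<in>space (leb d) - D. ennreal (Lip D y) \<partial>leb d) / emeasure (leb d) D \<le> ennreal (L D)" by (rule c7)
qed

lemma (in markov_mdp) outside_prob_bounds:
  assumes x: "x \<in> space (base M)" and \<pi>: "\<pi> \<in> policies M"
  shows "0 \<le> outside_prob M x \<pi> h D" "outside_prob M x \<pi> h D \<le> 1"
proof -
  interpret P: prob_space "traj M x \<pi> (horizon M)" by (rule prob_space_traj[OF x \<pi> order_refl])
  show "0 \<le> outside_prob M x \<pi> h D" "outside_prob M x \<pi> h D \<le> 1"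
    unfolding outside_prob_def by (simp_all add: P.prob_le_1)
qed

lemma (in markov_mdp) outside_prob_ge:
  assumes x: "x \<in> space (base M)" "{x} \<in> sets (base M)" and b: "\<And>t. t < horizon M \<Longrightarrow> b t \<in> space (act M)"
    and H: "1 \<le> horizon M" and D: "D \<in> sets (base M)" and Q: "Q \<in> sets (base M)" "emeasure (base M) Q < \<infinity>"
    and \<delta>: "0 \<le> \<delta>" "\<And>y. y \<in> Q \<Longrightarrow> \<delta> \<le> dens M 1 (b 0) y x"
  shows "\<delta> * measure (base M) (Q - D) \<le> outside_prob M x (\<lambda>t _. return (act M) (b t)) 1 D"
proof -
  let ?\<pi> = "\<lambda>t _. return (act M) (b t)"
  let ?T = "traj M x ?\<pi> (horizon M)"
  have \<pi>: "?\<pi> \<in> policies M" by (rule const_policy[OF b])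
  interpret P: prob_space ?T by (rule prob_space_traj[OF x(1) \<pi> order_refl])
  have g: "(indicator (- D) :: _ \<Rightarrow> ennreal) \<in> borel_measurable (base M)"
    using D by (simp add: borel_measurable_indicator_iff Diff_eq[symmetric] Int_commute[of "- D"])
  have Qs: "Q \<subseteq> space (base M)" using Q(1) by (rule sets.sets_into_space)
  have fin: "emeasure (base M) (Q - D) < \<infinity>"
    using Q D emeasure_mono[of "Q - D" Q "base M"] by (auto intro: order_le_less_trans)
  have "ennreal (\<delta> * measure (base M) (Q - D)) = (\<integral>\<^sup>+y. ennreal \<delta> * indicator (Q - D) y \<partial>base M)"
    using \<delta>(1) Q D fin by (subst nn_integral_cmult_indicator) (auto simp: ennreal_mult emeasure_eq_ennreal_measure)
  also have "\<dots> \<le> (\<integral>\<^sup>+y. (\<integral>\<^sup>+\<omega>. ennreal (dens M (Suc 0) (b 0) y (fst \<omega> 0)) \<partial>?T) * indicator (- D) y \<partial>base M)"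
  proof (rule nn_integral_mono)
    fix y assume "y \<in> space (base M)"
    show "ennreal \<delta> * indicator (Q - D) y \<le> (\<integral>\<^sup>+\<omega>. ennreal (dens M (Suc 0) (b 0) y (fst \<omega> 0)) \<partial>?T) * indicator (- D) y"
    proof (cases "y \<in> Q - D")
      case True
      have "ennreal \<delta> = (\<integral>\<^sup>+\<omega>. ennreal \<delta> \<partial>?T)" using P.emeasure_space_1 by simp
      also have "\<dots> \<le> (\<integral>\<^sup>+\<omega>. ennreal (dens M (Suc 0) (b 0) y (fst \<omega> 0)) \<partial>?T)"
        using AE_traj_initial[OF x \<pi> order_refl]
        by (intro nn_integral_mono_AE, eventually_elim) (use \<delta>(2)[of y] True in \<open>simp add: ennreal_leI\<close>)
      finally show ?thesis using True by simp
    qed simp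
  qed
  also have "\<dots> = (\<integral>\<^sup>+\<omega>. indicator (- D) (fst \<omega> (Suc 0)) \<partial>?T)"
    using H by (intro nn_integral_traj_const_policy[OF x(1) b _ g, symmetric]) auto
  also have "\<dots> = (\<integral>\<^sup>+\<omega>. indicator (- D) (fst \<omega> (Suc 0)) \<partial>traj M x ?\<pi> (Suc 0))"
    using H by (intro nn_integral_traj_state[OF x(1) \<pi> _ _ g]) auto
  also have "\<dots> = ennreal (outside_prob M x ?\<pi> 1 D)"
    using emeasure_outside[OF x(1) \<pi> _ D, of 1] H by simp
  finally show ?thesis using outside_prob_bounds(1)[OF x(1) \<pi>] by simp
qed

lemma (in markov_mdp) outside_prob_le_sum_SUP:
  assumes x: "x \<in> space (base M)" and \<pi>: "\<pi> \<in> policies M" and h: "h \<in> {1..H}"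
  shows "outside_prob M x \<pi> h D \<le> (\<Sum>h=1..H. SUP \<pi>\<in>policies M. outside_prob M x \<pi> h D)"
proof -
  have bdd: "bdd_above ((\<lambda>\<pi>. outside_prob M x \<pi> h D) ` policies M)" for h
    using outside_prob_bounds(2)[OF x] by (rule bdd_aboveI2)
  have "outside_prob M x \<pi> h D \<le> (SUP \<pi>\<in>policies M. outside_prob M x \<pi> h D)" by (rule cSUP_upper[OF \<pi> bdd])
  also have "\<dots> \<le> (\<Sum>h=1..H. SUP \<pi>\<in>policies M. outside_prob M x \<pi> h D)"
    using outside_prob_bounds(1)[OF x \<pi>] cSUP_upper[OF \<pi> bdd]
    by (intro member_le_sum[OF h]) (auto intro: order_trans)
  finally show ?thesis .
qed

section \<open>Exit probabilities and densities of the reflected MDP\<close>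

context
  fixes d :: nat and H :: nat and G :: real and M :: "(rvec, rvec) mdp" and \<rho> :: "rvec \<Rightarrow> rvec \<Rightarrow> real"
    and \<delta> :: "rvec set \<Rightarrow> real" and \<Lambda> :: real and L :: "rvec set \<Rightarrow> real" and Lip :: "rvec set \<Rightarrow> rvec \<Rightarrow> real"
  assumes EM: "euclidean_mdp d H G M \<rho>" and DC: "density_conditions d M \<rho> \<delta> \<Lambda> L Lip"
begin

interpretation markov_mdp M by (rule euclidean_mdp_markov[OF EM])

lemmas mdp_facts_dens = euclidean_mdpD[OF EM]

text \<open>The first step from \<open>x\<close> has density at least \<open>\<delta> Q\<close> on
  \<open>Q\<close>, so it lands in \<open>Q - D\<close> with at least this probability. Small exit
  probabilities hence force \<open>D\<close> to fill up any compact \<open>Q\<close> containing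
  \<open>x\<close>.\<close>

lemma sum_SUP_outside_ge:
  assumes H: "1 \<le> H" and x: "x \<in> Q" and D: "0 < measure (leb d) D"
    and Q: "compactin (euclid_top d) Q" "0 < measure (leb d) Q"
  shows "\<delta> Q * measure (leb d) (Q - D) \<le> (\<Sum>h=1..H. SUP \<pi>\<in>policies M. outside_prob M x \<pi> h D)"
proof -
  obtain a where a: "a \<in> space (act M)" using mdp_facts_dens(3) by blast
  note Dd = density_conditionsD[OF DC Q]
  note Qs = measure_pos_imp_sets[OF Q(2)]
  have xs: "x \<in> space (leb d)" using x Qs(1) sets.sets_into_space by blast
  have \<pi>: "(\<lambda>t _. return (act M) a) \<in> policies M" using a by (intro const_policy)
  have "\<delta> Q * measure (base M) (Q - D) \<le> outside_prob M x (\<lambda>t _. return (act M) ((\<lambda>_. a) t)) 1 D"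
  proof (rule outside_prob_ge)
    show "\<delta> Q \<le> dens M 1 a y x" if "y \<in> Q" for y using Dd(6)[of 1 a x y] that a x H mdp_facts_dens(2) by simp
  qed (use xs singleton_sets_leb[OF xs] a H mdp_facts_dens(1,2) measure_pos_imp_sets(1)[OF D] Qs Dd(2) in auto)
  also have "\<dots> \<le> (\<Sum>h=1..H. SUP \<pi>\<in>policies M. outside_prob M x \<pi> h D)"
    using xs H \<pi> mdp_facts_dens(1) by (intro outside_prob_le_sum_SUP) auto
  finally show ?thesis by (simp add: mdp_facts_dens(1))
qed

lemma sum_SUP_outside_nonneg:
  assumes x: "x \<in> space (leb d)"
  shows "0 \<le> (\<Sum>h=1..H. SUP \<pi>\<in>policies M. outside_prob M x \<pi> h D)"
proof (rule sum_nonneg)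
  fix h
  obtain a where a: "a \<in> space (act M)" using mdp_facts_dens(3) by blast
  have \<pi>: "(\<lambda>t _. return (act M) a) \<in> policies M" using a by (intro const_policy)
  have x': "x \<in> space (base M)" using x by (simp add: mdp_facts_dens(1))
  have bdd: "bdd_above ((\<lambda>\<pi>. outside_prob M x \<pi> h D) ` policies M)"
    using outside_prob_bounds(2)[OF x'] by (rule bdd_aboveI2)
  show "0 \<le> (SUP \<pi>\<in>policies M. outside_prob M x \<pi> h D)"
    using outside_prob_bounds(1)[OF x' \<pi>] cSUP_upper[OF \<pi> bdd] by (rule order_trans)
qed

context
  fixes D :: "rvec set"
  assumes D: "compactin (euclid_top d) D" "0 < measure (leb d) D"
begin

lemmas dens_facts = density_conditionsD[OF DC D]

text \<open>Redistribution adds at most \<open>1 / Leb(D)\<close>. The lower bound persists, the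
  upper one may be exceeded by this term, and for this reason the volume of the truncation sets has
  to be bounded from below later.\<close>

lemma reflect_dens_bounds:
  assumes h: "h \<in> {1..H}" and a: "a \<in> space (act M)" and s: "s \<in> D" and y: "y \<in> D"
  shows "\<delta> D \<le> dens (reflect D M) h a y s \<and> dens (reflect D M) h a y s \<le> \<Lambda> + 1 / measure (leb d) D"
proof -
  have D': "0 < measure (base M) D" using D by (simp add: mdp_facts_dens(1))
  have h': "h \<in> {1..horizon M}" using h by (simp add: mdp_facts_dens(2))
  have s': "s \<in> space (base M)" using restrict_leb(3)[OF D(2)] s by (auto simp: mdp_facts_dens(1))
  note m = reflected_mass[OF D' h' s' a]
  have "ennreal (reflected_mass M D h a s) \<le> 1" unfolding m(3)[symmetric] by simp
  then have "1 / measure (leb d) D * reflected_mass M D h a s \<le> 1 / measure (leb d) D * 1"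
    using D(2) by (intro mult_left_mono) auto
  moreover have "0 \<le> 1 / measure (leb d) D * reflected_mass M D h a s" using m(2) D(2) by simp
  ultimately show ?thesis using dens_facts(6)[OF h' a s y] unfolding reflect_simps mdp_facts_dens(1) by simp
qed

text \<open>The two summands of the condition on \<open>L\<close> match the two parts of a reflected
  density: the essential supremum controls the original density inside \<open>D\<close>, the
  integral outside divided by \<open>Leb(D)\<close> controls the redistributed mass.\<close>

lemma reflect_dens_Lipschitz:
  assumes h: "h \<in> {1..H}"
  shows "AE y in restrict_space (leb d) D. \<forall>s\<in>D. \<forall>a\<in>space (act M). \<forall>a'\<in>space (act M).
      \<bar>dens (reflect D M) h a y s - dens (reflect D M) h a' y s\<bar> \<le> L D * \<rho> a a'"
proof -
  interpret A: Metric_space "space (act M)" \<rho> by (rule mdp_facts_dens(6))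
  note Ds = measure_pos_imp_sets[OF D(2)]
  note sub = restrict_leb(3)[OF D(2)]
  have h': "h \<in> {1..horizon M}" using h by (simp add: mdp_facts_dens(2))
  define m where "m = measure (leb d) D"
  have m: "0 < m" "emeasure (leb d) D = ennreal m"
    using D(2) Ds(2) by (simp_all add: m_def emeasure_eq_ennreal_measure)
  define I where "I = (\<integral>\<^sup>+y\<in>space (leb d) - D. ennreal (Lip D y) \<partial>leb d)"
  define e where "e = esssup (restrict_space (leb d) D) (\<lambda>y. ennreal (Lip D y))"
  have le: "e + I / ennreal m \<le> ennreal (L D)" using dens_facts(8) unfolding e_def I_def m(2) .
  have "I / ennreal m \<le> e + I / ennreal m" by simp
  also note le
  finally have Im: "I / ennreal m < \<infinity>" using order_le_less_trans[OF _ ennreal_less_top] by simp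
  have "I < \<infinity>"
  proof (rule ccontr)
    assume "\<not> I < \<infinity>"
    then have "I = \<infinity>" by (simp add: not_less top_unique)
    then show False using Im m(1) by (simp add: ennreal_top_divide)
  qed
  then obtain J where J: "0 \<le> J" "I = ennreal J" by (cases I) auto
  have intLip: "integrable (leb d) (\<lambda>y. indicator (space (leb d) - D) y * Lip D y)"
    and valLip: "(LINT y|leb d. indicator (space (leb d) - D) y * Lip D y) = J"
  proof -
    have "(\<integral>\<^sup>+y. ennreal (indicator (space (leb d) - D) y * Lip D y) \<partial>leb d) = ennreal J"
      unfolding J(2)[symmetric] I_def by (intro nn_integral_cong) (auto simp: indicator_def)
    moreover have "(\<lambda>y. indicator (space (leb d) - D) y * Lip D y) \<in> borel_measurable (leb d)"
      using dens_facts(4) Ds(1) by simp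
    moreover have "AE y in leb d. 0 \<le> indicator (space (leb d) - D) y * Lip D y"
      using dens_facts(5) by (intro AE_I2) simp
    ultimately show "integrable (leb d) (\<lambda>y. indicator (space (leb d) - D) y * Lip D y)"
      "(LINT y|leb d. indicator (space (leb d) - D) y * Lip D y) = J"
      using J(1) nn_integral_eq_integrable[of "\<lambda>y. indicator (space (leb d) - D) y * Lip D y" "leb d" J] by simp_all
  qed
  have mass: "\<bar>reflected_mass M D h a s - reflected_mass M D h a' s\<bar> \<le> J * \<rho> a a'"
    if s: "s \<in> D" and a: "a \<in> space (act M)" "a' \<in> space (act M)" for s a a'
  proof -
    have s': "s \<in> space (base M)" using sub s by (auto simp: mdp_facts_dens(1))
    have int: "integrable (leb d) (\<lambda>y. indicator (space (leb d) - D) y * dens M h a y s)" if "a \<in> space (act M)" for a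
      using integrable_dens(1)[OF h' s' that] Ds(1)
      by (subst mult.commute, intro integrable_real_mult_indicator) (simp_all add: mdp_facts_dens(1))
    have "\<bar>reflected_mass M D h a s - reflected_mass M D h a' s\<bar> =
      \<bar>LINT y|leb d. indicator (space (leb d) - D) y * dens M h a y s - indicator (space (leb d) - D) y * dens M h a' y s\<bar>"
      unfolding reflected_mass_def set_lebesgue_integral_def mdp_facts_dens(1) real_scaleR_def
      using int a by (subst Bochner_Integration.integral_diff) auto
    also have "\<dots> \<le> (LINT y|leb d. \<bar>indicator (space (leb d) - D) y * dens M h a y s - indicator (space (leb d) - D) y * dens M h a' y s\<bar>)"
      by (rule integral_abs_bound)
    also have "\<dots> \<le> (LINT y|leb d. (indicator (space (leb d) - D) y * Lip D y) * \<rho> a a')"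
    proof (rule integral_mono)
      show "integrable (leb d) (\<lambda>y. \<bar>indicator (space (leb d) - D) y * dens M h a y s - indicator (space (leb d) - D) y * dens M h a' y s\<bar>)"
        using int a by (intro integrable_abs Bochner_Integration.integrable_diff) auto
      show "integrable (leb d) (\<lambda>y. indicator (space (leb d) - D) y * Lip D y * \<rho> a a')"
        using intLip by (rule integrable_mult_left)
      fix y assume y: "y \<in> space (leb d)"
      have "edist d s s = 0" by (simp add: edist_def L2_set_def)
      then show "\<bar>indicator (space (leb d) - D) y * dens M h a y s - indicator (space (leb d) - D) y * dens M h a' y s\<bar>
          \<le> indicator (space (leb d) - D) y * Lip D y * \<rho> a a'"
        using dens_facts(7)[OF h' a s s y] by (simp add: indicator_def)
    qed
    also have "\<dots> = J * \<rho> a a'" by (simp only: integral_mult_left_zero valLip)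
    finally show ?thesis .
  qed
  have "AE y in restrict_space (leb d) D. ennreal (Lip D y) \<le> e"
    unfolding e_def by (rule esssup_AE)
  then show ?thesis using AE_space
  proof eventually_elim
    case (elim y)
    then have y: "y \<in> D" "y \<in> space (leb d)" using restrict_leb(1)[OF D(2)] sub by auto
    have "ennreal (Lip D y) + I / ennreal m \<le> e + I / ennreal m" using elim(1) by (rule add_right_mono)
    also note le
    also have "ennreal (Lip D y) + I / ennreal m = ennreal (Lip D y + J / m)"
      unfolding J(2) using J(1) m(1) dens_facts(5)[OF y(2)] by (simp add: divide_ennreal)
    finally have Lle: "Lip D y + J / m \<le> L D" using dens_facts(3) by simp
    show ?case
    proof (intro ballI)
      fix s a a' assume s: "s \<in> D" and a: "a \<in> space (act M)" "a' \<in> space (act M)"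
      have r: "0 \<le> \<rho> a a'" by (rule A.nonneg)
      have e0: "edist d s s = 0" by (simp add: edist_def L2_set_def)
      have "dens (reflect D M) h a y s - dens (reflect D M) h a' y s =
        (dens M h a y s - dens M h a' y s) + (reflected_mass M D h a s - reflected_mass M D h a' s) / m"
        unfolding reflect_simps mdp_facts_dens(1) m_def[symmetric] by (simp add: diff_divide_distrib)
      then have "\<bar>dens (reflect D M) h a y s - dens (reflect D M) h a' y s\<bar> \<le> \<bar>dens M h a y s - dens M h a' y s\<bar> + \<bar>(reflected_mass M D h a s - reflected_mass M D h a' s) / m\<bar>"
        by (metis abs_triangle_ineq)
      also have "\<dots> \<le> Lip D y * \<rho> a a' + J * \<rho> a a' / m"
      proof (rule add_mono)
        show "\<bar>dens M h a y s - dens M h a' y s\<bar> \<le> Lip D y * \<rho> a a'"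
          using dens_facts(7)[OF h' a s s y(2)] unfolding e0 add_0 .
        show "\<bar>(reflected_mass M D h a s - reflected_mass M D h a' s) / m\<bar> \<le> J * \<rho> a a' / m"
          unfolding abs_divide abs_of_pos[OF m(1)] using mass[OF s a] m(1) by (intro divide_right_mono) auto
      qed
      also have "\<dots> = (Lip D y + J / m) * \<rho> a a'" by (simp add: distrib_right)
      also have "\<dots> \<le> L D * \<rho> a a'" using Lle r by (rule mult_right_mono)
      finally show "\<bar>dens (reflect D M) h a y s - dens (reflect D M) h a' y s\<bar> \<le> L D * \<rho> a a'" .
    qed
  qed
qed

end

end

section \<open>Asymptotics\<close>

lemma sum_half_powers_le: "j0 \<le> J \<Longrightarrow> (\<Sum>j\<in>{j0<..J}. (1 / 2 :: real) ^ j) \<le> (1 / 2) ^ j0"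
proof -
  assume "j0 \<le> J"
  then have "(\<Sum>j\<in>{j0<..J}. (1 / 2 :: real) ^ j) = (1 / 2) ^ j0 - (1 / 2) ^ J"
  proof (induction J rule: dec_induct)
    case (step n)
    have "{j0<..Suc n} = insert (Suc n) {j0<..n}" using step.hyps by auto
    then show ?case using step.IH by simp
  qed simp
  then show ?thesis by simp
qed

text \<open>The starting level has \<open>2 ^ j0\<close> of the order of \<open>ln N\<close>. In the
  coarse part, \<open>s j0 \<le> S\<close> bounds the root of the entropy by
  \<open>S * ln N\<close>, with factor \<Lambda>. In the fine part, with factor \<open>L\<close>,
  the scales sum to at most \<open>2 / ln N\<close>, which beats \<open>sqrt (ln (2 * N))\<close>,
  and the entropies contribute only the tail of \<open>s\<close>. The last level is \<open>N\<close>
  itself, so that \<open>N * (1 / 2) ^ N \<le> 1\<close>.\<close>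

lemma chaining_cost_le:
  fixes C :: "nat \<Rightarrow> 'a set" and N j0 :: nat
  defines "s \<equiv> \<lambda>j. (1 / 2) ^ j * sqrt (ln (real (card (C j))))"
  assumes C: "\<And>j. finite (C j)" "\<And>j. C j \<noteq> {}" and s: "summable s" and S: "suminf s \<le> S"
    and N: "2 ^ j0 \<le> ln (real N)" "ln (real N) < 2 ^ Suc j0" and nn: "0 \<le> \<Lambda>" "0 \<le> L"
  shows "j0 \<le> N" "chaining_cost \<Lambda> L C j0 N N \<le> \<Lambda> * (sqrt N * (sqrt 2 * (sqrt (ln (2 * real N)) + S * ln N)) + 1)
    + L * (2 * sqrt 2 * sqrt N * (2 * (sqrt (ln (2 * real N)) / ln N) + (\<Sum>i. s (i + Suc j0))) + 1)"
proof -
  have lnN: "1 \<le> ln (real N)" using N(1) one_le_power[of "2::real" j0] by linarith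
  have N1: "1 \<le> real N" using lnN by (cases "N = 0") (auto simp: Suc_le_eq)
  have "real j0 < 2 ^ j0" by (rule of_nat_less_two_power)
  also have "\<dots> \<le> ln N" by (rule N(1))
  also have "\<dots> \<le> N" using ln_le_minus_one[of "real N"] N1 by linarith
  finally show j0N: "j0 \<le> N" by simp
  have c1: "1 \<le> real (card (C j))" for j using C by (simp add: Suc_le_eq card_gt_0_iff)
  have s0: "0 \<le> s j" for j unfolding s_def using c1[of j] by simp
  have root: "sqrt (2 * ln (2 * (real N * card (C j)))) \<le> sqrt 2 * (sqrt (ln (2 * real N)) + sqrt (ln (card (C j))))" for j
  proof -
    have "0 < real (card (C j))" using c1[of j] by linarith
    have "ln (2 * (real N * card (C j))) = ln (2 * real N * card (C j))" by (simp add: mult.assoc)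
    also have "\<dots> = ln (2 * real N) + ln (card (C j))" using N1 \<open>0 < real (card (C j))\<close> by (subst ln_mult_pos) auto
    also have "sqrt (2 * (ln (2 * real N) + ln (card (C j)))) \<le> sqrt 2 * (sqrt (ln (2 * real N)) + sqrt (ln (card (C j))))"
    proof -
      have "0 \<le> ln (2 * real N)" "0 \<le> ln (real (card (C j)))" using N1 c1[of j] by (auto intro!: ln_ge_zero)
      note sqrt_add_le_add_sqrt[OF this]
      then show ?thesis unfolding real_sqrt_mult by (rule mult_left_mono) simp
    qed
    finally show ?thesis by simp
  qed
  have "s j0 \<le> suminf s" using sum_le_suminf[OF s, of "{j0}"] s0 by simp
  then have "s j0 \<le> S" using S by linarith
  then have "2 ^ j0 * s j0 \<le> 2 ^ j0 * S" by (intro mult_left_mono) auto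
  then have "sqrt (ln (card (C j0))) \<le> 2 ^ j0 * S" by (simp add: s_def power_divide)
  also have "\<dots> \<le> ln N * S" using N(1) \<open>s j0 \<le> S\<close> s0[of j0] by (intro mult_right_mono) auto
  finally have coarse: "sqrt (ln (card (C j0))) \<le> S * ln N" by (simp add: mult.commute)
  have t1: "\<Lambda> * (sqrt N * sqrt (2 * ln (2 * (real N * card (C j0))))) \<le> \<Lambda> * (sqrt N * (sqrt 2 * (sqrt (ln (2 * real N)) + S * ln N)))"
    using nn coarse by (intro mult_left_mono order_trans[OF root]) auto
  have tail: "(\<Sum>j\<in>{j0<..N}. s j) \<le> (\<Sum>i. s (i + Suc j0))"
  proof -
    have "(\<Sum>j\<in>{j0<..N}. s j) = (\<Sum>j\<in>{0 + Suc j0..<(N - j0) + Suc j0}. s j)"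
      using j0N by (intro sum.cong) auto
    also have "\<dots> = (\<Sum>i\<in>{0..<N - j0}. s (i + Suc j0))" by (rule sum.shift_bounds_nat_ivl)
    also have "\<dots> \<le> (\<Sum>i. s (i + Suc j0))"
      using s0 by (intro sum_le_suminf summable_ignore_initial_segment[OF s]) auto
    finally show ?thesis .
  qed
  have "(1 / 2 :: real) ^ j0 \<le> 2 / ln N"
  proof -
    have "(1 / 2 :: real) ^ j0 = 2 / 2 ^ Suc j0" by (simp add: power_divide)
    also have "\<dots> \<le> 2 / ln N" using N(2) lnN by (intro divide_left_mono) auto
    finally show ?thesis .
  qed
  then have half: "(\<Sum>j\<in>{j0<..N}. (1 / 2 :: real) ^ j) \<le> 2 / ln N" using sum_half_powers_le[OF j0N] by linarith
  have "(\<Sum>j\<in>{j0<..N}. 2 * L * (1 / 2) ^ j * (sqrt N * sqrt (2 * ln (2 * (real N * card (C j))))))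
    \<le> (\<Sum>j\<in>{j0<..N}. 2 * L * (1 / 2) ^ j * (sqrt N * (sqrt 2 * (sqrt (ln (2 * real N)) + sqrt (ln (card (C j)))))))"
    using nn by (intro sum_mono mult_left_mono root) auto
  also have "\<dots> = (\<Sum>j\<in>{j0<..N}. L * (2 * sqrt 2 * sqrt N) * ((1 / 2) ^ j * sqrt (ln (2 * real N)) + s j))"
    by (intro sum.cong) (simp_all add: s_def algebra_simps)
  also have "\<dots> = L * (2 * sqrt 2 * sqrt N) * ((\<Sum>j\<in>{j0<..N}. (1 / 2) ^ j) * sqrt (ln (2 * real N)) + (\<Sum>j\<in>{j0<..N}. s j))"
    by (simp only: sum_distrib_left[symmetric] sum_distrib_right[symmetric] sum.distrib)
  also have "\<dots> \<le> L * (2 * sqrt 2 * sqrt N) * (2 / ln N * sqrt (ln (2 * real N)) + (\<Sum>i. s (i + Suc j0)))"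
    using nn N1 by (intro mult_left_mono add_mono mult_right_mono half tail) auto
  finally have t2: "(\<Sum>j\<in>{j0<..N}. 2 * L * (1 / 2) ^ j * (sqrt N * sqrt (2 * ln (2 * (real N * card (C j))))))
    \<le> L * (2 * sqrt 2 * sqrt N * (2 * (sqrt (ln (2 * real N)) / ln N) + (\<Sum>i. s (i + Suc j0))))"
    by (simp add: mult.assoc)
  have "real N * (1 / 2) ^ N \<le> 1" using of_nat_less_two_power[of N, where 'a = real] by (simp add: power_divide)
  then have "L * (real N * (1 / 2) ^ N) \<le> L * 1" using nn by (intro mult_left_mono)
  then have t3: "real N * (L * (1 / 2) ^ N) + \<Lambda> \<le> L + \<Lambda>" by (simp add: mult.left_commute)
  show "chaining_cost \<Lambda> L C j0 N N \<le> \<Lambda> * (sqrt N * (sqrt 2 * (sqrt (ln (2 * real N)) + S * ln N)) + 1)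
    + L * (2 * sqrt 2 * sqrt N * (2 * (sqrt (ln (2 * real N)) / ln N) + (\<Sum>i. s (i + Suc j0))) + 1)"
    unfolding chaining_cost_def using t1 t2 t3 by (simp add: distrib_left)
qed

text \<open>\<open>R1\<close>, \<open>R2\<close> and \<open>R3\<close> compare the coarse part, the
  fine part and the denominators with the target rate. For \<open>R1\<close> and \<open>R3\<close>
  the bound on \<Lambda>/\<delta> leaves a factor N^(-\<alpha>/2), and here \<alpha> > 0 is
  essential. The fine part has no power to spare: it vanishes because of
  \<open>sqrt (ln (2 * x)) / ln x\<close> in \<open>R2\<close> and the tail \<open>tl\<close> of the
  entropy sum.\<close>

lemma sampling_error_small:
  fixes C :: "nat \<Rightarrow> 'a set" and \<delta> \<Lambda> L :: "nat \<Rightarrow> real" and \<alpha> q \<kappa> B \<eta> :: real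
  assumes C: "\<And>j. finite (C j)" "\<And>j. C j \<noteq> {}"
    and s: "summable (\<lambda>j. (1 / 2) ^ j * sqrt (ln (real (card (C j)))))"
    and \<alpha>: "0 < \<alpha>" and B: "0 \<le> B" and \<kappa>: "0 \<le> \<kappa>" and \<eta>: "0 < \<eta>"
    and ev: "\<forall>\<^sub>F N in sequentially. 0 < \<delta> N \<and> 0 \<le> \<Lambda> N \<and> 0 \<le> L N \<and>
      \<Lambda> N / \<delta> N \<le> \<kappa> * (ln (real N) powr (q / 2) * real N powr (\<alpha> / 2)) \<and>
      L N / \<delta> N \<le> \<kappa> * (ln (real N) powr q * real N powr \<alpha>)"
  shows "\<forall>\<^sub>F N in sequentially. \<exists>j0 J. j0 \<le> J \<and>
    16 * B / (\<delta> N * N) * chaining_cost (\<Lambda> N) (L N) C j0 J N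
      + 2 * B / \<delta> N * (\<Lambda> N * sqrt N * sqrt (2 * ln (2 * N)) / (real N - 1))
    \<le> \<eta> * (ln (real N) powr q * real N powr (\<alpha> - 1 / 2))"
proof -
  define s where "s j = (1 / 2) ^ j * sqrt (ln (real (card (C j))))" for j
  have sums: "summable s" using s unfolding s_def .
  define S where "S = \<bar>suminf s\<bar> + 1"
  have S: "suminf s \<le> S" "0 < S" by (auto simp: S_def)
  \<comment> \<open>The level at which the scale \<open>(1 / 2) ^ j0\<close> is comparable to
    \<open>1 / ln N\<close>: it tends to infinity, so the tail vanishes, yet slowly enough for the
    coarse net to cost only logarithms.\<close>
  define j0 where "j0 N = nat \<lfloor>log 2 (ln (real N))\<rfloor>" for N
  have j0: "2 ^ j0 N \<le> ln (real N)" "ln (real N) < 2 ^ Suc (j0 N)" if "1 \<le> ln (real N)" for N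
  proof -
    have l: "0 \<le> log 2 (ln (real N))" using that by simp
    have e: "ln (real N) = 2 powr log 2 (ln (real N))" using that by simp
    have "real (j0 N) \<le> log 2 (ln (real N))" unfolding j0_def using l by linarith
    then have "2 powr real (j0 N) \<le> 2 powr log 2 (ln (real N))" by (intro powr_mono) auto
    then show "2 ^ j0 N \<le> ln (real N)" unfolding e[symmetric] by (simp add: powr_realpow)
    have "log 2 (ln (real N)) < real (Suc (j0 N))" unfolding j0_def using l by linarith
    then have "2 powr log 2 (ln (real N)) < 2 powr real (Suc (j0 N))" by (intro powr_less_mono) auto
    then show "ln (real N) < 2 ^ Suc (j0 N)" unfolding e[symmetric] by (simp add: powr_realpow[symmetric] del: power_Suc)
  qed
  define tl where "tl N = (\<Sum>i. s (i + Suc (j0 N)))" for N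
  have "filterlim (\<lambda>N. Suc (j0 N)) at_top sequentially"
  proof -
    have "filterlim (\<lambda>x::real. log 2 (ln x)) at_top at_top" by real_asymp
    then have l: "filterlim (\<lambda>N. log 2 (ln (real N))) at_top sequentially"
      by (rule filterlim_compose) (rule filterlim_real_sequentially)
    show ?thesis
      unfolding filterlim_at_top
    proof
      fix Z :: nat
      from l have "\<forall>\<^sub>F N in sequentially. real Z \<le> log 2 (ln (real N))" by (simp add: filterlim_at_top)
      then show "\<forall>\<^sub>F N in sequentially. Z \<le> Suc (j0 N)"
        unfolding j0_def by eventually_elim linarith
    qed
  qed
  then have tl: "tl \<longlonglongrightarrow> 0"
    unfolding tl_def by (rule filterlim_compose[where g = "\<lambda>k. \<Sum>i. s (i + k)", OF suminf_exist_split2[OF sums]])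
  define R1 where "R1 x = ln x powr (- q / 2) * x powr (- \<alpha> / 2 - 1 / 2) * (sqrt x * (sqrt 2 * (sqrt (ln (2 * x)) + S * ln x)) + 1)" for x :: real
  define R2 where "R2 x = x powr (- 1 / 2) * (sqrt x * (2 * (sqrt (ln (2 * x)) / ln x)) + 1)" for x :: real
  define R3 where "R3 x = ln x powr (- q / 2) * x powr (1 / 2 - \<alpha> / 2) * sqrt x * sqrt (2 * ln (2 * x)) / (x - 1)" for x :: real
  have R: "((\<lambda>N. R1 (real N)) \<longlongrightarrow> 0) sequentially" "((\<lambda>N. R2 (real N)) \<longlongrightarrow> 0) sequentially" "((\<lambda>N. R3 (real N)) \<longlongrightarrow> 0) sequentially"
  proof -
    have "(R1 \<longlongrightarrow> 0) at_top" unfolding R1_def using \<alpha> S(2) by real_asymp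
    moreover have "(R2 \<longlongrightarrow> 0) at_top" unfolding R2_def by real_asymp
    moreover have "(R3 \<longlongrightarrow> 0) at_top" unfolding R3_def using \<alpha> by real_asymp
    ultimately show "((\<lambda>N. R1 (real N)) \<longlongrightarrow> 0) sequentially" "((\<lambda>N. R2 (real N)) \<longlongrightarrow> 0) sequentially" "((\<lambda>N. R3 (real N)) \<longlongrightarrow> 0) sequentially"
      using filterlim_compose[OF _ filterlim_real_sequentially] by blast+
  qed
  have "(\<lambda>N. 16 * B * (\<kappa> * R1 (real N) + \<kappa> * (2 * sqrt 2 * (R2 (real N) + tl N))) + 2 * B * (\<kappa> * R3 (real N)))
      \<longlonglongrightarrow> 16 * B * (\<kappa> * 0 + \<kappa> * (2 * sqrt 2 * (0 + 0))) + 2 * B * (\<kappa> * 0)"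
    by (intro tendsto_intros R tl)
  then have "(\<lambda>N. 16 * B * (\<kappa> * R1 (real N) + \<kappa> * (2 * sqrt 2 * (R2 (real N) + tl N))) + 2 * B * (\<kappa> * R3 (real N))) \<longlonglongrightarrow> 0"
    by simp
  then have small: "\<forall>\<^sub>F N in sequentially. 16 * B * (\<kappa> * R1 (real N) + \<kappa> * (2 * sqrt 2 * (R2 (real N) + tl N))) + 2 * B * (\<kappa> * R3 (real N)) < \<eta>"
    using \<eta> by (rule order_tendstoD)
  have large: "\<forall>\<^sub>F N in sequentially. 1 \<le> ln (real N)"
  proof -
    have "filterlim (\<lambda>N. ln (real N)) at_top sequentially"
      by (rule filterlim_compose[OF ln_at_top filterlim_real_sequentially])
    then show ?thesis by (simp add: filterlim_at_top)
  qed
  show ?thesis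
    using ev small large
  proof eventually_elim
    case (elim N)
    define l where "l = ln (real N)"
    define x where "x = real N"
    have l1: "1 \<le> l" using elim(3) by (simp add: l_def)
    have x1: "1 < x" 
    proof -
      have N0: "0 < real N" using l1 unfolding l_def by (cases "N = 0") auto
      show ?thesis using l1 ln_gt_zero_iff[OF N0] unfolding l_def x_def by linarith
    qed
    have d: "0 < \<delta> N" and nn: "0 \<le> \<Lambda> N" "0 \<le> L N" using elim(1) by auto
    have b1: "\<Lambda> N / \<delta> N \<le> \<kappa> * (l powr (q / 2) * x powr (\<alpha> / 2))" and b2: "L N / \<delta> N \<le> \<kappa> * (l powr q * x powr \<alpha>)"
      using elim(1) by (auto simp: l_def x_def)
    note cc = chaining_cost_le[OF C s S(1)[unfolded s_def[abs_def]] j0[OF elim(3)] nn, folded s_def, folded tl_def l_def x_def]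
    define u1 where "u1 = sqrt x * (sqrt 2 * (sqrt (ln (2 * x)) + S * l)) + 1"
    define u2 where "u2 = 2 * sqrt 2 * sqrt x * (2 * (sqrt (ln (2 * x)) / l) + tl N) + 1"
    define u3 where "u3 = sqrt x * sqrt (2 * ln (2 * x)) / (x - 1)"
    have s0: "0 \<le> s j" for j
    proof -
      have "1 \<le> real (card (C j))" using C by (simp add: Suc_le_eq card_gt_0_iff)
      then show ?thesis unfolding s_def by simp
    qed
    have tl0: "0 \<le> tl N" unfolding tl_def using s0 by (intro suminf_nonneg summable_ignore_initial_segment[OF sums])
    have u0: "0 \<le> u1" "0 \<le> u2" "0 \<le> u3"
      unfolding u1_def u2_def u3_def using x1 l1 S(2) tl0 by (auto intro!: add_nonneg_nonneg mult_nonneg_nonneg divide_nonneg_nonneg)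
    have "16 * B / (\<delta> N * x) * chaining_cost (\<Lambda> N) (L N) C (j0 N) N N + 2 * B / \<delta> N * (\<Lambda> N * sqrt x * sqrt (2 * ln (2 * x)) / (x - 1))
      \<le> 16 * B / (\<delta> N * x) * (\<Lambda> N * u1 + L N * u2) + 2 * B / \<delta> N * (\<Lambda> N * sqrt x * sqrt (2 * ln (2 * x)) / (x - 1))"
      using cc(2) B d x1 unfolding u1_def u2_def by (intro add_right_mono mult_left_mono) auto
    also have "\<dots> = 16 * B / x * (\<Lambda> N / \<delta> N * u1 + L N / \<delta> N * u2) + 2 * B * (\<Lambda> N / \<delta> N * u3)"
      using d x1 by (simp add: u3_def field_simps)
    also have "\<dots> \<le> 16 * B / x * (\<kappa> * (l powr (q / 2) * x powr (\<alpha> / 2)) * u1 + \<kappa> * (l powr q * x powr \<alpha>) * u2)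
        + 2 * B * (\<kappa> * (l powr (q / 2) * x powr (\<alpha> / 2)) * u3)"
      using B x1 u0 b1 b2 by (intro add_mono mult_left_mono mult_right_mono) auto
    also have "\<dots> \<le> (16 * B * (\<kappa> * R1 x + \<kappa> * (2 * sqrt 2 * (R2 x + tl N))) + 2 * B * (\<kappa> * R3 x)) * (l powr q * x powr (\<alpha> - 1 / 2))"
    proof -
      define W where "W = l powr q * x powr (\<alpha> - 1 / 2)"
      have lq: "l powr (q / 2) = l powr (- q / 2) * l powr q" by (simp add: powr_add[symmetric])
      have xa: "x powr (\<alpha> / 2) = x * (x powr (- \<alpha> / 2 - 1 / 2) * x powr (\<alpha> - 1 / 2))"
      proof -
        have "x * (x powr (- \<alpha> / 2 - 1 / 2) * x powr (\<alpha> - 1 / 2)) = x powr 1 * (x powr (- \<alpha> / 2 - 1 / 2) * x powr (\<alpha> - 1 / 2))"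
          using x1 by simp
        then show ?thesis by (simp only: powr_add[symmetric]) (simp add: field_simps)
      qed
      have xa': "x powr (\<alpha> / 2) = x powr (1 / 2 - \<alpha> / 2) * x powr (\<alpha> - 1 / 2)"
        by (simp add: powr_add[symmetric])
      have xb: "x powr \<alpha> = x * (x powr (- 1 / 2) * x powr (\<alpha> - 1 / 2))"
      proof -
        have "x * (x powr (- 1 / 2) * x powr (\<alpha> - 1 / 2)) = x powr 1 * (x powr (- 1 / 2) * x powr (\<alpha> - 1 / 2))" using x1 by simp
        then show ?thesis by (simp only: powr_add[symmetric]) simp
      qed
      have e1: "l powr (q / 2) * x powr (\<alpha> / 2) * u1 = x * (R1 x * W)"
        unfolding lq xa unfolding R1_def W_def u1_def l_def x_def by (simp add: mult_ac)
      have e3: "l powr (q / 2) * x powr (\<alpha> / 2) * u3 = R3 x * W"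
        unfolding lq xa' unfolding R3_def W_def u3_def l_def x_def by (simp add: mult_ac)
      have sx: "x powr (- 1 / 2) * sqrt x = 1" using x1 by (simp add: powr_half_sqrt[symmetric] powr_add[symmetric])
      have e2: "l powr q * x powr \<alpha> * u2 \<le> x * ((2 * sqrt 2 * (R2 x + tl N)) * W)"
      proof -
        have "x powr (- 1 / 2) * u2 \<le> 2 * sqrt 2 * (R2 x + tl N)"
        proof -
          have "x powr (- 1 / 2) * u2 = 2 * sqrt 2 * (x powr (- 1 / 2) * sqrt x) * (2 * (sqrt (ln (2 * x)) / l) + tl N) + x powr (- 1 / 2)"
            unfolding u2_def by (simp add: algebra_simps)
          also have "\<dots> = 2 * sqrt 2 * (2 * (sqrt (ln (2 * x)) / l) + tl N) + x powr (- 1 / 2)" unfolding sx by simp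
          also have "R2 x = x powr (- 1 / 2) * sqrt x * (2 * (sqrt (ln (2 * x)) / l)) + x powr (- 1 / 2)"
            unfolding R2_def l_def x_def by (simp add: algebra_simps)
          then have R2x: "R2 x = 2 * (sqrt (ln (2 * x)) / l) + x powr (- 1 / 2)" unfolding sx by simp
          have "1 * x powr (- 1 / 2) \<le> 2 * sqrt 2 * x powr (- 1 / 2)"
          proof (rule mult_right_mono)
            have "1 \<le> sqrt (2::real)" by simp
            then show "1 \<le> 2 * sqrt (2::real)" by linarith
          qed simp
          then have "2 * sqrt 2 * (2 * (sqrt (ln (2 * x)) / l) + tl N) + x powr (- 1 / 2) \<le> 2 * sqrt 2 * (R2 x + tl N)"
            unfolding R2x by (simp add: algebra_simps)
          finally show ?thesis .
        qed
        then have "x * W * (x powr (- 1 / 2) * u2) \<le> x * W * (2 * sqrt 2 * (R2 x + tl N))"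
          using x1 by (intro mult_left_mono) (auto simp: W_def)
        also have "x * W * (2 * sqrt 2 * (R2 x + tl N)) = x * ((2 * sqrt 2 * (R2 x + tl N)) * W)" by (simp only: mult_ac)
        also have "x * W * (x powr (- 1 / 2) * u2) = l powr q * x powr \<alpha> * u2" unfolding xb W_def by (simp only: mult_ac)
        finally show ?thesis .
      qed
      have "16 * B / x * (\<kappa> * (l powr (q / 2) * x powr (\<alpha> / 2)) * u1 + \<kappa> * (l powr q * x powr \<alpha>) * u2)
        + 2 * B * (\<kappa> * (l powr (q / 2) * x powr (\<alpha> / 2)) * u3)
        = 16 * B / x * (\<kappa> * (l powr (q / 2) * x powr (\<alpha> / 2) * u1) + \<kappa> * (l powr q * x powr \<alpha> * u2))
        + 2 * B * (\<kappa> * (l powr (q / 2) * x powr (\<alpha> / 2) * u3))" by (simp only: mult.assoc)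
      also have "\<dots> \<le> 16 * B / x * (\<kappa> * (x * (R1 x * W)) + \<kappa> * (x * ((2 * sqrt 2 * (R2 x + tl N)) * W))) + 2 * B * (\<kappa> * (R3 x * W))"
        unfolding e1 e3 using B x1 \<kappa> e2 by (intro add_mono mult_left_mono order_refl) auto
      also have "\<dots> = (16 * B * (\<kappa> * R1 x + \<kappa> * (2 * sqrt 2 * (R2 x + tl N))) + 2 * B * (\<kappa> * R3 x)) * W"
        using x1 by (simp add: field_simps)
      finally show ?thesis unfolding W_def .
    qed
    also have "\<dots> \<le> \<eta> * (l powr q * x powr (\<alpha> - 1 / 2))"
      using elim(2) unfolding x_def by (intro mult_right_mono) auto
    finally show ?case
      using cc(1) unfolding l_def x_def by (intro exI[of _ "j0 N"] exI[of _ N]) simp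
  qed
qed

text \<open>\<open>X\<close> is the size at which the bound would equal \<epsilon> if
  \<open>ln N\<close> were exactly \<gamma> times \<open>ln (1 / \<epsilon>)\<close>; the factor
  \<open>\<gamma> powr - q\<close> cancels the power of \<gamma> that this substitution produces.
  Taking \<open>N\<close> near \<open>2 * X\<close> pays for the errors of the approximation, and
  \<open>N \<le> 2 * X\<close> gives the 4.\<close>

lemma budget_exists:
  fixes err :: "nat \<Rightarrow> ennreal" and A \<gamma> q :: real
  assumes A: "1 \<le> A" and \<gamma>: "0 < \<gamma>" and q: "0 \<le> q"
    and err: "\<And>\<eta>. 0 < \<eta> \<Longrightarrow> \<forall>\<^sub>F N in sequentially.
      err N \<le> ennreal (A * (1 + \<eta>) * \<gamma> powr - q * (ln (real N) powr q * real N powr (- 1 / \<gamma>)))"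
  shows "\<forall>\<^sub>F \<epsilon> in at_right 0. \<exists>N\<ge>2. err N \<le> ennreal \<epsilon> \<and>
    real N ^ 2 \<le> 4 * (A powr (2 * \<gamma>) * (ln (1 / \<epsilon>) powr (2 * q * \<gamma>) / \<epsilon> powr (2 * \<gamma>)))"
proof -
  \<comment> \<open>One factor \<open>1 + \<eta>\<close> comes from the bound on \<open>err\<close>,
    another \<open>q\<close> of them from
    \<open>ln N \<le> \<gamma> * (1 + \<eta>) * ln (1 / \<epsilon>)\<close>. Their product is made
    equal to the gain \<open>(3 / 2) powr (1 / \<gamma>)\<close> obtained from
    \<open>N \<ge> 3 / 2 * X\<close>.\<close>
  define \<eta> where "\<eta> = (3 / 2) powr (1 / (\<gamma> * (1 + q))) - 1"
  have \<eta>: "0 < \<eta>" unfolding \<eta>_def using \<gamma> q by simp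
  have \<eta>_eq: "(1 + \<eta>) powr (1 + q) = (3 / 2) powr (1 / \<gamma>)"
    unfolding \<eta>_def using q by (simp add: powr_powr)
  define X where "X \<epsilon> = (A * ln (1 / \<epsilon>) powr q / \<epsilon>) powr \<gamma>" for \<epsilon> :: real
  define K where "K \<epsilon> = nat \<lfloor>2 * X \<epsilon>\<rfloor>" for \<epsilon>
  have A0: "0 < A" using A by simp
  have Xlim: "filterlim X at_top (at_right 0)" unfolding X_def using A0 \<gamma> by real_asymp
  have Xln: "((\<lambda>\<epsilon>. ln (2 * X \<epsilon>) / ln (1 / \<epsilon>)) \<longlongrightarrow> \<gamma>) (at_right 0)" unfolding X_def using A0 \<gamma> by real_asymp
  have Klim: "filterlim K at_top (at_right 0)"
    unfolding filterlim_at_top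
  proof
    fix Z :: nat
    have "\<forall>\<^sub>F \<epsilon> in at_right 0. real Z \<le> X \<epsilon>" using Xlim by (simp add: filterlim_at_top)
    moreover have "\<forall>\<^sub>F \<epsilon> in at_right 0. 0 \<le> X \<epsilon>" using Xlim by (simp add: filterlim_at_top)
    ultimately show "\<forall>\<^sub>F \<epsilon> in at_right 0. Z \<le> K \<epsilon>" unfolding K_def by eventually_elim linarith
  qed
  have "\<forall>\<^sub>F \<epsilon> in at_right 0. err (K \<epsilon>) \<le> ennreal (A * (1 + \<eta>) * \<gamma> powr - q * (ln (real (K \<epsilon>)) powr q * real (K \<epsilon>) powr (- 1 / \<gamma>)))"
    using err[OF \<eta>] Klim by (rule eventually_compose_filterlim)
  moreover have "\<forall>\<^sub>F \<epsilon> in at_right 0. 2 \<le> X \<epsilon>" using Xlim by (simp add: filterlim_at_top)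
  moreover have "\<forall>\<^sub>F \<epsilon> in at_right 0. ln (2 * X \<epsilon>) / ln (1 / \<epsilon>) < \<gamma> * (1 + \<eta>)"
    using Xln \<gamma> \<eta> by (intro order_tendstoD(2)[OF Xln]) simp
  moreover have "\<forall>\<^sub>F \<epsilon> in at_right 0. \<epsilon> \<in> {0<..<1::real}" by (rule eventually_at_right_real) simp
  ultimately show ?thesis
  proof eventually_elim
    case (elim \<epsilon>)
    define l where "l = ln (1 / \<epsilon>)"
    have l: "0 < l" unfolding l_def using elim(4) by simp
    have e: "0 < \<epsilon>" using elim(4) by simp
    define N where "N = K \<epsilon>"
    have N: "3 / 2 * X \<epsilon> \<le> real N" "real N \<le> 2 * X \<epsilon>" "2 \<le> N"
      \<comment> \<open>Rounding down loses at most 1, which is at most \<open>X / 2\<close> because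
        \<open>2 \<le> X\<close>.\<close>
      unfolding N_def K_def using elim(2) by linarith+
    have base: "0 < A * l powr q / \<epsilon>" using A0 l e by simp
    have "ln (real N) \<le> ln (2 * X \<epsilon>)" using N elim(2) by (subst ln_le_cancel_iff) auto
    also have "\<dots> \<le> \<gamma> * (1 + \<eta>) * l" using elim(3) l unfolding l_def[symmetric] by (simp add: pos_divide_less_eq)
    finally have "ln (real N) powr q \<le> (\<gamma> * (1 + \<eta>) * l) powr q" using N(3) q by (intro powr_mono2) auto
    also have "\<dots> = \<gamma> powr q * (1 + \<eta>) powr q * l powr q" using \<gamma> \<eta> l by (simp add: powr_mult)
    finally have lnq: "ln (real N) powr q \<le> \<gamma> powr q * (1 + \<eta>) powr q * l powr q" .
    have "real N powr (- 1 / \<gamma>) \<le> (3 / 2 * X \<epsilon>) powr (- 1 / \<gamma>)"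
      using N elim(2) \<gamma> by (intro powr_mono2') auto
    also have "\<dots> = (3 / 2) powr (- 1 / \<gamma>) * X \<epsilon> powr (- 1 / \<gamma>)" using elim(2) by (subst powr_mult) auto
    also have "X \<epsilon> powr (- 1 / \<gamma>) = \<epsilon> / (A * l powr q)"
      unfolding X_def l_def[symmetric] powr_powr using \<gamma> base e A0 l by (simp add: powr_minus_divide abs_of_pos)
    finally have Npow: "real N powr (- 1 / \<gamma>) \<le> (3 / 2) powr (- 1 / \<gamma>) * (\<epsilon> / (A * l powr q))" .
    have "A * (1 + \<eta>) * \<gamma> powr - q * (ln (real N) powr q * real N powr (- 1 / \<gamma>)) \<le>
      A * (1 + \<eta>) * \<gamma> powr - q * ((\<gamma> powr q * (1 + \<eta>) powr q * l powr q) * ((3 / 2) powr (- 1 / \<gamma>) * (\<epsilon> / (A * l powr q))))"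
      using A0 \<eta> \<gamma> by (intro mult_left_mono mult_mono lnq Npow) auto
    also have "\<dots> = (\<gamma> powr - q * \<gamma> powr q) * ((1 + \<eta>) * (1 + \<eta>) powr q) * (3 / 2) powr (- 1 / \<gamma>) * (A * l powr q * (\<epsilon> / (A * l powr q)))"
      by (simp only: mult_ac)
    also have "\<gamma> powr - q * \<gamma> powr q = 1" using \<gamma> by (simp add: powr_add[symmetric])
    also have "(1 + \<eta>) * (1 + \<eta>) powr q = (3 / 2) powr (1 / \<gamma>)"
      unfolding \<eta>_eq[symmetric] using \<eta> by (simp add: powr_add)
    also have "A * l powr q * (\<epsilon> / (A * l powr q)) = \<epsilon>" using A0 l by simp
    also have "1 * (3 / 2 :: real) powr (1 / \<gamma>) * (3 / 2) powr (- 1 / \<gamma>) * \<epsilon> = \<epsilon>" by (simp add: powr_add[symmetric])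
    finally have "err N \<le> ennreal \<epsilon>" using elim(1) unfolding N_def by (metis ennreal_leI order_trans)
    moreover have "real N ^ 2 \<le> 4 * (A powr (2 * \<gamma>) * (ln (1 / \<epsilon>) powr (2 * q * \<gamma>) / \<epsilon> powr (2 * \<gamma>)))"
    proof -
      have "real N ^ 2 \<le> (2 * X \<epsilon>) ^ 2" using N(2) by (intro power_mono) auto
      also have "\<dots> = 4 * X \<epsilon> powr 2" using elim(2) by (simp add: power_mult_distrib powr_numeral)
      also have "X \<epsilon> powr 2 = (A * l powr q / \<epsilon>) powr (2 * \<gamma>)" unfolding X_def l_def by (simp add: powr_powr mult.commute)
      also have "\<dots> = A powr (2 * \<gamma>) * (l powr (2 * q * \<gamma>) / \<epsilon> powr (2 * \<gamma>))"
        using A0 l e by (simp add: powr_divide powr_mult powr_powr mult_ac)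
      finally show ?thesis unfolding l_def .
    qed
    ultimately show ?case using N(3) by blast
  qed
qed

text \<open>The exponent \<open>1 / \<gamma>\<close> is the smaller of \<beta> and 1/2 - \<alpha>.
  If it is \<beta>, the truncation term sets the rate and its constant is covered by
  \<open>A\<close>, while the sampling term fits into the slack \<eta>. Otherwise the truncation
  term has a spare negative power of \<open>N\<close> and both terms fit into the slack.\<close>

lemma rate_combination:
  fixes \<alpha> \<beta> q A T \<eta> :: real
  assumes \<beta>: "0 < \<beta>" and \<alpha>: "\<alpha> < 1 / 2" and A: "1 \<le> A" and T: "0 \<le> T" "T * (1 / \<beta>) powr q \<le> A" and \<eta>: "0 < \<eta>"
  defines "\<gamma> \<equiv> max (1 / \<beta>) (2 / (1 - 2 * \<alpha>))"
  shows "\<forall>\<^sub>F N in sequentially. \<eta> / 2 * \<gamma> powr - q * (ln (real N) powr q * real N powr (\<alpha> - 1 / 2))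
      + T * (ln (real N) powr q * real N powr - \<beta>)
    \<le> A * (1 + \<eta>) * \<gamma> powr - q * (ln (real N) powr q * real N powr (- 1 / \<gamma>))"
proof -
  have \<gamma>: "0 < \<gamma>" unfolding \<gamma>_def using \<beta> by (simp add: less_max_iff_disj)
  have inv: "1 / (2 / (1 - 2 * \<alpha>)) = 1 / 2 - \<alpha>" using \<alpha> by (simp add: field_simps)
  have gp: "0 < \<gamma> powr - q" using \<gamma> by simp
  show ?thesis
  proof (cases "\<beta> \<le> 1 / 2 - \<alpha>")
    case True
    have "2 / (1 - 2 * \<alpha>) \<le> 1 / \<beta>" using True \<alpha> \<beta> by (simp add: field_simps)
    then have g: "\<gamma> = 1 / \<beta>" "- 1 / \<gamma> = - \<beta>" using \<beta> by (simp_all add: \<gamma>_def)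
    have TA: "T \<le> A * \<gamma> powr - q"
    proof -
      have "T = T * (1 / \<beta>) powr q * \<gamma> powr - q" unfolding g using \<beta> by (simp add: powr_minus)
      also have "\<dots> \<le> A * \<gamma> powr - q" using T(2) gp by (intro mult_right_mono) auto
      finally show ?thesis .
    qed
    have "\<forall>\<^sub>F N in sequentially. (2::nat) \<le> N" by (rule eventually_ge_at_top)
    then show ?thesis
    proof eventually_elim
      case (elim N)
      define w where "w = ln (real N) powr q * real N powr - \<beta>"
      have w: "0 \<le> w" by (simp add: w_def)
      have "real N powr (\<alpha> - 1 / 2) \<le> real N powr - \<beta>" using elim True by (intro powr_mono) auto
      then have "ln (real N) powr q * real N powr (\<alpha> - 1 / 2) \<le> w" unfolding w_def by (intro mult_left_mono) auto
      then have "\<eta> / 2 * \<gamma> powr - q * (ln (real N) powr q * real N powr (\<alpha> - 1 / 2)) + T * w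
        \<le> \<eta> / 2 * \<gamma> powr - q * w + A * \<gamma> powr - q * w"
        using \<eta> gp TA w by (intro add_mono mult_left_mono mult_right_mono) auto
      also have "\<dots> = (\<eta> / 2 + A) * (\<gamma> powr - q * w)" by (simp add: algebra_simps)
      also have "\<dots> \<le> (A * (1 + \<eta>)) * (\<gamma> powr - q * w)"
      proof (rule mult_right_mono)
        have "1 * \<eta> \<le> A * \<eta>" using A \<eta> by (intro mult_right_mono) auto
        then show "\<eta> / 2 + A \<le> A * (1 + \<eta>)" using \<eta> by (simp add: distrib_left)
      qed (use w gp in simp)
      finally show ?case unfolding g(2) w_def by (simp add: mult.assoc)
    qed
  next
    case False
    then have "1 / \<beta> \<le> 2 / (1 - 2 * \<alpha>)" using \<alpha> \<beta> by (simp add: field_simps)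
    then have "\<gamma> = 2 / (1 - 2 * \<alpha>)" by (simp add: \<gamma>_def)
    then have g: "- 1 / \<gamma> = \<alpha> - 1 / 2" using inv by simp
    define z where "z = \<beta> + \<alpha> - 1 / 2"
    have z: "0 < z" using False by (simp add: z_def)
    have "((\<lambda>x::real. T * x powr - z) \<longlongrightarrow> 0) at_top" using z by real_asymp
    then have "((\<lambda>N. T * real N powr - z) \<longlongrightarrow> 0) sequentially"
      by (rule filterlim_compose) (rule filterlim_real_sequentially)
    moreover have "0 < \<eta> / 2 * \<gamma> powr - q" using \<eta> gp by simp
    ultimately have "\<forall>\<^sub>F N in sequentially. T * real N powr - z < \<eta> / 2 * \<gamma> powr - q" by (rule order_tendstoD)
    then show ?thesis
    proof eventually_elim
      case (elim N)
      define w where "w = ln (real N) powr q * real N powr (\<alpha> - 1 / 2)"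
      have w: "0 \<le> w" by (simp add: w_def)
      have "T * (ln (real N) powr q * real N powr - \<beta>) = T * real N powr - z * w"
        unfolding w_def z_def by (simp add: powr_add[symmetric])
      also have "\<dots> \<le> \<eta> / 2 * \<gamma> powr - q * w" using elim w by (intro mult_right_mono) auto
      finally have "\<eta> / 2 * \<gamma> powr - q * w + T * (ln (real N) powr q * real N powr - \<beta>) \<le> \<eta> * (\<gamma> powr - q * w)"
        by (simp add: mult.assoc)
      also have "\<dots> \<le> (A * (1 + \<eta>)) * (\<gamma> powr - q * w)"
      proof (rule mult_right_mono)
        have "1 * (1 + \<eta>) \<le> A * (1 + \<eta>)" using A \<eta> by (intro mult_right_mono) auto
        then show "\<eta> \<le> A * (1 + \<eta>)" by (rule order_trans[rotated]) simp
      qed (use w gp in simp)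
      finally show ?case unfolding g w_def by (simp add: mult.assoc)
    qed
  qed
qed

section \<open>Growth of the truncation sets\<close>

context
  fixes d :: nat and H :: nat and G :: real and M :: "(rvec, rvec) mdp" and \<rho> :: "rvec \<Rightarrow> rvec \<Rightarrow> real"
    and \<delta> :: "rvec set \<Rightarrow> real" and \<Lambda> :: real and L :: "rvec set \<Rightarrow> real" and Lip :: "rvec set \<Rightarrow> rvec \<Rightarrow> real"
    and x :: rvec and \<D> :: "nat \<Rightarrow> rvec set" and P :: "nat \<Rightarrow> real"
  assumes EM: "euclidean_mdp d H G M \<rho>" and DC: "density_conditions d M \<rho> \<delta> \<Lambda> L Lip"
    and H: "1 \<le> H" and d: "1 \<le> d"
    and \<D>: "\<And>N. 1 \<le> N \<Longrightarrow> compactin (euclid_top d) (\<D> N)" "\<And>N. 1 \<le> N \<Longrightarrow> 0 < measure (leb d) (\<D> N)"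
      "\<And>N. 1 \<le> N \<Longrightarrow> x \<in> \<D> N"
  defines "P \<equiv> \<lambda>N. \<Sum>h=1..H. SUP \<pi>\<in>policies M. outside_prob M x \<pi> h (\<D> N)"
begin

lemma measure_le_Diff:
  assumes "0 < measure (leb d) D" "0 < measure (leb d) Q"
  shows "measure (leb d) Q \<le> measure (leb d) D + measure (leb d) (Q - D)"
proof -
  note s = measure_pos_imp_sets[OF assms(1)] measure_pos_imp_sets[OF assms(2)]
  have f: "D \<in> fmeasurable (leb d)" "Q \<in> fmeasurable (leb d)" using s by (auto simp: fmeasurable_def)
  have "measure (leb d) Q \<le> measure (leb d) (D \<union> (Q - D))"
    using f by (intro measure_mono_fmeasurable) (auto intro: fmeasurableD)
  also have "\<dots> \<le> measure (leb d) D + measure (leb d) (Q - D)"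
    using f by (intro measure_Un_le) (auto intro: fmeasurableD)
  finally show ?thesis .
qed

lemma start_space: "x \<in> space (leb d)"
  using \<D>(3)[of 1] restrict_leb(3)[OF \<D>(2)[of 1]] by auto

lemma P_nonneg: "0 \<le> P N"
  unfolding P_def by (rule sum_SUP_outside_nonneg[OF EM DC start_space])

text \<open>Every cube around \<open>x\<close> has a positive lower density bound, so vanishing exit
  probabilities make \<open>\<D> N\<close> cover it up to measure 1. The sets \<open>\<D> N\<close>
  need not be nested for this.\<close>

lemma measure_truncation_at_top:
  assumes P0: "P \<longlonglongrightarrow> 0"
  shows "filterlim (\<lambda>N. measure (leb d) (\<D> N)) at_top sequentially"
  unfolding filterlim_at_top
proof
  fix Z :: real
  define r where "r = (\<Sum>i<d. \<bar>x i\<bar>) + \<bar>Z\<bar> + 1"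
  have r1: "1 \<le> r" "Z + 1 \<le> r" 
  proof -
    have "0 \<le> (\<Sum>i<d. \<bar>x i\<bar>)" by (rule sum_nonneg) simp
    then show "1 \<le> r" "Z + 1 \<le> r" unfolding r_def using abs_ge_self[of Z] by linarith+
  qed
  define Q where "Q = ({..<d} \<rightarrow>\<^sub>E {- r..r})"
  have cQ: "compactin (euclid_top d) Q" unfolding Q_def by (rule compactin_cube)
  have mQ: "measure (leb d) Q = (2 * r) ^ d"
    unfolding Q_def measure_def using measure_cube[of "- r" r d] r1 by simp
  then have pQ: "0 < measure (leb d) Q" using r1 by simp
  have xQ: "x \<in> Q"
  proof -
    have "\<bar>x i\<bar> \<le> r" if "i < d" for i
      using member_le_sum[of i "{..<d}" "\<lambda>i. \<bar>x i\<bar>"] that unfolding r_def by simp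
    then have "x i \<in> {- r..r}" if "i < d" for i using that by (simp add: abs_le_iff) (metis abs_le_iff minus_le_iff)
    then show ?thesis using start_space unfolding Q_def space_leb by (auto simp: PiE_iff)
  qed
  have "0 < \<delta> Q" using density_conditionsD(2)[OF DC cQ pQ] .
  then have "\<forall>\<^sub>F N in sequentially. P N < \<delta> Q" using order_tendstoD(2)[OF P0] by blast
  then show "\<forall>\<^sub>F N in sequentially. Z \<le> measure (leb d) (\<D> N)"
    using eventually_ge_at_top[of 1]
  proof eventually_elim
    case (elim N)
    have "\<delta> Q * measure (leb d) (Q - \<D> N) \<le> P N"
      unfolding P_def by (rule sum_SUP_outside_ge[OF EM DC H xQ \<D>(2)[OF elim(2)] cQ pQ])
    then have "\<delta> Q * measure (leb d) (Q - \<D> N) < \<delta> Q * 1" using elim(1) by simp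
    then have "measure (leb d) (Q - \<D> N) < 1" using \<open>0 < \<delta> Q\<close> by (subst (asm) mult_less_cancel_left_pos)
    \<comment> \<open>This is where the dimension must be positive: in dimension 0 the whole space
      has measure 1.\<close>
    moreover have "2 * r \<le> measure (leb d) Q" unfolding mQ using r1 d by (intro self_le_power) auto
    ultimately show ?case using measure_le_Diff[OF \<D>(2)[OF elim(2)] pQ] r1 by linarith
  qed
qed

text \<open>
  A density ratio growing only like a power of \<open>ln N\<close> is impossible: along \<open>N = 2\<^sup>j\<close> the mass that
  \<open>\<D> (2 * N)\<close> adds to \<open>\<D> N\<close> is at most \<open>P N / \<delta> (\<D> (2 * N))\<close>, which is summable in \<open>j\<close>, although
  the measure of \<open>\<D> N\<close> tends to infinity.
\<close>

lemma density_ratio_not_polylogarithmic: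
  assumes P0: "P \<longlonglongrightarrow> 0" and \<beta>: "0 < \<beta>"
    and \<delta>: "\<forall>\<^sub>F N in sequentially. 1 / \<delta> (\<D> N) \<le> \<kappa> * ln (real N) powr p"
    and Pr: "\<forall>\<^sub>F N in sequentially. P N \<le> \<kappa>' * (ln (real N) powr q * real N powr - \<beta>)"
  shows False
proof -
  define a where "a j = measure (leb d) (\<D> (2 ^ j))" for j
  define s where "s j = \<kappa> * \<kappa>' * (ln (2 ^ Suc j) powr p * ln (2 ^ j) powr q * (2 ^ j) powr - \<beta>)" for j :: nat
  have p2: "filterlim (\<lambda>j. 2 ^ j :: nat) at_top sequentially"
  proof (rule filterlim_at_top_mono[OF filterlim_ident])
    show "\<forall>\<^sub>F j in sequentially. j \<le> 2 ^ j" by (intro always_eventually allI less_imp_le[OF less_exp])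
  qed
  have p2': "filterlim (\<lambda>j. 2 ^ Suc j :: nat) at_top sequentially"
    by (rule filterlim_compose[OF p2 filterlim_Suc])
  have "summable s"
  proof (rule summable_comparison_test_bigo)
    show "s \<in> O(\<lambda>j. 1 / real j ^ 2)"
    proof -
      have "(\<lambda>j. ln (2 ^ Suc j) powr p * ln (2 ^ j) powr q * (2 ^ j) powr - \<beta>) \<in> O(\<lambda>j. 1 / real j ^ 2)"
        using \<beta> by real_asymp
      then show ?thesis unfolding s_def by (cases "\<kappa> * \<kappa>' = 0") auto
    qed
    show "summable (\<lambda>j. norm (1 / real j ^ 2))" using inverse_power_summable[of 2, where 'a = real] by (simp add: divide_inverse)
  qed
  have "\<forall>\<^sub>F j in sequentially. a (Suc j) \<le> a j + s j"
    using eventually_compose_filterlim[OF \<delta> p2'] eventually_compose_filterlim[OF Pr p2]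
  proof eventually_elim
    case (elim j)
    have N: "1 \<le> (2::nat) ^ j" "1 \<le> (2::nat) ^ Suc j" by simp_all
    note \<D>j = \<D>(1)[OF N(2)] \<D>(2)[OF N(2)]
    have \<delta>p: "0 < \<delta> (\<D> (2 ^ Suc j))" using density_conditionsD(2)[OF DC \<D>j] .
    have "\<delta> (\<D> (2 ^ Suc j)) * measure (leb d) (\<D> (2 ^ Suc j) - \<D> (2 ^ j)) \<le> P (2 ^ j)"
      unfolding P_def by (rule sum_SUP_outside_ge[OF EM DC H \<D>(3)[OF N(2)] \<D>(2)[OF N(1)] \<D>j])
    then have "measure (leb d) (\<D> (2 ^ Suc j) - \<D> (2 ^ j)) \<le> 1 / \<delta> (\<D> (2 ^ Suc j)) * P (2 ^ j)"
      using \<delta>p by (simp add: field_simps)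
    also have "\<dots> \<le> (\<kappa> * ln (real (2 ^ Suc j)) powr p) * (\<kappa>' * (ln (real (2 ^ j)) powr q * real (2 ^ j) powr - \<beta>))"
      using elim \<delta>p P_nonneg by (intro mult_mono) (auto intro: order_trans[rotated])
    also have "\<dots> = s j" unfolding s_def by (simp only: of_nat_power of_nat_numeral mult_ac)
    finally show ?case
      using measure_le_Diff[OF \<D>(2)[OF N(1)] \<D>(2)[OF N(2)]] unfolding a_def by linarith
  qed
  then obtain k where k: "\<And>j. k \<le> j \<Longrightarrow> a (Suc j) \<le> a j + s j" unfolding eventually_sequentially by blast
  have "a (k + n) \<le> a k + (\<Sum>i<n. s (i + k))" for n
  proof (induction n)
    case (Suc n) then show ?case using k[of "k + n"] by (simp add: add.commute)
  qed simp
  moreover obtain K where "\<And>n. (\<Sum>i<n. s (i + k)) \<le> K"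
  proof -
    have "convergent (\<lambda>n. \<Sum>i<n. s (i + k))"
      by (rule summable_iff_convergent[THEN iffD1, OF summable_ignore_initial_segment[OF \<open>summable s\<close>]])
    then have "Bseq (\<lambda>n. \<Sum>i<n. s (i + k))" by (rule convergent_imp_Bseq)
    then obtain K where "\<And>n. norm (\<Sum>i<n. s (i + k)) \<le> K" by (auto simp: Bseq_def)
    then have "\<And>n. (\<Sum>i<n. s (i + k)) \<le> K" by (metis real_norm_def abs_le_D1)
    then show ?thesis using that by blast
  qed
  ultimately have bound: "a (k + n) \<le> a k + K" for n by (meson add_left_mono order_trans)
  have "filterlim (\<lambda>j. a j) at_top sequentially"
    unfolding a_def by (rule filterlim_compose[OF measure_truncation_at_top[OF P0] p2])
  then have "\<forall>\<^sub>F j in sequentially. a k + K + 1 \<le> a j" unfolding filterlim_at_top by blast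
  then obtain m where "\<And>j. m \<le> j \<Longrightarrow> a k + K + 1 \<le> a j" unfolding eventually_sequentially by blast
  from this[of "k + m"] bound[of m] show False by simp
qed

end

section \<open>The complexity bound in a fixed dimension\<close>

lemma action_precompact:
  assumes "euclidean_mdp d H G M \<rho>" shows "precompact (space (act M)) \<rho>"
proof -
  note E = euclidean_mdpD[OF assms]
  interpret A: Metric_space "space (act M)" \<rho> by (rule E(6))
  have "compact_space (subtopology (euclid_top d) (space (act M)))" using E(4) by (rule compact_space_subtopology)
  then have "compactin A.mtopology (space (act M))"
    unfolding E(7)[symmetric] compact_space_def by simp
  then show ?thesis by (rule A.precompact_compact)
qed

lemma state_precompact:
  assumes "compactin (euclid_top d) D" shows "precompact D (edist d)"
  using assms Metric_space.precompact_compact[OF Metric_space_edist] unfolding euclid_top_def by blast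

text \<open>The growth condition taken apart. It bounds the square of \<Lambda>/\<delta>, hence the
  root of \<open>R\<close>. Since it is stated in \<open>ennreal\<close>, it also forces the Dudley
  integral \<open>X\<close> to be finite, and a positive lower bound \<open>e\<close> on
  \<open>X\<close> isolates \<open>l / \<delta>\<close>.\<close>

lemma quotient_bound_of_growth:
  fixes X :: ennreal and l \<delta> \<Lambda> R e :: real
  assumes le: "(ennreal l * X + Y) / ennreal \<delta> + ennreal (\<Lambda>\<^sup>2 / \<delta>\<^sup>2) \<le> ennreal R"
    and pos: "0 < l" "0 < \<delta>" "0 < \<Lambda>" and R: "0 \<le> R"
  shows "\<Lambda> / \<delta> \<le> sqrt R" "X < \<infinity>" "ennreal e \<le> X \<Longrightarrow> 0 < e \<Longrightarrow> l / \<delta> \<le> R / e"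
proof -
  have "ennreal (\<Lambda>\<^sup>2 / \<delta>\<^sup>2) \<le> (ennreal l * X + Y) / ennreal \<delta> + ennreal (\<Lambda>\<^sup>2 / \<delta>\<^sup>2)" by simp
  also note le
  finally have "(\<Lambda> / \<delta>)\<^sup>2 \<le> R" using R by (simp add: power_divide)
  then show "\<Lambda> / \<delta> \<le> sqrt R" by (rule real_le_rsqrt)
  have "ennreal l * X / ennreal \<delta> \<le> (ennreal l * X + Y) / ennreal \<delta>" by (intro divide_right_mono_ennreal) simp
  also have "\<dots> \<le> (ennreal l * X + Y) / ennreal \<delta> + ennreal (\<Lambda>\<^sup>2 / \<delta>\<^sup>2)" by simp
  also note le
  finally have X: "ennreal l * X / ennreal \<delta> \<le> ennreal R" .
  show fin: "X < \<infinity>"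
  proof (rule ccontr)
    assume "\<not> X < \<infinity>"
    then have "X = top" by (simp add: not_less top_unique)
    then show False using X pos by (simp add: ennreal_mult_top ennreal_top_divide top_unique)
  qed
  assume e: "ennreal e \<le> X" "0 < e"
  have "ennreal (l * e / \<delta>) = ennreal l * ennreal e / ennreal \<delta>"
    using pos e(2) by (simp add: ennreal_mult[symmetric] divide_ennreal)
  also have "\<dots> \<le> ennreal l * X / ennreal \<delta>" using e(1) by (intro divide_right_mono_ennreal mult_left_mono) auto
  also note X
  finally have "l * e / \<delta> \<le> R" using R by simp
  then show "l / \<delta> \<le> R / e" using e(2) pos by (simp add: field_simps)
qed

text \<open>\<open>A\<close> stands for the maximum in the claim. What is asked of it is to dominate
  1 and the constant of the truncation error, since the sampling error is of smaller order than the
  target rate and can be given any positive constant.\<close>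

lemma complexity_le:
  fixes \<alpha> \<beta> c q G :: real and C\<^sub>1 C\<^sub>2 :: "nat \<Rightarrow> real \<Rightarrow> nat \<Rightarrow> real" and d H :: nat
    and M :: "(rvec, rvec) mdp" and \<rho> :: "rvec \<Rightarrow> rvec \<Rightarrow> real" and \<D> :: "nat \<Rightarrow> rvec set"
  assumes EM: "euclidean_mdp d H G M \<rho>" and DC: "density_conditions d M \<rho> \<delta> \<Lambda> L Lip"
    and H: "1 \<le> H" and d: "1 \<le> d" and \<alpha>: "0 \<le> \<alpha>" "\<alpha> < 1 / 2" and \<beta>: "0 < \<beta>"
    and c: "0 < c" and q: "0 \<le> q"
    and C12: "\<And>x y. 1 \<le> x \<Longrightarrow> 1 \<le> y \<Longrightarrow> 0 \<le> C\<^sub>1 x y d \<and> C\<^sub>1 x y d \<le> c * \<bar>real x * y\<bar> powr q \<and>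
      0 \<le> C\<^sub>2 x y d \<and> C\<^sub>2 x y d \<le> c * \<bar>real x * y\<bar> powr q"
    and b: "\<And>h. h < H \<Longrightarrow> b h \<in> space (act M)"
    and \<D>: "\<And>N. 1 \<le> N \<Longrightarrow> compactin (euclid_top d) (\<D> N)" "\<And>N. 1 \<le> N \<Longrightarrow> 0 < measure (leb d) (\<D> N)"
      "\<And>N. 1 \<le> N \<Longrightarrow> x \<in> \<D> N"
    and growth: "\<And>N. N > N\<^sub>0 \<Longrightarrow> (ennreal (L (\<D> N)) * dudley (\<D> N \<times> space (act M)) (sum_metric (edist d) \<rho>)
        + ennreal (L (\<D> N) * mdiam (\<D> N) (edist d) * mdiam (space (act M)) \<rho>)) / ennreal (\<delta> (\<D> N))
        + ennreal (\<Lambda>\<^sup>2 / (\<delta> (\<D> N))\<^sup>2) \<le> ennreal (C\<^sub>1 H (ln (real N)) d * real N powr \<alpha>)"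
    and outside: "\<And>N. N > N\<^sub>0 \<Longrightarrow> (\<Sum>h=1..H. SUP \<pi>\<in>policies M. outside_prob M x \<pi> h (\<D> N))
        \<le> C\<^sub>2 H (ln (real N)) d * real N powr - \<beta>"
    and A: "1 \<le> A" "2 * G * c * real H * (real H / \<beta>) powr q \<le> A"
  defines "\<gamma> \<equiv> max (1 / \<beta>) (2 / (1 - 2 * \<alpha>))"
  shows "\<forall>\<^sub>F \<epsilon> in at_right 0. complexity M b x \<D> \<epsilon> \<le> ennreal (4 * (real H * A powr (2 * \<gamma>) *
    (ln (1 / \<epsilon>) powr (2 * q * \<gamma>) / \<epsilon> powr (2 * \<gamma>))))"
proof -
  note E = euclidean_mdpD[OF EM]
  interpret A: Metric_space "space (act M)" \<rho> by (rule E(6))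
  note Dd = density_conditionsD[OF DC \<D>(1,2)]
  have G: "0 \<le> G" using G_nonneg[OF EM \<D>(2)[of 1] \<D>(3)[of 1]] by simp
  define P where "P N = (\<Sum>h=1..H. SUP \<pi>\<in>policies M. outside_prob M x \<pi> h (\<D> N))" for N
  note P_def' = P_def[abs_def]
  have \<Lambda>: "0 < \<Lambda>" using Dd(1)[of 1] by simp
  define \<kappa> where "\<kappa> = c * real H powr q"
  have \<kappa>: "0 < \<kappa>" using c H by (simp add: \<kappa>_def)
  define large where "large N \<longleftrightarrow> N > N\<^sub>0 \<and> 2 \<le> N \<and> 1 \<le> ln (real N)" for N
  have ev_large: "\<forall>\<^sub>F N in sequentially. large N"
  proof -
    have "filterlim (\<lambda>N. ln (real N)) at_top sequentially"
      by (rule filterlim_compose[OF ln_at_top filterlim_real_sequentially])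
    then have "\<forall>\<^sub>F N in sequentially. 1 \<le> ln (real N)" by (simp add: filterlim_at_top)
    then show ?thesis
      unfolding large_def using eventually_gt_at_top[of N\<^sub>0] eventually_ge_at_top[of 2] by eventually_elim simp
  qed
  have poly: "c * \<bar>real H * ln (real N)\<bar> powr q = \<kappa> * ln (real N) powr q" if "large N" for N
    using that unfolding large_def \<kappa>_def by (simp add: abs_mult powr_mult)
  have P_le: "P N \<le> \<kappa> * (ln (real N) powr q * real N powr - \<beta>)" if N: "large N" for N
  proof -
    have "P N \<le> C\<^sub>2 H (ln (real N)) d * real N powr - \<beta>" unfolding P_def using N by (intro outside) (simp add: large_def)
    also have "\<dots> \<le> \<kappa> * ln (real N) powr q * real N powr - \<beta>"
      using C12[OF H, of "ln (real N)"] N unfolding poly[OF N] by (intro mult_right_mono) (auto simp: large_def)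
    finally show ?thesis by (simp add: mult.assoc)
  qed
  define R where "R N = C\<^sub>1 H (ln (real N)) d * real N powr \<alpha>" for N
  have R: "0 \<le> R N" "R N \<le> \<kappa> * (ln (real N) powr q * real N powr \<alpha>)" if N: "large N" for N
  proof -
    have "0 \<le> C\<^sub>1 H (ln (real N)) d" "C\<^sub>1 H (ln (real N)) d \<le> \<kappa> * ln (real N) powr q"
      using C12[OF H, of "ln (real N)"] N unfolding poly[OF N] by (auto simp: large_def)
    then show "0 \<le> R N" "R N \<le> \<kappa> * (ln (real N) powr q * real N powr \<alpha>)"
      unfolding R_def mult.assoc[symmetric] by (auto intro: mult_right_mono)
  qed
  have pos: "0 < L (\<D> N)" "0 < \<delta> (\<D> N)" if "large N" for N using Dd(2,3)[of N] that by (auto simp: large_def)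
  have le: "(ennreal (L (\<D> N)) * dudley (\<D> N \<times> space (act M)) (sum_metric (edist d) \<rho>)
        + ennreal (L (\<D> N) * mdiam (\<D> N) (edist d) * mdiam (space (act M)) \<rho>)) / ennreal (\<delta> (\<D> N))
        + ennreal (\<Lambda>\<^sup>2 / (\<delta> (\<D> N))\<^sup>2) \<le> ennreal (R N)" if "large N" for N
    unfolding R_def using that by (intro growth) (simp add: large_def)
  have dud: "dudley (space (act M)) \<rho> \<le> dudley (\<D> N \<times> space (act M)) (sum_metric (edist d) \<rho>)" if N: "large N" for N
  proof (rule dudley_snd_le[OF Metric_space_edist _ state_precompact _ A.Metric_space_axioms order_refl action_precompact[OF EM] E(3)])
    have N1: "1 \<le> N" using N by (simp add: large_def)
    show "\<D> N \<subseteq> space (leb d)" by (rule restrict_leb(3)[OF \<D>(2)[OF N1]])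
    show "compactin (euclid_top d) (\<D> N)" by (rule \<D>(1)[OF N1])
    show "\<D> N \<noteq> {}" using \<D>(3)[OF N1] by blast
  qed
  have ratio: "\<Lambda> / \<delta> (\<D> N) \<le> sqrt \<kappa> * (ln (real N) powr (q / 2) * real N powr (\<alpha> / 2))" if N: "large N" for N
  proof -
    have "\<Lambda> / \<delta> (\<D> N) \<le> sqrt (R N)" by (rule quotient_bound_of_growth(1)[OF le[OF N] pos[OF N] \<Lambda> R(1)[OF N]])
    also have "\<dots> \<le> sqrt (\<kappa> * (ln (real N) powr q * real N powr \<alpha>))" using R(2)[OF N] by (rule real_sqrt_le_mono)
    also have "\<dots> = sqrt \<kappa> * (ln (real N) powr (q / 2) * real N powr (\<alpha> / 2))"
      using N by (simp add: real_sqrt_mult powr_half_sqrt[symmetric] powr_powr large_def)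
    finally show ?thesis .
  qed
  have P0: "P \<longlonglongrightarrow> 0"
  proof (rule tendsto_sandwich[OF _ _ tendsto_const])
    show "\<forall>\<^sub>F N in sequentially. 0 \<le> P N"
      unfolding P_def using sum_SUP_outside_nonneg[OF EM DC start_space[OF EM DC H d \<D>]] by simp
    show "\<forall>\<^sub>F N in sequentially. P N \<le> \<kappa> * (ln (real N) powr q * real N powr - \<beta>)"
      using ev_large by eventually_elim (rule P_le)
    have "((\<lambda>x::real. \<kappa> * (ln x powr q * x powr - \<beta>)) \<longlongrightarrow> 0) at_top" using \<beta> by real_asymp
    then show "(\<lambda>N. \<kappa> * (ln (real N) powr q * real N powr - \<beta>)) \<longlonglongrightarrow> 0"
      by (rule filterlim_compose) (rule filterlim_real_sequentially)
  qed
  \<comment> \<open>For \<alpha> = 0 the bound \<open>ratio\<close> would make 1/\<delta>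
    polylogarithmic, contradicting \<open>density_ratio_not_polylogarithmic\<close>. This secures
    the spare power required by \<open>sampling_error_small\<close>.\<close>
  have \<alpha>0: "0 < \<alpha>"
  proof (rule ccontr)
    assume "\<not> 0 < \<alpha>"
    then have "\<alpha> = 0" using \<alpha> by simp
    show False
    proof (rule density_ratio_not_polylogarithmic[OF EM DC H d \<D> P0[unfolded P_def'] \<beta>])
      show "\<forall>\<^sub>F N in sequentially. 1 / \<delta> (\<D> N) \<le> sqrt \<kappa> / \<Lambda> * ln (real N) powr (q / 2)"
        using ev_large
      proof eventually_elim
        case (elim N)
        then have "\<Lambda> / \<delta> (\<D> N) / \<Lambda> \<le> sqrt \<kappa> * ln (real N) powr (q / 2) / \<Lambda>"
          using ratio[OF elim] \<Lambda> unfolding \<open>\<alpha> = 0\<close> by (intro divide_right_mono) (auto simp: large_def)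
        then show ?case using \<Lambda> by simp
      qed
      show "\<forall>\<^sub>F N in sequentially. (\<Sum>h=1..H. SUP \<pi>\<in>policies M. outside_prob M x \<pi> h (\<D> N)) \<le> \<kappa> * (ln (real N) powr q * real N powr - \<beta>)"
        using ev_large unfolding P_def[symmetric] by eventually_elim (rule P_le)
    qed
  qed
  have "filterlim (\<lambda>N. measure (leb d) (\<D> N)) at_top sequentially"
    by (rule measure_truncation_at_top[OF EM DC H d \<D> P0[unfolded P_def']])
  \<comment> \<open>Eventually the redistributed part of a reflected density is at most \<Lambda>,
    so the upper bound of the densities at most doubles.\<close>
  then have ev_leb: "\<forall>\<^sub>F N in sequentially. 1 / \<Lambda> \<le> measure (leb d) (\<D> N)" unfolding filterlim_at_top by blast
  define \<Lambda>' where "\<Lambda>' N = \<Lambda> + 1 / measure (leb d) (\<D> N)" for N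
  obtain N1 where N1: "large N1" using ev_large eventually_happens'[OF sequentially_bot] by blast
  text \<open>
    If there is only one action, any positive Lipschitz constant will do; otherwise the Dudley
    integral of the action space is positive and bounds \<open>L / \<delta>\<close>.
  \<close>
  have "\<exists>C L' \<kappa>'. (\<forall>j. finite (C j) \<and> C j \<noteq> {} \<and> C j \<subseteq> space (act M) \<and> (\<forall>a\<in>space (act M). \<exists>c\<in>C j. \<rho> a c \<le> (1 / 2) ^ j)) \<and>
    summable (\<lambda>j. (1 / 2) ^ j * sqrt (ln (real (card (C j))))) \<and> 0 \<le> \<kappa>' \<and>
    (\<forall>N. large N \<longrightarrow> 0 < L' N \<and> L' N / \<delta> (\<D> N) \<le> \<kappa>' * (ln (real N) powr q * real N powr \<alpha>) \<and>
      (\<forall>h\<in>{1..H}. AE y in restrict_space (leb d) (\<D> N). \<forall>s\<in>\<D> N. \<forall>a\<in>space (act M). \<forall>a'\<in>space (act M).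
        \<bar>dens (reflect (\<D> N) M) h a y s - dens (reflect (\<D> N) M) h a' y s\<bar> \<le> L' N * \<rho> a a'))"
  proof (cases "\<exists>a. space (act M) = {a}")
    case True
    then obtain a where a: "space (act M) = {a}" by blast
    have raa: "\<rho> a a = 0" using A.mdist_zero a by simp
    show ?thesis
    \<comment> \<open>With \<open>L' N = \<delta> (\<D> N)\<close> the quotient is 1, and the
      one-point net is exact at every scale.\<close>
    proof (rule exI[of _ "\<lambda>_. {a}"], rule exI[of _ "\<lambda>N. \<delta> (\<D> N)"], rule exI[of _ 1], intro conjI allI impI)
      fix N assume N: "large N"
      show "0 < \<delta> (\<D> N)" by (rule pos(2)[OF N])
      have "1 \<le> ln (real N) powr q" "1 \<le> real N powr \<alpha>"
        using N q \<alpha> by (auto simp: large_def intro!: ge_one_powr_ge_zero)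
      then have "1 * 1 \<le> ln (real N) powr q * real N powr \<alpha>" by (intro mult_mono) auto
      then show "\<delta> (\<D> N) / \<delta> (\<D> N) \<le> 1 * (ln (real N) powr q * real N powr \<alpha>)" using pos(2)[OF N] by simp
    qed (use a raa in auto)
  next
    case False
    then obtain a a' where a: "a \<in> space (act M)" "a' \<in> space (act M)" "a \<noteq> a'" using E(3) by blast
    note pc = action_precompact[OF EM]
    have "dudley (space (act M)) \<rho> < \<infinity>"
      using dud[OF N1] quotient_bound_of_growth(2)[OF le[OF N1] pos[OF N1] \<Lambda> R(1)[OF N1]] by (rule order_le_less_trans)
    note sm = dudley_summable[OF A.Metric_space_axioms order_refl pc E(3) this]
    obtain e where e: "0 \<le> e" "dudley (space (act M)) \<rho> = ennreal e"
      using \<open>dudley (space (act M)) \<rho> < \<infinity>\<close> by (cases "dudley (space (act M)) \<rho>") auto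
    have e0: "0 < e" using dudley_pos[OF A.Metric_space_axioms order_refl pc a] unfolding e(2) by simp
    have "\<forall>j. \<exists>C. finite_net (space (act M)) \<rho> ((1 / 2) ^ j) C \<and> card C = covering_number (space (act M)) \<rho> ((1 / 2) ^ j)"
      using covering_number_attained[OF pc] by simp
    from choice[OF this] obtain C where
      C: "\<And>j. finite_net (space (act M)) \<rho> ((1 / 2) ^ j) (C j)" "\<And>j. card (C j) = covering_number (space (act M)) \<rho> ((1 / 2) ^ j)"
      by blast
    show ?thesis
    proof (rule exI[of _ C], rule exI[of _ "\<lambda>N. L (\<D> N)"], rule exI[of _ "\<kappa> / e"], intro conjI allI impI ballI)
      show "finite (C j)" "C j \<subseteq> space (act M)" for j using C(1)[of j] by (auto simp: finite_net_def)
      show "C j \<noteq> {}" for j by (rule finite_net_nonempty[OF C(1) E(3)])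
      show "\<exists>c\<in>C j. \<rho> a c \<le> (1 / 2) ^ j" if "a \<in> space (act M)" for a j
        using C(1)[of j] that unfolding finite_net_def by (auto simp: A.commute[of a])
      show "summable (\<lambda>j. (1 / 2) ^ j * sqrt (ln (real (card (C j)))))" unfolding C(2) by (rule sm)
      show "0 \<le> \<kappa> / e" using \<kappa> e0 by simp
      fix N assume N: "large N"
      have N1: "1 \<le> N" using N by (simp add: large_def)
      show "0 < L (\<D> N)" by (rule pos(1)[OF N])
      have "L (\<D> N) / \<delta> (\<D> N) \<le> R N / e"
        by (rule quotient_bound_of_growth(3)[OF le[OF N] pos[OF N] \<Lambda> R(1)[OF N] _ e0]) (use dud[OF N] e(2) in simp)
      also have "\<dots> \<le> \<kappa> * (ln (real N) powr q * real N powr \<alpha>) / e" using R(2)[OF N] e0 by (intro divide_right_mono) auto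
      finally show "L (\<D> N) / \<delta> (\<D> N) \<le> \<kappa> / e * (ln (real N) powr q * real N powr \<alpha>)" by simp
      fix h assume "h \<in> {1..H}"
      then show "AE y in restrict_space (leb d) (\<D> N). \<forall>s\<in>\<D> N. \<forall>a\<in>space (act M). \<forall>a'\<in>space (act M).
        \<bar>dens (reflect (\<D> N) M) h a y s - dens (reflect (\<D> N) M) h a' y s\<bar> \<le> L (\<D> N) * \<rho> a a'"
        by (rule reflect_dens_Lipschitz[OF EM DC \<D>(1,2)[OF N1]])
    qed
  qed
  then obtain C L' \<kappa>' where
    nets: "\<forall>j. finite (C j) \<and> C j \<noteq> {} \<and> C j \<subseteq> space (act M) \<and> (\<forall>a\<in>space (act M). \<exists>c\<in>C j. \<rho> a c \<le> (1 / 2) ^ j)"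
    and sm: "summable (\<lambda>j. (1 / 2) ^ j * sqrt (ln (real (card (C j)))))" and \<kappa>': "0 \<le> \<kappa>'"
    and lip: "\<forall>N. large N \<longrightarrow> 0 < L' N \<and> L' N / \<delta> (\<D> N) \<le> \<kappa>' * (ln (real N) powr q * real N powr \<alpha>) \<and>
      (\<forall>h\<in>{1..H}. AE y in restrict_space (leb d) (\<D> N). \<forall>s\<in>\<D> N. \<forall>a\<in>space (act M). \<forall>a'\<in>space (act M).
        \<bar>dens (reflect (\<D> N) M) h a y s - dens (reflect (\<D> N) M) h a' y s\<bar> \<le> L' N * \<rho> a a')"
    by (elim exE conjE) (rule that; assumption)
  have C: "finite (C j)" "C j \<noteq> {}" "C j \<subseteq> space (act M)" "\<And>a. a \<in> space (act M) \<Longrightarrow> \<exists>c\<in>C j. \<rho> a c \<le> (1 / 2) ^ j" for j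
    using nets[THEN spec, of j] by (elim conjE; simp)+
  have L': "0 < L' N" "L' N / \<delta> (\<D> N) \<le> \<kappa>' * (ln (real N) powr q * real N powr \<alpha>)"
    "\<And>h. h \<in> {1..H} \<Longrightarrow> AE y in restrict_space (leb d) (\<D> N). \<forall>s\<in>\<D> N. \<forall>a\<in>space (act M). \<forall>a'\<in>space (act M).
        \<bar>dens (reflect (\<D> N) M) h a y s - dens (reflect (\<D> N) M) h a' y s\<bar> \<le> L' N * \<rho> a a'" if "large N" for N
  proof -
    note l = lip[THEN spec, THEN mp, OF that]
    show "0 < L' N" by (rule l[THEN conjunct1])
    show "L' N / \<delta> (\<D> N) \<le> \<kappa>' * (ln (real N) powr q * real N powr \<alpha>)" by (rule l[THEN conjunct2, THEN conjunct1])
    show "AE y in restrict_space (leb d) (\<D> N). \<forall>s\<in>\<D> N. \<forall>a\<in>space (act M). \<forall>a'\<in>space (act M).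
        \<bar>dens (reflect (\<D> N) M) h a y s - dens (reflect (\<D> N) M) h a' y s\<bar> \<le> L' N * \<rho> a a'" if "h \<in> {1..H}" for h
      by (rule l[THEN conjunct2, THEN conjunct2, THEN bspec, OF that])
  qed
  define B where "B = G * (real H + 1) + 1"
  define T where "T = 2 * G * real H * \<kappa>"
  have B0: "0 \<le> B" using G by (simp add: B_def)
  have T0: "0 \<le> T" using G \<kappa> by (simp add: T_def)
  have TA: "T * (1 / \<beta>) powr q \<le> A"
  proof -
    have "T * (1 / \<beta>) powr q = 2 * G * c * real H * (real H / \<beta>) powr q"
      unfolding T_def \<kappa>_def using \<beta> by (simp add: powr_divide)
    then show ?thesis using A(2) by simp
  qed
  have \<gamma>: "0 < \<gamma>" unfolding \<gamma>_def using \<beta> by (simp add: less_max_iff_disj)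
  define \<kappa>'' where "\<kappa>'' = max (2 * sqrt \<kappa>) \<kappa>'"
  have err: "\<forall>\<^sub>F N in sequentially. mesh_error M b x (\<D> N) N \<le> ennreal (A * (1 + \<eta>) * \<gamma> powr - q * (ln (real N) powr q * real N powr (- 1 / \<gamma>)))"
    if \<eta>: "0 < \<eta>" for \<eta>
  proof -
    \<comment> \<open>Division by \<open>H\<close> because each of the \<open>H\<close> steps
      contributes a sampling error; the rest is the share of the slack that
      \<open>rate_combination\<close> reserves for sampling.\<close>
    define \<eta>' where "\<eta>' = \<eta> / 2 * \<gamma> powr - q / real H"
    have \<eta>': "0 < \<eta>'" unfolding \<eta>'_def using \<eta> \<gamma> H by simp
    have "\<forall>\<^sub>F N in sequentially. \<exists>j0 J. j0 \<le> J \<and>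
      16 * B / (\<delta> (\<D> N) * N) * chaining_cost (\<Lambda>' N) (L' N) C j0 J N
        + 2 * B / \<delta> (\<D> N) * (\<Lambda>' N * sqrt N * sqrt (2 * ln (2 * N)) / (real N - 1))
      \<le> \<eta>' * (ln (real N) powr q * real N powr (\<alpha> - 1 / 2))"
    proof (rule sampling_error_small[OF C(1,2) sm \<alpha>0 B0 _ \<eta>'])
      show "0 \<le> \<kappa>''" using \<kappa>' by (simp add: \<kappa>''_def)
      show "\<forall>\<^sub>F N in sequentially. 0 < \<delta> (\<D> N) \<and> 0 \<le> \<Lambda>' N \<and> 0 \<le> L' N \<and>
        \<Lambda>' N / \<delta> (\<D> N) \<le> \<kappa>'' * (ln (real N) powr (q / 2) * real N powr (\<alpha> / 2)) \<and>
        L' N / \<delta> (\<D> N) \<le> \<kappa>'' * (ln (real N) powr q * real N powr \<alpha>)"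
        using ev_large ev_leb
      proof eventually_elim
        case (elim N)
        have m0: "0 < measure (leb d) (\<D> N)" using elim(1) by (intro \<D>) (simp add: large_def)
        have "1 / measure (leb d) (\<D> N) \<le> \<Lambda>" using elim(2) \<Lambda> m0 by (simp add: field_simps)
        then have "\<Lambda>' N \<le> 2 * \<Lambda>" by (simp add: \<Lambda>'_def)
        then have "\<Lambda>' N / \<delta> (\<D> N) \<le> 2 * (\<Lambda> / \<delta> (\<D> N))" using pos(2)[OF elim(1)] by (simp add: divide_right_mono)
        also have "\<dots> \<le> 2 * (sqrt \<kappa> * (ln (real N) powr (q / 2) * real N powr (\<alpha> / 2)))"
          using ratio[OF elim(1)] by (intro mult_left_mono) auto
        also have "\<dots> = 2 * sqrt \<kappa> * (ln (real N) powr (q / 2) * real N powr (\<alpha> / 2))" by simp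
        also have "\<dots> \<le> \<kappa>'' * (ln (real N) powr (q / 2) * real N powr (\<alpha> / 2))"
          by (intro mult_right_mono) (auto simp: \<kappa>''_def)
        finally have 1: "\<Lambda>' N / \<delta> (\<D> N) \<le> \<kappa>'' * (ln (real N) powr (q / 2) * real N powr (\<alpha> / 2))" .
        have "\<kappa>' * (ln (real N) powr q * real N powr \<alpha>) \<le> \<kappa>'' * (ln (real N) powr q * real N powr \<alpha>)"
          by (intro mult_right_mono) (auto simp: \<kappa>''_def)
        then have 2: "L' N / \<delta> (\<D> N) \<le> \<kappa>'' * (ln (real N) powr q * real N powr \<alpha>)"
          by (rule order_trans[OF L'(2)[OF elim(1)]])
        have "0 \<le> \<Lambda>' N" using \<Lambda> m0 by (simp add: \<Lambda>'_def)
        then show ?case using 1 2 pos(2)[OF elim(1)] less_imp_le[OF L'(1)[OF elim(1)]] by blast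
      qed
    qed
    moreover note rate_combination[OF \<beta> \<alpha>(2) A(1) T0 TA \<eta>, folded \<gamma>_def]
    ultimately show ?thesis
      using ev_large
    proof eventually_elim
      case (elim N)
      have N2: "2 \<le> N" "1 \<le> N" using elim(3) by (auto simp: large_def)
      from elim(1) obtain j0 J where J: "j0 \<le> J" and small:
        "16 * B / (\<delta> (\<D> N) * N) * chaining_cost (\<Lambda>' N) (L' N) C j0 J N
          + 2 * B / \<delta> (\<D> N) * (\<Lambda>' N * sqrt N * sqrt (2 * ln (2 * N)) / (real N - 1))
        \<le> \<eta>' * (ln (real N) powr q * real N powr (\<alpha> - 1 / 2))" (is "?E \<le> _") by blast
      have bnd: "\<delta> (\<D> N) \<le> dens (reflect (\<D> N) M) h a y s \<and> dens (reflect (\<D> N) M) h a y s \<le> \<Lambda>' N"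
        if "h \<in> {1..H}" "a \<in> space (act M)" "s \<in> \<D> N" "y \<in> \<D> N" for h a s y
        unfolding \<Lambda>'_def using that by (rule reflect_dens_bounds[OF EM DC \<D>(1,2)[OF N2(2)]])
      have "mesh_error M b x (\<D> N) N \<le> ennreal (real H * ?E + 2 * G * real H * P N)"
        unfolding P_def B_def
        by (rule mesh_error_le[OF EM \<D>(2,3)[OF N2(2)] b pos(2)[OF elim(3)] L'(1)[OF elim(3)] bnd L'(3)[OF elim(3)] H N2(1) J C])
          assumption+
      also have "\<dots> \<le> ennreal (A * (1 + \<eta>) * \<gamma> powr - q * (ln (real N) powr q * real N powr (- 1 / \<gamma>)))"
      proof (rule ennreal_leI)
        have "real H * ?E \<le> real H * (\<eta>' * (ln (real N) powr q * real N powr (\<alpha> - 1 / 2)))"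
          using small by (intro mult_left_mono) auto
        also have "\<dots> = \<eta> / 2 * \<gamma> powr - q * (ln (real N) powr q * real N powr (\<alpha> - 1 / 2))"
          unfolding \<eta>'_def using H by simp
        finally have 1: "real H * ?E \<le> \<dots>" .
        have "2 * G * real H * P N \<le> 2 * G * real H * (\<kappa> * (ln (real N) powr q * real N powr - \<beta>))"
          using G P_le[OF elim(3)] by (intro mult_left_mono) auto
        also have "\<dots> = T * (ln (real N) powr q * real N powr - \<beta>)" by (simp add: T_def)
        finally show "real H * ?E + 2 * G * real H * P N \<le> A * (1 + \<eta>) * \<gamma> powr - q * (ln (real N) powr q * real N powr (- 1 / \<gamma>))"
          using 1 elim(2) by linarith
      qed
      finally show ?case .
    qed
  qed
  have "\<forall>\<^sub>F \<epsilon> in at_right 0. \<exists>N\<ge>2. mesh_error M b x (\<D> N) N \<le> ennreal \<epsilon> \<and>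
    real N ^ 2 \<le> 4 * (A powr (2 * \<gamma>) * (ln (1 / \<epsilon>) powr (2 * q * \<gamma>) / \<epsilon> powr (2 * \<gamma>)))"
    using A(1) \<gamma> q by (rule budget_exists) (rule err)
  then show ?thesis
  proof eventually_elim
    case (elim \<epsilon>)
    then obtain N where N: "2 \<le> N" "mesh_error M b x (\<D> N) N \<le> ennreal \<epsilon>"
      "real N ^ 2 \<le> 4 * (A powr (2 * \<gamma>) * (ln (1 / \<epsilon>) powr (2 * q * \<gamma>) / \<epsilon> powr (2 * \<gamma>)))" by blast
    have "complexity M b x \<D> \<epsilon> \<le> ennreal (real (horizon M) * real N ^ 2)"
      unfolding complexity_def using N(1,2) by (intro INF_lower) simp
    also have "\<dots> \<le> ennreal (real H * (4 * (A powr (2 * \<gamma>) * (ln (1 / \<epsilon>) powr (2 * q * \<gamma>) / \<epsilon> powr (2 * \<gamma>)))))"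
      unfolding E(2) using N(3) by (intro ennreal_leI mult_left_mono) auto
    finally show ?case by (simp add: mult.assoc mult.left_commute)
  qed
qed

theorem proposition4:
  shows "\<exists>K>0. \<forall>(G::real) (\<alpha>::real) (\<beta>::real)
    (C\<^sub>1 :: nat \<Rightarrow> real \<Rightarrow> nat \<Rightarrow> real) (C\<^sub>2 :: nat \<Rightarrow> real \<Rightarrow> nat \<Rightarrow> real)
    (c :: nat \<Rightarrow> real) (q :: nat \<Rightarrow> real) (H::nat)
    (M :: nat \<Rightarrow> (rvec, rvec) mdp) (\<rho> :: nat \<Rightarrow> rvec \<Rightarrow> rvec \<Rightarrow> real)
    (\<delta> :: nat \<Rightarrow> rvec set \<Rightarrow> real) (\<Lambda> :: nat \<Rightarrow> real) (L :: nat \<Rightarrow> rvec set \<Rightarrow> real)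
    (Lip :: nat \<Rightarrow> rvec set \<Rightarrow> rvec \<Rightarrow> real).
    0 \<le> \<alpha> \<and> \<alpha> < 1 / 2 \<and> 0 < \<beta> \<and> 1 \<le> H \<and>
    (\<forall>d\<ge>1. 0 < c d \<and> 0 \<le> q d \<and>
      (\<forall>x\<ge>1. \<forall>y\<ge>1.
        0 \<le> C\<^sub>1 x y d \<and> C\<^sub>1 x y d \<le> c d * \<bar>real x * y\<bar> powr q d \<and>
        0 \<le> C\<^sub>2 x y d \<and> C\<^sub>2 x y d \<le> c d * \<bar>real x * y\<bar> powr q d)) \<and>
    (\<forall>d\<ge>1. euclidean_mdp d H G (M d) (\<rho> d) \<and>
      density_conditions d (M d) (\<rho> d) (\<delta> d) (\<Lambda> d) (L d) (Lip d))
    \<longrightarrow>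
    (\<forall>d\<ge>1. \<forall>(x\<^sub>0::rvec) (b :: nat \<Rightarrow> rvec) (\<D> :: nat \<Rightarrow> rvec set) (N\<^sub>0::nat).
      (\<forall>h<H. b h \<in> space (act (M d))) \<and>
      (\<forall>N\<ge>1. compactin (euclid_top d) (\<D> N) \<and> 0 < measure (leb d) (\<D> N) \<and> x\<^sub>0 \<in> \<D> N) \<and>
      (\<forall>N>N\<^sub>0.
        (ennreal (L d (\<D> N))
            * dudley (\<D> N \<times> space (act (M d))) (sum_metric (edist d) (\<rho> d))
          + ennreal (L d (\<D> N) * mdiam (\<D> N) (edist d) * mdiam (space (act (M d))) (\<rho> d)))
          / ennreal (\<delta> d (\<D> N))
          + ennreal ((\<Lambda> d)\<^sup>2 / (\<delta> d (\<D> N))\<^sup>2)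
        \<le> ennreal (C\<^sub>1 H (ln (real N)) d * real N powr \<alpha>)) \<and>
      (\<forall>N>N\<^sub>0.
        (\<Sum>h=1..H. SUP \<pi>\<in>policies (M d). outside_prob (M d) x\<^sub>0 \<pi> h (\<D> N))
        \<le> C\<^sub>2 H (ln (real N)) d * real N powr (- \<beta>))
      \<longrightarrow>
      (\<exists>\<epsilon>\<^sub>0>0. \<forall>\<epsilon>. 0 < \<epsilon> \<and> \<epsilon> < \<epsilon>\<^sub>0 \<longrightarrow>
        complexity (M d) b x\<^sub>0 \<D> \<epsilon> \<le> ennreal
          (K * (real H
            * Max {2 * G * c d * real H ^ 2 * (2 * real H / (1 - 2 * \<alpha>)) powr q d,
                   2 * G * c d * real H * (real H / \<beta>) powr q d,
                   1} powr (2 * max (1 / \<beta>) (2 / (1 - 2 * \<alpha>)))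
            * (ln (1 / \<epsilon>) powr (2 * q d * max (1 / \<beta>) (2 / (1 - 2 * \<alpha>)))
               / \<epsilon> powr (2 * max (1 / \<beta>) (2 / (1 - 2 * \<alpha>))))))))"
\<comment> \<open>The square of the factor 2 in \<open>N = \<lfloor>2 X\<rfloor>\<close>; nothing
  else enters the absolute constant.\<close>
proof (rule exI[of _ 4], rule conjI, simp, intro allI impI, elim conjE)
  fix G \<alpha> \<beta> :: real and C\<^sub>1 C\<^sub>2 :: "nat \<Rightarrow> real \<Rightarrow> nat \<Rightarrow> real" and c q :: "nat \<Rightarrow> real" and H :: nat
    and M :: "nat \<Rightarrow> (rvec, rvec) mdp" and \<rho> :: "nat \<Rightarrow> rvec \<Rightarrow> rvec \<Rightarrow> real"
    and \<delta> :: "nat \<Rightarrow> rvec set \<Rightarrow> real" and \<Lambda> :: "nat \<Rightarrow> real" and L :: "nat \<Rightarrow> rvec set \<Rightarrow> real"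
    and Lip :: "nat \<Rightarrow> rvec set \<Rightarrow> rvec \<Rightarrow> real" and d :: nat
    and x\<^sub>0 :: rvec and b :: "nat \<Rightarrow> rvec" and \<D> :: "nat \<Rightarrow> rvec set" and N\<^sub>0 :: nat
  assume par: "0 \<le> \<alpha>" "\<alpha> < 1 / 2" "0 < \<beta>" "1 \<le> H" and d: "1 \<le> d"
    and C: "\<forall>d\<ge>1. 0 < c d \<and> 0 \<le> q d \<and>
      (\<forall>x\<ge>1. \<forall>y\<ge>1.
        0 \<le> C\<^sub>1 x y d \<and> C\<^sub>1 x y d \<le> c d * \<bar>real x * y\<bar> powr q d \<and>
        0 \<le> C\<^sub>2 x y d \<and> C\<^sub>2 x y d \<le> c d * \<bar>real x * y\<bar> powr q d)"
    and M: "\<forall>d\<ge>1. euclidean_mdp d H G (M d) (\<rho> d) \<and> density_conditions d (M d) (\<rho> d) (\<delta> d) (\<Lambda> d) (L d) (Lip d)"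
    and b: "\<forall>h<H. b h \<in> space (act (M d))"
    and \<D>: "\<forall>N\<ge>1. compactin (euclid_top d) (\<D> N) \<and> 0 < measure (leb d) (\<D> N) \<and> x\<^sub>0 \<in> \<D> N"
    and growth: "\<forall>N>N\<^sub>0.
        (ennreal (L d (\<D> N))
            * dudley (\<D> N \<times> space (act (M d))) (sum_metric (edist d) (\<rho> d))
          + ennreal (L d (\<D> N) * mdiam (\<D> N) (edist d) * mdiam (space (act (M d))) (\<rho> d)))
          / ennreal (\<delta> d (\<D> N))
          + ennreal ((\<Lambda> d)\<^sup>2 / (\<delta> d (\<D> N))\<^sup>2)
        \<le> ennreal (C\<^sub>1 H (ln (real N)) d * real N powr \<alpha>)"
    and outside: "\<forall>N>N\<^sub>0.
        (\<Sum>h=1..H. SUP \<pi>\<in>policies (M d). outside_prob (M d) x\<^sub>0 \<pi> h (\<D> N))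
        \<le> C\<^sub>2 H (ln (real N)) d * real N powr (- \<beta>)"
  let ?A = "Max {2 * G * c d * real H ^ 2 * (2 * real H / (1 - 2 * \<alpha>)) powr q d,
                   2 * G * c d * real H * (real H / \<beta>) powr q d, 1}"
  let ?\<gamma> = "max (1 / \<beta>) (2 / (1 - 2 * \<alpha>))"
  have "\<forall>\<^sub>F \<epsilon> in at_right 0. complexity (M d) b x\<^sub>0 \<D> \<epsilon> \<le> ennreal (4 * (real H * ?A powr (2 * ?\<gamma>) *
    (ln (1 / \<epsilon>) powr (2 * q d * ?\<gamma>) / \<epsilon> powr (2 * ?\<gamma>))))"
  proof (rule complexity_le)
    show "euclidean_mdp d H G (M d) (\<rho> d)" "density_conditions d (M d) (\<rho> d) (\<delta> d) (\<Lambda> d) (L d) (Lip d)"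
      using M d by blast+
    show "0 < c d" "0 \<le> q d" using C d by blast+
    show "0 \<le> C\<^sub>1 x y d \<and> C\<^sub>1 x y d \<le> c d * \<bar>real x * y\<bar> powr q d \<and> 0 \<le> C\<^sub>2 x y d \<and> C\<^sub>2 x y d \<le> c d * \<bar>real x * y\<bar> powr q d"
      if "1 \<le> x" "1 \<le> y" for x y using C d that by blast
    show "b h \<in> space (act (M d))" if "h < H" for h using b that by blast
    show "compactin (euclid_top d) (\<D> N)" "0 < measure (leb d) (\<D> N)" "x\<^sub>0 \<in> \<D> N" if "1 \<le> N" for N using \<D> that by blast+
    show "1 \<le> ?A" "2 * G * c d * real H * (real H / \<beta>) powr q d \<le> ?A" by (rule Max_ge; simp)+
  qed (use par d growth outside in blast)+
  then show "\<exists>\<epsilon>\<^sub>0>0. \<forall>\<epsilon>. 0 < \<epsilon> \<and> \<epsilon> < \<epsilon>\<^sub>0 \<longrightarrow> complexity (M d) b x\<^sub>0 \<D> \<epsilon> \<le> ennreal (4 * (real H * ?A powr (2 * ?\<gamma>) *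
    (ln (1 / \<epsilon>) powr (2 * q d * ?\<gamma>) / \<epsilon> powr (2 * ?\<gamma>))))"
    unfolding eventually_at_right_field by blast
qed

end
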